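(* Let $k\ge1$ be an integer and $\rho>0$. There exist constants $C_1,C_2>0$, independent of the mesh (i.e. of the polygon $F$ and of its size), such that for every polygon $F$ satisfying the mesh regularity assumption (M) with parameter $\rho$, the bilinear form on $\mathbf V^e_k(F)\times\mathbf V^e_k(F)$ $$S^F_e(\mathbf v_h,\mathbf w_h)=h_F\sum_{e\subseteq\partial F}(\mathbf v_h\cdot\mathbf t_e,\mathbf w_h\cdot\mathbf t_e)_e+h_F^2(\mathrm{rot}_F\mathbf v_h,\mathrm{rot}_F\mathbf w_h)_F+(\mathbf\Pi^{0,F}_{k+1}\mathbf v_h,\mathbf\Pi^{0,F}_{k+1}\mathbf w_h)_F$$ satisfies $$C_1\|\mathbf v_h\|_F^2\le S^F_e(\mathbf v_h,\mathbf v_h)\le C_2\|\mathbf v_h\|_F^2\qquad\forall\mathbf v_h\in\mathbf V^e_k(F).$$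
   Context: (M): $F\subset\mathbb R^2$ is a polygon with diameter $h_F$; $F$ is star-shaped with respect to a disk of radius $\ge\rho h_F$, and every edge $e$ has length $h_e\ge\rho h_F$. $(\cdot,\cdot)_D$ and $\|\cdot\|_D$ are the $L^2(D)$ inner product and norm. $\mathbf n_e$ is the unit outer normal on $e$, $\mathbf t_e=(-n_2,n_1)$ if $\mathbf n_e=(n_1,n_2)$. $\mathrm{rot}_F\mathbf v=\partial_{x_1}v_2-\partial_{x_2}v_1$, $\mathrm{div}_F\mathbf v=\partial_{x_1}v_1+\partial_{x_2}v_2$. $\mathbb P_k(D)$: polynomials of degree at most $k$ on $D$. $\mathbf\Pi^{0,F}_{k+1}$ is the $\mathbf L^2(F)$-orthogonal projection onto $(\mathbb P_{k+1}(F))^2$. $\mathbf V^e_k(F)=\{\mathbf v_h\in\mathbf L^2(F):\mathrm{div}_F\mathbf v_h\in\mathbb P_k(F),\ \mathrm{rot}_F\mathbf v_h\in\mathbb P_{k-1}(F),\ \mathbf v_h\cdot\mathbf t_e\in\mathbb P_k(e)\ \forall e\subseteq\partial F\}$. *)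

theory Defs
  imports "HOL-Analysis.Analysis"
begin

definition in_L2 :: "'a::euclidean_space set \<Rightarrow> ('a \<Rightarrow> 'b::euclidean_space) \<Rightarrow> bool" where
  "in_L2 D f \<longleftrightarrow> f \<in> borel_measurable (lebesgue_on D)
     \<and> integrable (lebesgue_on D) (\<lambda>x. (norm (f x))\<^sup>2)"

definition L2_inner :: "'a::euclidean_space set \<Rightarrow> ('a \<Rightarrow> 'b::euclidean_space) \<Rightarrow> ('a \<Rightarrow> 'b) \<Rightarrow> real" where
  "L2_inner D f g = (\<integral>x. f x \<bullet> g x \<partial>lebesgue_on D)"

definition L2_norm :: "'a::euclidean_space set \<Rightarrow> ('a \<Rightarrow> 'b::euclidean_space) \<Rightarrow> real" where
  "L2_norm D f = sqrt (L2_inner D f f)"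

definition edge_start :: "(real^2) list \<Rightarrow> nat \<Rightarrow> real^2" where
  "edge_start vs i = vs ! i"

definition edge_end :: "(real^2) list \<Rightarrow> nat \<Rightarrow> real^2" where
  "edge_end vs i = vs ! (Suc i mod length vs)"

definition edge :: "(real^2) list \<Rightarrow> nat \<Rightarrow> (real^2) set" where
  "edge vs i = closed_segment (edge_start vs i) (edge_end vs i)"

definition edge_length :: "(real^2) list \<Rightarrow> nat \<Rightarrow> real" where
  "edge_length vs i = dist (edge_start vs i) (edge_end vs i)"

text \<open>
  \<open>F\<close> is the (open) polygon with cyclic vertex list \<open>vs\<close>: the bounded domain whose boundary is
  the simple closed polygonal line through \<open>vs\<close>.  Either orientation of \<open>vs\<close> is allowed, and so
  are consecutive collinear edges (hanging nodes).
\<close>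
definition polygon :: "(real^2) list \<Rightarrow> (real^2) set \<Rightarrow> bool" where
  "polygon vs F \<longleftrightarrow>
     length vs \<ge> 3 \<and> distinct vs
     \<and> (\<forall>i<length vs. \<forall>j<length vs. i \<noteq> j \<longrightarrow>
          edge vs i \<inter> edge vs j =
            {edge_start vs i, edge_end vs i} \<inter> {edge_start vs j, edge_end vs j})
     \<and> open F \<and> connected F \<and> bounded F
     \<and> frontier F = (\<Union>i<length vs. edge vs i)"

definition star_shaped_wrt :: "'a::real_vector set \<Rightarrow> 'a set \<Rightarrow> bool" where
  "star_shaped_wrt S B \<longleftrightarrow> (\<forall>x\<in>S. convex hull (insert x B) \<subseteq> S)"

definition mesh_regular :: "real \<Rightarrow> (real^2) list \<Rightarrow> (real^2) set \<Rightarrow> bool" where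
  "mesh_regular \<rho> vs F \<longleftrightarrow> polygon vs F
     \<and> (\<exists>c r. r \<ge> \<rho> * diameter F \<and> star_shaped_wrt F (ball c r))
     \<and> (\<forall>i<length vs. edge_length vs i \<ge> \<rho> * diameter F)"

text \<open>
  Functions on an edge are given on the plane and used only through their values on the edge;
  integration with respect to arc length is pulled back to \<open>{0..1}\<close>.
\<close>
definition edge_L2 :: "(real^2) list \<Rightarrow> nat \<Rightarrow> (real^2 \<Rightarrow> real) \<Rightarrow> bool" where
  "edge_L2 vs i g \<longleftrightarrow> in_L2 {0..1} (g \<circ> linepath (edge_start vs i) (edge_end vs i))"

definition edge_inner :: "(real^2) list \<Rightarrow> nat \<Rightarrow> (real^2 \<Rightarrow> real) \<Rightarrow> (real^2 \<Rightarrow> real) \<Rightarrow> real" where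
  "edge_inner vs i f g = edge_length vs i *
     L2_inner {0..1} (f \<circ> linepath (edge_start vs i) (edge_end vs i))
                     (g \<circ> linepath (edge_start vs i) (edge_end vs i))"

definition polys :: "nat \<Rightarrow> (real^2 \<Rightarrow> real) set" where
  "polys k = {p. \<exists>c :: nat \<Rightarrow> nat \<Rightarrow> real.
     p = (\<lambda>x. \<Sum>i\<le>k. \<Sum>j\<le>k - i. c i j * (x $ 1) ^ i * (x $ 2) ^ j)}"

definition poly_on :: "nat \<Rightarrow> (real^2) set \<Rightarrow> (real^2 \<Rightarrow> real) \<Rightarrow> bool" where
  "poly_on k D f \<longleftrightarrow> (\<exists>p\<in>polys k. \<forall>x\<in>D. f x = p x)"

definition vec_polys :: "nat \<Rightarrow> (real^2 \<Rightarrow> real^2) set" where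
  "vec_polys k = {q. \<forall>i. (\<lambda>x. q x $ i) \<in> polys k}"

text \<open>
  The projection is represented by the polynomial field on the whole plane; it is unique because
  a polynomial vanishing on a nonempty open set vanishes.
\<close>
definition L2_proj :: "nat \<Rightarrow> (real^2) set \<Rightarrow> (real^2 \<Rightarrow> real^2) \<Rightarrow> (real^2 \<Rightarrow> real^2)" where
  "L2_proj k F v =
     (THE q. q \<in> vec_polys k \<and> (\<forall>p\<in>vec_polys k. L2_inner F (\<lambda>x. v x - q x) p = 0))"

definition pderiv_at :: "2 \<Rightarrow> (real^2 \<Rightarrow> real) \<Rightarrow> real^2 \<Rightarrow> real" where
  "pderiv_at i \<phi> x = frechet_derivative \<phi> (at x) (axis i 1)"

definition C1_fun :: "(real^2 \<Rightarrow> real) \<Rightarrow> bool" where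
  "C1_fun \<phi> \<longleftrightarrow> (\<forall>x. \<phi> differentiable at x) \<and> (\<forall>i. continuous_on UNIV (pderiv_at i \<phi>))"

definition test_fun :: "(real^2) set \<Rightarrow> (real^2 \<Rightarrow> real) \<Rightarrow> bool" where
  "test_fun F \<phi> \<longleftrightarrow> C1_fun \<phi> \<and> (\<exists>K. compact K \<and> K \<subseteq> F \<and> (\<forall>x. x \<notin> K \<longrightarrow> \<phi> x = 0))"

text \<open>
  Weak (distributional) divergence and rotation of an \<open>L\<^sup>2\<close> field, tested against compactly
  supported continuously differentiable functions; both are determined almost everywhere.
\<close>
definition has_weak_div :: "(real^2) set \<Rightarrow> (real^2 \<Rightarrow> real^2) \<Rightarrow> (real^2 \<Rightarrow> real) \<Rightarrow> bool" where
  "has_weak_div F v d \<longleftrightarrow> in_L2 F d \<and>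
     (\<forall>\<phi>. test_fun F \<phi> \<longrightarrow>
        (\<integral>x. d x * \<phi> x \<partial>lebesgue_on F) =
        - (\<integral>x. v x $ 1 * pderiv_at 1 \<phi> x + v x $ 2 * pderiv_at 2 \<phi> x \<partial>lebesgue_on F))"

definition has_weak_rot :: "(real^2) set \<Rightarrow> (real^2 \<Rightarrow> real^2) \<Rightarrow> (real^2 \<Rightarrow> real) \<Rightarrow> bool" where
  "has_weak_rot F v r \<longleftrightarrow> in_L2 F r \<and>
     (\<forall>\<phi>. test_fun F \<phi> \<longrightarrow>
        (\<integral>x. r x * \<phi> x \<partial>lebesgue_on F) =
        (\<integral>x. v x $ 1 * pderiv_at 2 \<phi> x - v x $ 2 * pderiv_at 1 \<phi> x \<partial>lebesgue_on F))"

definition weak_rot :: "(real^2) set \<Rightarrow> (real^2 \<Rightarrow> real^2) \<Rightarrow> (real^2 \<Rightarrow> real)" where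
  "weak_rot F v = (SOME r. has_weak_rot F v r)"

text \<open>
  The tangential trace of a field \<open>v\<close> in \<open>H(rot)\<close> is defined by Green's formula.  For smooth \<open>v\<close>,
  with unit outer normal \<open>n = (n\<^sub>1, n\<^sub>2)\<close> and \<open>t = (- n\<^sub>2, n\<^sub>1)\<close>, integration by parts gives
    \<open>\<integral>\<^sub>F (rot v) \<phi> = \<integral>\<^sub>F (v\<^sub>1 \<partial>\<^sub>2\<phi> - v\<^sub>2 \<partial>\<^sub>1\<phi>) + \<integral>\<^sub>\<partial>\<^sub>F (v \<bullet> t) \<phi>\<close>,
  so the direction of \<open>t\<close> is fixed by the formula itself, whatever the orientation of \<open>vs\<close>.
  Here \<open>g i\<close> is \<open>v \<bullet> t\<close> on the \<open>i\<close>-th edge, determined almost everywhere on that edge.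
\<close>
definition has_tangential_trace ::
    "(real^2) list \<Rightarrow> (real^2) set \<Rightarrow> (real^2 \<Rightarrow> real^2) \<Rightarrow> (nat \<Rightarrow> real^2 \<Rightarrow> real) \<Rightarrow> bool" where
  "has_tangential_trace vs F v g \<longleftrightarrow>
     (\<forall>i<length vs. edge_L2 vs i (g i)) \<and>
     (\<exists>r. has_weak_rot F v r \<and>
       (\<forall>\<phi>. C1_fun \<phi> \<longrightarrow>
          (\<integral>x. r x * \<phi> x \<partial>lebesgue_on F) =
          (\<integral>x. v x $ 1 * pderiv_at 2 \<phi> x - v x $ 2 * pderiv_at 1 \<phi> x \<partial>lebesgue_on F)
          + (\<Sum>i<length vs. edge_inner vs i (g i) \<phi>)))"

definition tangential_trace ::
    "(real^2) list \<Rightarrow> (real^2) set \<Rightarrow> (real^2 \<Rightarrow> real^2) \<Rightarrow> (nat \<Rightarrow> real^2 \<Rightarrow> real)" where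
  "tangential_trace vs F v = (SOME g. has_tangential_trace vs F v g)"

definition edge_space :: "nat \<Rightarrow> (real^2) list \<Rightarrow> (real^2) set \<Rightarrow> (real^2 \<Rightarrow> real^2) set" where
  "edge_space k vs F = {v. in_L2 F v
     \<and> (\<exists>d. has_weak_div F v d \<and> poly_on k F d)
     \<and> (\<exists>r. has_weak_rot F v r \<and> poly_on (k - 1) F r)
     \<and> (\<exists>g. has_tangential_trace vs F v g \<and> (\<forall>i<length vs. poly_on k (edge vs i) (g i)))}"

definition S_edge ::
    "nat \<Rightarrow> (real^2) list \<Rightarrow> (real^2) set \<Rightarrow> (real^2 \<Rightarrow> real^2) \<Rightarrow> (real^2 \<Rightarrow> real^2) \<Rightarrow> real" where
  "S_edge k vs F v w =
     diameter F * (\<Sum>i<length vs.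
        edge_inner vs i (tangential_trace vs F v i) (tangential_trace vs F w i))
     + (diameter F)\<^sup>2 * L2_inner F (weak_rot F v) (weak_rot F w)
     + L2_inner F (L2_proj (k + 1) F v) (L2_proj (k + 1) F w)"

end

theory Submission
  imports Defs
begin

text \<open>
  Upper bound.  Testing the weak rotation, a polynomial, against itself times a bubble supported in
  the disk of radius \<open>\<rho> h\<close> controls \<open>h * \<parallel>rot v\<parallel>\<close> by \<open>\<parallel>v\<parallel>\<close>, since all norms on polynomials are
  equivalent.  The trace on an edge is bounded in the same way, with a bubble supported in the
  triangle spanned by the edge and the centre of the disk; these triangles are disjoint, so the
  local estimates add up.

  Lower bound.  The bubble estimate also bounds \<open>div v\<close>, so there is a polynomial field \<open>p\<close> of degree
  \<open>k + 1\<close> and of size at most \<open>C * \<parallel>v\<parallel>\<close> with \<open>div p = div v\<close>.  The difference \<open>u = v - p\<close> is free of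
  divergence, hence an \<open>L\<^sup>2\<close> limit of curls of \<open>C\<^sup>1\<close> functions \<open>\<eta>\<close>.  In \<open>(v, v) = (v, p) + (v, u)\<close> the first
  inner product only sees the projection of \<open>v\<close>, and Green's formula turns \<open>(v, curl \<eta>)\<close> into a term
  with \<open>rot v\<close> and one with the tangential trace, which the Poincare and trace inequalities for
  \<open>\<eta>\<close> bound by \<open>\<parallel>curl \<eta>\<parallel>\<close>.
\<close>

section \<open>Square integrable functions\<close>

text \<open>The constants must not depend on the shape of \<open>F\<close>, and there is no
  reference element to which all admissible polygons could be mapped. The geometry therefore enters
  only through the quotient of \<open>diameter F\<close> and the disk radius
  \<open>R = \<rho> * diameter F\<close>, and through the lower bound on edge lengths. Quantitative
  constants come from fixed disks and from the unit interval; polynomials are compared through their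
  coefficients in the variable (x - c) / h. The degree \<open>k + 1\<close> of the projection is the
  degree of an antiderivative of the divergence. The curl is chosen within half of
  \<open>L2_norm F v\<close> of \<open>u\<close>, so that the error can be absorbed into the
  left-hand side. A second difficulty is that \<open>weak_rot\<close> and
  \<open>tangential_trace\<close> are arbitrary choices, and that the trace is known only through
  Green's formula. Both have to be shown unique almost everywhere before the polynomial
  representatives supplied by \<open>edge_space\<close> say anything about
  \<open>S_edge\<close>.\<close>

lemma L2_norm_sq: "(L2_norm D f)\<^sup>2 = (\<integral>x. (norm (f x))\<^sup>2 \<partial>lebesgue_on D)"
proof -
  have "0 \<le> (\<integral>x. (norm (f x))\<^sup>2 \<partial>lebesgue_on D)" by (rule Bochner_Integration.integral_nonneg) simp
  then show ?thesis
    by (simp add: L2_norm_def L2_inner_def power2_norm_eq_inner)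
qed

lemma L2_inner_self: "L2_inner D f f = (L2_norm D f)\<^sup>2"
  by (simp add: L2_norm_sq) (simp add: L2_inner_def power2_norm_eq_inner)

lemma L2_norm_nonneg [simp]: "0 \<le> L2_norm D f"
proof -
  have "0 \<le> (\<integral>x. (norm (f x))\<^sup>2 \<partial>lebesgue_on D)" by (rule Bochner_Integration.integral_nonneg) simp
  then show ?thesis by (simp add: L2_norm_def L2_inner_def power2_norm_eq_inner)
qed

lemma L2_norm_le: "0 \<le> b \<Longrightarrow> (\<integral>x. (norm (f x))\<^sup>2 \<partial>lebesgue_on D) \<le> b\<^sup>2 \<Longrightarrow> L2_norm D f \<le> b"
  using L2_norm_sq[of D f] by (metis power2_le_imp_le)

lemma in_L2_meas: "in_L2 D f \<Longrightarrow> f \<in> borel_measurable (lebesgue_on D)"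
  by (simp add: in_L2_def)

lemma integrable_inner_L2:
  assumes f: "in_L2 D f" and g: "in_L2 D g"
  shows "integrable (lebesgue_on D) (\<lambda>x. f x \<bullet> g x)"
proof (rule Bochner_Integration.integrable_bound)
  show "integrable (lebesgue_on D) (\<lambda>x. (norm (f x))\<^sup>2 + (norm (g x))\<^sup>2)"
    using f g by (auto simp: in_L2_def)
  show "(\<lambda>x. f x \<bullet> g x) \<in> borel_measurable (lebesgue_on D)"
    using f g by (auto simp: in_L2_def)
  have "norm (f x \<bullet> g x) \<le> (norm (f x))\<^sup>2 + (norm (g x))\<^sup>2" for x
  proof -
    have "norm (f x \<bullet> g x) \<le> norm (f x) * norm (g x)"
      by (simp add: Cauchy_Schwarz_ineq2)
    also have "\<dots> \<le> (norm (f x))\<^sup>2 + (norm (g x))\<^sup>2"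
      using sum_squares_bound[of "norm (f x)" "norm (g x)"]
        mult_nonneg_nonneg[OF norm_ge_zero[of "f x"] norm_ge_zero[of "g x"]]
      unfolding mult.assoc by linarith
    finally show ?thesis .
  qed
  then show "AE x in lebesgue_on D. norm (f x \<bullet> g x) \<le> norm ((norm (f x))\<^sup>2 + (norm (g x))\<^sup>2)"
    by (intro AE_I2) simp
qed

lemma in_L2_scaleR: "in_L2 D f \<Longrightarrow> in_L2 D (\<lambda>x. a *\<^sub>R f x)"
  by (auto simp: in_L2_def power_mult_distrib)

lemma in_L2_minus: "in_L2 D f \<Longrightarrow> in_L2 D (\<lambda>x. - f x)"
  using in_L2_scaleR[of D f "-1"] by simp

lemma in_L2_add:
  assumes f: "in_L2 D f" and g: "in_L2 D g"
  shows "in_L2 D (\<lambda>x. f x + g x)"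
proof -
  have "integrable (lebesgue_on D) (\<lambda>x. (norm (f x))\<^sup>2 + 2 * (f x \<bullet> g x) + (norm (g x))\<^sup>2)"
    using f g integrable_inner_L2[OF f g] by (auto simp: in_L2_def)
  moreover have "(norm (f x + g x))\<^sup>2 = (norm (f x))\<^sup>2 + 2 * (f x \<bullet> g x) + (norm (g x))\<^sup>2" for x
    by (simp add: power2_norm_eq_inner inner_add inner_commute)
  ultimately show ?thesis using f g by (auto simp: in_L2_def)
qed

lemma in_L2_diff: "in_L2 D f \<Longrightarrow> in_L2 D g \<Longrightarrow> in_L2 D (\<lambda>x. f x - g x)"
  using in_L2_add[of D f "\<lambda>x. - g x"] in_L2_minus[of D g] by simp

lemma in_L2_dominated:
  assumes g: "in_L2 D g" and f: "f \<in> borel_measurable (lebesgue_on D)"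
    and le: "\<And>x. x \<in> D \<Longrightarrow> norm (f x) \<le> norm (g x)" and D: "D \<in> sets lebesgue"
  shows "in_L2 D f"
  unfolding in_L2_def
proof
  show "integrable (lebesgue_on D) (\<lambda>x. (norm (f x))\<^sup>2)"
  proof (rule Bochner_Integration.integrable_bound)
    show "integrable (lebesgue_on D) (\<lambda>x. (norm (g x))\<^sup>2)" using g by (simp add: in_L2_def)
    show "(\<lambda>x. (norm (f x))\<^sup>2) \<in> borel_measurable (lebesgue_on D)" using f by auto
    show "AE x in lebesgue_on D. norm ((norm (f x))\<^sup>2) \<le> norm ((norm (g x))\<^sup>2)"
      using le D by (intro AE_I2) (auto simp: space_restrict_space intro!: power_mono)
  qed
qed (use f in auto)

lemma in_L2_bounded:
  assumes f: "f \<in> borel_measurable (lebesgue_on D)" and D: "D \<in> lmeasurable"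
    and le: "\<And>x. x \<in> D \<Longrightarrow> norm (f x) \<le> b"
  shows "in_L2 D (f :: 'a::euclidean_space \<Rightarrow> 'b::euclidean_space)"
proof -
  have "in_L2 D (\<lambda>x::'a. b)"
    using D by (simp add: in_L2_def lmeasurable_iff_integrable_on fmeasurable_def)
       (metis D finite_measure_lebesgue_on finite_measure.integrable_const)
  from in_L2_dominated[OF this f] D le show ?thesis
    by (auto simp: fmeasurable_def intro: order_trans[OF _ abs_ge_self])
qed

lemma in_L2_continuous:
  assumes "continuous_on UNIV f" "D \<in> lmeasurable" "bounded D"
  shows "in_L2 D (f :: 'a::euclidean_space \<Rightarrow> 'b::euclidean_space)"
proof -
  have "compact (f ` closure D)"
    by (intro compact_continuous_image) (use assms in \<open>auto intro: continuous_on_subset\<close>)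
  then obtain b where b: "\<And>x. x \<in> closure D \<Longrightarrow> norm (f x) \<le> b"
    by (meson bounded_iff compact_imp_bounded imageI)
  show ?thesis
  proof (rule in_L2_bounded)
    show "f \<in> borel_measurable (lebesgue_on D)"
      using assms(1) by (intro measurable_restrict_space1 measurable_completion) (auto intro: borel_measurable_continuous_onI)
    show "norm (f x) \<le> b" if "x \<in> D" for x using b that closure_subset by blast
  qed fact
qed

lemma in_L2_component:
  assumes "in_L2 D (f :: 'a::euclidean_space \<Rightarrow> real^2)"  "D \<in> sets lebesgue"
  shows "in_L2 D (\<lambda>x. f x $ i)"
proof (rule in_L2_dominated[OF assms(1)])
  show "(\<lambda>x. f x $ i) \<in> borel_measurable (lebesgue_on D)"
    using in_L2_meas[OF assms(1)] by (rule measurable_compose) (auto intro!: borel_measurable_continuous_onI continuous_intros)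
  show "norm (f x $ i) \<le> norm (f x)" for x by (rule Finite_Cartesian_Product.norm_nth_le)
qed (use assms in auto)

lemma L2_inner_CS:
  assumes f: "in_L2 D f" and g: "in_L2 D g"
  shows "\<bar>L2_inner D f g\<bar> \<le> L2_norm D f * L2_norm D g"
proof -
  let ?a = "L2_norm D f" and ?b = "L2_norm D g"
  \<comment> \<open>Nonnegativity of the squared norm of
    \<open>s *\<^sub>R f x + t *\<^sub>R g x\<close>. The inequality is its discriminant condition,
    obtained from (s, t) = (b, a) and (b, -a), where a and b are the two norms.\<close>
  have q: "0 \<le> s\<^sup>2 * ?a\<^sup>2 + 2 * s * t * L2_inner D f g + t\<^sup>2 * ?b\<^sup>2" for s t
  proof -
    have "0 \<le> (\<integral>x. (norm (s *\<^sub>R f x + t *\<^sub>R g x))\<^sup>2 \<partial>lebesgue_on D)" by (rule Bochner_Integration.integral_nonneg) simp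
    also have "\<dots> = (\<integral>x. s\<^sup>2 * (norm (f x))\<^sup>2 + 2 * s * t * (f x \<bullet> g x) + t\<^sup>2 * (norm (g x))\<^sup>2 \<partial>lebesgue_on D)"
      unfolding power2_norm_eq_inner
      by (rule Bochner_Integration.integral_cong)
         (auto simp: inner_add inner_commute algebra_simps power2_eq_square)
    also have "\<dots> = s\<^sup>2 * ?a\<^sup>2 + 2 * s * t * L2_inner D f g + t\<^sup>2 * ?b\<^sup>2"
      using integrable_inner_L2[OF f g] f g unfolding L2_norm_sq L2_inner_def
      by (simp add: in_L2_def)
    finally show ?thesis .
  qed
  show ?thesis
  proof (cases "?a = 0 \<or> ?b = 0")
    case False
    then have pos: "?a > 0" "?b > 0" using L2_norm_nonneg[of D f] L2_norm_nonneg[of D g] by linarith+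
    have "0 \<le> ?b\<^sup>2 * ?a\<^sup>2 + 2 * ?b * ?a * L2_inner D f g + ?a\<^sup>2 * ?b\<^sup>2"
         "0 \<le> ?b\<^sup>2 * ?a\<^sup>2 + 2 * ?b * (-?a) * L2_inner D f g + (-?a)\<^sup>2 * ?b\<^sup>2"
      using q[of ?b ?a] q[of ?b "-?a"] by auto
    then have "0 \<le> 2 * (?a * ?b) * (?a * ?b + L2_inner D f g)" "0 \<le> 2 * (?a * ?b) * (?a * ?b - L2_inner D f g)"
      by (simp_all add: power2_eq_square algebra_simps)
    moreover have "0 < 2 * (?a * ?b)" using pos by simp
    ultimately have "0 \<le> ?a * ?b + L2_inner D f g" "0 \<le> ?a * ?b - L2_inner D f g"
      using zero_le_mult_iff not_le by blast+
    then show ?thesis by (simp add: abs_le_iff)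
  next
    case True
    \<comment> \<open>If one norm vanishes, the form is affine in the corresponding variable; the
      value inserted below would make it equal to -1.\<close>
    have "L2_inner D f g = 0"
    proof (rule ccontr)
      assume n: "L2_inner D f g \<noteq> 0"
      from True show False
      proof
        assume a0: "?a = 0"
        have "0 \<le> 2 * (- (?b\<^sup>2 + 1) / (2 * L2_inner D f g)) * L2_inner D f g + ?b\<^sup>2"
          using q[of "- (?b\<^sup>2 + 1) / (2 * L2_inner D f g)" 1] a0 by simp
        then show False using n by (simp add: field_simps)
      next
        assume b0: "?b = 0"
        have "0 \<le> 2 * (- (?a\<^sup>2 + 1) / (2 * L2_inner D f g)) * L2_inner D f g + ?a\<^sup>2"
          using q[of 1 "- (?a\<^sup>2 + 1) / (2 * L2_inner D f g)"] b0 by simp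
        then show False using n by (simp add: field_simps)
      qed
    qed
    then show ?thesis using True by auto
  qed
qed

lemma L2_inner_add_right: "in_L2 D f \<Longrightarrow> in_L2 D g \<Longrightarrow> in_L2 D k \<Longrightarrow>
    L2_inner D f (\<lambda>x. g x + k x) = L2_inner D f g + L2_inner D f k"
  by (simp add: L2_inner_def inner_add_right integrable_inner_L2)

lemma L2_inner_diff_right: "in_L2 D f \<Longrightarrow> in_L2 D g \<Longrightarrow> in_L2 D k \<Longrightarrow>
    L2_inner D f (\<lambda>x. g x - k x) = L2_inner D f g - L2_inner D f k"
  by (simp add: L2_inner_def inner_diff_right integrable_inner_L2)

lemma L2_inner_diff_left: "in_L2 D f \<Longrightarrow> in_L2 D g \<Longrightarrow> in_L2 D k \<Longrightarrow>
    L2_inner D (\<lambda>x. f x - g x) k = L2_inner D f k - L2_inner D g k"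
  by (simp add: L2_inner_def inner_diff_left integrable_inner_L2)

lemma L2_inner_sum_right: "in_L2 D f \<Longrightarrow> (\<And>i. i \<in> I \<Longrightarrow> in_L2 D (g i)) \<Longrightarrow>
    L2_inner D f (\<lambda>x. \<Sum>i\<in>I. c i *\<^sub>R g i x) = (\<Sum>i\<in>I. c i * L2_inner D f (g i))"
  by (simp add: L2_inner_def inner_sum_right integrable_inner_L2)

lemma L2_norm_triangle:
  assumes f: "in_L2 D f" and g: "in_L2 D g"
  shows "L2_norm D (\<lambda>x. f x + g x) \<le> L2_norm D f + L2_norm D g"
proof (rule L2_norm_le)
  have "(\<integral>x. (norm (f x + g x))\<^sup>2 \<partial>lebesgue_on D)
      = (\<integral>x. (norm (f x))\<^sup>2 + 2 * (f x \<bullet> g x) + (norm (g x))\<^sup>2 \<partial>lebesgue_on D)"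
    by (rule Bochner_Integration.integral_cong) (auto simp: power2_norm_eq_inner inner_add inner_commute)
  also have "\<dots> = (L2_norm D f)\<^sup>2 + 2 * L2_inner D f g + (L2_norm D g)\<^sup>2"
    using integrable_inner_L2[OF f g] f g unfolding L2_norm_sq L2_inner_def by (simp add: in_L2_def)
  also have "\<dots> \<le> (L2_norm D f + L2_norm D g)\<^sup>2"
    using L2_inner_CS[OF f g] by (simp add: power2_sum abs_le_iff)
  finally show "(\<integral>x. (norm (f x + g x))\<^sup>2 \<partial>lebesgue_on D) \<le> (L2_norm D f + L2_norm D g)\<^sup>2" .
qed simp

lemma L2_norm_minus [simp]: "L2_norm D (\<lambda>x. - f x) = L2_norm D f"
  by (simp add: L2_norm_def L2_inner_def)

lemma L2_norm_triangle_diff: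
  assumes f: "in_L2 D f" and g: "in_L2 D g"
  shows "L2_norm D (\<lambda>x. f x - g x) \<le> L2_norm D f + L2_norm D g"
  using L2_norm_triangle[OF f in_L2_minus[OF g]] by simp

lemma L2_norm_cong_AE:
  assumes "AE x in lebesgue_on D. f x = g x" "f \<in> borel_measurable (lebesgue_on D)" "g \<in> borel_measurable (lebesgue_on D)"
  shows "L2_norm D f = L2_norm D g"
  unfolding L2_norm_def L2_inner_def
  by (rule arg_cong[where f=sqrt], rule integral_cong_AE) (use assms in \<open>auto elim: AE_mp\<close>)

lemma L2_norm_bounded:
  assumes "D \<in> lmeasurable" "\<And>x. x \<in> D \<Longrightarrow> norm (f x) \<le> b" "0 \<le> b"
    "f \<in> borel_measurable (lebesgue_on D)"
  shows "L2_norm D f \<le> b * sqrt (measure lebesgue D)"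
proof (rule L2_norm_le)
  have D: "D \<in> sets lebesgue" using assms by auto
  have i: "integrable (lebesgue_on D) (\<lambda>x. b\<^sup>2)"
    by (rule finite_measure.integrable_const[OF finite_measure_lebesgue_on[OF assms(1)]])
  have "(\<integral>x. (norm (f x))\<^sup>2 \<partial>lebesgue_on D) \<le> (\<integral>x. b\<^sup>2 \<partial>lebesgue_on D)"
  proof (rule integral_mono)
    show "integrable (lebesgue_on D) (\<lambda>x. (norm (f x))\<^sup>2)"
      using in_L2_bounded[OF assms(4,1,2)] by (simp add: in_L2_def)
  qed (use i assms D in \<open>auto simp: space_restrict_space intro!: power_mono\<close>)
  also have "\<dots> = b\<^sup>2 * measure lebesgue D" using D by (simp add: measure_restrict_space space_restrict_space)
  also have "\<dots> = (b * sqrt (measure lebesgue D))\<^sup>2" by (simp add: power_mult_distrib)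
  finally show "(\<integral>x. (norm (f x))\<^sup>2 \<partial>lebesgue_on D) \<le> (b * sqrt (measure lebesgue D))\<^sup>2" .
qed (use assms in auto)

section \<open>Continuously differentiable functions of two variables\<close>

text \<open>C^1 regularity with the gradient carried along as data. The
  \<open>frechet_derivative\<close> inside \<open>pderiv_at\<close> is then evaluated once, in
  \<open>has_grad_pderiv\<close>, and partial derivatives appear as components of
  \<open>g\<close>.\<close>

definition has_grad :: "(real^2 \<Rightarrow> real) \<Rightarrow> (real^2 \<Rightarrow> real^2) \<Rightarrow> bool" where
  "has_grad \<phi> g \<longleftrightarrow> (\<forall>x. (\<phi> has_derivative (\<lambda>v. g x \<bullet> v)) (at x)) \<and> continuous_on UNIV g"

text \<open>The sign is chosen so that \<open>rot90\<close> of the gradient of \<open>\<phi>\<close> is the field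
  \<open>(\<partial>\<^sub>2\<phi>, - \<partial>\<^sub>1\<phi>)\<close> of Green's formula.\<close>
definition rot90 :: "real^2 \<Rightarrow> real^2" where
  "rot90 g = vector [g $ 2, - g $ 1]"

lemma rot90_nth [simp]: "rot90 g $ 1 = g $ 2" "rot90 g $ 2 = - g $ 1"
  by (simp_all add: rot90_def)

lemma inner_real2: "x \<bullet> y = x $ 1 * y $ 1 + x $ 2 * y $ 2" for x y :: "real^2"
  by (simp add: inner_vec_def sum_2)

lemma norm_rot90 [simp]: "norm (rot90 g) = norm g"
  by (simp add: norm_eq_sqrt_inner inner_real2 algebra_simps)

lemma linear_rot90: "linear rot90"
  by (rule linearI) (simp_all add: vec_eq_iff forall_2)

lemma inner_rot90: "rot90 x \<bullet> y = - (x \<bullet> rot90 y)" "rot90 x \<bullet> rot90 y = x \<bullet> y"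
  by (simp_all add: inner_real2)

lemma rot90_rot90 [simp]: "rot90 (rot90 x) = - x"
  by (simp add: vec_eq_iff forall_2)

lemma in_L2_rot90:
  assumes "in_L2 D f" "D \<in> sets lebesgue"
  shows "in_L2 D (\<lambda>x. rot90 (f x))"
proof (rule in_L2_dominated[OF assms(1)])
  show "(\<lambda>x. rot90 (f x)) \<in> borel_measurable (lebesgue_on D)"
    by (rule measurable_compose[OF in_L2_meas[OF assms(1)] borel_measurable_continuous_onI])
       (rule linear_continuous_on[OF linear_rot90[unfolded linear_conv_bounded_linear]])
qed (use assms in auto)

lemma L2_norm_rot90 [simp]: "L2_norm D (\<lambda>x. rot90 (f x)) = L2_norm D f"
  by (simp add: L2_norm_def L2_inner_def inner_rot90)

lemma has_grad_derivative: "has_grad \<phi> g \<Longrightarrow> (\<phi> has_derivative (\<lambda>v. g x \<bullet> v)) (at x)"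
  by (simp add: has_grad_def)

lemma continuous_on_grad: "has_grad \<phi> g \<Longrightarrow> continuous_on UNIV g"
  by (simp add: has_grad_def)

lemma has_grad_continuous_on: "has_grad \<phi> g \<Longrightarrow> continuous_on UNIV \<phi>"
  by (intro continuous_at_imp_continuous_on ballI has_derivative_continuous[OF has_grad_derivative])

lemma has_grad_pderiv: "has_grad \<phi> g \<Longrightarrow> pderiv_at i \<phi> x = g x $ i"
  using frechet_derivative_at[OF has_grad_derivative[of \<phi> g x], symmetric]
  by (simp add: pderiv_at_def inner_axis)

lemma has_grad_C1: assumes "has_grad \<phi> g" shows "C1_fun \<phi>"
  unfolding C1_fun_def
proof (intro conjI allI)
  show "\<phi> differentiable at x" for x
    using has_grad_derivative[OF assms] differentiable_def by blast
  have "pderiv_at i \<phi> = (\<lambda>x. g x $ i)" for i using has_grad_pderiv[OF assms] by blast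
  then show "continuous_on UNIV (pderiv_at i \<phi>)" for i
    using continuous_on_component[OF continuous_on_grad[OF assms]] by simp
qed

lemma has_grad_const: "has_grad (\<lambda>x. a) (\<lambda>x. 0)"
  by (auto simp: has_grad_def intro!: derivative_eq_intros)

lemma has_grad_affine: "has_grad (\<lambda>x. a \<bullet> (x - c)) (\<lambda>x. a)"
  by (auto simp: has_grad_def intro!: derivative_eq_intros)

lemma has_grad_add: "has_grad f f' \<Longrightarrow> has_grad g g' \<Longrightarrow> has_grad (\<lambda>x. f x + g x) (\<lambda>x. f' x + g' x)"
  by (auto simp: has_grad_def inner_add_left intro!: derivative_eq_intros continuous_intros)

lemma has_grad_diff: "has_grad f f' \<Longrightarrow> has_grad g g' \<Longrightarrow> has_grad (\<lambda>x. f x - g x) (\<lambda>x. f' x - g' x)"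
  by (auto simp: has_grad_def inner_diff_left intro!: derivative_eq_intros continuous_intros)

lemma has_grad_mult:
  assumes "has_grad f f'" "has_grad g g'"
  shows "has_grad (\<lambda>x. f x * g x) (\<lambda>x. f x *\<^sub>R g' x + g x *\<^sub>R f' x)"
  unfolding has_grad_def
proof (intro conjI allI)
  fix x
  show "((\<lambda>x. f x * g x) has_derivative (\<lambda>v. (f x *\<^sub>R g' x + g x *\<^sub>R f' x) \<bullet> v)) (at x)"
    by (rule has_derivative_eq_rhs[OF has_derivative_mult[OF has_grad_derivative[OF assms(1)] has_grad_derivative[OF assms(2)]]])
       (auto simp: inner_add_left algebra_simps)
  show "continuous_on UNIV (\<lambda>x. f x *\<^sub>R g' x + g x *\<^sub>R f' x)"
    by (intro continuous_intros has_grad_continuous_on[OF assms(1)] has_grad_continuous_on[OF assms(2)]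
         continuous_on_grad[OF assms(1)] continuous_on_grad[OF assms(2)])
qed

lemma has_grad_cmult: "has_grad g g' \<Longrightarrow> has_grad (\<lambda>x. a * g x) (\<lambda>x. a *\<^sub>R g' x)"
  using has_grad_mult[OF has_grad_const[of a], of g g'] by simp

lemma has_grad_sum:
  "(\<And>i. i \<in> I \<Longrightarrow> has_grad (f i) (f' i)) \<Longrightarrow> has_grad (\<lambda>x. \<Sum>i\<in>I. f i x) (\<lambda>x. \<Sum>i\<in>I. f' i x)"
  by (induction I rule: infinite_finite_induct) (auto intro: has_grad_add has_grad_const)

lemma has_grad_compose_real:
  assumes f: "has_grad f f'" and \<beta>: "\<And>t. (\<beta> has_real_derivative \<beta>' t) (at t)" and c: "continuous_on UNIV \<beta>'"
  shows "has_grad (\<lambda>x. \<beta> (f x)) (\<lambda>x. \<beta>' (f x) *\<^sub>R f' x)"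
  unfolding has_grad_def
proof (intro conjI allI)
  fix x
  have "(\<beta> has_derivative (*) (\<beta>' (f x))) (at (f x))"
    using \<beta> by (simp add: has_field_derivative_def)
  from has_derivative_compose[OF has_grad_derivative[OF f, of x] this]
  show "((\<lambda>x. \<beta> (f x)) has_derivative (\<lambda>v. (\<beta>' (f x) *\<^sub>R f' x) \<bullet> v)) (at x)" by simp
  have "continuous_on UNIV (\<lambda>x. \<beta>' (f x))"
    using continuous_on_compose2[OF c has_grad_continuous_on[OF f]] by simp
  then show "continuous_on UNIV (\<lambda>x. \<beta>' (f x) *\<^sub>R f' x)"
    using continuous_on_grad[OF f] by (intro continuous_intros)
qed

lemma has_grad_compose_affine:
  assumes f: "has_grad f f'"
  shows "has_grad (\<lambda>x. f (vector [a \<bullet> (x - c), b \<bullet> (x - c)]))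
    (\<lambda>x. (f' (vector [a \<bullet> (x - c), b \<bullet> (x - c)]) $ 1) *\<^sub>R a + (f' (vector [a \<bullet> (x - c), b \<bullet> (x - c)]) $ 2) *\<^sub>R b)"
  (is "has_grad (\<lambda>x. f (?A x)) ?g")
  unfolding has_grad_def
proof (intro conjI allI)
  have lin: "linear (\<lambda>v. vector [a \<bullet> v, b \<bullet> v] :: real^2)"
    by (rule linearI) (simp_all add: vec_eq_iff forall_2 inner_add_right)
  have A: "?A x = vector [a \<bullet> x, b \<bullet> x] - vector [a \<bullet> c, b \<bullet> c]" for x
    by (simp add: vec_eq_iff forall_2 inner_diff_right)
  have dA: "(?A has_derivative (\<lambda>v. vector [a \<bullet> v, b \<bullet> v])) (at x)" for x
    unfolding A using linear_imp_has_derivative[OF lin] by (auto intro!: derivative_eq_intros)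
  fix x
  from has_derivative_compose[OF dA has_grad_derivative[OF f]]
  show "((\<lambda>x. f (?A x)) has_derivative (\<lambda>v. ?g x \<bullet> v)) (at x)"
    by (rule has_derivative_eq_rhs) (simp add: fun_eq_iff inner_real2 algebra_simps)
  have "continuous_on UNIV ?A" using dA by (meson continuous_at_imp_continuous_on has_derivative_continuous)
  then have "continuous_on UNIV (\<lambda>x. f' (?A x))"
    using continuous_on_compose2[OF continuous_on_grad[OF f]] by blast
  then show "continuous_on UNIV ?g" by (intro continuous_intros)
qed

lemma has_grad_shift:
  assumes "has_grad f f'" shows "has_grad (\<lambda>x. f (a + s *\<^sub>R x)) (\<lambda>x. s *\<^sub>R f' (a + s *\<^sub>R x))"
  unfolding has_grad_def
proof (intro conjI allI)
  fix x
  have "((\<lambda>x. a + s *\<^sub>R x) has_derivative (\<lambda>v. s *\<^sub>R v)) (at x)" by (auto intro!: derivative_eq_intros)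
  from has_derivative_compose[OF this has_grad_derivative[OF assms]]
  show "((\<lambda>x. f (a + s *\<^sub>R x)) has_derivative (\<lambda>v. (s *\<^sub>R f' (a + s *\<^sub>R x)) \<bullet> v)) (at x)" by simp
  show "continuous_on UNIV (\<lambda>x. s *\<^sub>R f' (a + s *\<^sub>R x))"
    by (intro continuous_intros continuous_on_compose2[OF continuous_on_grad[OF assms]]) auto
qed

text \<open>At 0 the difference quotient is bounded by the absolute value of the increment. Hence
  the squared positive part is C^1, exactly the regularity asked for by \<open>C1_fun\<close>; the
  cut-off functions below are built from it.\<close>

lemma pos_sq_derivative: "((\<lambda>t. (max 0 t)\<^sup>2) has_real_derivative 2 * max 0 t) (at t)"
proof -
  consider "t > 0" | "t < 0" | "t = 0" by linarith
  then show ?thesis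
  proof cases
    case 1
    have "((\<lambda>t. t\<^sup>2) has_real_derivative 2 * max 0 t) (at t)"
      using 1 by (auto intro!: derivative_eq_intros)
    then show ?thesis
      by (rule has_field_derivative_transform_within_open[of _ _ _ "{0<..}"]) (use 1 in auto)
  next
    case 2
    have "((\<lambda>t. 0) has_real_derivative 2 * max 0 t) (at t)"
      using 2 by (auto intro!: derivative_eq_intros)
    then show ?thesis
      by (rule has_field_derivative_transform_within_open[of _ _ _ "{..<0}"]) (use 2 in auto)
  next
    case 3
    have "((\<lambda>h. ((max 0 (0 + h))\<^sup>2 - (max 0 0)\<^sup>2) / h) \<longlongrightarrow> 0) (at (0::real))"
    proof (rule Lim_null_comparison)
      show "\<forall>\<^sub>F h in at (0::real). norm (((max 0 (0 + h))\<^sup>2 - (max 0 0)\<^sup>2) / h) \<le> \<bar>h\<bar>"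
        by (auto simp: max_def power2_eq_square)
      show "((\<lambda>h::real. \<bar>h\<bar>) \<longlongrightarrow> 0) (at 0)" by (rule tendsto_eq_intros refl | simp)+
    qed
    then show ?thesis using 3 by (simp add: DERIV_def)
  qed
qed

lemma has_grad_pos_sq:
  assumes "has_grad f f'"
  shows "has_grad (\<lambda>x. (max 0 (f x))\<^sup>2) (\<lambda>x. (2 * max 0 (f x)) *\<^sub>R f' x)"
  by (rule has_grad_compose_real[OF assms, where \<beta>="\<lambda>t. (max 0 t)\<^sup>2" and \<beta>'="\<lambda>t. 2 * max 0 t", OF pos_sq_derivative])
     (intro continuous_intros)

text \<open>The outer square makes the function C^1 across the circle. It also makes
  \<open>bump\<close> a perfect square, so that a polynomial tested against itself times
  \<open>bump\<close> gives a squared norm in \<open>bubble_estimate\<close>.\<close>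

definition bump :: "real^2 \<Rightarrow> real \<Rightarrow> real^2 \<Rightarrow> real" where
  "bump c R x = (max 0 (R\<^sup>2 - (norm (x - c))\<^sup>2))\<^sup>2"

definition bump_grad :: "real^2 \<Rightarrow> real \<Rightarrow> real^2 \<Rightarrow> real^2" where
  "bump_grad c R x = (2 * max 0 (R\<^sup>2 - (norm (x - c))\<^sup>2)) *\<^sub>R (- 2 *\<^sub>R (x - c))"

lemma has_grad_bump: "has_grad (bump c R) (bump_grad c R)"
proof -
  have "has_grad (\<lambda>x. R\<^sup>2 - (norm (x - c))\<^sup>2) (\<lambda>x. - 2 *\<^sub>R (x - c))"
    unfolding has_grad_def power2_norm_eq_inner
    by (auto intro!: derivative_eq_intros continuous_intros simp: inner_commute)
  from has_grad_pos_sq[OF this] show ?thesis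
    by (simp add: bump_def[abs_def] bump_grad_def[abs_def])
qed

lemma bump_nonneg [simp]: "0 \<le> bump c R x" by (simp add: bump_def)

lemma bump_pos: "x \<in> ball c R \<Longrightarrow> 0 < bump c R x"
  using power_strict_mono[of "norm (x - c)" R 2]
  by (simp add: bump_def dist_norm norm_minus_commute max_def not_le)

lemma bump_outside: "x \<notin> cball c R \<Longrightarrow> 0 \<le> R \<Longrightarrow> bump c R x = 0" "x \<notin> cball c R \<Longrightarrow> 0 \<le> R \<Longrightarrow> bump_grad c R x = 0"
proof -
  assume "x \<notin> cball c R" "0 \<le> R"
  then have "R\<^sup>2 \<le> (norm (x - c))\<^sup>2" by (simp add: dist_norm norm_minus_commute power_mono)
  then show "bump c R x = 0" "bump_grad c R x = 0" by (simp_all add: bump_def bump_grad_def max_def)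
qed

text \<open>Supports are prescribed for functions only; this transfers them to gradients, which is
  what appears under the integrals.\<close>

lemma has_grad_zero_outside:
  assumes "has_grad \<phi> g" "closed K" "\<And>x. x \<notin> K \<Longrightarrow> \<phi> x = 0" "x \<notin> K"
  shows "g x = 0"
proof -
  have "((\<lambda>x. 0) has_derivative (\<lambda>v. 0)) (at x)" by simp
  then have "(\<phi> has_derivative (\<lambda>v. 0)) (at x)"
    by (rule has_derivative_transform_within_open[of _ _ _ _ "- K"]) (use assms in auto)
  from has_derivative_unique[OF this has_grad_derivative[OF assms(1)]]
  have "g x \<bullet> g x = 0" by metis
  then show ?thesis by simp
qed

section \<open>Gram matrices\<close>

text \<open>Completing the square, i.e. block elimination for a symmetric matrix bordered by row and
  column \<open>n\<close>: \<open>a\<close> solves the system whose right-hand side is the new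
  column, and the factor of \<open>(c n)\<^sup>2\<close> is the Schur complement.\<close>

lemma gram_schur:
  fixes B :: "'i \<Rightarrow> 'i \<Rightarrow> real"
  assumes fin: "finite I" and n: "n \<notin> I"
    and sym: "\<And>i j. B i j = B j i"
    and a: "\<And>i. i \<in> I \<Longrightarrow> (\<Sum>j\<in>I. B i j * a j) = B i n"
  shows "(\<Sum>i\<in>insert n I. \<Sum>j\<in>insert n I. c i * c j * B i j)
    = (\<Sum>i\<in>I. \<Sum>j\<in>I. (c i + c n * a i) * (c j + c n * a j) * B i j)
      + (c n)\<^sup>2 * (B n n - (\<Sum>j\<in>I. B n j * a j))"
proof -
  define P where "P = (\<Sum>i\<in>I. \<Sum>j\<in>I. c i * c j * B i j)"
  define q where "q = (\<Sum>i\<in>I. c i * B i n)"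
  define r where "r = (\<Sum>i\<in>I. a i * B i n)"
  have r: "(\<Sum>j\<in>I. B n j * a j) = r" unfolding r_def
  proof (rule sum.cong[OF refl])
    fix i show "B n i * a i = a i * B i n" using sym[of i n] by simp
  qed
  have s1: "(\<Sum>i\<in>I. \<Sum>j\<in>I. x i * a j * B i j) = (\<Sum>i\<in>I. x i * B i n)" for x :: "'i \<Rightarrow> real"
  proof (rule sum.cong[OF refl])
    fix i assume i: "i \<in> I"
    have "(\<Sum>j\<in>I. x i * a j * B i j) = x i * (\<Sum>j\<in>I. B i j * a j)"
      unfolding sum_distrib_left by (rule sum.cong) (simp_all add: mult_ac)
    then show "(\<Sum>j\<in>I. x i * a j * B i j) = x i * B i n" using a[OF i] by simp
  qed
  have s2: "(\<Sum>i\<in>I. \<Sum>j\<in>I. a i * x j * B i j) = (\<Sum>i\<in>I. x i * B i n)" for x :: "'i \<Rightarrow> real"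
  proof -
    have "(\<Sum>i\<in>I. \<Sum>j\<in>I. a i * x j * B i j) = (\<Sum>j\<in>I. \<Sum>i\<in>I. a i * x j * B i j)" by (rule sum.swap)
    also have "\<dots> = (\<Sum>i\<in>I. \<Sum>j\<in>I. x i * a j * B i j)"
    proof (intro sum.cong refl)
      fix i j show "a j * x i * B j i = x i * a j * B i j" using sym[of i j] by (simp add: mult_ac)
    qed
    finally show ?thesis unfolding s1 .
  qed
  have "(\<Sum>i\<in>I. \<Sum>j\<in>I. (c i + c n * a i) * (c j + c n * a j) * B i j)
     = (\<Sum>i\<in>I. \<Sum>j\<in>I. c i * c j * B i j + c n * (c i * a j * B i j) + c n * (a i * c j * B i j) + (c n)\<^sup>2 * (a i * a j * B i j))"
    by (intro sum.cong refl) (simp add: algebra_simps power2_eq_square)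
  also have "\<dots> = P + 2 * c n * q + (c n)\<^sup>2 * r"
    unfolding sum.distrib sum_distrib_left[symmetric] s1 s2 P_def[symmetric] q_def[symmetric] r_def[symmetric] by simp
  finally have 1: "(\<Sum>i\<in>I. \<Sum>j\<in>I. (c i + c n * a i) * (c j + c n * a j) * B i j) = P + 2 * c n * q + (c n)\<^sup>2 * r" .
  have "(\<Sum>i\<in>insert n I. \<Sum>j\<in>insert n I. c i * c j * B i j)
     = c n * c n * B n n + (\<Sum>j\<in>I. c n * c j * B n j) + ((\<Sum>i\<in>I. c i * c n * B i n) + P)"
    using fin n by (simp add: sum.distrib P_def)
  also have "(\<Sum>j\<in>I. c n * c j * B n j) = c n * q"
    unfolding q_def sum_distrib_left
  proof (rule sum.cong[OF refl])
    fix i show "c n * c i * B n i = c n * (c i * B i n)" using sym[of i n] by simp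
  qed
  also have "(\<Sum>i\<in>I. c i * c n * B i n) = c n * q"
    unfolding q_def sum_distrib_left by (rule sum.cong) auto
  finally show ?thesis unfolding 1 r by (simp add: algebra_simps power2_eq_square)
qed

text \<open>Induction on the index set with the Schur complement as pivot. The two conclusions are
  what finite-dimensional norm equivalence amounts to here: the normal equations are solvable, which
  yields the orthogonal projection, and the form dominates the sum of squared coefficients.\<close>

lemma gram_positive_definite:
  fixes B :: "'i \<Rightarrow> 'i \<Rightarrow> real"
  assumes "finite I" and sym: "\<And>i j. B i j = B j i"
    and "\<And>c. \<exists>i\<in>I. c i \<noteq> 0 \<Longrightarrow> 0 < (\<Sum>i\<in>I. \<Sum>j\<in>I. c i * c j * B i j)"
  shows "(\<forall>b. \<exists>c. \<forall>i\<in>I. (\<Sum>j\<in>I. B i j * c j) = b i) \<and>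
    (\<exists>\<alpha>>0. \<forall>c. \<alpha> * (\<Sum>i\<in>I. (c i)\<^sup>2) \<le> (\<Sum>i\<in>I. \<Sum>j\<in>I. c i * c j * B i j))"
  using assms(1,3)
proof (induction I rule: finite_induct)
  case empty
  show ?case by (auto intro: exI[of _ 1])
next
  case (insert n I)
  have pd: "0 < (\<Sum>i\<in>I. \<Sum>j\<in>I. c i * c j * B i j)" if "\<exists>i\<in>I. c i \<noteq> 0" for c
  proof -
    have "(\<Sum>i\<in>insert n I. \<Sum>j\<in>insert n I. (c(n := 0)) i * (c(n := 0)) j * B i j) = (\<Sum>i\<in>I. \<Sum>j\<in>I. c i * c j * B i j)"
      using insert.hyps by (auto intro!: sum.cong)
    moreover have "\<exists>i\<in>insert n I. (c(n := 0)) i \<noteq> 0" using that insert.hyps by auto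
    ultimately show ?thesis using insert.prems[of "c(n := 0)"] by simp
  qed
  from insert.IH[OF pd] obtain \<alpha> where solve: "\<And>b. \<exists>c. \<forall>i\<in>I. (\<Sum>j\<in>I. B i j * c j) = b i"
    and \<alpha>: "\<alpha> > 0" "\<And>c. \<alpha> * (\<Sum>i\<in>I. (c i)\<^sup>2) \<le> (\<Sum>i\<in>I. \<Sum>j\<in>I. c i * c j * B i j)" by blast
  obtain a where a: "\<And>i. i \<in> I \<Longrightarrow> (\<Sum>j\<in>I. B i j * a j) = B i n" using solve[of "\<lambda>i. B i n"] by blast
  define s where "s = B n n - (\<Sum>j\<in>I. B n j * a j)"
  note schur = gram_schur[OF insert.hyps sym a, folded s_def]
  \<comment> \<open>The vector with entry 1 at \<open>n\<close> and \<open>- a\<close> on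
    \<open>I\<close> annihilates the first term of \<open>schur\<close>, so its positive value is
    the pivot itself.\<close>
  have s: "s > 0"
  proof -
    let ?c = "\<lambda>i. if i = n then 1 else - a i"
    have "(\<Sum>i\<in>I. \<Sum>j\<in>I. (?c i + ?c n * a i) * (?c j + ?c n * a j) * B i j) = 0"
      by (intro sum.neutral ballI) (use insert.hyps in auto)
    with schur[of ?c] insert.prems[of ?c] show ?thesis by simp
  qed
  have 1: "\<exists>c. \<forall>i\<in>insert n I. (\<Sum>j\<in>insert n I. B i j * c j) = b i" for b
  proof -
    obtain y where y: "\<And>i. i \<in> I \<Longrightarrow> (\<Sum>j\<in>I. B i j * y j) = b i" using solve[of b] by blast
    \<comment> \<open>Subtracting \<open>t\<close> times \<open>a\<close> from \<open>y\<close>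
      keeps the rows in \<open>I\<close> solved whatever \<open>t\<close> is; row \<open>n\<close>
      then determines \<open>t\<close>.\<close>
    define t where "t = (b n - (\<Sum>j\<in>I. B n j * y j)) / s"
    let ?c = "\<lambda>i. if i = n then t else y i - t * a i"
    have e: "(\<Sum>j\<in>insert n I. B i j * ?c j) = B i n * t + ((\<Sum>j\<in>I. B i j * y j) - t * (\<Sum>j\<in>I. B i j * a j))" for i
    proof -
      have "(\<Sum>j\<in>I. B i j * ?c j) = (\<Sum>j\<in>I. B i j * y j - t * (B i j * a j))"
        by (rule sum.cong) (use insert.hyps in \<open>auto simp: algebra_simps\<close>)
      then show ?thesis using insert.hyps by (simp add: sum_subtractf sum_distrib_left)
    qed
    have "(\<Sum>j\<in>insert n I. B i j * ?c j) = b i" if "i \<in> insert n I" for i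
    proof (cases "i = n")
      case True
      have "t * s = b n - (\<Sum>j\<in>I. B n j * y j)" using s by (simp add: t_def)
      then show ?thesis unfolding e True s_def by (simp add: algebra_simps)
    next
      case False
      then show ?thesis unfolding e using y a that by (simp add: algebra_simps)
    qed
    then show ?thesis by (intro exI[of _ ?c] ballI)
  qed
  define A where "A = (\<Sum>i\<in>I. (a i)\<^sup>2)"
  have A: "A \<ge> 0" unfolding A_def by (rule sum_nonneg) simp
  \<comment> \<open>Passing from the shifted coefficients back to \<open>c i\<close> costs a factor
    2 and adds \<open>2 * A\<close> to the weight of \<open>(c n)\<^sup>2\<close>, whence the two
    quotients.\<close>
  define \<beta> where "\<beta> = min (\<alpha> / 2) (s / (2 * A + 1))"
  have "\<beta> \<le> s / (2 * A + 1)" by (simp add: \<beta>_def)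
  then have \<beta>: "\<beta> > 0" "2 * \<beta> \<le> \<alpha>" "\<beta> * (2 * A + 1) \<le> s"
    using \<alpha>(1) s A by (simp_all add: \<beta>_def[symmetric] pos_le_divide_eq) (simp_all add: \<beta>_def)
  have 2: "\<beta> * (\<Sum>i\<in>insert n I. (c i)\<^sup>2) \<le> (\<Sum>i\<in>insert n I. \<Sum>j\<in>insert n I. c i * c j * B i j)" for c
  proof -
    define X where "X = (\<Sum>i\<in>I. (c i + c n * a i)\<^sup>2)"
    have X: "X \<ge> 0" unfolding X_def by (rule sum_nonneg) simp
    have "(\<Sum>i\<in>I. (c i)\<^sup>2) \<le> (\<Sum>i\<in>I. 2 * (c i + c n * a i)\<^sup>2 + 2 * (c n)\<^sup>2 * (a i)\<^sup>2)"
    proof (rule sum_mono)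
      fix i
      have "0 \<le> (c i + 2 * (c n * a i))\<^sup>2" by simp
      then show "(c i)\<^sup>2 \<le> 2 * (c i + c n * a i)\<^sup>2 + 2 * (c n)\<^sup>2 * (a i)\<^sup>2"
        by (simp add: power2_eq_square algebra_simps)
    qed
    also have "\<dots> = 2 * X + 2 * (c n)\<^sup>2 * A" by (simp add: sum.distrib sum_distrib_left X_def A_def)
    finally have "(\<Sum>i\<in>insert n I. (c i)\<^sup>2) \<le> 2 * X + (2 * A + 1) * (c n)\<^sup>2"
      using insert.hyps by (simp add: algebra_simps)
    then have "\<beta> * (\<Sum>i\<in>insert n I. (c i)\<^sup>2) \<le> \<beta> * (2 * X + (2 * A + 1) * (c n)\<^sup>2)"
      using \<beta>(1) by (simp add: mult_left_mono)
    also have "\<dots> = (2 * \<beta>) * X + (\<beta> * (2 * A + 1)) * (c n)\<^sup>2" by (simp add: algebra_simps)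
    also have "\<dots> \<le> \<alpha> * X + s * (c n)\<^sup>2"
      by (intro add_mono mult_right_mono \<beta>) (use X in auto)
    also have "\<dots> \<le> (\<Sum>i\<in>insert n I. \<Sum>j\<in>insert n I. c i * c j * B i j)"
    proof (rule ord_le_eq_trans[OF _ schur[of c, symmetric]])
      show "\<alpha> * X + s * (c n)\<^sup>2 \<le> (\<Sum>i\<in>I. \<Sum>j\<in>I. (c i + c n * a i) * (c j + c n * a j) * B i j) + (c n)\<^sup>2 * s"
        unfolding X_def mult.commute[of s] by (rule add_right_mono[OF \<alpha>(2)])
    qed
    finally show ?thesis .
  qed
  show ?case by (intro conjI allI 1 exI[of _ \<beta>] 2 \<beta>(1))
qed

text \<open>Almost-everywhere linear independence is positive definiteness of the Gram matrix.
  Solvability of the normal equations serves the projection; the coefficient bound serves the bubble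
  estimates in the disk and on the edges.\<close>

lemma gram_L2:
  fixes m :: "'i \<Rightarrow> 'a::euclidean_space \<Rightarrow> real"
  assumes fin: "finite I" and m: "\<And>i. i \<in> I \<Longrightarrow> in_L2 D (m i)"
    and indep: "\<And>c. AE x in lebesgue_on D. (\<Sum>i\<in>I. c i * m i x) = 0 \<Longrightarrow> \<forall>i\<in>I. c i = 0"
  shows "(\<forall>b. \<exists>c. \<forall>i\<in>I. (\<Sum>j\<in>I. L2_inner D (m i) (m j) * c j) = b i) \<and>
    (\<exists>\<alpha>>0. \<forall>c. \<alpha> * (\<Sum>i\<in>I. (c i)\<^sup>2) \<le> (\<integral>x. (\<Sum>i\<in>I. c i * m i x)\<^sup>2 \<partial>lebesgue_on D))"
proof -
  have int: "integrable (lebesgue_on D) (\<lambda>x. m i x * m j x)" if "i \<in> I" "j \<in> I" for i j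
    using integrable_inner_L2[OF m m, of i j] that by simp
  have sq: "(\<Sum>i\<in>I. c i * m i x)\<^sup>2 = (\<Sum>i\<in>I. \<Sum>j\<in>I. c i * c j * (m i x * m j x))" for c x
    unfolding power2_eq_square sum_product by (intro sum.cong refl) (simp add: mult_ac)
  have Q: "(\<integral>x. (\<Sum>i\<in>I. c i * m i x)\<^sup>2 \<partial>lebesgue_on D) = (\<Sum>i\<in>I. \<Sum>j\<in>I. c i * c j * L2_inner D (m i) (m j))" for c
    unfolding sq L2_inner_def using int by (simp add: Bochner_Integration.integral_sum)
  have int2: "integrable (lebesgue_on D) (\<lambda>x. (\<Sum>i\<in>I. c i * m i x)\<^sup>2)" for c
    unfolding sq using int by (intro Bochner_Integration.integrable_sum integrable_mult_right)
  have "0 < (\<Sum>i\<in>I. \<Sum>j\<in>I. c i * c j * L2_inner D (m i) (m j))" if "\<exists>i\<in>I. c i \<noteq> 0" for c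
  proof -
    have "(\<integral>x. (\<Sum>i\<in>I. c i * m i x)\<^sup>2 \<partial>lebesgue_on D) \<noteq> 0"
    proof
      assume 0: "(\<integral>x. (\<Sum>i\<in>I. c i * m i x)\<^sup>2 \<partial>lebesgue_on D) = 0"
      have "AE x in lebesgue_on D. (\<Sum>i\<in>I. c i * m i x)\<^sup>2 = 0"
        by (rule iffD1[OF integral_nonneg_eq_0_iff_AE[OF int2[of c]] 0]) simp
      then have "AE x in lebesgue_on D. (\<Sum>i\<in>I. c i * m i x) = 0"
        by (simp only: power_eq_0_iff) simp
      from indep[OF this] that show False by auto
    qed
    moreover have "0 \<le> (\<integral>x. (\<Sum>i\<in>I. c i * m i x)\<^sup>2 \<partial>lebesgue_on D)"
      by (rule Bochner_Integration.integral_nonneg) simp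
    ultimately have "0 < (\<integral>x. (\<Sum>i\<in>I. c i * m i x)\<^sup>2 \<partial>lebesgue_on D)" by (simp only: order.strict_iff_order) simp
    from ord_less_eq_trans[OF this Q[of c]] show ?thesis .
  qed
  note pd = this
  have symm: "L2_inner D (m i) (m j) = L2_inner D (m j) (m i)" for i j by (simp add: L2_inner_def mult.commute)
  have gp: "(\<forall>b. \<exists>c. \<forall>i\<in>I. (\<Sum>j\<in>I. L2_inner D (m i) (m j) * c j) = b i) \<and>
    (\<exists>\<alpha>>0. \<forall>c. \<alpha> * (\<Sum>i\<in>I. (c i)\<^sup>2) \<le> (\<Sum>i\<in>I. \<Sum>j\<in>I. c i * c j * L2_inner D (m i) (m j)))"
    by (rule gram_positive_definite[where B = "\<lambda>i j. L2_inner D (m i) (m j)", OF fin symm pd])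
  then obtain \<alpha> where "\<alpha> > 0" and
    \<alpha>: "\<And>c. \<alpha> * (\<Sum>i\<in>I. (c i)\<^sup>2) \<le> (\<Sum>i\<in>I. \<Sum>j\<in>I. c i * c j * L2_inner D (m i) (m j))" by auto
  have "\<alpha> * (\<Sum>i\<in>I. (c i)\<^sup>2) \<le> (\<integral>x. (\<Sum>i\<in>I. c i * m i x)\<^sup>2 \<partial>lebesgue_on D)" for c
    by (rule ord_le_eq_trans[OF \<alpha>[of c] Q[of c, symmetric]])
  then show ?thesis using conjunct1[OF gp] \<open>\<alpha> > 0\<close> by auto
qed

section \<open>Polynomials of two variables\<close>

definition xpow :: "nat \<times> nat \<Rightarrow> real^2 \<Rightarrow> real" where
  "xpow p x = (x $ 1) ^ fst p * (x $ 2) ^ snd p"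

text \<open>One finite set of exponent pairs replaces the dependent double sum of
  \<open>polys\<close>, so that monomials form an indexed family to which \<open>gram_L2\<close>
  applies.\<close>

definition degs :: "nat \<Rightarrow> (nat \<times> nat) set" where
  "degs k = {p. fst p + snd p \<le> k}"

lemma degs_eq: "degs k = Sigma {..k} (\<lambda>i. {..k - i})"
  by (auto simp: degs_def)

lemma finite_degs [simp]: "finite (degs k)" by (simp add: degs_eq)

lemma sum_degs: "(\<Sum>p\<in>degs k. f p) = (\<Sum>i\<le>k. \<Sum>j\<le>k - i. f (i, j))"
  by (simp add: degs_eq sum.Sigma)

lemma polys_iff: "f \<in> polys k \<longleftrightarrow> (\<exists>c. f = (\<lambda>x. \<Sum>p\<in>degs k. c p * xpow p x))"
proof
  assume "f \<in> polys k"
  then obtain c where "f = (\<lambda>x. \<Sum>i\<le>k. \<Sum>j\<le>k - i. c i j * (x $ 1) ^ i * (x $ 2) ^ j)" by (auto simp: polys_def)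
  then have "f = (\<lambda>x. \<Sum>p\<in>degs k. c (fst p) (snd p) * xpow p x)"
    by (simp add: sum_degs xpow_def mult.assoc)
  then show "\<exists>c. f = (\<lambda>x. \<Sum>p\<in>degs k. c p * xpow p x)" by (rule exI[of _ "\<lambda>p. c (fst p) (snd p)"])
next
  assume "\<exists>c. f = (\<lambda>x. \<Sum>p\<in>degs k. c p * xpow p x)"
  then obtain c where "f = (\<lambda>x. \<Sum>p\<in>degs k. c p * xpow p x)" ..
  then show "f \<in> polys k" unfolding polys_def
    by (auto simp: sum_degs xpow_def mult.assoc intro!: exI[of _ "\<lambda>i j. c (i, j)"])
qed

lemma polysE: assumes "f \<in> polys k" obtains c where "\<And>x. f x = (\<Sum>p\<in>degs k. c p * xpow p x)"
  using assms by (auto simp: polys_iff)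

lemma polysI: "(\<And>x. f x = (\<Sum>p\<in>degs k. c p * xpow p x)) \<Longrightarrow> f \<in> polys k"
  by (auto simp: polys_iff)

lemma polys_add: assumes "f \<in> polys k" "g \<in> polys k" shows "(\<lambda>x. f x + g x) \<in> polys k"
proof -
  from assms obtain c d where "\<And>x. f x = (\<Sum>p\<in>degs k. c p * xpow p x)" "\<And>x. g x = (\<Sum>p\<in>degs k. d p * xpow p x)"
    by (auto elim!: polysE)
  then show ?thesis by (intro polysI[of _ "\<lambda>p. c p + d p"]) (simp add: algebra_simps sum.distrib)
qed

lemma polys_cmult: assumes "f \<in> polys k" shows "(\<lambda>x. a * f x) \<in> polys k"
proof -
  from assms obtain c where "\<And>x. f x = (\<Sum>p\<in>degs k. c p * xpow p x)"
    by (auto elim!: polysE)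
  then show ?thesis by (intro polysI[of _ "\<lambda>p. a * c p"]) (simp add: sum_distrib_left mult.assoc)
qed

lemma polys_zero: "(\<lambda>x. 0) \<in> polys k"
  by (rule polysI[of _ "\<lambda>_. 0"]) simp

lemma polys_diff: "f \<in> polys k \<Longrightarrow> g \<in> polys k \<Longrightarrow> (\<lambda>x. f x - g x) \<in> polys k"
  using polys_add[of f k "\<lambda>x. - 1 * g x"] polys_cmult[of g k "-1"] by simp

lemma polys_sum: "(\<And>i. i \<in> I \<Longrightarrow> f i \<in> polys k) \<Longrightarrow> (\<lambda>x. \<Sum>i\<in>I. f i x) \<in> polys k"
  by (induction I rule: infinite_finite_induct) (auto intro: polys_add polys_zero)

lemma polys_xpow: "p \<in> degs k \<Longrightarrow> xpow p \<in> polys k"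
  by (rule polysI[of _ "\<lambda>q. if q = p then 1 else 0"]) (simp add: if_distrib[of "\<lambda>a. a * _"] sum.delta cong: if_cong)

lemma xpow_mult: "xpow p x * xpow q x = xpow (fst p + fst q, snd p + snd q) x"
  by (simp add: xpow_def power_add mult_ac)

lemma polys_mult: assumes "f \<in> polys m" "g \<in> polys n" shows "(\<lambda>x. f x * g x) \<in> polys (m + n)"
proof -
  from assms obtain c d where f: "\<And>x. f x = (\<Sum>p\<in>degs m. c p * xpow p x)" and g: "\<And>x. g x = (\<Sum>p\<in>degs n. d p * xpow p x)"
    by (auto elim!: polysE)
  have "f x * g x = (\<Sum>p\<in>degs m. \<Sum>q\<in>degs n. (c p * d q) * xpow (fst p + fst q, snd p + snd q) x)" for x
    unfolding f g sum_product xpow_mult[symmetric] by (intro sum.cong refl) (simp add: mult_ac)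
  then have "(\<lambda>x. f x * g x) = (\<lambda>x. \<Sum>p\<in>degs m. \<Sum>q\<in>degs n. (c p * d q) * xpow (fst p + fst q, snd p + snd q) x)"
    by blast
  also have "\<dots> \<in> polys (m + n)"
    by (intro polys_sum polys_cmult polys_xpow) (auto simp: degs_def)
  finally show ?thesis .
qed

lemma polys_const: "(\<lambda>x. a) \<in> polys k"
  using polys_cmult[OF polys_xpow[of "(0,0)" k], of a] by (simp add: xpow_def degs_def)

lemma polys_mono: assumes "f \<in> polys m" "m \<le> n" shows "f \<in> polys n"
  using polys_mult[OF assms(1) polys_const[of 1 "n - m"]] assms(2) by simp

lemma polys_coord: "(\<lambda>x. x $ i) \<in> polys 1"
proof -
  consider "i = 1" | "i = 2" using exhaust_2 by blast
  then show ?thesis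
  proof cases
    case 1 then show ?thesis using polys_xpow[of "(1,0)" 1] by (simp add: degs_def xpow_def[abs_def])
  next
    case 2 then show ?thesis using polys_xpow[of "(0,1)" 1] by (simp add: degs_def xpow_def[abs_def])
  qed
qed

lemma polys_power: "f \<in> polys m \<Longrightarrow> (\<lambda>x. f x ^ n) \<in> polys (m * n)"
proof (induction n)
  case (Suc n)
  then show ?case using polys_mult[OF Suc.prems Suc.IH] by simp
qed (simp add: polys_const)

lemma polys_subst:
  assumes "f \<in> polys k" "s \<in> polys 1" "w \<in> polys 1"
  shows "(\<lambda>x. f (vector [s x, w x])) \<in> polys k"
proof -
  from assms obtain c where f: "\<And>x. f x = (\<Sum>p\<in>degs k. c p * xpow p x)" by (auto elim!: polysE)
  have "(\<lambda>x. s x ^ fst p * w x ^ snd p) \<in> polys k" if "p \<in> degs k" for p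
  proof (rule polys_mono)
    show "(\<lambda>x. s x ^ fst p * w x ^ snd p) \<in> polys (1 * fst p + 1 * snd p)"
      by (intro polys_mult polys_power assms)
  qed (use that in \<open>simp add: degs_def\<close>)
  then show ?thesis unfolding f xpow_def by (simp add: polys_sum polys_cmult)
qed

lemma polys_scale: assumes "f \<in> polys k" shows "(\<lambda>x. f (c + h *\<^sub>R x)) \<in> polys k"
proof -
  have 1: "(\<lambda>x::real^2. c $ i + h * x $ i) \<in> polys 1" for i
    by (intro polys_add polys_cmult polys_coord polys_const)
  have "(\<lambda>x. f (c + h *\<^sub>R x)) = (\<lambda>x. f (vector [c $ 1 + h * x $ 1, c $ 2 + h * x $ 2]))"
    by (intro ext arg_cong[where f = f]) (simp add: vec_eq_iff forall_2)
  then show ?thesis using polys_subst[OF assms 1[of 1] 1[of 2]] by simp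
qed

text \<open>Substituting coordinates that are affine in the first variable keeps the total degree.
  Evaluating the result at \<open>vector [t, 0]\<close> removes every monomial containing the second
  variable and leaves a polynomial in \<open>t\<close>.\<close>

lemma polys_on_line:
  assumes "f \<in> polys k" shows "\<exists>e. \<forall>t. f (linepath a b t) = (\<Sum>j\<le>k. e j * t ^ j)"
proof -
  have 1: "(\<lambda>x::real^2. a $ i + (b $ i - a $ i) * x $ 1) \<in> polys 1" for i
    by (intro polys_add polys_cmult polys_coord polys_const)
  from polys_subst[OF assms 1[of 1] 1[of 2]] obtain c where
    c: "\<And>x. f (vector [a $ 1 + (b $ 1 - a $ 1) * x $ 1, a $ 2 + (b $ 2 - a $ 2) * x $ 1]) = (\<Sum>p\<in>degs k. c p * xpow p x)"
    by (elim polysE) auto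
  have "f (linepath a b t) = (\<Sum>j\<le>k. c (j, 0) * t ^ j)" for t
  proof -
    have "linepath a b t = vector [a $ 1 + (b $ 1 - a $ 1) * t, a $ 2 + (b $ 2 - a $ 2) * t]"
      by (simp add: linepath_def vec_eq_iff forall_2 algebra_simps)
    then have "f (linepath a b t) = (\<Sum>p\<in>degs k. c p * xpow p (vector [t, 0]))"
      using c[of "vector [t, 0]"] by simp
    also have "\<dots> = (\<Sum>i\<le>k. \<Sum>j\<le>k - i. if j = 0 then c (i, j) * t ^ i else 0)"
      unfolding sum_degs by (intro sum.cong refl) (auto simp: xpow_def power_0_left)
    also have "\<dots> = (\<Sum>j\<le>k. c (j, 0) * t ^ j)" by (simp add: sum.delta)
    finally show ?thesis .
  qed
  then show ?thesis by (intro exI[of _ "\<lambda>j. c (j, 0)"] allI)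
qed

lemma has_grad_coord: "has_grad (\<lambda>x. x $ i) (\<lambda>x. axis i 1)"
  using has_grad_affine[of "axis i 1" 0] by (simp add: inner_axis')

lemma has_grad_power: "has_grad f f' \<Longrightarrow> has_grad (\<lambda>x. f x ^ n) (\<lambda>x. (real n * f x ^ (n - 1)) *\<^sub>R f' x)"
  by (rule has_grad_compose_real[where \<beta> = "\<lambda>t. t ^ n" and \<beta>' = "\<lambda>t. real n * t ^ (n - 1)"])
     (auto intro!: derivative_eq_intros continuous_intros)

definition xpow_grad :: "nat \<times> nat \<Rightarrow> real^2 \<Rightarrow> real^2" where
  "xpow_grad p x = vector [real (fst p) * (x $ 1) ^ (fst p - 1) * (x $ 2) ^ snd p,
      real (snd p) * (x $ 1) ^ fst p * (x $ 2) ^ (snd p - 1)]"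

lemma has_grad_xpow: "has_grad (xpow p) (xpow_grad p)"
proof -
  have "xpow_grad p = (\<lambda>x. (x $ 1) ^ fst p *\<^sub>R ((real (snd p) * (x $ 2) ^ (snd p - 1)) *\<^sub>R axis 2 1)
      + (x $ 2) ^ snd p *\<^sub>R ((real (fst p) * (x $ 1) ^ (fst p - 1)) *\<^sub>R axis 1 1))"
    by (auto simp: fun_eq_iff xpow_grad_def vec_eq_iff forall_2 axis_def)
  then show ?thesis
    using has_grad_mult[OF has_grad_power[OF has_grad_coord[of 1]] has_grad_power[OF has_grad_coord[of 2]], of "fst p" "snd p"]
    by (simp add: xpow_def[abs_def])
qed

lemma continuous_on_xpow: "continuous_on UNIV (xpow p)"
  by (rule has_grad_continuous_on[OF has_grad_xpow])

lemma continuous_on_polys: "f \<in> polys k \<Longrightarrow> continuous_on UNIV f"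
  unfolding polys_iff by (auto intro!: continuous_on_sum continuous_on_mult continuous_on_const continuous_on_xpow)

lemma poly1_zero:
  fixes c :: "nat \<Rightarrow> real"
  assumes "infinite S" "\<And>t. t \<in> S \<Longrightarrow> (\<Sum>i\<le>n. c i * t ^ i) = 0" "i \<le> n"
  shows "c i = 0"
proof (rule ccontr)
  assume "c i \<noteq> 0"
  then have "finite {z. (\<Sum>i\<le>n. c i * z ^ i) = 0}" using polyfun_rootbound assms(3) by blast
  moreover have "S \<subseteq> {z. (\<Sum>i\<le>n. c i * z ^ i) = 0}" using assms(2) by blast
  ultimately show False using assms(1) finite_subset by blast
qed

lemma vector_in_ball:
  fixes a :: "real^2"
  assumes "\<bar>s - a $ 1\<bar> < r / 2" "\<bar>t - a $ 2\<bar> < r / 2"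
  shows "vector [s, t] \<in> ball a r"
proof -
  have "norm (vector [s, t] - a) \<le> (\<Sum>i\<in>UNIV. \<bar>(vector [s, t] - a) $ i\<bar>)" by (rule norm_le_l1_cart)
  also have "\<dots> < r" using assms by (simp add: sum_2)
  finally show ?thesis by (simp add: dist_norm norm_minus_commute)
qed

text \<open>The ball contains a square. For fixed first coordinate the sum is a polynomial in the
  second one with infinitely many zeros, so its coefficients vanish; these are polynomials in the
  first coordinate, and the argument repeats.\<close>

lemma poly2_zero:
  assumes r: "r > 0" and z: "\<And>x. x \<in> ball a r \<Longrightarrow> (\<Sum>p\<in>degs k. c p * xpow p x) = 0" and p: "p \<in> degs k"
  shows "c p = 0"
proof -
  let ?S = "{a $ 1 - r / 2 <..< a $ 1 + r / 2}" and ?T = "{a $ 2 - r / 2 <..< a $ 2 + r / 2}"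
  have inf: "infinite ?S" "infinite ?T" using r by auto
  \<comment> \<open>Extension by zero turns the triangular range of exponents into a full square,
    where the two sums can be interchanged.\<close>
  define d where "d = (\<lambda>p. if p \<in> degs k then c p else 0)"
  have d0: "(\<Sum>j\<le>k. (\<Sum>i\<le>k. d (i, j) * s ^ i) * t ^ j) = 0" if "s \<in> ?S" "t \<in> ?T" for s t
  proof -
    have "vector [s, t] \<in> ball a r" using that by (intro vector_in_ball) (simp_all only: greaterThanLessThan_iff abs_less_iff, linarith+)
    from z[OF this] have "0 = (\<Sum>p\<in>degs k. d p * (s ^ fst p * t ^ snd p))"
      by (simp add: xpow_def d_def)
    also have "\<dots> = (\<Sum>p\<in>{..k} \<times> {..k}. d p * (s ^ fst p * t ^ snd p))"
      by (rule sum.mono_neutral_left) (auto simp: degs_def d_def)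
    also have "\<dots> = (\<Sum>i\<le>k. \<Sum>j\<le>k. d (i, j) * (s ^ i * t ^ j))"
      by (simp add: sum.cartesian_product case_prod_beta')
    also have "\<dots> = (\<Sum>j\<le>k. (\<Sum>i\<le>k. d (i, j) * s ^ i) * t ^ j)"
      by (subst sum.swap) (simp add: sum_distrib_right sum_distrib_left mult_ac)
    finally show ?thesis by simp
  qed
  have jk: "snd p \<le> k" "fst p \<le> k" using p by (auto simp: degs_def)
  have "(\<Sum>i\<le>k. d (i, snd p) * s ^ i) = 0" if "s \<in> ?S" for s
    by (rule poly1_zero[OF inf(2) _ jk(1), of "\<lambda>j. (\<Sum>i\<le>k. d (i, j) * s ^ i)"]) (rule d0[OF that])
  from poly1_zero[OF inf(1) this jk(2)] have "d p = 0" by simp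
  then show ?thesis using p by (simp add: d_def)
qed

lemma AE_zero_open:
  fixes f :: "'a::euclidean_space \<Rightarrow> real"
  assumes f: "continuous_on UNIV f" and ae: "AE x in lebesgue_on D. f x = 0" and U: "open U" "U \<subseteq> D" "D \<in> sets lebesgue"
    and x: "x \<in> U"
  shows "f x = 0"
proof (rule ccontr)
  assume nz: "f x \<noteq> 0"
  let ?V = "U \<inter> f -` (- {0})"
  have op: "open ?V" using f U(1) by (intro open_Int open_vimage) auto
  have "AE x in lebesgue. x \<in> D \<longrightarrow> f x = 0" using ae U(3) by (simp add: AE_restrict_space_iff)
  then have "AE x in lebesgue. x \<notin> ?V" by (rule AE_mp) (use U(2) in auto)
  then have "?V \<in> null_sets lebesgue"
    using op by (auto simp: AE_iff_null_sets)
  then have "negligible ?V" by (simp add: negligible_iff_null_sets)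
  moreover have "?V \<noteq> {}" using x nz by auto
  ultimately show False using op open_not_negligible by blast
qed

lemma xpow_indep:
  assumes "open F" "F \<noteq> {}" "AE x in lebesgue_on F. (\<Sum>p\<in>degs k. c p * xpow p x) = 0"
  shows "\<forall>p\<in>degs k. c p = 0"
proof
  fix p assume p: "p \<in> degs k"
  obtain a r where r: "r > 0" "ball a r \<subseteq> F" using assms(1,2) open_contains_ball by (metis ex_in_conv)
  show "c p = 0"
  proof (rule poly2_zero[OF r(1) _ p])
    fix x assume x: "x \<in> ball a r"
    show "(\<Sum>p\<in>degs k. c p * xpow p x) = 0"
      by (rule AE_zero_open[OF _ assms(3,1)])
         (use x r(2) assms(1) in \<open>auto intro!: continuous_on_sum continuous_on_mult continuous_on_const continuous_on_xpow\<close>)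
  qed
qed

section \<open>The orthogonal projection onto polynomial fields\<close>

lemma continuous_on_vec_polys: assumes "p \<in> vec_polys k" shows "continuous_on UNIV p"
proof -
  have "continuous_on UNIV (\<lambda>x. p x $ i)" for i using assms continuous_on_polys by (auto simp: vec_polys_def)
  then have "continuous_on UNIV (\<lambda>x. \<chi> i. p x $ i)" by (rule continuous_on_vec_lambda)
  then show ?thesis by simp
qed

text \<open>The definite description in \<open>L2_proj\<close> has to be justified. Existence is
  componentwise, from the Gram system of the monomials. For uniqueness, the difference of two
  candidates is a polynomial field orthogonal to itself, so it vanishes almost everywhere on
  \<open>F\<close> and, by \<open>xpow_indep\<close>, on the whole plane.\<close>

lemma L2_proj_props:
  assumes F: "open F" "F \<noteq> {}" "bounded F" and v: "in_L2 F v"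
  shows "L2_proj k F v \<in> vec_polys k" "\<And>p. p \<in> vec_polys k \<Longrightarrow> L2_inner F (\<lambda>x. v x - L2_proj k F v x) p = 0"
proof -
  have Fm: "F \<in> lmeasurable" "F \<in> sets lebesgue" using lmeasurable_open[OF F(3,1)] by auto
  have L2p: "in_L2 F f" if "f \<in> polys k" for f
    by (rule in_L2_continuous[OF continuous_on_polys[OF that] Fm(1) F(3)])
  have L2x: "in_L2 F (xpow p)" for p
    using in_L2_continuous[OF continuous_on_xpow Fm(1) F(3)] .
  have solve: "\<forall>b. \<exists>c. \<forall>p\<in>degs k. (\<Sum>q\<in>degs k. L2_inner F (xpow p) (xpow q) * c q) = b p"
  proof -
    have "\<forall>i\<in>degs k. c i = 0" if "AE x in lebesgue_on F. (\<Sum>i\<in>degs k. c i * xpow i x) = 0" for c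
      by (rule xpow_indep[OF F(1,2) that])
    note indep = this
    show ?thesis
    proof (rule conjunct1[OF gram_L2[where m = xpow and D = F and I = "degs k"]])
      show "\<forall>p\<in>degs k. c p = 0" if "AE x in lebesgue_on F. (\<Sum>p\<in>degs k. c p * xpow p x) = 0" for c
        using that by (rule indep)
    qed (simp_all add: L2x)
  qed
  have ex1: "\<exists>q\<in>polys k. \<forall>p\<in>polys k. L2_inner F p (\<lambda>x. w x - q x) = 0" if w: "in_L2 F w" for w :: "real^2 \<Rightarrow> real"
  proof -
    obtain c where c: "\<And>p. p \<in> degs k \<Longrightarrow> (\<Sum>q\<in>degs k. L2_inner F (xpow p) (xpow q) * c q) = L2_inner F (xpow p) w"
      using spec[OF solve, of "\<lambda>p. L2_inner F (xpow p) w"] by auto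
    let ?q = "\<lambda>x. \<Sum>q\<in>degs k. c q * xpow q x"
    have q: "?q \<in> polys k" by (rule polysI) simp
    have "L2_inner F (xpow p) ?q = L2_inner F (xpow p) w" if "p \<in> degs k" for p
      using L2_inner_sum_right[OF L2x[of p], of "degs k" xpow c] L2x c[OF that] by (simp add: mult.commute)
    then have 0: "L2_inner F (\<lambda>x. w x - ?q x) (xpow p) = 0" if "p \<in> degs k" for p
      using L2_inner_diff_right[OF L2x[of p] w L2p[OF q]] that by (simp add: L2_inner_def mult.commute)
    have "L2_inner F p (\<lambda>x. w x - ?q x) = 0" if pk: "p \<in> polys k" for p
    proof -
      obtain d where d: "p = (\<lambda>x. \<Sum>q\<in>degs k. d q * xpow q x)" using pk by (auto simp: polys_iff)
      have "L2_inner F (\<lambda>x. w x - ?q x) p = 0" unfolding d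
        using L2_inner_sum_right[OF in_L2_diff[OF w L2p[OF q]], of "degs k" xpow d] L2x 0 by simp
      then show ?thesis by (simp add: L2_inner_def mult.commute)
    qed
    then show ?thesis by (intro bexI[of _ ?q] ballI q)
  qed
  have L2i: "in_L2 F (\<lambda>x. w x $ i)" if "in_L2 F w" for w :: "real^2 \<Rightarrow> real^2" and i
    by (rule in_L2_component[OF that Fm(2)])
  have L2v: "in_L2 F p" if "p \<in> vec_polys k" for p
    using in_L2_continuous[OF continuous_on_vec_polys[OF that] Fm(1) F(3)] .
  have vinner: "L2_inner F w p = L2_inner F (\<lambda>x. p x $ 1) (\<lambda>x. w x $ 1) + L2_inner F (\<lambda>x. p x $ 2) (\<lambda>x. w x $ 2)"
    if "in_L2 F w" "in_L2 F p" for w p :: "real^2 \<Rightarrow> real^2"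
    using integrable_inner_L2[OF L2i[OF that(2)] L2i[OF that(1)]]
    by (simp add: L2_inner_def inner_real2 mult.commute)
  define P where "P = (\<lambda>q. q \<in> vec_polys k \<and> (\<forall>p\<in>vec_polys k. L2_inner F (\<lambda>x. v x - q x) p = 0))"
  have ex: "\<exists>q. P q"
  proof -
    obtain q1 where q1: "q1 \<in> polys k" "\<And>p. p \<in> polys k \<Longrightarrow> L2_inner F p (\<lambda>x. v x $ 1 - q1 x) = 0"
      using ex1[OF L2i[OF v, of 1]] by auto
    obtain q2 where q2: "q2 \<in> polys k" "\<And>p. p \<in> polys k \<Longrightarrow> L2_inner F p (\<lambda>x. v x $ 2 - q2 x) = 0"
      using ex1[OF L2i[OF v, of 2]] by auto
    let ?q = "\<lambda>x. vector [q1 x, q2 x] :: real^2"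
    have q: "?q \<in> vec_polys k"
      unfolding vec_polys_def mem_Collect_eq forall_2 using q1(1) q2(1) by simp
    have "P ?q" unfolding P_def
    proof (intro conjI ballI q)
      fix p assume p: "p \<in> vec_polys k"
      then have pc: "(\<lambda>x. p x $ i) \<in> polys k" for i by (simp add: vec_polys_def)
      show "L2_inner F (\<lambda>x. v x - ?q x) p = 0"
        using vinner[OF in_L2_diff[OF v L2v[OF q]] L2v[OF p]] q1(2)[OF pc] q2(2)[OF pc] by simp
    qed
    then show ?thesis by (rule exI[where x = ?q])
  qed
  have uniq: "q = q'" if "P q" "P q'" for q q'
  proof -
    let ?e = "\<lambda>x. q x - q' x"
    have e: "?e \<in> vec_polys k" using that by (auto simp: P_def vec_polys_def intro: polys_diff)
    have q: "in_L2 F q" "in_L2 F q'" using that L2v by (auto simp: P_def)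
    have "L2_inner F ?e ?e = L2_inner F (\<lambda>x. (v x - q' x) - (v x - q x)) ?e" by simp
    also have "\<dots> = 0"
      using L2_inner_diff_left[OF in_L2_diff[OF v q(2)] in_L2_diff[OF v q(1)] L2v[OF e]] that e by (simp add: P_def)
    finally have "(\<integral>x. (norm (?e x))\<^sup>2 \<partial>lebesgue_on F) = 0" by (simp add: L2_inner_def power2_norm_eq_inner)
    then have "AE x in lebesgue_on F. (norm (?e x))\<^sup>2 = 0"
      using integral_nonneg_eq_0_iff_AE[of "lebesgue_on F" "\<lambda>x. (norm (?e x))\<^sup>2"] L2v[OF e] by (simp add: in_L2_def)
    then have ae: "AE x in lebesgue_on F. ?e x $ i = 0" for i by (rule AE_mp) (intro AE_I2, simp)
    have "?e x $ i = 0" for x i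
    proof -
      have "(\<lambda>x. ?e x $ i) \<in> polys k" using e by (simp only: vec_polys_def mem_Collect_eq)
      then obtain c where c: "\<And>x. ?e x $ i = (\<Sum>p\<in>degs k. c p * xpow p x)" by (elim polysE) auto
      have "AE x in lebesgue_on F. (\<Sum>p\<in>degs k. c p * xpow p x) = 0" using ae[of i] unfolding c .
      then have "\<forall>p\<in>degs k. c p = 0" by (rule xpow_indep[OF F(1,2)])
      then show ?thesis unfolding c by (simp add: sum.neutral)
    qed
    then show "q = q'" by (simp add: fun_eq_iff vec_eq_iff)
  qed
  have "\<exists>!q. P q" using ex uniq by auto
  then have "P (The P)" by (rule theI')
  then have "P (L2_proj k F v)" by (simp add: L2_proj_def P_def)
  then show "L2_proj k F v \<in> vec_polys k" "\<And>p. p \<in> vec_polys k \<Longrightarrow> L2_inner F (\<lambda>x. v x - L2_proj k F v x) p = 0"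
    unfolding P_def by auto
qed

section \<open>Density and uniqueness\<close>

text \<open>By Stone-Weierstrass \<open>f\<close> also annihilates all continuous functions. The
  sign of \<open>f\<close> is an almost-everywhere limit of continuous functions; clipped to [-1, 1]
  they give products dominated by the absolute value of \<open>f\<close>, so dominated convergence
  makes its integral zero.\<close>

lemma AE_zero_of_polynomial_moments:
  fixes f :: "'a::euclidean_space \<Rightarrow> real"
  assumes K: "compact K" and f: "integrable (lebesgue_on K) f"
    and mom: "\<And>p. real_polynomial_function p \<Longrightarrow> (\<integral>x. f x * p x \<partial>lebesgue_on K) = 0"
  shows "AE x in lebesgue_on K. f x = 0"
proof -
  have Ks: "K \<in> sets lebesgue" using lmeasurable_compact[OF K] by auto
  have fm: "f \<in> borel_measurable (lebesgue_on K)" using f by auto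
  have af: "integrable (lebesgue_on K) (\<lambda>x. \<bar>f x\<bar>)" using f by auto
  have cm: "g \<in> borel_measurable (lebesgue_on K)" if "continuous_on UNIV g" for g :: "'a \<Rightarrow> real"
    using that by (intro measurable_restrict_space1 measurable_completion) (auto intro: borel_measurable_continuous_onI)
  have intg: "integrable (lebesgue_on K) (\<lambda>x. f x * g x)"
    if "g \<in> borel_measurable (lebesgue_on K)" "\<And>x. x \<in> K \<Longrightarrow> \<bar>g x\<bar> \<le> b" for g b
  proof (rule Bochner_Integration.integrable_bound)
    show "integrable (lebesgue_on K) (\<lambda>x. b * \<bar>f x\<bar>)" using af by simp
    show "(\<lambda>x. f x * g x) \<in> borel_measurable (lebesgue_on K)" using fm that(1) by simp
    show "AE x in lebesgue_on K. norm (f x * g x) \<le> norm (b * \<bar>f x\<bar>)"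
    proof (rule AE_I2)
      fix x assume "x \<in> space (lebesgue_on K)"
      then have "\<bar>g x\<bar> \<le> b" using that(2) by (simp add: space_restrict_space)
      then have "\<bar>f x\<bar> * \<bar>g x\<bar> \<le> \<bar>f x\<bar> * b" "0 \<le> b" by (auto intro: mult_left_mono)
      then show "norm (f x * g x) \<le> norm (b * \<bar>f x\<bar>)" by (simp add: abs_mult mult.commute)
    qed
  qed
  have bd: "\<exists>b. \<forall>x\<in>K. \<bar>g x\<bar> \<le> b" if "continuous_on UNIV g" for g :: "'a \<Rightarrow> real"
  proof -
    have "compact (g ` K)" using continuous_on_subset[OF that] by (intro compact_continuous_image K) auto
    then show ?thesis by (meson bounded_real compact_imp_bounded imageI)
  qed
  have cont: "(\<integral>x. f x * g x \<partial>lebesgue_on K) = 0" if g: "continuous_on UNIV g" for g :: "'a \<Rightarrow> real"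
  proof -
    let ?I = "\<integral>x. \<bar>f x\<bar> \<partial>lebesgue_on K"
    have le: "\<bar>\<integral>x. f x * g x \<partial>lebesgue_on K\<bar> \<le> e * ?I" if e: "e > 0" for e
    proof -
      obtain p where p: "real_polynomial_function p" "\<And>x. x \<in> K \<Longrightarrow> \<bar>g x - p x\<bar> < e"
        using Stone_Weierstrass_real_polynomial_function[OF K continuous_on_subset[OF g] e] by auto
      have pc: "continuous_on UNIV p" using p(1) continuous_on_polymonial_function real_polynomial_function_eq by blast
      obtain b1 where b1: "\<And>x. x \<in> K \<Longrightarrow> \<bar>g x\<bar> \<le> b1" using bd[OF g] by auto
      obtain b2 where b2: "\<And>x. x \<in> K \<Longrightarrow> \<bar>p x\<bar> \<le> b2" using bd[OF pc] by auto
      have "(\<integral>x. f x * g x \<partial>lebesgue_on K) = (\<integral>x. f x * g x \<partial>lebesgue_on K) - (\<integral>x. f x * p x \<partial>lebesgue_on K)"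
        using mom[OF p(1)] by simp
      also have "\<dots> = (\<integral>x. f x * (g x - p x) \<partial>lebesgue_on K)"
        using intg[OF cm[OF g] b1] intg[OF cm[OF pc] b2] by (simp add: right_diff_distrib)
      finally have "\<bar>\<integral>x. f x * g x \<partial>lebesgue_on K\<bar> \<le> (\<integral>x. \<bar>f x * (g x - p x)\<bar> \<partial>lebesgue_on K)" by simp
      also have "\<dots> \<le> (\<integral>x. e * \<bar>f x\<bar> \<partial>lebesgue_on K)"
      proof (rule integral_mono)
        show "integrable (lebesgue_on K) (\<lambda>x. \<bar>f x * (g x - p x)\<bar>)"
          using intg[of "\<lambda>x. g x - p x" e] cm[OF g] cm[OF pc] p(2) less_imp_le by (intro integrable_abs) auto
        show "\<bar>f x * (g x - p x)\<bar> \<le> e * \<bar>f x\<bar>" if "x \<in> space (lebesgue_on K)" for x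
          using p(2)[of x] that Ks by (simp add: space_restrict_space abs_mult mult.commute[of e] mult_left_mono)
      qed (use af in simp)
      finally show ?thesis by simp
    qed
    have "\<bar>\<integral>x. f x * g x \<partial>lebesgue_on K\<bar> \<le> 0 + e" if e: "e > 0" for e
    proof -
      define J where "J = ?I"
      have J: "0 \<le> J" unfolding J_def by (rule Bochner_Integration.integral_nonneg) simp
      have "\<bar>\<integral>x. f x * g x \<partial>lebesgue_on K\<bar> \<le> (e / (J + 1)) * J"
        using le[of "e / (J + 1)"] e J by (simp add: J_def[symmetric])
      also have "\<dots> \<le> e" using e J by (simp add: field_simps)
      finally show ?thesis by simp
    qed
    then have "\<bar>\<integral>x. f x * g x \<partial>lebesgue_on K\<bar> \<le> 0" by (rule field_le_epsilon)
    then show ?thesis by simp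
  qed
  have "(\<lambda>x. sgn (f x)) \<in> borel_measurable (lebesgue_on K)" using fm by measurable
  \<comment> \<open>\<open>measurable_on\<close> is by definition approximability by continuous
    functions off a negligible set, which is how these approximations are obtained.\<close>
  then have "(\<lambda>x. sgn (f x)) measurable_on K" using measurable_on_iff_borel_measurable[OF Ks] by auto
  then obtain N g where N: "negligible N" and g: "\<And>n. continuous_on UNIV (g n)"
    and lim: "\<And>x. x \<notin> N \<Longrightarrow> (\<lambda>n. g n x) \<longlonglongrightarrow> (if x \<in> K then sgn (f x) else 0)"
    unfolding measurable_on_def by auto
  define h where "h = (\<lambda>n x. max (-1) (min 1 (g n x :: real)))"
  have hc: "continuous_on UNIV (h n)" for n unfolding h_def by (intro continuous_intros g)
  have hb: "\<bar>h n x\<bar> \<le> 1" for n x by (auto simp: h_def)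
  have "AE x in lebesgue. x \<notin> N" using N by (simp add: negligible_iff_null_sets AE_not_in)
  then have aeN: "AE x in lebesgue_on K. x \<notin> N" using Ks by (auto simp: AE_restrict_space_iff)
  have "(\<lambda>n. \<integral>x. f x * h n x \<partial>lebesgue_on K) \<longlonglongrightarrow> (\<integral>x. \<bar>f x\<bar> \<partial>lebesgue_on K)"
  proof (rule integral_dominated_convergence[where w = "\<lambda>x. \<bar>f x\<bar>"])
    show "AE x in lebesgue_on K. (\<lambda>n. f x * h n x) \<longlonglongrightarrow> \<bar>f x\<bar>"
      using aeN AE_space
    proof eventually_elim
      case (elim x)
      then have "(\<lambda>n. g n x) \<longlonglongrightarrow> sgn (f x)" using lim[of x] Ks by (simp add: space_restrict_space)
      then have "(\<lambda>n. f x * h n x) \<longlonglongrightarrow> f x * max (-1) (min 1 (sgn (f x)))"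
        unfolding h_def by (intro tendsto_intros)
      also have "f x * max (-1) (min 1 (sgn (f x))) = \<bar>f x\<bar>" by (auto simp: sgn_if)
      finally show ?case .
    qed
    show "AE x in lebesgue_on K. norm (f x * h n x) \<le> \<bar>f x\<bar>" for n
      using hb by (auto simp: abs_mult intro!: mult_left_le)
    show "(\<lambda>x. f x * h n x) \<in> borel_measurable (lebesgue_on K)" for n using fm cm[OF hc] by simp
  qed (use af fm in auto)
  then have "(\<integral>x. \<bar>f x\<bar> \<partial>lebesgue_on K) = 0" using cont[OF hc] by (simp add: LIMSEQ_const_iff)
  then have "AE x in lebesgue_on K. \<bar>f x\<bar> = 0"
    using integral_nonneg_eq_0_iff_AE[OF af] by simp
  then show ?thesis by simp
qed

text \<open>Truncating at a large level costs little in the norm. The truncated function is the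
  almost-everywhere limit of equally truncated continuous functions; on a set of finite measure a
  constant dominates, so the convergence also holds in the norm.\<close>

lemma L2_dense_continuous:
  fixes f :: "'a::euclidean_space \<Rightarrow> real"
  assumes F: "F \<in> lmeasurable" and f: "in_L2 F f" and e: "e > 0"
  shows "\<exists>g b. continuous_on UNIV g \<and> (\<forall>x. \<bar>g x\<bar> \<le> b) \<and> L2_norm F (\<lambda>x. f x - g x) < e"
proof -
  have Fs: "F \<in> sets lebesgue" using F by auto
  have fm: "f \<in> borel_measurable (lebesgue_on F)" using in_L2_meas[OF f] .
  define T where "T = (\<lambda>M y. max (- M) (min M y) :: real)"
  have Tb: "M \<ge> 0 \<Longrightarrow> \<bar>T M y\<bar> \<le> M" and Tl: "M \<ge> 0 \<Longrightarrow> \<bar>y - T M y\<bar> \<le> \<bar>y\<bar>" and Te: "\<bar>y\<bar> \<le> M \<Longrightarrow> T M y = y" for M y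
    by (auto simp: T_def)
  have Tm: "(\<lambda>x. T M (u x)) \<in> borel_measurable (lebesgue_on F)" if "u \<in> borel_measurable (lebesgue_on F)" for M u
    unfolding T_def using that by measurable
  have "(\<lambda>n. \<integral>x. (f x - T (real n) (f x))\<^sup>2 \<partial>lebesgue_on F) \<longlonglongrightarrow> (\<integral>x. 0 \<partial>lebesgue_on F)"
  proof (rule integral_dominated_convergence[where w = "\<lambda>x. (norm (f x))\<^sup>2"])
    show "AE x in lebesgue_on F. (\<lambda>n. (f x - T (real n) (f x))\<^sup>2) \<longlonglongrightarrow> 0"
    proof (rule AE_I2)
      fix x
      obtain m where m: "\<bar>f x\<bar> \<le> real m" using real_arch_simple by blast
      have "\<forall>\<^sub>F n in sequentially. (f x - T (real n) (f x))\<^sup>2 = 0"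
        using eventually_ge_at_top[of m] by eventually_elim (use m in \<open>simp add: Te\<close>)
      then show "(\<lambda>n. (f x - T (real n) (f x))\<^sup>2) \<longlonglongrightarrow> 0" by (rule tendsto_eventually)
    qed
    show "AE x in lebesgue_on F. norm ((f x - T (real n) (f x))\<^sup>2) \<le> (norm (f x))\<^sup>2" for n
      using Tl[of "real n"] by (auto simp: abs_le_square_iff)
    show "(\<lambda>x. (f x - T (real n) (f x))\<^sup>2) \<in> borel_measurable (lebesgue_on F)" for n
      using fm Tm[OF fm] by measurable
  qed (use f in \<open>auto simp: in_L2_def\<close>)
  then have "(\<lambda>n. \<integral>x. (f x - T (real n) (f x))\<^sup>2 \<partial>lebesgue_on F) \<longlonglongrightarrow> 0" by simp
  then have "\<forall>\<^sub>F n in sequentially. (\<integral>x. (f x - T (real n) (f x))\<^sup>2 \<partial>lebesgue_on F) < (e/2)\<^sup>2"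
    by (rule order_tendstoD) (use e in simp)
  then obtain m where m: "(\<integral>x. (f x - T (real m) (f x))\<^sup>2 \<partial>lebesgue_on F) < (e/2)\<^sup>2"
    by (auto simp: eventually_sequentially)
  define M where "M = real m"
  have "f measurable_on F" using fm measurable_on_iff_borel_measurable[OF Fs] by auto
  then obtain N g where N: "negligible N" and g: "\<And>n. continuous_on UNIV (g n)"
    and lim: "\<And>x. x \<notin> N \<Longrightarrow> (\<lambda>n. g n x) \<longlonglongrightarrow> (if x \<in> F then f x else 0)"
    unfolding measurable_on_def by auto
  have hc: "continuous_on UNIV (\<lambda>x. T M (g n x))" for n unfolding T_def by (intro continuous_intros g)
  have cm: "g \<in> borel_measurable (lebesgue_on F)" if "continuous_on UNIV g" for g :: "'a \<Rightarrow> real"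
    using that by (intro measurable_restrict_space1 measurable_completion) (auto intro: borel_measurable_continuous_onI)
  have "AE x in lebesgue. x \<notin> N" using N by (simp add: negligible_iff_null_sets AE_not_in)
  then have aeN: "AE x in lebesgue_on F. x \<notin> N" using Fs by (auto simp: AE_restrict_space_iff)
  have "(\<lambda>n. \<integral>x. (T M (f x) - T M (g n x))\<^sup>2 \<partial>lebesgue_on F) \<longlonglongrightarrow> (\<integral>x. 0 \<partial>lebesgue_on F)"
  proof (rule integral_dominated_convergence[where w = "\<lambda>x. (2 * M)\<^sup>2"])
    show "AE x in lebesgue_on F. (\<lambda>n. (T M (f x) - T M (g n x))\<^sup>2) \<longlonglongrightarrow> 0"
      using aeN AE_space
    proof eventually_elim
      case (elim x)
      then have "(\<lambda>n. g n x) \<longlonglongrightarrow> f x" using lim[of x] Fs by (simp add: space_restrict_space)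
      then have "(\<lambda>n. (T M (f x) - T M (g n x))\<^sup>2) \<longlonglongrightarrow> (T M (f x) - T M (f x))\<^sup>2"
        unfolding T_def by (intro tendsto_intros)
      then show ?case by simp
    qed
    show "AE x in lebesgue_on F. norm ((T M (f x) - T M (g n x))\<^sup>2) \<le> (2 * M)\<^sup>2" for n
    proof (rule AE_I2)
      fix x
      have "\<bar>T M (f x) - T M (g n x)\<bar> \<le> 2 * M" using Tb[of M "f x"] Tb[of M "g n x"] by (simp add: M_def)
      then have "\<bar>T M (f x) - T M (g n x)\<bar>\<^sup>2 \<le> (2 * M)\<^sup>2" by (rule power_mono) simp
      then show "norm ((T M (f x) - T M (g n x))\<^sup>2) \<le> (2 * M)\<^sup>2" by simp
    qed
    show "(\<lambda>x. (T M (f x) - T M (g n x))\<^sup>2) \<in> borel_measurable (lebesgue_on F)" for n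
      using Tm[OF fm] cm[OF hc] by measurable
    show "integrable (lebesgue_on F) (\<lambda>x. (2 * M)\<^sup>2)"
      by (rule finite_measure.integrable_const[OF finite_measure_lebesgue_on[OF F]])
  qed auto
  then have "(\<lambda>n. \<integral>x. (T M (f x) - T M (g n x))\<^sup>2 \<partial>lebesgue_on F) \<longlonglongrightarrow> 0" by simp
  then have "\<forall>\<^sub>F n in sequentially. (\<integral>x. (T M (f x) - T M (g n x))\<^sup>2 \<partial>lebesgue_on F) < (e/2)\<^sup>2"
    by (rule order_tendstoD) (use e in simp)
  then obtain n where n: "(\<integral>x. (T M (f x) - T M (g n x))\<^sup>2 \<partial>lebesgue_on F) < (e/2)\<^sup>2"
    by (auto simp: eventually_sequentially)
  have TL2: "in_L2 F (\<lambda>x. T M (u x))" if "u \<in> borel_measurable (lebesgue_on F)" for u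
    by (rule in_L2_bounded[OF Tm[OF that] F, of _ M]) (use Tb[of M] in \<open>simp add: M_def\<close>)
  have "L2_norm F (\<lambda>x. f x - T M (g n x)) = L2_norm F (\<lambda>x. (f x - T M (f x)) + (T M (f x) - T M (g n x)))" by simp
  also have "\<dots> \<le> L2_norm F (\<lambda>x. f x - T M (f x)) + L2_norm F (\<lambda>x. T M (f x) - T M (g n x))"
    by (rule L2_norm_triangle) (intro in_L2_diff f TL2 fm cm g)+
  also have "\<dots> < e/2 + e/2"
  proof (rule add_strict_mono)
    have "(L2_norm F (\<lambda>x. f x - T M (f x)))\<^sup>2 < (e/2)\<^sup>2" using m by (simp add: L2_norm_sq M_def)
    then show "L2_norm F (\<lambda>x. f x - T M (f x)) < e/2" by (rule power2_less_imp_less) (use e in simp)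
    have "(L2_norm F (\<lambda>x. T M (f x) - T M (g n x)))\<^sup>2 < (e/2)\<^sup>2" using n by (simp add: L2_norm_sq)
    then show "L2_norm F (\<lambda>x. T M (f x) - T M (g n x)) < e/2" by (rule power2_less_imp_less) (use e in simp)
  qed
  finally have "L2_norm F (\<lambda>x. f x - T M (g n x)) < e" by simp
  moreover have "\<forall>x. \<bar>T M (g n x)\<bar> \<le> M" using Tb[of M] by (simp add: M_def)
  ultimately show ?thesis using hc[of n] by (intro exI[of _ "\<lambda>x. T M (g n x)"] exI[of _ M]) auto
qed

section \<open>Test functions and weak derivatives\<close>

lemma real_polynomial_function_has_grad:
  assumes "real_polynomial_function p" shows "\<exists>g. has_grad p g"
  using assms
proof (induction rule: real_polynomial_function.induct)
  case (linear f)
  define a :: "real^2" where "a = (\<chi> i. f (axis i 1))"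
  have "f x = a \<bullet> (x - 0)" for x :: "real^2"
  proof -
    have l: "linear f" using linear by (rule bounded_linear.linear)
    have "x = (x $ 1) *\<^sub>R axis 1 1 + (x $ 2) *\<^sub>R axis 2 1" by (simp add: vec_eq_iff forall_2 axis_def)
    then have "f x = f ((x $ 1) *\<^sub>R axis 1 1 + (x $ 2) *\<^sub>R axis 2 1)" by (rule arg_cong)
    then have "f x = x $ 1 * f (axis 1 1) + x $ 2 * f (axis 2 1)"
      by (simp add: linear_add[OF l] linear_scale[OF l])
    then show ?thesis by (simp add: a_def inner_real2 mult.commute)
  qed
  then have "f = (\<lambda>x. a \<bullet> (x - 0))" by (rule ext)
  then show ?case using has_grad_affine[of a 0] by (intro exI[of _ "\<lambda>x. a"]) simp
next
  case (const c) show ?case by (rule exI, rule has_grad_const)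
next
  case (add f g) then show ?case by (elim exE) (rule exI, rule has_grad_add)
next
  case (mult f g) then show ?case by (elim exE) (rule exI, rule has_grad_mult)
qed

definition test_pair :: "(real^2) set \<Rightarrow> (real^2 \<Rightarrow> real) \<Rightarrow> (real^2 \<Rightarrow> real^2) \<Rightarrow> bool" where
  "test_pair F \<phi> g \<longleftrightarrow> has_grad \<phi> g \<and> (\<exists>K. compact K \<and> K \<subseteq> F \<and> (\<forall>x. x \<notin> K \<longrightarrow> \<phi> x = 0))"

lemma test_pair_test_fun: "test_pair F \<phi> g \<Longrightarrow> test_fun F \<phi>"
  by (auto simp: test_pair_def test_fun_def has_grad_C1)

lemma has_weak_rot_test:
  assumes "has_weak_rot F v r" "test_pair F \<phi> g"
  shows "(\<integral>x. r x * \<phi> x \<partial>lebesgue_on F) = (\<integral>x. v x \<bullet> rot90 (g x) \<partial>lebesgue_on F)"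
proof -
  have g: "has_grad \<phi> g" using assms by (simp add: test_pair_def)
  show ?thesis using assms test_pair_test_fun[OF assms(2)]
    by (simp add: has_weak_rot_def inner_real2 has_grad_pderiv[OF g])
qed

lemma has_weak_div_test:
  assumes "has_weak_div F v d" "test_pair F \<phi> g"
  shows "(\<integral>x. d x * \<phi> x \<partial>lebesgue_on F) = - (\<integral>x. v x \<bullet> g x \<partial>lebesgue_on F)"
proof -
  have g: "has_grad \<phi> g" using assms by (simp add: test_pair_def)
  show ?thesis using assms test_pair_test_fun[OF assms(2)]
    by (simp add: has_weak_div_def inner_real2 has_grad_pderiv[OF g])
qed

text \<open>On a closed disk inside \<open>F\<close>, \<open>bump\<close> times any polynomial is a
  test function. Hence \<open>f\<close> times \<open>bump\<close> has vanishing polynomial moments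
  there and is zero almost everywhere; \<open>bump\<close> is positive in the open disk.\<close>

lemma AE_zero_of_test:
  assumes F: "open F" "bounded F" and f: "in_L2 F f"
    and z: "\<And>\<phi> g. test_pair F \<phi> g \<Longrightarrow> (\<integral>x. f x * \<phi> x \<partial>lebesgue_on F) = 0"
  shows "AE x in lebesgue_on F. f x = (0::real)"
proof -
  have Fm: "F \<in> lmeasurable" "F \<in> sets lebesgue" using lmeasurable_open[OF F(2,1)] by auto
  have ball: "AE x in lebesgue. x \<in> ball a r \<longrightarrow> f x = 0" if ar: "r > 0" "cball a r \<subseteq> F" for a r
  proof -
    have Ks: "cball a r \<in> sets lebesgue" by (simp add: lmeasurable_cball)
    have int: "integrable (lebesgue_on F) (\<lambda>x. f x * bump a r x)"
      using integrable_inner_L2[OF f in_L2_continuous[OF has_grad_continuous_on[OF has_grad_bump] Fm(1) F(2)]] by simp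
    have eq: "indicator (cball a r) x *\<^sub>R (f x * bump a r x * q) = indicator F x *\<^sub>R (f x * bump a r x * q)" for x q
      using ar bump_outside(1)[of x a r] by (auto simp: indicator_def)
    have "AE x in lebesgue_on (cball a r). f x * bump a r x = 0"
    proof (rule AE_zero_of_polynomial_moments)
      show "integrable (lebesgue_on (cball a r)) (\<lambda>x. f x * bump a r x)"
      proof -
        have "integrable lebesgue (\<lambda>x. indicator F x *\<^sub>R (f x * bump a r x * 1))"
          using int Fm(2) by (simp add: integrable_restrict_space)
        then have "integrable lebesgue (\<lambda>x. indicator (cball a r) x *\<^sub>R (f x * bump a r x * 1))"
          by (simp only: eq)
        then show ?thesis using Ks by (simp add: integrable_restrict_space)
      qed
      fix p assume "real_polynomial_function (p :: real^2 \<Rightarrow> real)"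
      then obtain g where g: "has_grad p g" using real_polynomial_function_has_grad by auto
      have tp: "test_pair F (\<lambda>x. bump a r x * p x) (\<lambda>x. bump a r x *\<^sub>R g x + p x *\<^sub>R bump_grad a r x)"
        unfolding test_pair_def using has_grad_mult[OF has_grad_bump g] ar bump_outside(1)[of _ a r]
        by (auto intro!: exI[of _ "cball a r"])
      have "(\<integral>x. f x * bump a r x * p x \<partial>lebesgue_on (cball a r)) = (\<integral>x. f x * bump a r x * p x \<partial>lebesgue_on F)"
        using Ks Fm(2) by (simp add: integral_restrict_space eq del: real_scaleR_def)
      also have "\<dots> = 0" using z[OF tp] by (simp add: mult.assoc)
      finally show "(\<integral>x. f x * bump a r x * p x \<partial>lebesgue_on (cball a r)) = 0" .
    qed simp
    then have "AE x in lebesgue. x \<in> cball a r \<longrightarrow> f x * bump a r x = 0"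
      using Ks by (simp add: AE_restrict_space_iff)
    then show ?thesis
    proof eventually_elim
      case (elim x)
      then show ?case using bump_pos[of x a r] by auto
    qed
  qed
  let ?B = "{ball a r |a r. r > 0 \<and> cball a r \<subseteq> F}"
  have U: "F = \<Union>?B"
  proof (intro equalityI subsetI)
    fix x assume "x \<in> F"
    then obtain r where "r > 0" "cball x r \<subseteq> F" using F(1) open_contains_cball by blast
    then show "x \<in> \<Union>?B" by (intro UnionI[of "ball x r"]) auto
  next
    fix x assume "x \<in> \<Union>?B"
    then show "x \<in> F" by (auto simp: subset_iff)
  qed
  \<comment> \<open>A countable subcover is taken because a union of uncountably many null sets need
    not be null.\<close>
  obtain B' where B': "B' \<subseteq> ?B" "countable B'" "\<Union>B' = \<Union>?B"
    by (rule Lindelof[of ?B]) auto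
  have "AE x in lebesgue. \<forall>S\<in>B'. x \<in> S \<longrightarrow> f x = 0"
  proof (subst AE_ball_countable[OF B'(2)], rule ballI)
    fix S assume "S \<in> B'"
    then obtain a r where "S = ball a r" "r > 0" "cball a r \<subseteq> F" using B'(1) by auto
    then show "AE x in lebesgue. x \<in> S \<longrightarrow> f x = 0" using ball[of r a] by simp
  qed
  then have "AE x in lebesgue. x \<in> F \<longrightarrow> f x = 0"
    by eventually_elim (use U B'(3) in auto)
  then show ?thesis using Fm(2) by (simp add: AE_restrict_space_iff)
qed

text \<open>\<open>weak_rot\<close> picks an arbitrary weak rotation; by this lemma its norm is that
  of any other representative, in particular of the polynomial one.\<close>

lemma weak_rot_unique:
  assumes F: "open F" "bounded F" and r: "has_weak_rot F v r" "has_weak_rot F v r'"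
  shows "AE x in lebesgue_on F. r x = r' x"
proof -
  have Fm: "F \<in> lmeasurable" using lmeasurable_open[OF F(2,1)] .
  have L: "in_L2 F r" "in_L2 F r'" using r by (auto simp: has_weak_rot_def)
  have "AE x in lebesgue_on F. r x - r' x = 0"
  proof (rule AE_zero_of_test[OF F in_L2_diff[OF L]])
    fix \<phi> g assume t: "test_pair F \<phi> g"
    have P: "in_L2 F \<phi>" using t by (intro in_L2_continuous[OF has_grad_continuous_on Fm F(2)]) (auto simp: test_pair_def)
    have "(\<integral>x. (r x - r' x) * \<phi> x \<partial>lebesgue_on F) = (\<integral>x. r x * \<phi> x \<partial>lebesgue_on F) - (\<integral>x. r' x * \<phi> x \<partial>lebesgue_on F)"
      using integrable_inner_L2[OF L(1) P] integrable_inner_L2[OF L(2) P] by (simp add: left_diff_distrib)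
    then show "(\<integral>x. (r x - r' x) * \<phi> x \<partial>lebesgue_on F) = 0"
      using has_weak_rot_test[OF r(1) t] has_weak_rot_test[OF r(2) t] by simp
  qed
  then show ?thesis by eventually_elim simp
qed

section \<open>The bubble estimate\<close>

lemma integral_lebesgue_on_lborel:
  fixes G :: "'a::euclidean_space \<Rightarrow> 'b::euclidean_space"
  assumes "F \<in> sets lebesgue" "G \<in> borel_measurable borel" "\<And>x. x \<notin> F \<Longrightarrow> G x = 0"
  shows "(\<integral>x. G x \<partial>lebesgue_on F) = (\<integral>x. G x \<partial>lborel)"
proof -
  have "(\<integral>x. G x \<partial>lebesgue_on F) = (\<integral>x. indicator F x *\<^sub>R G x \<partial>lebesgue)"
    by (rule integral_restrict_space) (use assms in auto)
  also have "\<dots> = (\<integral>x. G x \<partial>lebesgue)"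
    by (rule Bochner_Integration.integral_cong) (use assms(3) in \<open>auto simp: indicator_def\<close>)
  also have "\<dots> = (\<integral>x. G x \<partial>lborel)" by (rule integral_completion) (use assms in auto)
  finally show ?thesis .
qed

lemma borel_continuous: "continuous_on UNIV f \<Longrightarrow> f \<in> borel_measurable borel"
  by (rule borel_measurable_continuous_onI)

lemma integral_lborel_scale:
  fixes G :: "real^2 \<Rightarrow> real"
  assumes "h > 0" "G \<in> borel_measurable borel"
  shows "(\<integral>x. G x \<partial>lborel) = h\<^sup>2 * (\<integral>y. G (c + h *\<^sub>R y) \<partial>lborel)"
proof -
  let ?T = "\<lambda>y::real^2. c + h *\<^sub>R y"
  have T: "?T \<in> borel \<rightarrow>\<^sub>M borel" by (rule borel_continuous) (intro continuous_intros)
  have "(\<integral>x. G x \<partial>lborel) = (\<integral>x. G x \<partial>density (distr lborel borel ?T) (\<lambda>_. ennreal (h ^ 2)))"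
    using lborel_affine[of h c] assms by (simp add: ennreal_power)
  also have "\<dots> = (\<integral>x. h ^ 2 *\<^sub>R G x \<partial>distr lborel borel ?T)"
    by (rule integral_density) (use assms in auto)
  also have "\<dots> = (\<integral>y. h ^ 2 *\<^sub>R G (?T y) \<partial>lborel)"
    by (rule integral_distr) (use assms T in auto)
  finally show ?thesis by simp
qed

text \<open>Translation invariance gives every difference quotient of \<open>\<psi>\<close> the
  integral zero. The quotients converge to the directional derivative and are bounded by the
  Lipschitz constant times \<open>norm e\<close> on a fixed ball, so dominated convergence
  applies.\<close>

lemma integral_grad_zero:
  assumes \<psi>: "has_grad \<psi> g" and K: "compact K" "\<And>x. x \<notin> K \<Longrightarrow> \<psi> x = 0"
  shows "(\<integral>x. g x \<bullet> e \<partial>lborel) = 0"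
proof -
  have gz: "g x = 0" if "x \<notin> K" for x
    by (rule has_grad_zero_outside[OF \<psi> compact_imp_closed[OF K(1)] K(2) that])
  have "compact (g ` K)" by (rule compact_continuous_image[OF continuous_on_subset[OF continuous_on_grad[OF \<psi>]] K(1)]) simp
  then obtain G where G: "\<And>x. x \<in> K \<Longrightarrow> norm (g x) \<le> G" by (meson bounded_iff compact_imp_bounded imageI)
  have G: "norm (g x) \<le> \<bar>G\<bar>" for x using G[of x] gz[of x] by (cases "x \<in> K") auto
  obtain A where A: "\<And>x. x \<in> K \<Longrightarrow> norm x \<le> A" using compact_imp_bounded[OF K(1)] by (auto simp: bounded_iff)
  have lip: "\<bar>\<psi> y - \<psi> x\<bar> \<le> \<bar>G\<bar> * norm (y - x)" for x y
  proof -
    have "norm (\<psi> y - \<psi> x) \<le> \<bar>G\<bar> * norm (y - x)"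
    proof (rule differentiable_bound[of UNIV \<psi> "\<lambda>z v. g z \<bullet> v"])
      show "onorm ((\<bullet>) (g z)) \<le> \<bar>G\<bar>" for z
        by (rule onorm_le) (metis Cauchy_Schwarz_ineq2 G mult_right_mono norm_ge_zero order_trans real_norm_def)
    qed (use has_grad_derivative[OF \<psi>] in auto)
    then show ?thesis by simp
  qed
  have \<psi>m: "\<psi> \<in> borel_measurable borel" by (rule borel_continuous[OF has_grad_continuous_on[OF \<psi>]])
  \<comment> \<open>Outside \<open>cball 0 B\<close> neither \<open>x\<close> nor any of its
    translates by at most \<open>norm e\<close> lies in \<open>K\<close>, so all difference
    quotients vanish there.\<close>
  define B where "B = \<bar>A\<bar> + norm e"
  let ?D = "\<lambda>n x. real (Suc n) * (\<psi> (inverse (real (Suc n)) *\<^sub>R e + x) - \<psi> x)"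
  have shm: "(\<lambda>x. \<psi> (a + x)) \<in> borel_measurable borel" for a
    by (intro borel_continuous continuous_on_compose2[OF has_grad_continuous_on[OF \<psi>]] continuous_intros) auto
  have "compact (\<psi> ` K)" by (rule compact_continuous_image[OF continuous_on_subset[OF has_grad_continuous_on[OF \<psi>]] K(1)]) simp
  then obtain b where b: "\<And>x. x \<in> K \<Longrightarrow> \<bar>\<psi> x\<bar> \<le> b" by (metis bounded_real compact_imp_bounded imageI)
  have int: "integrable lborel \<psi>"
  proof (rule Bochner_Integration.integrable_bound)
    have "emeasure lborel K < \<infinity>" by (rule emeasure_compact_finite[OF K(1)])
    then show "integrable lborel (\<lambda>x. indicator K x *\<^sub>R b)"
      using K(1) by (intro integrable_indicator) (auto simp: compact_imp_closed)
    show "AE x in lborel. norm (\<psi> x) \<le> norm (indicator K x *\<^sub>R b)"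
    proof (rule AE_I2)
      fix x show "norm (\<psi> x) \<le> norm (indicator K x *\<^sub>R b)" using b[of x] K(2)[of x] by (cases "x \<in> K") auto
    qed
  qed (use \<psi>m in simp)
  have shift: "integrable lborel (\<lambda>x. \<psi> (a + x))" "(\<integral>x. \<psi> (a + x) \<partial>lborel) = (\<integral>x. \<psi> x \<partial>lborel)" for a
  proof -
    have d: "distr lborel borel ((+) a) = (lborel :: (real^2) measure)" by (rule lborel_distr_plus)
    have "integrable (distr lborel borel ((+) a)) \<psi>" using int d by simp
    then show "integrable lborel (\<lambda>x. \<psi> (a + x))" by (subst (asm) integrable_distr_eq) (use \<psi>m in auto)
    have "(\<integral>x. \<psi> x \<partial>lborel) = (\<integral>x. \<psi> x \<partial>distr lborel borel ((+) a))" using d by simp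
    also have "\<dots> = (\<integral>x. \<psi> (a + x) \<partial>lborel)" by (rule integral_distr) (use \<psi>m in auto)
    finally show "(\<integral>x. \<psi> (a + x) \<partial>lborel) = (\<integral>x. \<psi> x \<partial>lborel)" by simp
  qed
  have "(\<lambda>n. \<integral>x. ?D n x \<partial>lborel) \<longlonglongrightarrow> (\<integral>x. g x \<bullet> e \<partial>lborel)"
  proof (rule integral_dominated_convergence[where w = "\<lambda>x. indicator (cball 0 B) x *\<^sub>R (\<bar>G\<bar> * norm e)"])
    show "AE x in lborel. (\<lambda>n. ?D n x) \<longlonglongrightarrow> g x \<bullet> e"
    proof (rule AE_I2)
      fix x
      have "((\<lambda>t. \<psi> (x + t *\<^sub>R e)) has_vector_derivative (g x \<bullet> e)) (at 0)"
      proof -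
        have "((\<lambda>t. x + t *\<^sub>R e) has_derivative (\<lambda>t. t *\<^sub>R e)) (at 0)" by (auto intro!: derivative_eq_intros)
        from has_derivative_compose[OF this, of \<psi> "\<lambda>v. g x \<bullet> v"] has_grad_derivative[OF \<psi>, of x]
        show ?thesis by (simp add: has_vector_derivative_def mult.commute)
      qed
      then have "((\<lambda>t. (\<psi> (x + t *\<^sub>R e) - \<psi> x) / t) \<longlongrightarrow> g x \<bullet> e) (at 0)"
        by (simp add: has_real_derivative_iff_has_vector_derivative[symmetric] DERIV_def)
      moreover have "filterlim (\<lambda>n. inverse (real (Suc n))) (at 0) sequentially"
        by (rule filterlim_atI[OF LIMSEQ_inverse_real_of_nat]) simp
      ultimately have "((\<lambda>n. (\<psi> (x + inverse (real (Suc n)) *\<^sub>R e) - \<psi> x) / inverse (real (Suc n))) \<longlongrightarrow> g x \<bullet> e) sequentially"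
        by (rule filterlim_compose)
      then show "(\<lambda>n. ?D n x) \<longlonglongrightarrow> g x \<bullet> e" by (simp add: field_simps)
    qed
    show "AE x in lborel. norm (?D n x) \<le> indicator (cball 0 B) x *\<^sub>R (\<bar>G\<bar> * norm e)" for n
    proof (rule AE_I2)
      fix x
      have ne: "norm (inverse (real (Suc n)) *\<^sub>R e) \<le> norm e"
        by (simp add: field_simps mult_left_le)
      show "norm (?D n x) \<le> indicator (cball 0 B) x *\<^sub>R (\<bar>G\<bar> * norm e)"
      proof (cases "x \<in> cball 0 B")
        case True
        have "\<bar>?D n x\<bar> \<le> real (Suc n) * (\<bar>G\<bar> * norm (inverse (real (Suc n)) *\<^sub>R e))"
          unfolding abs_mult using lip[of "inverse (real (Suc n)) *\<^sub>R e + x" x] by (intro mult_mono) auto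
        also have "\<dots> = \<bar>G\<bar> * norm e" by simp
        finally show ?thesis using True by simp
      next
        case False
        then have "norm x > \<bar>A\<bar> + norm e" by (simp add: B_def)
        moreover have "norm x \<le> norm (inverse (real (Suc n)) *\<^sub>R e + x) + norm (inverse (real (Suc n)) *\<^sub>R e)"
          using norm_triangle_ineq4[of "inverse (real (Suc n)) *\<^sub>R e + x" "inverse (real (Suc n)) *\<^sub>R e"] by simp
        ultimately have "\<not> norm x \<le> A" "\<not> norm (inverse (real (Suc n)) *\<^sub>R e + x) \<le> A"
          using ne norm_ge_zero[of e] by linarith+
        then have "x \<notin> K" "inverse (real (Suc n)) *\<^sub>R e + x \<notin> K" using A by blast+
        then show ?thesis using K(2) False by simp
      qed
    qed
    show "integrable lborel (\<lambda>x. indicator (cball 0 B :: (real^2) set) x *\<^sub>R (\<bar>G\<bar> * norm e))"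
      using emeasure_compact_finite[OF compact_cball[of "0 :: real^2" B]] by (intro integrable_indicator) auto
    show "(\<lambda>x. g x \<bullet> e) \<in> borel_measurable lborel"
      using borel_continuous[OF continuous_on_grad[OF \<psi>]] by simp
    show "?D n \<in> borel_measurable lborel" for n using shm \<psi>m by simp
  qed
  moreover have "(\<integral>x. ?D n x \<partial>lborel) = 0" for n
    using shift[of "inverse (real (Suc n)) *\<^sub>R e"] int by simp
  ultimately show ?thesis by (simp add: LIMSEQ_const_iff)
qed

text \<open>The product of \<open>q\<close> and \<open>\<phi>\<close> has compact support inside
  \<open>F\<close>, so the integral over \<open>F\<close> of its derivative is an integral over the
  plane and vanishes by \<open>integral_grad_zero\<close>; no boundary term arises.\<close>

lemma integration_by_parts:
  assumes F: "open F" "bounded F" and q: "has_grad q q'" and \<phi>: "test_pair F \<phi> g"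
  shows "(\<integral>x. q x * (g x \<bullet> e) \<partial>lebesgue_on F) = - (\<integral>x. (q' x \<bullet> e) * \<phi> x \<partial>lebesgue_on F)"
proof -
  have Fm: "F \<in> lmeasurable" "F \<in> sets lebesgue" using lmeasurable_open[OF F(2,1)] by auto
  from \<phi> obtain K where g: "has_grad \<phi> g" and K: "compact K" "K \<subseteq> F" "\<And>x. x \<notin> K \<Longrightarrow> \<phi> x = 0"
    by (auto simp: test_pair_def)
  have gz: "g x = 0" if "x \<notin> K" for x
    by (rule has_grad_zero_outside[OF g compact_imp_closed[OF K(1)] K(3) that])
  have c: "continuous_on UNIV (\<lambda>x. q x * (g x \<bullet> e))" "continuous_on UNIV (\<lambda>x. (q' x \<bullet> e) * \<phi> x)"
    using has_grad_continuous_on[OF g] continuous_on_grad[OF g] has_grad_continuous_on[OF q] continuous_on_grad[OF q]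
    by (auto intro!: continuous_on_mult continuous_on_inner continuous_on_const)
  have 1: "integrable (lebesgue_on F) (\<lambda>x. q x * (g x \<bullet> e))" "integrable (lebesgue_on F) (\<lambda>x. (q' x \<bullet> e) * \<phi> x)"
    using integrable_inner_L2[OF in_L2_continuous[OF c(1) Fm(1) F(2)] in_L2_continuous[OF continuous_on_const Fm(1) F(2), of 1]]
      integrable_inner_L2[OF in_L2_continuous[OF c(2) Fm(1) F(2)] in_L2_continuous[OF continuous_on_const Fm(1) F(2), of 1]]
    by simp_all
  have "(\<integral>x. q x * (g x \<bullet> e) \<partial>lebesgue_on F) + (\<integral>x. (q' x \<bullet> e) * \<phi> x \<partial>lebesgue_on F)
    = (\<integral>x. (q x *\<^sub>R g x + \<phi> x *\<^sub>R q' x) \<bullet> e \<partial>lebesgue_on F)"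
    using 1 by (simp add: inner_add_left mult.commute)
  also have "\<dots> = (\<integral>x. (q x *\<^sub>R g x + \<phi> x *\<^sub>R q' x) \<bullet> e \<partial>lborel)"
  proof (rule integral_lebesgue_on_lborel[OF Fm(2)])
    show "(\<lambda>x. (q x *\<^sub>R g x + \<phi> x *\<^sub>R q' x) \<bullet> e) \<in> borel_measurable borel"
      using continuous_on_grad[OF has_grad_mult[OF q g]]
      by (intro borel_continuous continuous_on_inner continuous_on_const)
    show "(q x *\<^sub>R g x + \<phi> x *\<^sub>R q' x) \<bullet> e = 0" if "x \<notin> F" for x
    proof -
      have "x \<notin> K" using that K(2) by auto
      then show ?thesis using K(3) gz by simp
    qed
  qed
  also have "\<dots> = 0"
    by (rule integral_grad_zero[OF has_grad_mult[OF q g] K(1)]) (simp add: K(3))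
  finally show ?thesis by simp
qed

definition unit_area :: real where "unit_area = measure lebesgue (ball (0::real^2) 1)"

lemma unit_area_pos: "unit_area > 0"
  unfolding unit_area_def using content_ball_pos[of 1 "0::real^2"] by simp

lemma measure_ball2: "r \<ge> 0 \<Longrightarrow> measure lebesgue (ball (c::real^2) r) = r\<^sup>2 * unit_area"
  using content_ball_conv_unit_ball[of r c] by (simp add: unit_area_def)

lemma measure_le_cball2:
  assumes "F \<in> sets lebesgue" "F \<subseteq> cball (c::real^2) h" "h \<ge> 0"
  shows "measure lebesgue F \<le> h\<^sup>2 * unit_area"
proof -
  have "measure lebesgue F \<le> measure lebesgue (cball c h)"
    by (rule measure_mono_fmeasurable) (use assms in \<open>auto simp: lmeasurable_cball\<close>)
  also have "\<dots> = measure lebesgue (ball c h)"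
    using content_cball_conv_ball[of c h] by simp
  finally show ?thesis using measure_ball2[OF assms(3)] by simp
qed

lemma abs_xpow_le_1: "norm y \<le> 1 \<Longrightarrow> \<bar>xpow p y\<bar> \<le> 1"
proof -
  assume "norm y \<le> 1"
  then have "\<bar>y $ i\<bar> \<le> 1" for i using component_le_norm_cart[of y i] by linarith
  then show ?thesis by (simp add: xpow_def abs_mult power_abs power_le_one mult_le_one)
qed

lemma sum_abs_sq_le:
  assumes "finite I" shows "(\<Sum>i\<in>I. \<bar>c i :: real\<bar>)\<^sup>2 \<le> real (card I) * (\<Sum>i\<in>I. (c i)\<^sup>2)"
  using Cauchy_Schwarz_ineq_sum[of "\<lambda>_. 1" "\<lambda>i. \<bar>c i\<bar>" I] by simp

text \<open>One statement for two uses: \<open>V\<close> is \<open>- v\<close> when \<open>d\<close>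
  is the divergence, and minus \<open>rot90\<close> of \<open>v\<close> when \<open>d\<close> is the
  rotation. The bound concerns the coefficients in the scaled variable. Of the two factors
  \<open>h\<close>, one comes from the area of \<open>F\<close> and one from the derivative.\<close>

definition bubble_const :: "nat \<Rightarrow> real \<Rightarrow> real \<Rightarrow> bool" where
  "bubble_const k \<rho> C \<longleftrightarrow> (\<forall>c h F V d. h > 0 \<longrightarrow> open F \<longrightarrow> ball c (\<rho> * h) \<subseteq> F \<longrightarrow> F \<subseteq> cball c h \<longrightarrow>
     in_L2 F V \<longrightarrow> d \<in> polys k \<longrightarrow>
     (\<forall>\<phi> g. test_pair F \<phi> g \<longrightarrow> (\<integral>x. d x * \<phi> x \<partial>lebesgue_on F) = (\<integral>x. V x \<bullet> g x \<partial>lebesgue_on F)) \<longrightarrow>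
     (\<exists>a. (\<forall>y. d (c + h *\<^sub>R y) = (\<Sum>p\<in>degs k. a p * xpow p y)) \<and> h\<^sup>2 * (\<Sum>p\<in>degs k. \<bar>a p\<bar>) \<le> C * L2_norm F V))"

text \<open>Tested against itself times a bump, \<open>d\<close> yields from below
  \<open>h\<^sup>2\<close> times the squared coefficients, by the Gram bound on the disk. From
  above, the gradient of the test function is at most a constant times the coefficients divided by
  \<open>h\<close>, and the root of the area restores a factor \<open>h\<close>. Dividing by the
  coefficients leaves a linear bound.\<close>

lemma bubble_estimate:
  fixes \<rho> :: real
  assumes \<rho>: "\<rho> > 0"
  shows "\<exists>C>0. bubble_const k \<rho> C"
proof -
  \<comment> \<open>Half the radius, so that the closed disk supporting the bump lies inside the
    open disk contained in \<open>F\<close>.\<close>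
  define \<sigma> where "\<sigma> = \<rho> / 2"
  have \<sigma>: "\<sigma> > 0" using \<rho> by (simp add: \<sigma>_def)
  let ?D = "cball (0::real^2) \<sigma>"
  \<comment> \<open>Monomials times the square root of \<open>bump\<close>: in scaled variables
    \<open>d\<close> times the test function becomes the square of a combination of the
    \<open>m p\<close>, to which \<open>gram_L2\<close> applies.\<close>
  define m where "m = (\<lambda>p y. xpow p y * max 0 (\<sigma>\<^sup>2 - (norm y)\<^sup>2))"
  have mc: "continuous_on UNIV (m p)" for p unfolding m_def by (intro continuous_intros continuous_on_xpow)
  have Dm: "?D \<in> lmeasurable" "bounded ?D" by auto
  have mL: "in_L2 ?D (m p)" for p by (rule in_L2_continuous[OF mc Dm])
  have indep: "\<forall>p\<in>degs k. a p = 0" if ae: "AE x in lebesgue_on ?D. (\<Sum>p\<in>degs k. a p * m p x) = 0" for a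
  proof
    fix p assume p: "p \<in> degs k"
    show "a p = 0"
    proof (rule poly2_zero[OF \<sigma> _ p])
      fix x :: "real^2" assume x: "x \<in> ball 0 \<sigma>"
      have "(\<Sum>p\<in>degs k. a p * m p x) = 0"
        by (rule AE_zero_open[OF _ ae open_ball[of 0 \<sigma>]])
           (use x in \<open>auto intro!: continuous_on_sum continuous_on_mult continuous_on_const mc\<close>)
      then have "(\<Sum>p\<in>degs k. a p * xpow p x) * max 0 (\<sigma>\<^sup>2 - (norm x)\<^sup>2) = 0"
        by (simp add: m_def sum_distrib_right mult.assoc)
      moreover have "(norm x)\<^sup>2 < \<sigma>\<^sup>2" using x by (intro power_strict_mono) auto
      ultimately show "(\<Sum>p\<in>degs k. a p * xpow p x) = 0" by auto
    qed
  qed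
  from gram_L2[where m = m and D = ?D, OF finite_degs[of k] mL] indep
  obtain \<alpha> where \<alpha>: "\<alpha> > 0" "\<And>a. \<alpha> * (\<Sum>p\<in>degs k. (a p)\<^sup>2) \<le> (\<integral>x. (\<Sum>p\<in>degs k. a p * m p x)\<^sup>2 \<partial>lebesgue_on ?D)"
    by auto
  define mg where "mg = (\<lambda>p x. xpow p x *\<^sub>R bump_grad 0 \<sigma> x + bump 0 \<sigma> x *\<^sub>R xpow_grad p x)"
  have mg: "has_grad (\<lambda>x. xpow p x * bump 0 \<sigma> x) (mg p)" for p
    unfolding mg_def by (rule has_grad_mult[OF has_grad_xpow has_grad_bump])
  have "\<forall>p. \<exists>b. \<forall>x\<in>cball 0 1. norm (mg p x) \<le> b"
  proof
    fix p
    have "compact (mg p ` cball 0 1)"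
      by (rule compact_continuous_image[OF continuous_on_subset[OF continuous_on_grad[OF mg]] compact_cball]) simp
    then show "\<exists>b. \<forall>x\<in>cball 0 1. norm (mg p x) \<le> b" by (meson bounded_iff compact_imp_bounded imageI)
  qed
  then obtain b where b: "\<And>p x. x \<in> cball 0 1 \<Longrightarrow> norm (mg p x) \<le> b p" by metis
  define \<beta> where "\<beta> = 1 + (\<Sum>p\<in>degs k. \<bar>b p\<bar>)"
  have \<beta>: "\<beta> > 0" unfolding \<beta>_def by (intro add_pos_nonneg sum_nonneg) auto
  have b\<beta>: "norm (mg p x) \<le> \<beta>" if "p \<in> degs k" "x \<in> cball 0 1" for p x
  proof -
    have "norm (mg p x) \<le> \<bar>b p\<bar>" using b[OF that(2), of p] by linarith
    also have "\<dots> \<le> (\<Sum>p\<in>degs k. \<bar>b p\<bar>)" by (rule member_le_sum) (use that in auto)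
    finally show ?thesis by (simp add: \<beta>_def)
  qed
  define n where "n = real (card (degs k))"
  have "(0, 0) \<in> degs k" by (simp add: degs_def)
  then have n: "n > 0" unfolding n_def using card_gt_0_iff[of "degs k"] by auto
  define C where "C = n * \<beta> * sqrt unit_area / \<alpha>"
  have C: "C > 0" unfolding C_def using n \<beta> \<alpha>(1) unit_area_pos by simp
  show ?thesis unfolding bubble_const_def
  proof (intro exI[of _ C] conjI C allI impI)
    fix c h F V d
    assume h: "h > 0" and F: "open F" "ball c (\<rho> * h) \<subseteq> F" "F \<subseteq> cball c h" and V: "in_L2 F V" and d: "d \<in> polys k"
      and weak: "\<forall>\<phi> g. test_pair F \<phi> g \<longrightarrow> (\<integral>x. d x * \<phi> x \<partial>lebesgue_on F) = (\<integral>x. V x \<bullet> g x \<partial>lebesgue_on F)"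
    have Fb: "bounded F" using F(3) bounded_cball bounded_subset by blast
    have Fm: "F \<in> lmeasurable" "F \<in> sets lebesgue" using lmeasurable_open[OF Fb F(1)] by auto
    from polys_scale[OF d, of c h] obtain a where a: "\<And>y. d (c + h *\<^sub>R y) = (\<Sum>p\<in>degs k. a p * xpow p y)"
      by (elim polysE) auto
    define s where "s = inverse h"
    have s: "s > 0" "h * s = 1" using h by (auto simp: s_def)
    define \<Phi> where "\<Phi> = (\<lambda>y. \<Sum>p\<in>degs k. a p * (xpow p y * bump 0 \<sigma> y))"
    define \<Phi>' where "\<Phi>' = (\<lambda>y. \<Sum>p\<in>degs k. a p *\<^sub>R mg p y)"
    have \<Phi>: "has_grad \<Phi> \<Phi>'" unfolding \<Phi>_def \<Phi>'_def by (intro has_grad_sum has_grad_cmult mg)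
    define \<phi> where "\<phi> = (\<lambda>x. \<Phi> (- s *\<^sub>R c + s *\<^sub>R x))"
    define g where "g = (\<lambda>x. s *\<^sub>R \<Phi>' (- s *\<^sub>R c + s *\<^sub>R x))"
    have \<phi>: "has_grad \<phi> g" unfolding \<phi>_def g_def by (rule has_grad_shift[OF \<Phi>])
    have inv: "- s *\<^sub>R c + s *\<^sub>R (c + h *\<^sub>R y) = y" for y using s by (simp add: scaleR_add_right mult.commute)
    have nrm: "norm (- s *\<^sub>R c + s *\<^sub>R x) = s * dist c x" for x
    proof -
      have "- s *\<^sub>R c + s *\<^sub>R x = s *\<^sub>R (x - c)" by (simp add: scaleR_diff_right)
      then show ?thesis using s by (simp add: dist_norm norm_minus_commute)
    qed
    have \<phi>0: "\<phi> x = 0" if "x \<notin> cball c (\<sigma> * h)" for x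
    proof -
      have "s * (\<sigma> * h) < s * dist c x" using that s by (intro mult_strict_left_mono) auto
      then have "- s *\<^sub>R c + s *\<^sub>R x \<notin> cball 0 \<sigma>" using s nrm by (simp add: mult_ac)
      then show ?thesis using bump_outside(1)[of "- s *\<^sub>R c + s *\<^sub>R x" 0 \<sigma>] \<sigma> by (simp add: \<phi>_def \<Phi>_def)
    qed
    have sub: "cball c (\<sigma> * h) \<subseteq> F"
    proof -
      have "\<sigma> * h < \<rho> * h" using \<rho> h by (simp add: \<sigma>_def)
      then have "cball c (\<sigma> * h) \<subseteq> ball c (\<rho> * h)" by auto
      then show ?thesis using F(2) by blast
    qed
    have tp: "test_pair F \<phi> g" unfolding test_pair_def using \<phi> \<phi>0 sub by (auto intro!: exI[of _ "cball c (\<sigma> * h)"])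
    have dphi: "d (c + h *\<^sub>R y) * \<phi> (c + h *\<^sub>R y) = (\<Sum>p\<in>degs k. a p * m p y)\<^sup>2" for y
    proof -
      have 1: "(\<Sum>p\<in>degs k. a p * m p y) = (\<Sum>p\<in>degs k. a p * xpow p y) * max 0 (\<sigma>\<^sup>2 - (norm y)\<^sup>2)"
        by (simp add: m_def sum_distrib_right mult.assoc)
      have 2: "\<phi> (c + h *\<^sub>R y) = (\<Sum>p\<in>degs k. a p * xpow p y) * (max 0 (\<sigma>\<^sup>2 - (norm y)\<^sup>2))\<^sup>2"
        unfolding \<phi>_def inv \<Phi>_def by (simp add: bump_def sum_distrib_right mult.assoc)
      show ?thesis unfolding 1 2 a by (simp add: power_mult_distrib power2_eq_square)
    qed
    have dm: "(\<lambda>x. d x * \<phi> x) \<in> borel_measurable borel"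
      by (rule borel_continuous[OF continuous_on_mult[OF continuous_on_polys[OF d] has_grad_continuous_on[OF \<phi>]]])
    have "(\<integral>x. d x * \<phi> x \<partial>lebesgue_on F) = (\<integral>x. d x * \<phi> x \<partial>lborel)"
    proof (rule integral_lebesgue_on_lborel[OF Fm(2) dm])
      fix x assume "x \<notin> F"
      then have "x \<notin> cball c (\<sigma> * h)" using sub by blast
      then show "d x * \<phi> x = 0" using \<phi>0 by simp
    qed
    also have "\<dots> = h\<^sup>2 * (\<integral>y. d (c + h *\<^sub>R y) * \<phi> (c + h *\<^sub>R y) \<partial>lborel)"
      by (rule integral_lborel_scale[OF h dm])
    also have "\<dots> = h\<^sup>2 * (\<integral>y. (\<Sum>p\<in>degs k. a p * m p y)\<^sup>2 \<partial>lborel)" unfolding dphi ..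
    also have "(\<integral>y. (\<Sum>p\<in>degs k. a p * m p y)\<^sup>2 \<partial>lborel) = (\<integral>y. (\<Sum>p\<in>degs k. a p * m p y)\<^sup>2 \<partial>lebesgue_on ?D)"
    proof (rule integral_lebesgue_on_lborel[symmetric])
      show "(\<lambda>y. (\<Sum>p\<in>degs k. a p * m p y)\<^sup>2) \<in> borel_measurable borel"
        by (intro borel_continuous continuous_on_power continuous_on_sum continuous_on_mult continuous_on_const mc)
      show "(\<Sum>p\<in>degs k. a p * m p y)\<^sup>2 = 0" if "y \<notin> ?D" for y
      proof -
        have "\<sigma>\<^sup>2 \<le> (norm y)\<^sup>2" using that \<sigma> by (intro power_mono) auto
        then show ?thesis by (simp add: m_def)
      qed
    qed simp
    finally have lhs: "(\<integral>x. d x * \<phi> x \<partial>lebesgue_on F) = h\<^sup>2 * (\<integral>y. (\<Sum>p\<in>degs k. a p * m p y)\<^sup>2 \<partial>lebesgue_on ?D)" .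
    define S where "S = (\<Sum>p\<in>degs k. \<bar>a p\<bar>)"
    have S: "S \<ge> 0" unfolding S_def by (rule sum_nonneg) simp
    have gm: "g \<in> borel_measurable (lebesgue_on F)"
      using continuous_on_grad[OF \<phi>] by (intro measurable_restrict_space1 measurable_completion) (auto intro: borel_continuous)
    have gb: "norm (g x) \<le> s * (S * \<beta>)" if x: "x \<in> F" for x
    proof -
      have "s * dist c x \<le> s * h" using x F(3) s by (intro mult_left_mono) auto
      then have y: "- s *\<^sub>R c + s *\<^sub>R x \<in> cball 0 1" (is "?y \<in> _") using nrm s by (simp add: mult.commute)
      have "norm (\<Phi>' ?y) \<le> (\<Sum>p\<in>degs k. norm (a p *\<^sub>R mg p ?y))" unfolding \<Phi>'_def by (rule norm_sum)
      also have "\<dots> \<le> (\<Sum>p\<in>degs k. \<bar>a p\<bar> * \<beta>)" using b\<beta>[OF _ y] by (intro sum_mono) (simp add: mult_left_mono)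
      also have "\<dots> = S * \<beta>" by (simp add: S_def sum_distrib_right)
      finally show ?thesis using s by (simp add: g_def)
    qed
    have "L2_norm F g \<le> (s * (S * \<beta>)) * sqrt (measure lebesgue F)"
      by (rule L2_norm_bounded[OF Fm(1) gb _ gm]) (use s S \<beta> in auto)
    also have "\<dots> \<le> (s * (S * \<beta>)) * (h * sqrt unit_area)"
    proof (rule mult_left_mono)
      have "sqrt (measure lebesgue F) \<le> sqrt (h\<^sup>2 * unit_area)"
        using measure_le_cball2[OF Fm(2) F(3)] h by simp
      then show "sqrt (measure lebesgue F) \<le> h * sqrt unit_area" using h by (simp add: real_sqrt_mult)
    qed (use s S \<beta> in auto)
    also have "\<dots> = S * \<beta> * sqrt unit_area" using s by (simp add: mult_ac) 
    finally have gn: "L2_norm F g \<le> S * \<beta> * sqrt unit_area" .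
    have gL: "in_L2 F g" by (rule in_L2_continuous[OF continuous_on_grad[OF \<phi>] Fm(1) Fb])
    \<comment> \<open>The Gram bound controls the sum of squares, while the gradient bound produces
      the sum of absolute values. Cauchy-Schwarz passes from one to the other at the price of the
      number \<open>n\<close> of monomials.\<close>
    have "h\<^sup>2 * (\<alpha> * S\<^sup>2) \<le> h\<^sup>2 * (n * (\<alpha> * (\<Sum>p\<in>degs k. (a p)\<^sup>2)))"
      using mult_left_mono[OF sum_abs_sq_le[OF finite_degs, of a k], of \<alpha>] \<alpha>(1)
      by (intro mult_left_mono) (simp_all add: S_def n_def mult_ac)
    also have "\<dots> \<le> h\<^sup>2 * (n * (\<integral>y. (\<Sum>p\<in>degs k. a p * m p y)\<^sup>2 \<partial>lebesgue_on ?D))"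
      using \<alpha>(2)[of a] n by (intro mult_left_mono) auto
    also have "\<dots> = n * L2_inner F V g" using lhs weak tp by (simp add: L2_inner_def)
    also have "\<dots> \<le> n * (L2_norm F V * (S * \<beta> * sqrt unit_area))"
    proof (rule mult_left_mono)
      have "L2_inner F V g \<le> L2_norm F V * L2_norm F g" using L2_inner_CS[OF V gL] by simp
      also have "\<dots> \<le> L2_norm F V * (S * \<beta> * sqrt unit_area)" by (rule mult_left_mono[OF gn]) simp
      finally show "L2_inner F V g \<le> L2_norm F V * (S * \<beta> * sqrt unit_area)" .
    qed (use n in simp)
    finally have fin: "h\<^sup>2 * (\<alpha> * S\<^sup>2) \<le> n * (L2_norm F V * (S * \<beta> * sqrt unit_area))" .
    have "h\<^sup>2 * S \<le> C * L2_norm F V"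
    proof (cases "S = 0")
      case True then show ?thesis using C by simp
    next
      case False
      then have Sp: "S > 0" using S by simp
      have "(h\<^sup>2 * S) * (\<alpha> * S) \<le> (n * \<beta> * sqrt unit_area * L2_norm F V) * S"
        using fin by (simp add: power2_eq_square mult_ac)
      then have "(h\<^sup>2 * S) * \<alpha> \<le> n * \<beta> * sqrt unit_area * L2_norm F V" using Sp by (simp add: mult_ac)
      then show ?thesis using \<alpha>(1) by (simp add: C_def field_simps)
    qed
    then show "\<exists>a. (\<forall>y. d (c + h *\<^sub>R y) = (\<Sum>p\<in>degs k. a p * xpow p y)) \<and> h\<^sup>2 * (\<Sum>p\<in>degs k. \<bar>a p\<bar>) \<le> C * L2_norm F V"
      using a unfolding S_def by (intro exI[of _ a]) auto
  qed
qed

section \<open>The trace inequality on a triangle\<close>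

lemma Basis_real2: "(Basis :: (real^2) set) = {axis 1 1, axis 2 1}"
  by (auto simp: Basis_vec_def) (metis exhaust_2)

lemma axis_12_ne: "axis 1 (1::real) \<noteq> (axis 2 1 :: real^2)"
  by (simp add: axis_eq_axis)

lemma vector2_measurable: "(\<lambda>(s, t). vector [s, t] :: real^2) \<in> borel_measurable (lborel \<Otimes>\<^sub>M lborel)"
proof -
  have "continuous_on UNIV (\<lambda>z::real \<times> real. fst z *\<^sub>R axis 1 1 + snd z *\<^sub>R (axis 2 1 :: real^2))"
    by (intro continuous_intros)
  moreover have "(\<lambda>(s, t). vector [s, t] :: real^2) = (\<lambda>z. fst z *\<^sub>R axis 1 1 + snd z *\<^sub>R (axis 2 1 :: real^2))"
    by (auto simp: fun_eq_iff vec_eq_iff forall_2 axis_def)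
  ultimately show ?thesis by (simp add: lborel_prod borel_continuous)
qed

lemma lborel_real2: "lborel = distr (lborel \<Otimes>\<^sub>M lborel) borel (\<lambda>(s, t). vector [s, t] :: real^2)"
proof (rule lborel_eqI)
  let ?P = "\<lambda>(s, t). vector [s, t] :: real^2"
  have P: "?P \<in> borel_measurable (lborel \<Otimes>\<^sub>M lborel)" by (rule vector2_measurable)
  fix l u :: "real^2" assume le: "\<And>b. b \<in> Basis \<Longrightarrow> l \<bullet> b \<le> u \<bullet> b"
  have le2: "l $ 1 \<le> u $ 1" "l $ 2 \<le> u $ 2"
    using le[of "axis 1 1"] le[of "axis 2 1"] by (simp_all add: Basis_real2 inner_axis)
  have "?P -` box l u = {l $ 1 <..< u $ 1} \<times> {l $ 2 <..< u $ 2}"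
    by (auto simp: mem_box_cart forall_2)
  then have "emeasure (distr (lborel \<Otimes>\<^sub>M lborel) borel ?P) (box l u) = emeasure (lborel \<Otimes>\<^sub>M lborel) ({l $ 1 <..< u $ 1} \<times> {l $ 2 <..< u $ 2})"
    using P by (subst emeasure_distr) (auto simp: space_pair_measure)
  also have "\<dots> = emeasure lborel {l $ 1 <..< u $ 1} * emeasure lborel {l $ 2 <..< u $ 2}"
    by (rule lborel.emeasure_pair_measure_Times) auto
  also have "\<dots> = ennreal ((u $ 1 - l $ 1) * (u $ 2 - l $ 2))"
    using le2 by (simp add: ennreal_mult)
  finally show "emeasure (distr (lborel \<Otimes>\<^sub>M lborel) borel ?P) (box l u) = (\<Prod>b\<in>Basis. (u - l) \<bullet> b)"
    by (simp add: Basis_real2 axis_12_ne inner_axis)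
qed simp

text \<open>\<open>p \<bullet> rot90 q\<close> is the determinant of the matrix with columns
  \<open>p\<close> and \<open>q\<close>. Boxes suffice to identify the measure, and for them the
  determinant formula for linear images applies.\<close>

lemma lborel_linear2:
  fixes p q :: "real^2"
  assumes \<delta>: "\<delta> = p \<bullet> rot90 q" "\<delta> \<noteq> 0"
  shows "lborel = density (distr lborel borel (\<lambda>y::real^2. y $ 1 *\<^sub>R p + y $ 2 *\<^sub>R q)) (\<lambda>_. ennreal \<bar>\<delta>\<bar>)"
proof (rule lborel_eqI)
  let ?L = "\<lambda>y::real^2. y $ 1 *\<^sub>R p + y $ 2 *\<^sub>R q"
  \<comment> \<open>The inverse map by Cramer's rule.\<close>
  let ?I = "\<lambda>x::real^2. vector [(rot90 q \<bullet> x) / \<delta>, - (rot90 p \<bullet> x) / \<delta>] :: real^2"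
  have L: "linear ?L" by (rule linearI) (simp_all add: algebra_simps)
  have I: "linear ?I" by (rule linearI) (simp_all add: vec_eq_iff forall_2 inner_add_right add_divide_distrib diff_divide_distrib)
  have \<delta>': "p $ 1 * q $ 2 - p $ 2 * q $ 1 = \<delta>" using \<delta>(1) by (simp add: inner_real2)
  have det: "det (matrix ?L) = \<delta>"
    by (simp add: det_2 matrix_def axis_def \<delta>'[symmetric])
  have LI: "?L (?I x) = x" for x
  proof -
    have "\<delta> *\<^sub>R ?L (?I x) = \<delta> *\<^sub>R x"
      using \<delta>(2) by (simp add: vec_eq_iff forall_2 inner_real2 distrib_left) (simp add: \<delta>'[symmetric] algebra_simps)
    then show ?thesis using \<delta>(2) by simp
  qed
  have IL: "?I (?L y) = y" for y
  proof -
    have "rot90 q \<bullet> ?L y = \<delta> * y $ 1" "- (rot90 p \<bullet> ?L y) = \<delta> * y $ 2"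
      by (simp_all add: inner_real2 \<delta>'[symmetric] algebra_simps)
    then show ?thesis using \<delta>(2) by (simp add: vec_eq_iff forall_2)
  qed
  have Lm: "?L \<in> borel_measurable borel"
    by (rule borel_continuous) (intro continuous_intros)
  fix l u :: "real^2" assume le: "\<And>b. b \<in> Basis \<Longrightarrow> l \<bullet> b \<le> u \<bullet> b"
  have pre: "?L -` box l u = ?I ` box l u"
  proof (intro equalityI subsetI)
    fix y assume "y \<in> ?L -` box l u"
    then have "?I (?L y) \<in> ?I ` box l u" by (intro imageI) simp
    then show "y \<in> ?I ` box l u" unfolding IL .
  next
    fix y assume "y \<in> ?I ` box l u"
    then obtain x where "y = ?I x" "x \<in> box l u" by (rule imageE)
    then show "y \<in> ?L -` box l u" using LI[of x] by simp
  qed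
  have S: "?I ` box l u \<in> lmeasurable" by (rule measurable_linear_image[OF I]) simp
  have "?L ` (?I ` box l u) = box l u" using LI by (simp add: image_image)
  then have m: "measure lebesgue (box l u) = \<bar>\<delta>\<bar> * measure lebesgue (?I ` box l u)"
    using measure_linear_image[OF L S] det by simp
  have b: "?L -` box l u \<in> sets borel" using measurable_sets[OF Lm, of "box l u"] by simp
  have "emeasure (density (distr lborel borel ?L) (\<lambda>_. ennreal \<bar>\<delta>\<bar>)) (box l u) = ennreal \<bar>\<delta>\<bar> * emeasure lborel (?L -` box l u)"
    using Lm by (simp add: emeasure_density nn_integral_cmult emeasure_distr)
  also have "emeasure lborel (?L -` box l u) = ennreal (measure lebesgue (?I ` box l u))"
  proof -
    have "emeasure lborel (?L -` box l u) = emeasure lebesgue (?L -` box l u)" using b by simp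
    also have "\<dots> = ennreal (measure lebesgue (?L -` box l u))"
      by (rule emeasure_eq_measure2) (use S pre in simp)
    finally show ?thesis unfolding pre .
  qed
  also have "ennreal \<bar>\<delta>\<bar> * ennreal (measure lebesgue (?I ` box l u)) = ennreal (measure lebesgue (box l u))"
    by (simp add: m ennreal_mult)
  also have "\<dots> = emeasure lborel (box l u)"
    using emeasure_eq_ennreal_measure[of lborel "box l u"] emeasure_lborel_box_finite[of l u]
    by (simp add: less_top[symmetric])
  also have "\<dots> = (\<Prod>b\<in>Basis. (u - l) \<bullet> b)" using le by simp
  finally show "emeasure (density (distr lborel borel ?L) (\<lambda>_. ennreal \<bar>\<delta>\<bar>)) (box l u) = (\<Prod>b\<in>Basis. (u - l) \<bullet> b)" .
qed simp

lemma nn_integral_affine2: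
  fixes p q c :: "real^2"
  assumes \<delta>: "\<delta> = p \<bullet> rot90 q" "\<delta> \<noteq> 0" and G[measurable]: "G \<in> borel_measurable borel"
  shows "(\<integral>\<^sup>+x. G x \<partial>lborel) = ennreal \<bar>\<delta>\<bar> * (\<integral>\<^sup>+s. \<integral>\<^sup>+t. G (c + s *\<^sub>R p + t *\<^sub>R q) \<partial>lborel \<partial>lborel)"
proof -
  let ?L = "\<lambda>y::real^2. y $ 1 *\<^sub>R p + y $ 2 *\<^sub>R q"
  let ?P = "\<lambda>(s, t). vector [s, t] :: real^2"
  have P: "?P \<in> borel_measurable (lborel \<Otimes>\<^sub>M lborel)" by (rule vector2_measurable)
  have Lm[measurable]: "?L \<in> borel_measurable borel"
    by (rule borel_continuous) (intro continuous_intros)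
  have "(\<integral>\<^sup>+x. G x \<partial>lborel) = (\<integral>\<^sup>+x. G x \<partial>distr lborel borel ((+) c))"
    using lborel_distr_plus[of c] by simp
  also have "\<dots> = (\<integral>\<^sup>+x. G (c + x) \<partial>lborel)" by (rule nn_integral_distr) auto
  also have "\<dots> = (\<integral>\<^sup>+x. G (c + x) \<partial>density (distr lborel borel ?L) (\<lambda>_. ennreal \<bar>\<delta>\<bar>))"
    using lborel_linear2[OF \<delta>] by simp
  also have "\<dots> = ennreal \<bar>\<delta>\<bar> * (\<integral>\<^sup>+y. G (c + ?L y) \<partial>lborel)"
    by (simp add: nn_integral_density nn_integral_distr nn_integral_cmult)
  also have "(\<integral>\<^sup>+y. G (c + ?L y) \<partial>lborel) = (\<integral>\<^sup>+y. G (c + ?L y) \<partial>distr (lborel \<Otimes>\<^sub>M lborel) borel ?P)"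
    using lborel_real2 by simp
  also have "\<dots> = (\<integral>\<^sup>+z. G (c + ?L (?P z)) \<partial>(lborel \<Otimes>\<^sub>M lborel))"
    by (rule nn_integral_distr[OF P]) simp
  also have "\<dots> = (\<integral>\<^sup>+s. \<integral>\<^sup>+t. G (c + ?L (?P (s, t))) \<partial>lborel \<partial>lborel)"
    by (rule lborel.nn_integral_fst[symmetric]) (use P in measurable)
  finally show ?thesis by (simp add: add.assoc)
qed

text \<open>Coordinates of \<open>x = c + s * p + w * q\<close>, where the edge from \<open>c + p\<close> to \<open>c + p + q\<close> is
  \<open>s = 1\<close>, \<open>0 \<le> w \<le> 1\<close>.\<close>
definition scoord :: "real^2 \<Rightarrow> real^2 \<Rightarrow> real^2 \<Rightarrow> real^2 \<Rightarrow> real" where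
  "scoord c p q x = (1 / (p \<bullet> rot90 q)) *\<^sub>R rot90 q \<bullet> (x - c)"

definition wcoord :: "real^2 \<Rightarrow> real^2 \<Rightarrow> real^2 \<Rightarrow> real^2 \<Rightarrow> real" where
  "wcoord c p q x = (- 1 / (p \<bullet> rot90 q)) *\<^sub>R rot90 p \<bullet> (x - c)"

text \<open>The open triangle with vertices \<open>c\<close>, \<open>c + p\<close>,
  \<open>c + p + q\<close>. The ray from \<open>c\<close> to the edge point with parameter t is the
  line w = t s, hence the condition that \<open>wcoord\<close> lies between 0 and
  \<open>scoord\<close>.\<close>

definition cone_triangle :: "real^2 \<Rightarrow> real^2 \<Rightarrow> real^2 \<Rightarrow> (real^2) set" where
  "cone_triangle c p q = {x. 0 < wcoord c p q x \<and> wcoord c p q x < scoord c p q x \<and> scoord c p q x < 1}"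

lemma coords_of_point:
  assumes "p \<bullet> rot90 q \<noteq> 0"
  shows "scoord c p q (c + s *\<^sub>R p + t *\<^sub>R q) = s" "wcoord c p q (c + s *\<^sub>R p + t *\<^sub>R q) = t"
proof -
  have 0: "rot90 q \<bullet> q = 0" "rot90 p \<bullet> p = 0" "rot90 q \<bullet> p = p \<bullet> rot90 q" "rot90 p \<bullet> q = - (p \<bullet> rot90 q)"
    by (simp_all add: inner_real2)
  have e: "c + s *\<^sub>R p + t *\<^sub>R q - c = s *\<^sub>R p + t *\<^sub>R q" by simp
  show "scoord c p q (c + s *\<^sub>R p + t *\<^sub>R q) = s" "wcoord c p q (c + s *\<^sub>R p + t *\<^sub>R q) = t"
    unfolding scoord_def wcoord_def e using assms by (simp_all add: inner_add_right 0)
qed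

lemma point_of_coords:
  assumes "p \<bullet> rot90 q \<noteq> 0"
  shows "x = c + scoord c p q x *\<^sub>R p + wcoord c p q x *\<^sub>R q"
proof -
  define \<delta> where "\<delta> = p \<bullet> rot90 q"
  define y where "y = x - c"
  have \<delta>': "p $ 1 * q $ 2 - p $ 2 * q $ 1 = \<delta>" by (simp add: \<delta>_def inner_real2)
  have "\<delta> *\<^sub>R (scoord c p q x *\<^sub>R p + wcoord c p q x *\<^sub>R q) = (rot90 q \<bullet> y) *\<^sub>R p - (rot90 p \<bullet> y) *\<^sub>R q"
    using assms by (simp add: scoord_def wcoord_def \<delta>_def[symmetric] y_def[symmetric] scaleR_add_right scaleR_diff_right)
  also have "\<dots> = \<delta> *\<^sub>R y"
    by (simp add: vec_eq_iff forall_2 inner_real2 \<delta>'[symmetric] algebra_simps)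
  finally have "scoord c p q x *\<^sub>R p + wcoord c p q x *\<^sub>R q = y" using assms by (simp add: \<delta>_def)
  then show ?thesis by (simp add: y_def algebra_simps)
qed

lemma continuous_on_coords: "continuous_on UNIV (scoord c p q)" "continuous_on UNIV (wcoord c p q)"
  unfolding scoord_def wcoord_def by (intro continuous_intros)+

lemma open_cone_triangle: "open (cone_triangle c p q)"
  unfolding cone_triangle_def
  by (intro open_Collect_conj open_Collect_less continuous_on_const continuous_on_coords)

text \<open>The one-dimensional estimate is put into extended nonnegative integrals because it is
  then integrated over further parameters, where Tonelli's theorem interchanges the integrals. The
  two endpoints form a null set.\<close>

lemma ennreal_FTC_le:
  fixes K k f :: "real \<Rightarrow> real"
  assumes K: "\<And>s. (K has_real_derivative k s) (at s)" and kc: "continuous_on UNIV k" and fc: "continuous_on UNIV f"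
    and le: "\<And>s. 0 \<le> s \<Longrightarrow> s \<le> 1 \<Longrightarrow> k s \<le> f s" and nn: "\<And>s. 0 \<le> s \<Longrightarrow> 0 \<le> f s"
  shows "ennreal (K 1 - K 0) \<le> (\<integral>\<^sup>+s. indicator {0<..<1} s * ennreal (f s) \<partial>lborel)"
proof -
  have ki: "integrable lborel (\<lambda>s. k s * indicator {0..1} s)"
    using borel_integrable_atLeastAtMost'[OF continuous_on_subset[OF kc], of 0 1] by (simp add: set_integrable_def mult.commute)
  have fi: "integrable lborel (\<lambda>s. f s * indicator {0..1} s)"
    using borel_integrable_atLeastAtMost'[OF continuous_on_subset[OF fc], of 0 1] by (simp add: set_integrable_def mult.commute)
  have "K 1 - K 0 = (\<integral>s. k s * indicator {0..1} s \<partial>lborel)"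
    using integral_FTC_Icc_real[of 0 1 K k] K kc by (simp add: continuous_on_eq_continuous_at)
  also have "\<dots> \<le> (\<integral>s. f s * indicator {0..1} s \<partial>lborel)"
    by (rule integral_mono[OF ki fi]) (auto simp: indicator_def le)
  finally have "ennreal (K 1 - K 0) \<le> ennreal (\<integral>s. f s * indicator {0..1} s \<partial>lborel)" by (rule ennreal_leI)
  also have "\<dots> = (\<integral>\<^sup>+s. ennreal (f s * indicator {0..1} s) \<partial>lborel)"
    by (rule nn_integral_eq_integral[OF fi, symmetric]) (auto simp: indicator_def nn)
  also have "\<dots> = (\<integral>\<^sup>+s. indicator {0<..<1} s * ennreal (f s) \<partial>lborel)"
  proof (rule nn_integral_cong_AE)
    have "AE s in lborel. s \<noteq> (0::real)" "AE s in lborel. s \<noteq> (1::real)" by (rule AE_lborel_singleton)+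
    then show "AE s in lborel. ennreal (f s * indicator {0..1} s) = indicator {0<..<1} s * ennreal (f s)"
      by eventually_elim (auto simp: indicator_def)
  qed
  finally show ?thesis .
qed

text \<open>Fundamental theorem for the square of \<open>\<zeta>\<close> multiplied by
  \<open>s\<^sup>2\<close>. The weight removes the value at \<open>c\<close>, and its derivative
  leaves a factor \<open>s\<close>, which is the Jacobian of the radial coordinates used next. The
  constant 3 is 2 from differentiating the weight plus 1 from splitting the mixed product.\<close>

lemma segment_trace:
  fixes \<zeta> :: "real^2 \<Rightarrow> real"
  assumes \<zeta>: "has_grad \<zeta> g" and v: "norm v \<le> h"
  shows "ennreal ((\<zeta> (c + v))\<^sup>2) \<le> (\<integral>\<^sup>+s. indicator {0<..<1} s * ennreal (s * (3 * (\<zeta> (c + s *\<^sub>R v))\<^sup>2 + h\<^sup>2 * (norm (g (c + s *\<^sub>R v)))\<^sup>2)) \<partial>lborel)"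
proof -
  define f where "f = (\<lambda>x. 3 * (\<zeta> x)\<^sup>2 + h\<^sup>2 * (norm (g x))\<^sup>2)"
  define z where "z = (\<lambda>s. \<zeta> (c + s *\<^sub>R v))"
  define z' where "z' = (\<lambda>s. g (c + s *\<^sub>R v) \<bullet> v)"
  define k where "k = (\<lambda>s. 2 * s * (z s)\<^sup>2 + s\<^sup>2 * (2 * z s * z' s))"
  have zd: "(z has_real_derivative z' s) (at s)" for s
  proof -
    have "((\<lambda>s. c + s *\<^sub>R v) has_derivative (\<lambda>t. t *\<^sub>R v)) (at s)" by (auto intro!: derivative_eq_intros)
    from has_derivative_compose[OF this has_grad_derivative[OF \<zeta>]]
    show ?thesis unfolding z_def z'_def has_field_derivative_def by (simp add: mult.commute[of _ "_ \<bullet> _"])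
  qed
  have zc: "continuous_on UNIV z" "continuous_on UNIV z'"
    unfolding z_def z'_def
    by (intro continuous_intros continuous_on_compose2[OF has_grad_continuous_on[OF \<zeta>]] continuous_on_compose2[OF continuous_on_grad[OF \<zeta>]]; simp)+
  have kd: "((\<lambda>s. s\<^sup>2 * (z s)\<^sup>2) has_real_derivative k s) (at s)" for s
    unfolding k_def by (auto intro!: derivative_eq_intros zd simp: power2_eq_square algebra_simps)
  have kc: "continuous_on UNIV k" unfolding k_def by (intro continuous_intros zc)
  have fc: "continuous_on UNIV (\<lambda>s. s * f (c + s *\<^sub>R v))"
    unfolding f_def by (intro continuous_intros continuous_on_compose2[OF has_grad_continuous_on[OF \<zeta>]] continuous_on_compose2[OF continuous_on_grad[OF \<zeta>]]; simp)
  have kf: "k s \<le> s * f (c + s *\<^sub>R v)" if s: "0 \<le> s" "s \<le> 1" for s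
  proof -
    have "\<bar>z' s\<bar> \<le> norm (g (c + s *\<^sub>R v)) * norm v" unfolding z'_def by (rule Cauchy_Schwarz_ineq2)
    also have "\<dots> \<le> norm (g (c + s *\<^sub>R v)) * h" by (rule mult_left_mono[OF v]) simp
    finally have "\<bar>z' s\<bar>\<^sup>2 \<le> (norm (g (c + s *\<^sub>R v)) * h)\<^sup>2" by (rule power_mono) simp
    then have z2: "(z' s)\<^sup>2 \<le> h\<^sup>2 * (norm (g (c + s *\<^sub>R v)))\<^sup>2" by (simp add: power_mult_distrib mult.commute)
    have "2 * z s * (s * z' s) \<le> (z s)\<^sup>2 + (s * z' s)\<^sup>2" by (rule sum_squares_bound)
    also have "(s * z' s)\<^sup>2 \<le> (z' s)\<^sup>2"
      using s by (simp add: power_mult_distrib mult_left_le_one_le power_le_one)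
    finally have "2 * z s * (s * z' s) \<le> (z s)\<^sup>2 + h\<^sup>2 * (norm (g (c + s *\<^sub>R v)))\<^sup>2" using z2 by simp
    then have "s * (2 * z s * (s * z' s)) \<le> s * ((z s)\<^sup>2 + h\<^sup>2 * (norm (g (c + s *\<^sub>R v)))\<^sup>2)" using s by (intro mult_left_mono) auto
    then show ?thesis unfolding k_def f_def z_def[symmetric] by (simp add: algebra_simps power2_eq_square z_def)
  qed
  have "ennreal (1\<^sup>2 * (z 1)\<^sup>2 - 0\<^sup>2 * (z 0)\<^sup>2) \<le> (\<integral>\<^sup>+s. indicator {0<..<1} s * ennreal (s * f (c + s *\<^sub>R v)) \<partial>lborel)"
    by (rule ennreal_FTC_le[OF kd kc fc kf]) (auto simp: f_def)
  then show ?thesis by (simp add: f_def z_def)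
qed

text \<open>Integrating \<open>segment_trace\<close> over the edge parameter sweeps out the triangle
  by the segments from \<open>c\<close> to the edge.\<close>

lemma trace_triangle:
  fixes \<zeta> :: "real^2 \<Rightarrow> real"
  assumes \<zeta>: "has_grad \<zeta> g" and \<delta>: "\<delta> = p \<bullet> rot90 q" "\<delta> \<noteq> 0"
    and h: "\<And>t. 0 \<le> t \<Longrightarrow> t \<le> 1 \<Longrightarrow> norm (p + t *\<^sub>R q) \<le> h"
  shows "ennreal \<bar>\<delta>\<bar> * (\<integral>\<^sup>+t. indicator {0<..<1} t * ennreal ((\<zeta> (c + p + t *\<^sub>R q))\<^sup>2) \<partial>lborel)
    \<le> (\<integral>\<^sup>+x. indicator (cone_triangle c p q) x * ennreal (3 * (\<zeta> x)\<^sup>2 + h\<^sup>2 * (norm (g x))\<^sup>2) \<partial>lborel)"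
proof -
  define f where "f = (\<lambda>x. 3 * (\<zeta> x)\<^sup>2 + h\<^sup>2 * (norm (g x))\<^sup>2)"
  have f0: "f x \<ge> 0" for x by (simp add: f_def)
  have fc: "continuous_on UNIV f"
    unfolding f_def by (intro continuous_intros has_grad_continuous_on[OF \<zeta>] continuous_on_grad[OF \<zeta>])
  have fm[measurable]: "f \<in> borel_measurable borel" by (rule borel_continuous[OF fc])
  have T[measurable]: "cone_triangle c p q \<in> sets borel" using open_cone_triangle by auto
  let ?t = "\<lambda>s t::real. indicator {0<..<1} t * (indicator {0<..<1} s * ennreal (s * f (c + s *\<^sub>R (p + t *\<^sub>R q))))"
  have "(\<integral>\<^sup>+t. indicator {0<..<1} t * ennreal ((\<zeta> (c + p + t *\<^sub>R q))\<^sup>2) \<partial>lborel) \<le> (\<integral>\<^sup>+t. \<integral>\<^sup>+s. ?t s t \<partial>lborel \<partial>lborel)"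
  proof (rule nn_integral_mono)
    fix t :: real
    show "indicator {0<..<1} t * ennreal ((\<zeta> (c + p + t *\<^sub>R q))\<^sup>2) \<le> (\<integral>\<^sup>+s. ?t s t \<partial>lborel)"
    proof (cases "t \<in> {0<..<1}")
      case True
      then have "norm (p + t *\<^sub>R q) \<le> h" using h by auto
      from segment_trace[OF \<zeta> this, of c] True show ?thesis by (simp add: f_def add.assoc)
    qed simp
  qed
  also have "\<dots> = (\<integral>\<^sup>+s. \<integral>\<^sup>+t. ?t s t \<partial>lborel \<partial>lborel)"
    by (rule lborel_pair.Fubini') measurable
  also have "\<dots> = (\<integral>\<^sup>+s. \<integral>\<^sup>+t. indicator (cone_triangle c p q) (c + s *\<^sub>R p + t *\<^sub>R q) * ennreal (f (c + s *\<^sub>R p + t *\<^sub>R q)) \<partial>lborel \<partial>lborel)"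
  proof (rule nn_integral_cong)
    fix s :: real
    show "(\<integral>\<^sup>+t. ?t s t \<partial>lborel) = (\<integral>\<^sup>+t. indicator (cone_triangle c p q) (c + s *\<^sub>R p + t *\<^sub>R q) * ennreal (f (c + s *\<^sub>R p + t *\<^sub>R q)) \<partial>lborel)"
    proof (cases "s \<in> {0<..<1}")
      case True
      then have s: "s > 0" "s < 1" by auto
      let ?H = "\<lambda>w. indicator {0<..<s} w * ennreal (f (c + s *\<^sub>R p + w *\<^sub>R q))"
      \<comment> \<open>The substitution w = s t turns the slanted parameter into the coordinate
        along \<open>q\<close>; its Jacobian \<open>s\<close> is the weight produced by
        \<open>segment_trace\<close>.\<close>
      have "(\<integral>\<^sup>+w. ?H w \<partial>lborel) = ennreal \<bar>s\<bar> * (\<integral>\<^sup>+t. ?H (0 + s * t) \<partial>lborel)"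
        by (rule nn_integral_real_affine) (use s in simp_all)
      also have "\<dots> = (\<integral>\<^sup>+t. ennreal s * ?H (0 + s * t) \<partial>lborel)"
        using s by (simp add: nn_integral_cmult)
      also have "\<dots> = (\<integral>\<^sup>+t. ?t s t \<partial>lborel)"
      proof (rule nn_integral_cong)
        fix t :: real
        have i: "indicator {0<..<s} (0 + s * t) = (indicator {0<..<1} t :: ennreal)"
          using s by (auto simp: indicator_def zero_less_mult_iff)
        show "ennreal s * ?H (0 + s * t) = ?t s t"
          unfolding i using s f0 by (auto simp: ennreal_mult' scaleR_add_right add.assoc indicator_def)
      qed
      finally have "(\<integral>\<^sup>+t. ?t s t \<partial>lborel) = (\<integral>\<^sup>+w. ?H w \<partial>lborel)" by simp
      also have "\<dots> = (\<integral>\<^sup>+t. indicator (cone_triangle c p q) (c + s *\<^sub>R p + t *\<^sub>R q) * ennreal (f (c + s *\<^sub>R p + t *\<^sub>R q)) \<partial>lborel)"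
        using s \<delta> coords_of_point[of p q c] by (intro nn_integral_cong) (auto simp: indicator_def cone_triangle_def)
      finally show ?thesis .
    next
      case False
      have "c + s *\<^sub>R p + t *\<^sub>R q \<notin> cone_triangle c p q" for t
        using False \<delta> coords_of_point[of p q c] by (auto simp: cone_triangle_def)
      then show ?thesis using False by simp
    qed
  qed
  finally have "(\<integral>\<^sup>+t. indicator {0<..<1} t * ennreal ((\<zeta> (c + p + t *\<^sub>R q))\<^sup>2) \<partial>lborel)
     \<le> (\<integral>\<^sup>+s. \<integral>\<^sup>+t. indicator (cone_triangle c p q) (c + s *\<^sub>R p + t *\<^sub>R q) * ennreal (f (c + s *\<^sub>R p + t *\<^sub>R q)) \<partial>lborel \<partial>lborel)" .
  note le = mult_left_mono[OF this, of "ennreal \<bar>\<delta>\<bar>"]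
  have e: "(\<integral>\<^sup>+x. indicator (cone_triangle c p q) x * ennreal (f x) \<partial>lborel) =
    ennreal \<bar>\<delta>\<bar> * (\<integral>\<^sup>+s. \<integral>\<^sup>+t. indicator (cone_triangle c p q) (c + s *\<^sub>R p + t *\<^sub>R q) * ennreal (f (c + s *\<^sub>R p + t *\<^sub>R q)) \<partial>lborel \<partial>lborel)"
    by (rule nn_integral_affine2[OF \<delta>]) measurable
  have "ennreal \<bar>\<delta>\<bar> * (\<integral>\<^sup>+t. indicator {0<..<1} t * ennreal ((\<zeta> (c + p + t *\<^sub>R q))\<^sup>2) \<partial>lborel)
    \<le> (\<integral>\<^sup>+x. indicator (cone_triangle c p q) x * ennreal (f x) \<partial>lborel)"
    unfolding e by (rule le) simp
  then show ?thesis unfolding f_def .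
qed

text \<open>A dilation by \<open>s\<close> has Jacobian \<open>s\<^sup>2\<close>, and its inverse is
  at most 4 for \<open>s\<close> at least 1/2. In \<open>poincare\<close> at least one of
  \<open>s\<close> and \<open>1 - s\<close> satisfies this.\<close>

lemma nn_integral_shrink:
  fixes G :: "real^2 \<Rightarrow> ennreal"
  assumes [measurable]: "G \<in> borel_measurable borel" "S \<in> sets borel" "F \<in> sets borel"
    and s: "s \<ge> 1/2" and sub: "\<And>x. x \<in> S \<Longrightarrow> a + s *\<^sub>R x \<in> F"
  shows "(\<integral>\<^sup>+x. indicator S x * G (a + s *\<^sub>R x) \<partial>lborel) \<le> 4 * (\<integral>\<^sup>+z. indicator F z * G z \<partial>lborel)"
proof -
  let ?T = "\<lambda>y::real^2. a + s *\<^sub>R y"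
  have [measurable]: "?T \<in> borel \<rightarrow>\<^sub>M borel" by (rule borel_continuous) (intro continuous_intros)
  have "(\<integral>\<^sup>+z. indicator F z * G z \<partial>lborel) = (\<integral>\<^sup>+z. indicator F z * G z \<partial>density (distr lborel borel ?T) (\<lambda>_. ennreal (s ^ 2)))"
    using lborel_affine[of s a] s by (simp add: ennreal_power)
  also have "\<dots> = ennreal (s\<^sup>2) * (\<integral>\<^sup>+x. indicator F (?T x) * G (?T x) \<partial>lborel)"
    by (simp add: nn_integral_density nn_integral_distr nn_integral_cmult)
  finally have e: "(\<integral>\<^sup>+z. indicator F z * G z \<partial>lborel) = ennreal (s\<^sup>2) * (\<integral>\<^sup>+x. indicator F (?T x) * G (?T x) \<partial>lborel)" .
  have "(1/2)\<^sup>2 \<le> s\<^sup>2" using s by (intro power_mono) auto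
  then have "ennreal 1 \<le> ennreal (4 * s\<^sup>2)" by (intro ennreal_leI) (simp add: power2_eq_square)
  then have s4: "1 \<le> 4 * ennreal (s\<^sup>2)" by (simp add: ennreal_mult)
  have "(\<integral>\<^sup>+x. indicator S x * G (?T x) \<partial>lborel) \<le> (\<integral>\<^sup>+x. indicator F (?T x) * G (?T x) \<partial>lborel)"
    by (intro nn_integral_mono mult_right_mono) (use sub in \<open>auto simp: indicator_def\<close>)
  also have "\<dots> = 1 * (\<integral>\<^sup>+x. indicator F (?T x) * G (?T x) \<partial>lborel)" by simp
  also have "\<dots> \<le> (4 * ennreal (s\<^sup>2)) * (\<integral>\<^sup>+x. indicator F (?T x) * G (?T x) \<partial>lborel)"
    by (rule mult_right_mono[OF s4]) simp
  also have "\<dots> = 4 * (\<integral>\<^sup>+z. indicator F z * G z \<partial>lborel)" unfolding e by (simp add: mult.assoc)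
  finally show ?thesis .
qed

lemma nn_integral_indicator_lebesgue_on:
  fixes f :: "'a::euclidean_space \<Rightarrow> real"
  assumes F: "F \<in> sets borel" and f: "f \<in> borel_measurable borel" and i: "integrable (lebesgue_on F) f" and nn: "\<And>x. 0 \<le> f x"
  shows "(\<integral>\<^sup>+x. indicator F x * ennreal (f x) \<partial>lborel) = ennreal (\<integral>x. f x \<partial>lebesgue_on F)"
proof -
  have "ennreal (\<integral>x. f x \<partial>lebesgue_on F) = (\<integral>\<^sup>+x. ennreal (f x) \<partial>lebesgue_on F)"
    by (rule nn_integral_eq_integral[OF i, symmetric]) (use nn in simp)
  also have "\<dots> = (\<integral>\<^sup>+x. ennreal (f x) * indicator F x \<partial>lebesgue)"
    by (rule nn_integral_restrict_space) (use F in simp)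
  also have "\<dots> = (\<integral>\<^sup>+x. indicator F x * ennreal (f x) \<partial>lborel)"
    by (simp add: nn_integral_completion mult.commute)
  finally show ?thesis by simp
qed

section \<open>Star-shaped domains and the Poincare inequality\<close>

text \<open>The disk radius stays a parameter, so that the estimates display their dependence on the
  quotient of diameter and radius; the value \<open>\<rho> * diameter F\<close> is inserted only in
  the final bounds.\<close>

locale star_domain =
  fixes F :: "(real^2) set" and c :: "real^2" and R :: real
  assumes opF: "open F" and bdF: "bounded F" and R_pos: "0 < R" and ball_sub: "ball c R \<subseteq> F"
    and star: "\<And>x y. x \<in> F \<Longrightarrow> y \<in> ball c R \<Longrightarrow> closed_segment x y \<subseteq> F"
begin

lemma F_meas: "F \<in> lmeasurable" "F \<in> sets lebesgue" "F \<in> sets borel"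
  using lmeasurable_open[OF bdF opF] opF by auto

lemma c_in_F: "c \<in> F"
  using ball_sub R_pos by (simp add: subset_iff)

lemma star': "x \<in> F \<Longrightarrow> y \<in> ball c R \<Longrightarrow> 0 \<le> s \<Longrightarrow> s \<le> 1 \<Longrightarrow> (1 - s) *\<^sub>R x + s *\<^sub>R y \<in> F"
  using star[of x y] by (auto simp: closed_segment_def)

text \<open>A point of the closure is replaced by a nearby point of \<open>F\<close>, and the other
  endpoint is moved so that the convex combination is unchanged. The open ball leaves room for that
  move because \<open>s\<close> is positive.\<close>

lemma closure_star:
  assumes x: "x \<in> closure F" and y: "y \<in> ball c R" and s: "0 < s" "s \<le> 1"
  shows "(1 - s) *\<^sub>R x + s *\<^sub>R y \<in> F"
proof (cases "s = 1")
  case True then show ?thesis using y ball_sub by auto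
next
  case False
  then have s': "s < 1" using s by simp
  \<comment> \<open>Shifting the first endpoint is compensated by \<open>r\<close> times the
    opposite shift of the second; \<open>e\<close> is the shift that still keeps the second endpoint
    in the ball.\<close>
  define r where "r = (1 - s) / s"
  have r: "r > 0" "s * r = 1 - s" using s s' by (auto simp: r_def)
  define e where "e = (R - dist c y) / r"
  have "e > 0" using y r by (simp add: e_def)
  then obtain x' where x': "x' \<in> F" "dist x' x < e" using x closure_approachable by blast
  define y' where "y' = y + r *\<^sub>R (x - x')"
  have "dist c y' \<le> dist c y + r * dist x' x"
  proof -
    have "dist c y' = norm ((c - y) - r *\<^sub>R (x - x'))" by (simp add: y'_def dist_norm diff_diff_eq)
    also have "\<dots> \<le> norm (c - y) + norm (r *\<^sub>R (x - x'))" by (rule norm_triangle_ineq4)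
    also have "\<dots> = dist c y + r * dist x' x" using r(1) by (simp add: dist_norm norm_minus_commute)
    finally show ?thesis .
  qed
  also have "\<dots> < dist c y + r * e" using x'(2) r by (simp add: mult_strict_left_mono)
  also have "\<dots> = R" using r by (simp add: e_def)
  finally have "y' \<in> ball c R" by simp
  from star'[OF x'(1) this, of s] s have "(1 - s) *\<^sub>R x' + s *\<^sub>R y' \<in> F" by simp
  moreover have "(1 - s) *\<^sub>R x' + s *\<^sub>R y' = (1 - s) *\<^sub>R x + s *\<^sub>R y"
  proof -
    have "s *\<^sub>R y' = s *\<^sub>R y + (1 - s) *\<^sub>R (x - x')" unfolding y'_def scaleR_add_right scaleR_scaleR r(2) ..
    then show ?thesis by (simp add: scaleR_diff_right)
  qed
  ultimately show ?thesis by simp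
qed

lemma closure_shrink:
  assumes "x \<in> closure F" "0 \<le> s" "s < 1" shows "c + s *\<^sub>R (x - c) \<in> F"
proof -
  have "(1 - (1 - s)) *\<^sub>R x + (1 - s) *\<^sub>R c \<in> F" by (rule closure_star) (use assms R_pos in auto)
  moreover have "(1 - (1 - s)) *\<^sub>R x + (1 - s) *\<^sub>R c = c + s *\<^sub>R (x - c)" by (simp add: algebra_simps)
  ultimately show ?thesis by simp
qed

abbreviation "h \<equiv> diameter F"

lemma dist_F: "x \<in> F \<Longrightarrow> y \<in> F \<Longrightarrow> dist x y \<le> h"
  using diameter_bounded_bound[OF bdF] by blast

lemma F_cball: "F \<subseteq> cball c h" "closure F \<subseteq> cball c h"
proof -
  show "F \<subseteq> cball c h" using dist_F[OF c_in_F] by auto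
  then show "closure F \<subseteq> cball c h" by (rule closure_minimal) simp
qed

lemma h_pos: "0 < h"
proof -
  have "c + (R/2) *\<^sub>R axis 1 1 \<in> F" using ball_sub R_pos by (auto simp: subset_iff dist_norm)
  from dist_F[OF c_in_F this] show ?thesis using R_pos by (simp add: dist_norm)
qed

lemma area_le: "sqrt (measure lebesgue F) \<le> h * sqrt unit_area"
proof -
  have "sqrt (measure lebesgue F) \<le> sqrt (h\<^sup>2 * unit_area)"
    using measure_le_cball2[OF F_meas(2) F_cball(1)] h_pos by simp
  then show ?thesis using h_pos by (simp add: real_sqrt_mult)
qed

text \<open>The squared difference of \<open>\<zeta>\<close> at x in \<open>F\<close> and y in the
  disk is bounded along the segment joining them, which lies in \<open>F\<close>. Integrating over
  x, y and the segment parameter bounds the average over y; some y in the disk does no worse than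
  this average, and \<open>\<zeta>\<close> at that point is the constant
  \<open>\<kappa>\<close>.\<close>

lemma poincare:
  assumes \<zeta>: "has_grad \<zeta> g"
  shows "\<exists>\<kappa>. L2_norm F (\<lambda>x. \<zeta> x - \<kappa>) \<le> 2 * h * (h / R) * L2_norm F g"
proof -
  let ?B = "ball c R"
  define f where "f = (\<lambda>x. ennreal ((norm (g x))\<^sup>2))"
  have gm[measurable]: "g \<in> borel_measurable borel" by (rule borel_continuous[OF continuous_on_grad[OF \<zeta>]])
  have \<zeta>m[measurable]: "\<zeta> \<in> borel_measurable borel" by (rule borel_continuous[OF has_grad_continuous_on[OF \<zeta>]])
  have fm[measurable]: "f \<in> borel_measurable borel" unfolding f_def by measurable
  have Fm[measurable]: "F \<in> sets borel" by (rule F_meas)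
  have Bm[measurable]: "?B \<in> sets borel" by simp
  define I where "I = (\<integral>\<^sup>+z. indicator F z * f z \<partial>lborel)"
  have gL: "in_L2 F g" by (rule in_L2_continuous[OF continuous_on_grad[OF \<zeta>] F_meas(1) bdF])
  have I: "I = ennreal ((L2_norm F g)\<^sup>2)"
    unfolding I_def f_def L2_norm_sq using gL F_meas by (intro nn_integral_indicator_lebesgue_on) (auto simp: in_L2_def)
  define mF where "mF = measure lebesgue F"
  define mB where "mB = measure lebesgue ?B"
  have eF: "emeasure lborel F = ennreal mF"
    using emeasure_eq_measure2[OF F_meas(1)] F_meas(3) by (simp add: mF_def)
  have eB: "emeasure lborel ?B = ennreal mB"
    using emeasure_eq_measure2[of ?B lebesgue] by (simp add: mB_def)
  have mB: "mB = R\<^sup>2 * unit_area" unfolding mB_def using measure_ball2[of R c] R_pos by simp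
  have mF: "mF \<le> h\<^sup>2 * unit_area" unfolding mF_def
    using measure_le_cball2[OF F_meas(2) F_cball(1)] h_pos by simp
  have mBF: "mB \<le> mF" unfolding mB_def mF_def
    by (rule measure_mono_fmeasurable) (use ball_sub F_meas in auto)
  have mBp: "mB > 0" using mB R_pos unit_area_pos by simp
  have seg: "ennreal ((\<zeta> x - \<zeta> y)\<^sup>2) \<le> ennreal (h\<^sup>2) * (\<integral>\<^sup>+s. indicator {0<..<1} s * f (y + s *\<^sub>R (x - y)) \<partial>lborel)"
    if xy: "x \<in> F" "y \<in> F" for x y
  proof -
    define v where "v = x - y"
    have v: "norm v \<le> h" using dist_F[OF xy] by (simp add: v_def dist_norm)
    define z where "z = (\<lambda>s. \<zeta> (y + s *\<^sub>R v))"
    define z' where "z' = (\<lambda>s. g (y + s *\<^sub>R v) \<bullet> v)"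
    define m where "m = z 1 - z 0"
    have zd: "(z has_real_derivative z' s) (at s)" for s
    proof -
      have "((\<lambda>s. y + s *\<^sub>R v) has_derivative (\<lambda>t. t *\<^sub>R v)) (at s)" by (auto intro!: derivative_eq_intros)
      from has_derivative_compose[OF this has_grad_derivative[OF \<zeta>]]
      show ?thesis unfolding z_def z'_def has_field_derivative_def by (simp add: mult.commute[of _ "_ \<bullet> _"])
    qed
    have gc: "continuous_on UNIV (\<lambda>s. g (y + s *\<^sub>R v))"
      by (intro continuous_intros continuous_on_compose2[OF continuous_on_grad[OF \<zeta>]]; simp)
    \<comment> \<open>The function 2 m z(s) - m^2 s increases by m^2 over [0, 1], while its
      derivative 2 m z' - m^2 is at most the square of z'. This is Cauchy-Schwarz for the segment
      integral in pointwise form.\<close>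
    have "ennreal ((2 * m * z 1 - m\<^sup>2 * 1) - (2 * m * z 0 - m\<^sup>2 * 0)) \<le> (\<integral>\<^sup>+s. indicator {0<..<1} s * ennreal (h\<^sup>2 * (norm (g (y + s *\<^sub>R v)))\<^sup>2) \<partial>lborel)"
    proof (rule ennreal_FTC_le)
      show "((\<lambda>s. 2 * m * z s - m\<^sup>2 * s) has_real_derivative (2 * m * z' s - m\<^sup>2)) (at s)" for s
        by (auto intro!: derivative_eq_intros zd)
      show "continuous_on UNIV (\<lambda>s. 2 * m * z' s - m\<^sup>2)" unfolding z'_def by (intro continuous_intros gc)
      show "continuous_on UNIV (\<lambda>s. h\<^sup>2 * (norm (g (y + s *\<^sub>R v)))\<^sup>2)" by (intro continuous_intros gc)
      fix s
      have "\<bar>z' s\<bar> \<le> norm (g (y + s *\<^sub>R v)) * norm v" unfolding z'_def by (rule Cauchy_Schwarz_ineq2)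
      also have "\<dots> \<le> norm (g (y + s *\<^sub>R v)) * h" by (rule mult_left_mono[OF v]) simp
      finally have "\<bar>z' s\<bar>\<^sup>2 \<le> (norm (g (y + s *\<^sub>R v)) * h)\<^sup>2" by (rule power_mono) simp
      moreover have "2 * m * z' s \<le> m\<^sup>2 + (z' s)\<^sup>2" by (rule sum_squares_bound)
      ultimately show "2 * m * z' s - m\<^sup>2 \<le> h\<^sup>2 * (norm (g (y + s *\<^sub>R v)))\<^sup>2" by (simp add: power_mult_distrib mult.commute)
    qed simp
    moreover have "(2 * m * z 1 - m\<^sup>2 * 1) - (2 * m * z 0 - m\<^sup>2 * 0) = (\<zeta> x - \<zeta> y)\<^sup>2"
    proof -
      have "z 1 - z 0 = \<zeta> x - \<zeta> y" by (simp add: z_def v_def)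
      then have "m = \<zeta> x - \<zeta> y" by (simp add: m_def)
      moreover have "(2 * m * z 1 - m\<^sup>2 * 1) - (2 * m * z 0 - m\<^sup>2 * 0) = m\<^sup>2"
        by (simp add: m_def power2_eq_square algebra_simps)
      ultimately show ?thesis by simp
    qed
    moreover have "(\<integral>\<^sup>+s. indicator {0<..<1} s * ennreal (h\<^sup>2 * (norm (g (y + s *\<^sub>R v)))\<^sup>2) \<partial>lborel)
       = ennreal (h\<^sup>2) * (\<integral>\<^sup>+s. indicator {0<..<1} s * f (y + s *\<^sub>R v) \<partial>lborel)"
    proof -
      have [measurable]: "(\<lambda>s::real. y + s *\<^sub>R v) \<in> borel_measurable borel" by (rule borel_continuous) (intro continuous_intros)
      show ?thesis by (subst nn_integral_cmult[symmetric]) (auto simp: f_def ennreal_mult mult_ac)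
    qed
    ultimately show ?thesis by (simp add: v_def)
  qed
  define J where "J = (\<lambda>y. \<integral>\<^sup>+x. indicator F x * ennreal ((\<zeta> x - \<zeta> y)\<^sup>2) \<partial>lborel)"
  have Jm[measurable]: "J \<in> borel_measurable borel" unfolding J_def by measurable
  let ?k = "\<lambda>y x s::real. indicator ?B y * (indicator F x * (indicator {0<..<1} s * f (y + s *\<^sub>R (x - y))))"
  \<comment> \<open>The segment point is s x + (1 - s) y. For s at least 1/2 it is integrated over x
    first, otherwise over y first, so that the dilation never shrinks by more than 1/2. This keeps
    the bound uniform in s.\<close>
  have kb: "(\<integral>\<^sup>+y. \<integral>\<^sup>+x. ?k y x s \<partial>lborel \<partial>lborel) \<le> indicator {0<..<1} s * (4 * (I * ennreal mF))" for s :: real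
  proof (cases "s \<in> {0<..<1}")
    case False then show ?thesis by simp
  next
    case True
    then have s: "0 < s" "s < 1" by auto
    show ?thesis
    proof (cases "s \<ge> 1/2")
      case sg: True
      have "(\<integral>\<^sup>+y. \<integral>\<^sup>+x. ?k y x s \<partial>lborel \<partial>lborel) \<le> (\<integral>\<^sup>+y. indicator ?B y * (4 * I) \<partial>lborel)"
      proof (rule nn_integral_mono)
        fix y
        show "(\<integral>\<^sup>+x. ?k y x s \<partial>lborel) \<le> indicator ?B y * (4 * I)"
        proof (cases "y \<in> ?B")
          case y: True
          have "(\<integral>\<^sup>+x. ?k y x s \<partial>lborel) = (\<integral>\<^sup>+x. indicator F x * f ((1 - s) *\<^sub>R y + s *\<^sub>R x) \<partial>lborel)"
            using True y by (intro nn_integral_cong) (simp add: algebra_simps)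
          also have "\<dots> \<le> 4 * I" unfolding I_def
            by (rule nn_integral_shrink) (use sg s y star'[of _ y "1 - s"] in \<open>auto simp: add.commute\<close>)
          finally show ?thesis using y by simp
        qed simp
      qed
      also have "\<dots> = 4 * I * ennreal mB"
        by (subst nn_integral_multc) (simp_all add: eB mult.commute borel_measurable_indicator)
      also have "\<dots> \<le> 4 * I * ennreal mF" by (intro mult_left_mono ennreal_leI mBF) simp
      finally show ?thesis using True by (simp add: mult.assoc)
    next
      case sl: False
      have "(\<integral>\<^sup>+y. \<integral>\<^sup>+x. ?k y x s \<partial>lborel \<partial>lborel) = (\<integral>\<^sup>+x. \<integral>\<^sup>+y. ?k y x s \<partial>lborel \<partial>lborel)"
        by (rule lborel_pair.Fubini'[symmetric]) measurable
      also have "\<dots> \<le> (\<integral>\<^sup>+x. indicator F x * (4 * I) \<partial>lborel)"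
      proof (rule nn_integral_mono)
        fix x
        show "(\<integral>\<^sup>+y. ?k y x s \<partial>lborel) \<le> indicator F x * (4 * I)"
        proof (cases "x \<in> F")
          case x: True
          have "(\<integral>\<^sup>+y. ?k y x s \<partial>lborel) = (\<integral>\<^sup>+y. indicator ?B y * f (s *\<^sub>R x + (1 - s) *\<^sub>R y) \<partial>lborel)"
            using True x by (intro nn_integral_cong) (simp add: algebra_simps)
          also have "\<dots> \<le> 4 * I" unfolding I_def
            by (rule nn_integral_shrink) (use sl s x star'[of x _ "1 - s"] in auto)
          finally show ?thesis using x by simp
        qed simp
      qed
      also have "\<dots> = 4 * I * ennreal mF" using eF by (simp add: nn_integral_multc mult.commute)
      finally show ?thesis using True by (simp add: mult.assoc)
    qed
  qed
  have "(\<integral>\<^sup>+y. indicator ?B y * J y \<partial>lborel) \<le> (\<integral>\<^sup>+y. \<integral>\<^sup>+x. ennreal (h\<^sup>2) * (\<integral>\<^sup>+s. ?k y x s \<partial>lborel) \<partial>lborel \<partial>lborel)"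
  proof (rule nn_integral_mono)
    fix y
    show "indicator ?B y * J y \<le> (\<integral>\<^sup>+x. ennreal (h\<^sup>2) * (\<integral>\<^sup>+s. ?k y x s \<partial>lborel) \<partial>lborel)"
    proof (cases "y \<in> ?B")
      case y: True
      have "J y \<le> (\<integral>\<^sup>+x. ennreal (h\<^sup>2) * (\<integral>\<^sup>+s. ?k y x s \<partial>lborel) \<partial>lborel)"
        unfolding J_def
      proof (rule nn_integral_mono)
        fix x
        show "indicator F x * ennreal ((\<zeta> x - \<zeta> y)\<^sup>2) \<le> ennreal (h\<^sup>2) * (\<integral>\<^sup>+s. ?k y x s \<partial>lborel)"
          using seg[of x y] y ball_sub by (cases "x \<in> F") (auto simp: subset_iff)
      qed
      then show ?thesis using y by simp
    qed simp
  qed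
  also have "\<dots> = ennreal (h\<^sup>2) * (\<integral>\<^sup>+y. \<integral>\<^sup>+x. \<integral>\<^sup>+s. ?k y x s \<partial>lborel \<partial>lborel \<partial>lborel)"
    by (simp add: nn_integral_cmult)
  also have "(\<integral>\<^sup>+y. \<integral>\<^sup>+x. \<integral>\<^sup>+s. ?k y x s \<partial>lborel \<partial>lborel \<partial>lborel) = (\<integral>\<^sup>+s. \<integral>\<^sup>+y. \<integral>\<^sup>+x. ?k y x s \<partial>lborel \<partial>lborel \<partial>lborel)"
  proof -
    have "(\<integral>\<^sup>+y. \<integral>\<^sup>+x. \<integral>\<^sup>+s. ?k y x s \<partial>lborel \<partial>lborel \<partial>lborel) = (\<integral>\<^sup>+y. \<integral>\<^sup>+s. \<integral>\<^sup>+x. ?k y x s \<partial>lborel \<partial>lborel \<partial>lborel)"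
      by (intro nn_integral_cong lborel_pair.Fubini') measurable
    also have "\<dots> = (\<integral>\<^sup>+s. \<integral>\<^sup>+y. \<integral>\<^sup>+x. ?k y x s \<partial>lborel \<partial>lborel \<partial>lborel)"
      by (rule lborel_pair.Fubini') measurable
    finally show ?thesis .
  qed
  also have "\<dots> \<le> (\<integral>\<^sup>+s. indicator {0<..<1} s * (4 * (I * ennreal mF)) \<partial>(lborel :: real measure))"
    by (rule nn_integral_mono) (rule kb)
  also have "\<dots> = 4 * (I * ennreal mF)" by (simp add: nn_integral_multc)
  finally have tot: "(\<integral>\<^sup>+y. indicator ?B y * J y \<partial>lborel) \<le> ennreal (h\<^sup>2) * (4 * (I * ennreal mF))"
    by (simp add: mult_left_mono)
  define K where "K = h\<^sup>2 * 4 * (L2_norm F g)\<^sup>2 * mF / mB"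
  have K0: "K \<ge> 0" unfolding K_def using mBp mBF by simp
  have KB: "ennreal (h\<^sup>2) * (4 * (I * ennreal mF)) = ennreal K * ennreal mB"
  proof -
    have "ennreal (h\<^sup>2) * (4 * (I * ennreal mF)) = ennreal (h\<^sup>2 * (4 * ((L2_norm F g)\<^sup>2 * mF)))"
      using mBp mBF unfolding I by (simp add: ennreal_mult')
    also have "h\<^sup>2 * (4 * ((L2_norm F g)\<^sup>2 * mF)) = K * mB" using mBp by (simp add: K_def)
    finally show ?thesis using K0 mBp by (simp add: ennreal_mult')
  qed
  \<comment> \<open>\<open>K\<close> is the bound for the double integral divided by the area of the
    disk; if \<open>J\<close> exceeded it on the whole disk, the double integral would be strictly
    larger than its bound.\<close>
  have "\<exists>y\<in>?B. J y \<le> ennreal K"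
  proof (rule ccontr)
    assume "\<not> (\<exists>y\<in>?B. J y \<le> ennreal K)"
    then have gt: "ennreal K < J y" if "y \<in> ?B" for y using that by (auto simp: not_le)
    have "(\<integral>\<^sup>+y. indicator ?B y * ennreal K \<partial>lborel) < (\<integral>\<^sup>+y. indicator ?B y * J y \<partial>lborel)"
    proof (rule nn_integral_less)
      show "(\<integral>\<^sup>+y. indicator ?B y * ennreal K \<partial>lborel) \<noteq> \<infinity>"
        using eB by (simp add: nn_integral_multc ennreal_mult_eq_top_iff)
      show "AE y in lborel. indicator ?B y * ennreal K \<le> indicator ?B y * J y"
        using gt by (intro AE_I2) (auto simp: indicator_def less_imp_le)
      show "\<not> (AE y in lborel. indicator ?B y * J y \<le> indicator ?B y * ennreal K)"
      proof
        assume "AE y in lborel. indicator ?B y * J y \<le> indicator ?B y * ennreal K"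
        then have "AE y in lborel. y \<notin> ?B"
        proof eventually_elim
          case (elim y)
          show ?case
          proof
            assume y: "y \<in> ?B"
            with elim have "J y \<le> ennreal K" by simp
            with gt[OF y] show False by simp
          qed
        qed
        then have "emeasure lborel ?B = 0" by (simp add: AE_iff_null null_sets_def ball_def)
        then show False using eB mBp by simp
      qed
    qed measurable
    moreover have "(\<integral>\<^sup>+y. indicator ?B y * ennreal K \<partial>lborel) = ennreal K * ennreal mB"
      by (subst nn_integral_multc) (simp_all add: eB mult.commute)
    ultimately show False using tot KB by simp
  qed
  then obtain y where y: "J y \<le> ennreal K" by blast
  have dL: "in_L2 F (\<lambda>x. \<zeta> x - \<zeta> y)"
    by (rule in_L2_continuous[OF _ F_meas(1) bdF]) (intro continuous_intros has_grad_continuous_on[OF \<zeta>])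
  have "J y = ennreal ((L2_norm F (\<lambda>x. \<zeta> x - \<zeta> y))\<^sup>2)"
    unfolding J_def L2_norm_sq using dL F_meas nn_integral_indicator_lebesgue_on[of F "\<lambda>x. (\<zeta> x - \<zeta> y)\<^sup>2"] by (simp add: in_L2_def)
  then have le: "(L2_norm F (\<lambda>x. \<zeta> x - \<zeta> y))\<^sup>2 \<le> K" using y K0 by simp
  have "mF / mB \<le> (h / R)\<^sup>2"
    using mF mBp R_pos unit_area_pos unfolding mB by (simp add: field_simps power2_eq_square)
  then have "K \<le> h\<^sup>2 * 4 * (L2_norm F g)\<^sup>2 * (h / R)\<^sup>2"
    unfolding K_def times_divide_eq_right[symmetric] by (intro mult_left_mono) auto
  also have "\<dots> = (2 * h * (h / R) * L2_norm F g)\<^sup>2" unfolding power2_eq_square by simp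
  finally have "(L2_norm F (\<lambda>x. \<zeta> x - \<zeta> y))\<^sup>2 \<le> (2 * h * (h / R) * L2_norm F g)\<^sup>2" using le by simp
  then have "L2_norm F (\<lambda>x. \<zeta> x - \<zeta> y) \<le> 2 * h * (h / R) * L2_norm F g"
    by (rule power2_le_imp_le) (use h_pos R_pos in simp)
  then show ?thesis by blast
qed

end

section \<open>The cone triangles over the edges of a polygon\<close>

lemma frac_in_edge: "0 \<le> t \<Longrightarrow> t \<le> 1 \<Longrightarrow> a + t *\<^sub>R (b - a) \<in> closed_segment a (b :: real^2)"
  by (auto simp: closed_segment_def algebra_simps intro!: exI[of _ t])

lemma lagrange2: "(p \<bullet> rot90 q)\<^sup>2 + (p \<bullet> q)\<^sup>2 = (norm p)\<^sup>2 * (norm q)\<^sup>2"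
  unfolding power2_norm_eq_inner by (simp add: inner_real2 power2_eq_square algebra_simps)

locale star_polygon = star_domain +
  fixes vs :: "(real^2) list"
  assumes poly: "polygon vs F"
begin

abbreviation "n \<equiv> length vs"

definition "p i = edge_start vs i - c"
definition "q i = edge_end vs i - edge_start vs i"
definition "\<delta> i = p i \<bullet> rot90 (q i)"
definition "s i = scoord c (p i) (q i)"
definition "w i = wcoord c (p i) (q i)"
definition "T i = cone_triangle c (p i) (q i)"

lemma n3: "n \<ge> 3" using poly by (simp add: polygon_def)

lemma edge_frontier: "i < n \<Longrightarrow> edge vs i \<subseteq> frontier F"
  using poly by (auto simp: polygon_def)

lemma edge_closure: "i < n \<Longrightarrow> x \<in> edge vs i \<Longrightarrow> x \<in> closure F"
  using edge_frontier by (auto simp: frontier_def)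

lemma edge_not_F: "i < n \<Longrightarrow> x \<in> edge vs i \<Longrightarrow> x \<notin> F"
  using edge_frontier[of i] opF by (auto simp: frontier_def interior_open)

lemma edge_inter: "i < n \<Longrightarrow> j < n \<Longrightarrow> i \<noteq> j \<Longrightarrow> edge vs i \<inter> edge vs j \<subseteq> {edge_start vs i, edge_end vs i}"
  using poly by (auto simp: polygon_def)

lemma q_nonzero: assumes "i < n" shows "q i \<noteq> 0"
proof -
  have ne: "i \<noteq> Suc i mod n"
  proof (cases "Suc i = n")
    case True then show ?thesis using n3 by simp
  next
    case False then show ?thesis using assms by simp
  qed
  have "Suc i mod n < n" using n3 by (intro mod_less_divisor) linarith
  then have "vs ! i \<noteq> vs ! (Suc i mod n)"
    using poly assms ne by (simp add: polygon_def nth_eq_iff_index_eq)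
  then show ?thesis by (simp add: q_def edge_start_def edge_end_def)
qed

lemma edge_length_eq: "edge_length vs i = norm (q i)"
  by (simp add: edge_length_def q_def dist_norm norm_minus_commute)

lemma linepath_edge: "linepath (edge_start vs i) (edge_end vs i) t = c + p i + t *\<^sub>R q i"
  by (simp add: linepath_def p_def q_def algebra_simps)

lemma edge_point: "0 \<le> t \<Longrightarrow> t \<le> 1 \<Longrightarrow> c + p i + t *\<^sub>R q i \<in> edge vs i"
  using frac_in_edge[of t "edge_start vs i" "edge_end vs i"] by (simp add: edge_def p_def q_def)

text \<open>If the line through an edge met the disk, an edge point would lie in \<open>F\<close>.
  Either the meeting point is itself on the edge, or the endpoint nearer to it lies strictly between
  it and the other endpoint and so belongs to \<open>F\<close> by
  \<open>closure_star\<close>.\<close>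

lemma edge_line_far: assumes i: "i < n" shows "c + p i + \<tau> *\<^sub>R q i \<notin> ball c R"
proof
  assume y: "c + p i + \<tau> *\<^sub>R q i \<in> ball c R"
  have start: "c + p i \<in> edge vs i" "c + p i + q i \<in> edge vs i" using edge_point[of 0 i] edge_point[of 1 i] by auto
  consider "0 \<le> \<tau>" "\<tau> \<le> 1" | "\<tau> > 1" | "\<tau> < 0" by linarith
  then show False
  proof cases
    case 1 then show ?thesis using edge_point edge_not_F[OF i] y ball_sub by blast
  next
    case 2
    have "(1 - 1 / \<tau>) *\<^sub>R (c + p i) + (1 / \<tau>) *\<^sub>R (c + p i + \<tau> *\<^sub>R q i) \<in> F"
      by (rule closure_star[OF edge_closure[OF i start(1)] y]) (use 2 in auto)
    moreover have "(1 - 1 / \<tau>) *\<^sub>R (c + p i) + (1 / \<tau>) *\<^sub>R (c + p i + \<tau> *\<^sub>R q i) = c + p i + q i"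
      using 2 by (simp add: algebra_simps)
    ultimately show ?thesis using edge_not_F[OF i start(2)] by simp
  next
    case 3
    define a where "a = 1 / (1 - \<tau>)"
    have a: "0 < a" "a \<le> 1" "a * \<tau> = a - 1" using 3 by (auto simp: a_def field_simps)
    have "(1 - a) *\<^sub>R (c + p i + q i) + a *\<^sub>R (c + p i + \<tau> *\<^sub>R q i) \<in> F"
      by (rule closure_star[OF edge_closure[OF i start(2)] y a(1,2)])
    moreover have "(1 - a) *\<^sub>R (c + p i + q i) + a *\<^sub>R (c + p i + \<tau> *\<^sub>R q i) = c + p i"
    proof -
      have "a *\<^sub>R (c + p i + \<tau> *\<^sub>R q i) = a *\<^sub>R (c + p i) + (a - 1) *\<^sub>R q i"
        unfolding scaleR_add_right scaleR_scaleR a(3) ..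
      then show ?thesis by (simp add: algebra_simps)
    qed
    ultimately show ?thesis using edge_not_F[OF i start(1)] by simp
  qed
qed

text \<open>The absolute value of \<open>\<delta> i\<close> divided by the edge length is the
  distance of \<open>c\<close> from the line through the edge, which is at least \<open>R\<close> by
  \<open>edge_line_far\<close>. The parameter \<open>\<tau>\<close> is that of the foot of the
  perpendicular; \<open>lagrange2\<close> rewrites the squared distance.\<close>

lemma delta_ge: assumes i: "i < n" shows "R * norm (q i) \<le> \<bar>\<delta> i\<bar>"
proof -
  have q0: "norm (q i) > 0" using q_nonzero[OF i] by simp
  define \<tau> where "\<tau> = - (p i \<bullet> q i) / (norm (q i))\<^sup>2"
  have "dist (c + p i + \<tau> *\<^sub>R q i) c = norm (p i + \<tau> *\<^sub>R q i)" by (simp add: dist_norm add.assoc)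
  then have "R \<le> norm (p i + \<tau> *\<^sub>R q i)"
    using edge_line_far[OF i, of \<tau>] by (simp add: dist_commute not_less)
  then have "R\<^sup>2 \<le> (norm (p i + \<tau> *\<^sub>R q i))\<^sup>2" using R_pos by (intro power_mono) auto
  also have "\<dots> = (norm (p i))\<^sup>2 + 2 * \<tau> * (p i \<bullet> q i) + \<tau>\<^sup>2 * (norm (q i))\<^sup>2"
    unfolding power2_norm_eq_inner by (simp add: inner_add inner_commute power2_eq_square algebra_simps)
  also have "\<dots> = (norm (p i))\<^sup>2 - (p i \<bullet> q i)\<^sup>2 / (norm (q i))\<^sup>2"
    using q0 by (simp add: \<tau>_def power2_eq_square field_simps)
  finally have "R\<^sup>2 * (norm (q i))\<^sup>2 \<le> ((norm (p i))\<^sup>2 - (p i \<bullet> q i)\<^sup>2 / (norm (q i))\<^sup>2) * (norm (q i))\<^sup>2"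
    by (rule mult_right_mono) simp
  also have "\<dots> = (norm (p i))\<^sup>2 * (norm (q i))\<^sup>2 - (p i \<bullet> q i)\<^sup>2" using q0 by (simp add: left_diff_distrib)
  also have "\<dots> = (\<delta> i)\<^sup>2" using lagrange2[of "p i" "q i"] by (simp add: \<delta>_def)
  finally have "(R * norm (q i))\<^sup>2 \<le> \<bar>\<delta> i\<bar>\<^sup>2" by (simp add: power_mult_distrib)
  then show ?thesis by (rule power2_le_imp_le) simp
qed

lemma delta_nonzero: assumes "i < n" shows "\<delta> i \<noteq> 0"
proof -
  have "0 < R * norm (q i)" using R_pos q_nonzero[OF assms] by simp
  then show ?thesis using delta_ge[OF assms] by auto
qed

lemma point_eq: "i < n \<Longrightarrow> x = c + s i x *\<^sub>R p i + w i x *\<^sub>R q i"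
  using point_of_coords[of "p i" "q i" x c] delta_nonzero[of i] by (simp add: s_def w_def \<delta>_def)

lemma coords_eq:
  assumes "i < n" shows "s i (c + a *\<^sub>R p i + b *\<^sub>R q i) = a" "w i (c + a *\<^sub>R p i + b *\<^sub>R q i) = b"
  using coords_of_point[of "p i" "q i" c a b] delta_nonzero[OF assms] by (simp_all add: s_def w_def \<delta>_def)

lemma coords_edge:
  assumes "i < n" shows "s i (c + p i + t *\<^sub>R q i) = 1" "w i (c + p i + t *\<^sub>R q i) = t"
  using coords_eq[OF assms, of 1 t] by simp_all

lemma T_iff: "x \<in> T i \<longleftrightarrow> 0 < w i x \<and> w i x < s i x \<and> s i x < 1"
  by (simp add: T_def cone_triangle_def s_def w_def)

text \<open>Radial projection: \<open>y\<close> is where the ray from \<open>c\<close> through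
  \<open>x\<close> meets the edge, and \<open>s i x\<close> is the ratio in which \<open>x\<close>
  divides the segment from \<open>c\<close> to \<open>y\<close>.\<close>

lemma cone_point:
  assumes i: "i < n" and x: "0 < w i x" "w i x < s i x"
  defines "y \<equiv> c + p i + (w i x / s i x) *\<^sub>R q i"
  shows "y \<in> edge vs i" "x = c + s i x *\<^sub>R (y - c)" "y = c + (1 / s i x) *\<^sub>R (x - c)"
proof -
  show "y \<in> edge vs i" unfolding y_def by (rule edge_point) (use x in auto)
  have "s i x *\<^sub>R (y - c) = s i x *\<^sub>R p i + w i x *\<^sub>R q i"
    using x by (simp add: y_def scaleR_add_right add.assoc)
  then show 1: "x = c + s i x *\<^sub>R (y - c)" using point_eq[OF i, of x] by (simp add: add.assoc)
  have "x - c = (c + s i x *\<^sub>R (y - c)) - c" by (rule arg_cong[OF 1, of "\<lambda>z. z - c"])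
  then have "x - c = s i x *\<^sub>R (y - c)" by simp
  then have "(1 / s i x) *\<^sub>R (x - c) = y - c" using x by simp
  then show "y = c + (1 / s i x) *\<^sub>R (x - c)" by simp
qed

lemma cone_closure:
  assumes i: "i < n" and x: "0 < w i x" "w i x < s i x" and cl: "x \<in> closure F"
  shows "s i x \<le> 1"
proof (rule ccontr)
  assume "\<not> s i x \<le> 1"
  then have "c + (1 / s i x) *\<^sub>R (x - c) \<in> F" by (intro closure_shrink[OF cl]) auto
  then show False using cone_point[OF i x] edge_not_F[OF i] by simp
qed

text \<open>Each point of the triangle is a strict contraction towards \<open>c\<close> of an edge
  point, which lies in the closure of \<open>F\<close>.\<close>

lemma T_sub_F: assumes i: "i < n" shows "T i \<subseteq> F"
proof
  fix x assume "x \<in> T i"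
  then have x: "0 < w i x" "w i x < s i x" "s i x < 1" by (auto simp: T_iff)
  have "c + s i x *\<^sub>R ((c + p i + (w i x / s i x) *\<^sub>R q i) - c) \<in> F"
    by (rule closure_shrink[OF edge_closure[OF i cone_point(1)[OF i x(1,2)]]]) (use x in auto)
  then show "x \<in> F" using cone_point(2)[OF i x(1,2)] by simp
qed

text \<open>Within \<open>F\<close> the unbounded sector over edge \<open>i\<close> ends at that
  edge. A function supported in the sector, such as \<open>edge_test\<close>, is therefore supported
  in \<open>T i\<close> as far as integrals over \<open>F\<close> are concerned.\<close>

lemma cone_F:
  assumes i: "i < n" and x: "0 < w i x" "w i x < s i x" and F: "x \<in> F"
  shows "x \<in> T i"
proof -
  have "s i x \<le> 1" using cone_closure[OF i x] F closure_subset by blast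
  moreover have "s i x \<noteq> 1"
  proof
    assume "s i x = 1"
    then have "c + p i + w i x *\<^sub>R q i = x" using point_eq[OF i, of x, symmetric] by simp
    then have "x \<in> edge vs i" using edge_point[of "w i x" i] x \<open>s i x = 1\<close> by simp
    then show False using edge_not_F[OF i] F by simp
  qed
  ultimately show ?thesis using x by (simp add: T_iff)
qed

text \<open>In the sector, \<open>s i x\<close> is at most 1 on the closure and below 1 only inside
  \<open>F\<close>, so a frontier point of the sector has \<open>s i x = 1\<close> and lies on edge
  \<open>i\<close>. Two edges share only endpoints, and at an endpoint \<open>w i x\<close> is 0 or
  1.\<close>

lemma other_edge:
  assumes i: "i < n" and j: "j < n" "j \<noteq> i" and x: "x \<in> edge vs j"
  shows "\<not> (0 < w i x \<and> w i x < s i x)"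
proof
  assume *: "0 < w i x \<and> w i x < s i x"
  have "s i x \<le> 1" using cone_closure[OF i] * edge_closure[OF j(1) x] by simp
  moreover have "\<not> s i x < 1" using T_sub_F[OF i] edge_not_F[OF j(1) x] * by (auto simp: T_iff)
  ultimately have s1: "s i x = 1" by simp
  then have "c + p i + w i x *\<^sub>R q i = x" using point_eq[OF i, of x, symmetric] by simp
  then have "x \<in> edge vs i" using edge_point[of "w i x" i] * s1 by simp
  then have "x = edge_start vs i \<or> x = edge_end vs i" using edge_inter[of i j] i j x by blast
  then have "x = c + p i + 0 *\<^sub>R q i \<or> x = c + p i + 1 *\<^sub>R q i" by (simp add: p_def q_def)
  then have "w i x = 0 \<or> w i x = 1" using coords_edge[OF i] by metis
  then show False using * s1 by simp
qed

text \<open>A common point is projected radially to both edges. If the projections differ, the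
  nearer one is a strict contraction of the other and would lie in \<open>F\<close>; if they agree,
  \<open>other_edge\<close> is violated.\<close>

lemma T_disjoint: assumes i: "i < n" and j: "j < n" "j \<noteq> i" shows "T i \<inter> T j = {}"
proof -
  have False if i: "i < n" and j: "j < n" "j \<noteq> i" and x: "x \<in> T i" "x \<in> T j" and le: "s i x \<le> s j x" for i j x
  proof -
    have xi: "0 < w i x" "w i x < s i x" and xj: "0 < w j x" "w j x < s j x" using x by (auto simp: T_iff)
    define y where "y = c + p i + (w i x / s i x) *\<^sub>R q i"
    define z where "z = c + p j + (w j x / s j x) *\<^sub>R q j"
    have y: "y \<in> edge vs i" "x = c + s i x *\<^sub>R (y - c)" unfolding y_def by (rule cone_point[OF i xi])+
    have z: "z \<in> edge vs j" "z = c + (1 / s j x) *\<^sub>R (x - c)"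
      unfolding z_def by (rule cone_point(1)[OF j(1) xj] cone_point(3)[OF j(1) xj])+
    have zy: "z = c + (s i x / s j x) *\<^sub>R (y - c)"
    proof -
      have "x - c = (c + s i x *\<^sub>R (y - c)) - c" by (rule arg_cong[OF y(2), of "\<lambda>z. z - c"])
      then have "x - c = s i x *\<^sub>R (y - c)" by simp
      then show ?thesis using z(2) by simp
    qed
    show False
    proof (cases "s i x = s j x")
      case True
      then have "z = y" using zy xj by simp
      then have "y \<in> edge vs j" using z(1) by simp
      from other_edge[OF i j this] show False
        using coords_edge[OF i, of "w i x / s i x"] xi by (simp add: y_def)
    next
      case False
      then have "s i x / s j x < 1" "0 \<le> s i x / s j x" using le xi xj by (auto simp: field_simps)
      then have "z \<in> F" unfolding zy by (intro closure_shrink edge_closure[OF i y(1)])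
      then show False using edge_not_F[OF j(1) z(1)] by simp
    qed
  qed
  from this[OF i j] this[OF j(1) i] j(2) show ?thesis by (metis disjoint_iff linear)
qed

lemma T_meas: "T i \<in> sets borel" using open_cone_triangle by (auto simp: T_def)

lemma indicator_T_meas: "indicator (T i) \<in> borel_measurable (lebesgue_on F)"
  using T_meas[of i] by (intro measurable_restrict_space1 borel_measurable_indicator) simp

lemma sum_indicator_T: "(\<Sum>i<n. indicator (T i) x) \<le> (1::real)"
proof -
  have "disjoint_family_on T {..<n}"
    unfolding disjoint_family_on_def using T_disjoint by blast
  then have "(\<Sum>i<n. indicator (T i) x) = (indicator (\<Union>i<n. T i) x :: real)"
    by (intro indicator_UN_disjoint[symmetric]) auto
  then show ?thesis by (simp add: indicator_def)
qed

lemma sum_T_integral: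
  fixes f :: "real^2 \<Rightarrow> real"
  assumes f: "integrable (lebesgue_on F) f" and nn: "\<And>x. 0 \<le> f x"
  shows "(\<Sum>i<n. \<integral>x. indicator (T i) x * f x \<partial>lebesgue_on F) \<le> (\<integral>x. f x \<partial>lebesgue_on F)"
proof -
  have i: "integrable (lebesgue_on F) (\<lambda>x. indicator (T i) x * f x)" for i
  proof (rule Bochner_Integration.integrable_bound[OF f])
    show "(\<lambda>x. indicator (T i) x * f x) \<in> borel_measurable (lebesgue_on F)"
      using f by (intro borel_measurable_times indicator_T_meas) simp
  qed (auto simp: indicator_def)
  have "(\<Sum>i<n. \<integral>x. indicator (T i) x * f x \<partial>lebesgue_on F) = (\<integral>x. (\<Sum>i<n. indicator (T i) x * f x) \<partial>lebesgue_on F)"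
    by (rule Bochner_Integration.integral_sum[symmetric]) (rule i)
  also have "\<dots> \<le> (\<integral>x. f x \<partial>lebesgue_on F)"
  proof (rule integral_mono)
    show "(\<Sum>i<n. indicator (T i) x * f x) \<le> f x" for x
      using mult_right_mono[OF sum_indicator_T[of x] nn[of x]] by (simp add: sum_distrib_right)
    show "integrable (lebesgue_on F) (\<lambda>x. \<Sum>i<n. indicator (T i) x * f x)"
      by (rule Bochner_Integration.integrable_sum) (rule i)
  qed (rule f)
  finally show ?thesis .
qed

lemma norm_edge_point_le: assumes "i < n" "0 \<le> t" "t \<le> 1" shows "norm (p i + t *\<^sub>R q i) \<le> h"
proof -
  have "c + p i + t *\<^sub>R q i \<in> closure F" using edge_closure[OF assms(1) edge_point] assms by simp
  then have "dist (c + p i + t *\<^sub>R q i) c \<le> h" using F_cball(2) by (auto simp: dist_commute)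
  then show ?thesis by (simp add: dist_norm add.assoc)
qed

lemma edge_inner_nonneg: "0 \<le> edge_inner vs i f f"
  unfolding edge_inner_def edge_length_def L2_inner_self by simp

text \<open>\<open>delta_ge\<close> replaces the determinant in \<open>trace_triangle\<close> by
  \<open>R\<close> times the edge length, and the edge length is the arc-length factor in
  \<open>edge_inner\<close>. The constant no longer involves the individual edge.\<close>

lemma edge_trace:
  assumes i: "i < n" and \<zeta>: "has_grad \<zeta> g"
  shows "R * edge_inner vs i \<zeta> \<zeta> \<le> (\<integral>x. indicator (T i) x * (3 * (\<zeta> x)\<^sup>2 + h\<^sup>2 * (norm (g x))\<^sup>2) \<partial>lebesgue_on F)"
proof -
  let ?f = "\<lambda>x. 3 * (\<zeta> x)\<^sup>2 + h\<^sup>2 * (norm (g x))\<^sup>2"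
  let ?u = "\<lambda>t. (\<zeta> (c + p i + t *\<^sub>R q i))\<^sup>2"
  define X where "X = (\<integral>t. ?u t \<partial>lebesgue_on {0..1})"
  define Y where "Y = (\<integral>x. indicator (T i) x * ?f x \<partial>lebesgue_on F)"
  have uc: "continuous_on UNIV (\<lambda>t. \<zeta> (c + p i + t *\<^sub>R q i))"
    by (intro continuous_intros continuous_on_compose2[OF has_grad_continuous_on[OF \<zeta>]]; simp)
  have "in_L2 {0..1::real} (\<lambda>t. \<zeta> (c + p i + t *\<^sub>R q i))" by (rule in_L2_continuous[OF uc]) auto
  then have ui: "integrable (lebesgue_on {0..1}) ?u" by (simp add: in_L2_def)
  have um: "?u \<in> borel_measurable borel" by (intro borel_continuous continuous_intros uc)
  have X0: "X \<ge> 0" unfolding X_def by (rule Bochner_Integration.integral_nonneg) simp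
  have "ennreal X = (\<integral>\<^sup>+t. indicator {0..1} t * ennreal (?u t) \<partial>lborel)"
    unfolding X_def by (rule nn_integral_indicator_lebesgue_on[symmetric]) (use um ui in auto)
  also have "\<dots> = (\<integral>\<^sup>+t. indicator {0<..<1} t * ennreal (?u t) \<partial>lborel)"
  proof (rule nn_integral_cong_AE)
    have "AE s in lborel. s \<noteq> (0::real)" "AE s in lborel. s \<noteq> (1::real)" by (rule AE_lborel_singleton)+
    then show "AE t in lborel. indicator {0..1} t * ennreal (?u t) = indicator {0<..<1} t * ennreal (?u t)"
      by eventually_elim (auto simp: indicator_def)
  qed
  finally have eX: "ennreal X = (\<integral>\<^sup>+t. indicator {0<..<1} t * ennreal (?u t) \<partial>lborel)" .
  have fL: "in_L2 F \<zeta>" "in_L2 F g"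
    by (rule in_L2_continuous[OF has_grad_continuous_on[OF \<zeta>] F_meas(1) bdF] in_L2_continuous[OF continuous_on_grad[OF \<zeta>] F_meas(1) bdF])+
  have fi: "integrable (lebesgue_on F) ?f" using fL by (simp add: in_L2_def)
  have im: "indicator (T i) \<in> borel_measurable (borel :: (real^2) measure)" using T_meas by simp
  have fm: "?f \<in> borel_measurable borel" by (intro borel_continuous continuous_intros has_grad_continuous_on[OF \<zeta>] continuous_on_grad[OF \<zeta>])
  have fTi: "integrable (lebesgue_on F) (\<lambda>x. indicator (T i) x * ?f x)"
  proof (rule Bochner_Integration.integrable_bound[OF fi])
    show "(\<lambda>x. indicator (T i) x * ?f x) \<in> borel_measurable (lebesgue_on F)"
      by (rule borel_measurable_times[OF indicator_T_meas borel_measurable_integrable[OF fi]])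
  qed (auto simp: indicator_def)
  have "ennreal \<bar>\<delta> i\<bar> * ennreal X \<le> (\<integral>\<^sup>+x. indicator (T i) x * ennreal (?f x) \<partial>lborel)"
    unfolding eX T_def by (rule trace_triangle[OF \<zeta> \<delta>_def delta_nonzero[OF i]]) (rule norm_edge_point_le[OF i])
  also have "\<dots> = (\<integral>\<^sup>+x. indicator F x * ennreal (indicator (T i) x * ?f x) \<partial>lborel)"
    by (rule nn_integral_cong) (use T_sub_F[OF i] in \<open>auto simp: indicator_def\<close>)
  also have "\<dots> = ennreal Y"
    unfolding Y_def
    by (rule nn_integral_indicator_lebesgue_on[OF F_meas(3) borel_measurable_times[OF im fm] fTi]) simp
  finally have "ennreal (\<bar>\<delta> i\<bar> * X) \<le> ennreal Y" by (simp add: ennreal_mult')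
  moreover have "0 \<le> Y" unfolding Y_def by (rule Bochner_Integration.integral_nonneg) simp
  ultimately have "\<bar>\<delta> i\<bar> * X \<le> Y" by simp
  moreover have "R * norm (q i) * X \<le> \<bar>\<delta> i\<bar> * X" by (rule mult_right_mono[OF delta_ge[OF i] X0])
  moreover have "edge_inner vs i \<zeta> \<zeta> = norm (q i) * X"
    by (simp add: edge_inner_def edge_length_eq X_def L2_inner_def comp_def linepath_edge power2_eq_square)
  ultimately show ?thesis by (simp add: Y_def mult.assoc)
qed

lemma edge_trace_sum:
  assumes \<zeta>: "has_grad \<zeta> g"
  shows "R * (\<Sum>i<n. edge_inner vs i \<zeta> \<zeta>) \<le> 3 * (L2_norm F \<zeta>)\<^sup>2 + h\<^sup>2 * (L2_norm F g)\<^sup>2"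
proof -
  have fL: "in_L2 F \<zeta>" "in_L2 F g"
    by (rule in_L2_continuous[OF has_grad_continuous_on[OF \<zeta>] F_meas(1) bdF] in_L2_continuous[OF continuous_on_grad[OF \<zeta>] F_meas(1) bdF])+
  have "R * (\<Sum>i<n. edge_inner vs i \<zeta> \<zeta>) \<le> (\<Sum>i<n. \<integral>x. indicator (T i) x * (3 * (\<zeta> x)\<^sup>2 + h\<^sup>2 * (norm (g x))\<^sup>2) \<partial>lebesgue_on F)"
    unfolding sum_distrib_left by (rule sum_mono) (use edge_trace[OF _ \<zeta>] in simp)
  also have "\<dots> \<le> (\<integral>x. 3 * (\<zeta> x)\<^sup>2 + h\<^sup>2 * (norm (g x))\<^sup>2 \<partial>lebesgue_on F)"
    by (rule sum_T_integral) (use fL in \<open>auto simp: in_L2_def\<close>)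
  also have "\<dots> = 3 * (L2_norm F \<zeta>)\<^sup>2 + h\<^sup>2 * (L2_norm F g)\<^sup>2"
    using fL by (simp add: L2_norm_sq in_L2_def)
  finally show ?thesis .
qed

text \<open>\<open>has_tangential_trace\<close> with its existentially hidden weak rotation exposed
  as \<open>r\<close>, and with test functions accompanied by their gradients.\<close>

definition green :: "(real^2 \<Rightarrow> real^2) \<Rightarrow> (real^2 \<Rightarrow> real) \<Rightarrow> (nat \<Rightarrow> real^2 \<Rightarrow> real) \<Rightarrow> bool" where
  "green v r g \<longleftrightarrow> has_weak_rot F v r \<and> (\<forall>i<n. edge_L2 vs i (g i)) \<and>
    (\<forall>\<phi> \<phi>'. has_grad \<phi> \<phi>' \<longrightarrow> L2_inner F r \<phi> = L2_inner F v (\<lambda>x. rot90 (\<phi>' x)) + (\<Sum>i<n. edge_inner vs i (g i) \<phi>))"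

lemma trace_green: assumes "has_tangential_trace vs F v g" shows "\<exists>r. green v r g"
proof -
  from assms obtain r where r: "has_weak_rot F v r"
    and G: "\<And>\<phi>. C1_fun \<phi> \<Longrightarrow> (\<integral>x. r x * \<phi> x \<partial>lebesgue_on F) =
          (\<integral>x. v x $ 1 * pderiv_at 2 \<phi> x - v x $ 2 * pderiv_at 1 \<phi> x \<partial>lebesgue_on F)
          + (\<Sum>i<length vs. edge_inner vs i (g i) \<phi>)"
    by (auto simp: has_tangential_trace_def)
  have "green v r g" unfolding green_def
  proof (intro conjI r allI impI)
    show "edge_L2 vs i (g i)" if "i < n" for i using assms that by (simp add: has_tangential_trace_def)
    fix \<phi> \<phi>' assume \<phi>: "has_grad \<phi> \<phi>'"
    show "L2_inner F r \<phi> = L2_inner F v (\<lambda>x. rot90 (\<phi>' x)) + (\<Sum>i<n. edge_inner vs i (g i) \<phi>)"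
      using G[OF has_grad_C1[OF \<phi>]] by (simp add: L2_inner_def inner_real2 has_grad_pderiv[OF \<phi>])
  qed
  then show ?thesis by (rule exI[where x = r])
qed

lemma edge_inner_CS:
  assumes "edge_L2 vs i f" "edge_L2 vs i g"
  shows "\<bar>edge_inner vs i f g\<bar> \<le> sqrt (edge_inner vs i f f) * sqrt (edge_inner vs i g g)"
proof -
  have "\<bar>edge_inner vs i f g\<bar> \<le> edge_length vs i *
    (L2_norm {0..1} (f \<circ> linepath (edge_start vs i) (edge_end vs i)) * L2_norm {0..1} (g \<circ> linepath (edge_start vs i) (edge_end vs i)))"
    unfolding edge_inner_def abs_mult using L2_inner_CS[OF assms[unfolded edge_L2_def]]
    by (simp add: edge_length_def mult_left_mono)
  also have "\<dots> = sqrt (edge_inner vs i f f) * sqrt (edge_inner vs i g g)"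
    by (simp add: edge_inner_def L2_inner_self real_sqrt_mult edge_length_def)
  finally show ?thesis .
qed

lemma edge_L2_continuous: assumes "continuous_on UNIV \<phi>" shows "edge_L2 vs i \<phi>"
proof -
  have "continuous_on UNIV (\<lambda>t. \<phi> (c + p i + t *\<^sub>R q i))"
    by (intro continuous_intros continuous_on_compose2[OF assms]; simp)
  then have "in_L2 {0..1::real} (\<lambda>t. \<phi> (c + p i + t *\<^sub>R q i))" by (rule in_L2_continuous) auto
  then show ?thesis by (simp add: edge_L2_def comp_def linepath_edge)
qed

text \<open>Green's formula moves the curl from \<open>\<zeta>\<close> to \<open>v\<close>. The term
  with \<open>r\<close> is bounded by \<open>poincare\<close>, the edge terms by
  \<open>edge_trace_sum\<close> followed by \<open>poincare\<close>; only the norm of the gradient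
  of \<open>\<zeta>\<close> survives.\<close>

lemma rot_duality:
  assumes G: "green v r t" and \<zeta>: "has_grad \<zeta> g" and vL: "in_L2 F v"
  shows "\<bar>L2_inner F v (\<lambda>x. rot90 (g x))\<bar> \<le>
    (L2_norm F r * (2 * h * (h / R)) + sqrt (\<Sum>i<n. edge_inner vs i (t i) (t i)) * sqrt ((3 * (2 * h * (h / R))\<^sup>2 + h\<^sup>2) / R)) * L2_norm F g"
proof -
  let ?P = "2 * h * (h / R)"
  let ?N = "L2_norm F g"
  obtain \<kappa> where \<kappa>: "L2_norm F (\<lambda>x. \<zeta> x - \<kappa>) \<le> ?P * ?N" using poincare[OF \<zeta>] by blast
  \<comment> \<open>Subtracting the constant leaves the curl unchanged and makes the function itself
    controllable by its gradient.\<close>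
  define z where "z = (\<lambda>x. \<zeta> x - \<kappa>)"
  have z: "has_grad z g" using has_grad_diff[OF \<zeta> has_grad_const[of \<kappa>]] by (simp add: z_def)
  have rL: "in_L2 F r" using G by (simp add: green_def has_weak_rot_def)
  have zL: "in_L2 F z" by (rule in_L2_continuous[OF has_grad_continuous_on[OF z] F_meas(1) bdF])
  have zn: "L2_norm F z \<le> ?P * ?N" using \<kappa> by (simp add: z_def)
  have P0: "?P \<ge> 0" using h_pos R_pos by simp
  define E where "E = (\<Sum>i<n. edge_inner vs i (t i) (t i))"
  define Z where "Z = (\<Sum>i<n. edge_inner vs i z z)"
  have "\<bar>\<Sum>i<n. edge_inner vs i (t i) z\<bar> \<le> (\<Sum>i<n. \<bar>edge_inner vs i (t i) z\<bar>)" by (rule sum_abs)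
  also have "\<dots> \<le> (\<Sum>i<n. sqrt (edge_inner vs i (t i) (t i)) * sqrt (edge_inner vs i z z))"
    using G by (intro sum_mono edge_inner_CS edge_L2_continuous[OF has_grad_continuous_on[OF z]]) (auto simp: green_def)
  also have "\<dots> \<le> sqrt E * sqrt Z"
  proof -
    have "(\<Sum>i<n. sqrt (edge_inner vs i (t i) (t i)) * sqrt (edge_inner vs i z z))\<^sup>2 \<le> E * Z"
      using Cauchy_Schwarz_ineq_sum[of "\<lambda>i. sqrt (edge_inner vs i (t i) (t i))" "\<lambda>i. sqrt (edge_inner vs i z z)" "{..<n}"]
      by (simp add: E_def Z_def edge_inner_nonneg)
    then show ?thesis using real_le_rsqrt by (simp add: real_sqrt_mult[symmetric])
  qed
  also have "\<dots> \<le> sqrt E * (sqrt ((3 * ?P\<^sup>2 + h\<^sup>2) / R) * ?N)"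
  proof (rule mult_left_mono)
    have "R * Z \<le> 3 * (L2_norm F z)\<^sup>2 + h\<^sup>2 * ?N\<^sup>2" unfolding Z_def by (rule edge_trace_sum[OF z])
    also have "\<dots> \<le> 3 * (?P * ?N)\<^sup>2 + h\<^sup>2 * ?N\<^sup>2" using power_mono[OF zn, of 2] by simp
    also have "\<dots> = (3 * ?P\<^sup>2 + h\<^sup>2) * ?N\<^sup>2"
      unfolding power_mult_distrib[of ?P ?N] by (simp only: distrib_right mult.assoc)
    finally have "Z \<le> (3 * ?P\<^sup>2 + h\<^sup>2) / R * ?N\<^sup>2" using R_pos by (simp add: field_simps)
    then have "sqrt Z \<le> sqrt ((3 * ?P\<^sup>2 + h\<^sup>2) / R * ?N\<^sup>2)" by (rule real_sqrt_le_mono)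
    then show "sqrt Z \<le> sqrt ((3 * ?P\<^sup>2 + h\<^sup>2) / R) * ?N" by (simp only: real_sqrt_mult real_sqrt_abs) simp
    show "0 \<le> sqrt E" unfolding E_def by (intro real_sqrt_ge_zero sum_nonneg edge_inner_nonneg)
  qed
  finally have b: "\<bar>\<Sum>i<n. edge_inner vs i (t i) z\<bar> \<le> sqrt E * sqrt ((3 * ?P\<^sup>2 + h\<^sup>2) / R) * ?N" by (simp add: mult.assoc)
  have "\<bar>L2_inner F r z\<bar> \<le> L2_norm F r * L2_norm F z" by (rule L2_inner_CS[OF rL zL])
  also have "\<dots> \<le> L2_norm F r * (?P * ?N)" by (rule mult_left_mono[OF zn]) simp
  finally have a: "\<bar>L2_inner F r z\<bar> \<le> L2_norm F r * ?P * ?N" by (simp add: mult.assoc)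
  have "L2_inner F v (\<lambda>x. rot90 (g x)) = L2_inner F r z - (\<Sum>i<n. edge_inner vs i (t i) z)"
    using G z by (auto simp: green_def)
  then have "\<bar>L2_inner F v (\<lambda>x. rot90 (g x))\<bar> \<le> L2_norm F r * ?P * ?N + sqrt E * sqrt ((3 * ?P\<^sup>2 + h\<^sup>2) / R) * ?N"
    using a b by linarith
  then show ?thesis by (simp add: E_def distrib_right)
qed

text \<open>By \<open>other_edge\<close>, a function vanishing outside the sector over edge
  \<open>i\<close> vanishes on all other edges; it isolates a single edge term in Green's
  formula.\<close>

lemma green_edge:
  assumes G: "green v r t" and i: "i < n" and \<phi>: "has_grad \<phi> g"
    and z: "\<And>x. \<not> (0 < w i x \<and> w i x < s i x) \<Longrightarrow> \<phi> x = 0"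
  shows "L2_inner F r \<phi> = L2_inner F v (\<lambda>x. rot90 (g x)) + edge_inner vs i (t i) \<phi>"
proof -
  have "edge_inner vs j (t j) \<phi> = 0" if j: "j < n" "j \<noteq> i" for j
  proof -
    have "L2_inner {0..1} (t j \<circ> linepath (edge_start vs j) (edge_end vs j)) (\<phi> \<circ> linepath (edge_start vs j) (edge_end vs j))
      = (\<integral>x. 0 \<partial>lebesgue_on {0..1::real})"
      unfolding L2_inner_def
    proof (rule Bochner_Integration.integral_cong)
      fix a :: real assume "a \<in> space (lebesgue_on {0..1})"
      then have "0 \<le> a" "a \<le> 1" by (auto simp: space_restrict_space)
      then have "c + p j + a *\<^sub>R q j \<in> edge vs j" by (rule edge_point)
      then have "\<phi> (c + p j + a *\<^sub>R q j) = 0" using other_edge[OF i j] z by blast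
      then show "(t j \<circ> linepath (edge_start vs j) (edge_end vs j)) a \<bullet> (\<phi> \<circ> linepath (edge_start vs j) (edge_end vs j)) a = 0"
        by (simp add: linepath_edge)
    qed simp
    then show ?thesis by (simp add: edge_inner_def)
  qed
  then have "(\<Sum>j<n. edge_inner vs j (t j) \<phi>) = (\<Sum>j<n. if j = i then edge_inner vs i (t i) \<phi> else 0)"
    by (intro sum.cong) auto
  also have "\<dots> = edge_inner vs i (t i) \<phi>" using i by (simp add: sum.delta)
  finally show ?thesis using G \<phi> by (auto simp: green_def)
qed

end

section \<open>The edge bubbles\<close>

text \<open>Edge bubble in the coordinates (s, w): it is positive exactly in the sector 0 < w < s
  and vanishes to second order on the two sides through \<open>c\<close>. At s = 1 it does not
  vanish inside the edge but equals the square of t (1 - t), so that it sees the trace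
  there.\<close>

definition wedge :: "real^2 \<Rightarrow> real" where
  "wedge y = (max 0 (y $ 2))\<^sup>2 * (max 0 (y $ 1 - y $ 2))\<^sup>2"

definition wedge_grad :: "real^2 \<Rightarrow> real^2" where
  "wedge_grad y = (max 0 (y $ 2))\<^sup>2 *\<^sub>R ((2 * max 0 (y $ 1 - y $ 2)) *\<^sub>R (axis 1 1 - axis 2 1))
    + (max 0 (y $ 1 - y $ 2))\<^sup>2 *\<^sub>R ((2 * max 0 (y $ 2)) *\<^sub>R axis 2 1)"

lemma has_grad_wedge: "has_grad wedge wedge_grad"
  unfolding wedge_def[abs_def] wedge_grad_def[abs_def]
  by (rule has_grad_mult[OF has_grad_pos_sq[OF has_grad_coord] has_grad_pos_sq[OF has_grad_diff[OF has_grad_coord has_grad_coord]]])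

lemma wedge_outside:
  assumes "\<not> (0 < y $ 2 \<and> y $ 2 < y $ 1)" shows "wedge y = 0" "wedge_grad y = 0"
  using assms by (auto simp: wedge_def wedge_grad_def max_def)

definition wedge_const :: "nat \<Rightarrow> real \<Rightarrow> bool" where
  "wedge_const k b \<longleftrightarrow> 0 \<le> b \<and> (\<forall>j\<le>k. \<forall>y. 0 < y $ 2 \<longrightarrow> y $ 2 < y $ 1 \<longrightarrow> y $ 1 < 1 \<longrightarrow>
     norm (xpow (0, j) y *\<^sub>R wedge_grad y + wedge y *\<^sub>R xpow_grad (0, j) y) \<le> b)"

lemma wedge_grad_bound: "\<exists>b. wedge_const k b"
proof -
  define G where "G = (\<lambda>j y. xpow (0, j) y *\<^sub>R wedge_grad y + wedge y *\<^sub>R xpow_grad (0, j) y)"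
  have G: "has_grad (\<lambda>y. xpow (0, j) y * wedge y) (G j)" for j
    unfolding G_def by (rule has_grad_mult[OF has_grad_xpow has_grad_wedge])
  have "\<exists>b. \<forall>y\<in>cball 0 2. norm (G j y) \<le> b" for j
  proof -
    have "compact (G j ` cball 0 2)"
      by (rule compact_continuous_image[OF continuous_on_subset[OF continuous_on_grad[OF G]] compact_cball]) simp
    then show ?thesis by (meson bounded_iff compact_imp_bounded imageI)
  qed
  then obtain b where b: "\<And>j y. y \<in> cball 0 2 \<Longrightarrow> norm (G j y) \<le> b j" by metis
  let ?b = "\<Sum>j\<le>k. \<bar>b j\<bar>"
  have "norm (G j y) \<le> ?b" if j: "j \<le> k" and y: "0 < y $ 2" "y $ 2 < y $ 1" "y $ 1 < 1" for j y
  proof -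
    have "norm y \<le> (\<Sum>i\<in>UNIV. \<bar>y $ i\<bar>)" by (rule norm_le_l1_cart)
    then have "y \<in> cball 0 2" using y by (simp add: sum_2)
    then have "norm (G j y) \<le> \<bar>b j\<bar>" using b[of y j] by linarith
    also have "\<dots> \<le> ?b" by (rule member_le_sum) (use j in auto)
    finally show ?thesis .
  qed
  then show ?thesis unfolding G_def wedge_const_def by (intro exI[of _ ?b] conjI sum_nonneg) auto
qed

text \<open>The weight t (1 - t) is the square root of \<open>wedge\<close> on the edge, in the same
  role as the square root of \<open>bump\<close> in \<open>bubble_estimate\<close>.\<close>

definition edge_gram_const :: "nat \<Rightarrow> real \<Rightarrow> bool" where
  "edge_gram_const k \<alpha> \<longleftrightarrow> 0 < \<alpha> \<and> (\<forall>e :: nat \<Rightarrow> real. \<alpha> * (\<Sum>j\<le>k. (e j)\<^sup>2) \<le> (\<integral>t. (\<Sum>j\<le>k. e j * (t ^ j * (t * (1 - t))))\<^sup>2 \<partial>lebesgue_on {0..1}))"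

lemma edge_gram: "\<exists>\<alpha>. edge_gram_const k \<alpha>"
proof -
  define m where "m = (\<lambda>j t. t ^ j * (t * (1 - t)) :: real)"
  have mc: "continuous_on UNIV (m j)" for j unfolding m_def by (intro continuous_intros)
  have mL: "in_L2 {0..1} (m j)" for j by (rule in_L2_continuous[OF mc]) auto
  have indep: "\<forall>j\<in>{..k}. e j = 0" if ae: "AE t in lebesgue_on {0..1}. (\<Sum>j\<le>k. e j * m j t) = 0" for e
  proof
    fix j assume j: "j \<in> {..k}"
    show "e j = 0"
    proof (rule poly1_zero[of "{0<..<1::real}" e k])
      show "infinite {0<..<1::real}" by simp
      fix t :: real assume t: "t \<in> {0<..<1}"
      have "(\<Sum>j\<le>k. e j * m j t) = 0"
        by (rule AE_zero_open[OF _ ae, of "{0<..<1}"])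
           (use t in \<open>auto intro!: continuous_on_sum continuous_on_mult continuous_on_const mc\<close>)
      then have "(\<Sum>j\<le>k. e j * t ^ j) * (t * (1 - t)) = 0" by (simp add: m_def sum_distrib_right mult.assoc)
      then show "(\<Sum>j\<le>k. e j * t ^ j) = 0" using t by simp
    qed (use j in simp)
  qed
  from gram_L2[where m = m and D = "{0..1}" and I = "{..k}", OF finite_atMost mL] indep
  show ?thesis unfolding m_def edge_gram_const_def by auto
qed

context star_polygon
begin

text \<open>\<open>\<alpha>s i\<close> and \<open>\<alpha>w i\<close> are the gradients of the
  affine coordinates \<open>s i\<close> and \<open>w i\<close>.\<close>

definition "\<alpha>s i = (1 / (p i \<bullet> rot90 (q i))) *\<^sub>R rot90 (q i)"
definition "\<alpha>w i = (- 1 / (p i \<bullet> rot90 (q i))) *\<^sub>R rot90 (p i)"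
definition coords :: "nat \<Rightarrow> real^2 \<Rightarrow> real^2" where
  "coords i x = vector [\<alpha>s i \<bullet> (x - c), \<alpha>w i \<bullet> (x - c)]"

lemma coords_nth: "coords i x $ 1 = s i x" "coords i x $ 2 = w i x"
  by (simp_all add: coords_def \<alpha>s_def \<alpha>w_def s_def w_def scoord_def wcoord_def)

lemma coords_on_edge: "i < n \<Longrightarrow> coords i (c + p i + t *\<^sub>R q i) = vector [1, t]"
  by (simp add: vec_eq_iff forall_2 coords_nth coords_edge)

definition edge_test :: "nat \<Rightarrow> (real^2 \<Rightarrow> real) \<Rightarrow> real^2 \<Rightarrow> real" where
  "edge_test i \<Gamma> x = \<Gamma> (coords i x) * wedge (coords i x)"

definition edge_test_grad :: "nat \<Rightarrow> (real^2 \<Rightarrow> real) \<Rightarrow> (real^2 \<Rightarrow> real^2) \<Rightarrow> real^2 \<Rightarrow> real^2" where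
  "edge_test_grad i \<Gamma> \<Gamma>' x = (let y = coords i x; G = \<Gamma> y *\<^sub>R wedge_grad y + wedge y *\<^sub>R \<Gamma>' y in G $ 1 *\<^sub>R \<alpha>s i + G $ 2 *\<^sub>R \<alpha>w i)"

lemma has_grad_edge_test: "has_grad \<Gamma> \<Gamma>' \<Longrightarrow> has_grad (edge_test i \<Gamma>) (edge_test_grad i \<Gamma> \<Gamma>')"
  using has_grad_compose_affine[OF has_grad_mult[OF _ has_grad_wedge], of \<Gamma> \<Gamma>' "\<alpha>s i" c "\<alpha>w i"]
  unfolding edge_test_def[abs_def] edge_test_grad_def[abs_def] coords_def Let_def by simp

lemma edge_test_outside:
  assumes "\<not> (0 < w i x \<and> w i x < s i x)" shows "edge_test i \<Gamma> x = 0" "edge_test_grad i \<Gamma> \<Gamma>' x = 0"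
  using wedge_outside[of "coords i x"] assms by (simp_all add: edge_test_def edge_test_grad_def coords_nth)

lemma edge_test_on_edge:
  assumes "i < n" "0 \<le> t" "t \<le> 1" shows "edge_test i \<Gamma> (c + p i + t *\<^sub>R q i) = \<Gamma> (vector [1, t]) * (t * (1 - t))\<^sup>2"
  using assms by (simp add: edge_test_def coords_on_edge wedge_def power_mult_distrib)

text \<open>Chain rule. By \<open>delta_ge\<close>, the gradient of \<open>s i\<close> has length at
  most 1 / R and that of \<open>w i\<close> at most h divided by R times the edge length. The second
  bound is the reason why short edges have to be excluded.\<close>

lemma norm_edge_test_grad:
  assumes i: "i < n" and b: "norm (\<Gamma> (coords i x) *\<^sub>R wedge_grad (coords i x) + wedge (coords i x) *\<^sub>R \<Gamma>' (coords i x)) \<le> b"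
  shows "norm (edge_test_grad i \<Gamma> \<Gamma>' x) \<le> b * (1 / R + h / (R * norm (q i)))"
proof -
  define G where "G = \<Gamma> (coords i x) *\<^sub>R wedge_grad (coords i x) + wedge (coords i x) *\<^sub>R \<Gamma>' (coords i x)"
  have b0: "b \<ge> 0" using b norm_ge_zero order_trans by blast
  have q0: "norm (q i) > 0" using q_nonzero[OF i] by simp
  have d: "R * norm (q i) \<le> \<bar>\<delta> i\<bar>" "0 < R * norm (q i)" using delta_ge[OF i] R_pos q0 by auto
  then have d0: "0 < \<bar>\<delta> i\<bar>" by linarith
  have "norm (\<alpha>s i) = norm (q i) / \<bar>\<delta> i\<bar>" by (simp add: \<alpha>s_def \<delta>_def)
  also have "\<dots> \<le> norm (q i) / (R * norm (q i))" using d by (intro divide_left_mono) auto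
  also have "\<dots> = 1 / R" using q0 by simp
  finally have 1: "norm (\<alpha>s i) \<le> 1 / R" .
  have "norm (\<alpha>w i) = norm (p i) / \<bar>\<delta> i\<bar>" by (simp add: \<alpha>w_def \<delta>_def)
  also have "\<dots> \<le> norm (p i) / (R * norm (q i))" using d by (intro divide_left_mono) auto
  also have "\<dots> \<le> h / (R * norm (q i))" using norm_edge_point_le[OF i, of 0] d by (intro divide_right_mono) auto
  finally have 2: "norm (\<alpha>w i) \<le> h / (R * norm (q i))" .
  have G: "\<bar>G $ k\<bar> \<le> b" for k using component_le_norm_cart[of G k] b by (simp add: G_def)
  have "norm (edge_test_grad i \<Gamma> \<Gamma>' x) = norm (G $ 1 *\<^sub>R \<alpha>s i + G $ 2 *\<^sub>R \<alpha>w i)"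
    by (simp add: edge_test_grad_def G_def Let_def)
  also have "\<dots> \<le> \<bar>G $ 1\<bar> * norm (\<alpha>s i) + \<bar>G $ 2\<bar> * norm (\<alpha>w i)"
    by (rule order_trans[OF norm_triangle_ineq]) simp
  also have "\<dots> \<le> b * (1 / R) + b * (h / (R * norm (q i)))"
    by (intro add_mono mult_mono G 1 2) (use b0 in auto)
  finally show ?thesis by (simp add: distrib_left)
qed

lemma L2_inner_localize:
  assumes "\<And>x. x \<in> F \<Longrightarrow> x \<notin> T i \<Longrightarrow> g x = 0"
  shows "L2_inner F f g = L2_inner F (\<lambda>x. indicator (T i) x *\<^sub>R f x) g"
  unfolding L2_inner_def
  by (rule Bochner_Integration.integral_cong) (use assms F_meas in \<open>auto simp: indicator_def space_restrict_space\<close>)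

lemma in_L2_indicator_T: assumes "in_L2 F f" shows "in_L2 F (\<lambda>x. indicator (T i) x *\<^sub>R f x)"
proof (rule in_L2_dominated[OF assms])
  show "(\<lambda>x. indicator (T i) x *\<^sub>R f x) \<in> borel_measurable (lebesgue_on F)"
    by (rule borel_measurable_scaleR[OF indicator_T_meas in_L2_meas[OF assms]])
qed (use F_meas in \<open>auto simp: indicator_def\<close>)

lemma sum_L2_norm_T:
  assumes "in_L2 F f" shows "(\<Sum>i<n. (L2_norm F (\<lambda>x. indicator (T i) x *\<^sub>R f x))\<^sup>2) \<le> (L2_norm F f)\<^sup>2"
proof -
  have "(L2_norm F (\<lambda>x. indicator (T i) x *\<^sub>R f x))\<^sup>2 = (\<integral>x. indicator (T i) x * (norm (f x))\<^sup>2 \<partial>lebesgue_on F)" for i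
    unfolding L2_norm_sq by (rule Bochner_Integration.integral_cong) (auto simp: indicator_def)
  then show ?thesis using sum_T_integral[of "\<lambda>x. (norm (f x))\<^sup>2"] assms by (simp add: in_L2_def L2_norm_sq)
qed

text \<open>Green's formula is tested with the trace polynomial times \<open>wedge\<close>. The edge
  term is bounded below by \<open>edge_gram_const\<close>. The two area terms live in
  \<open>T i\<close>, so only the parts of \<open>r\<close> and \<open>v\<close> on that triangle
  enter, which is what makes the estimates summable over the edges.\<close>

lemma edge_estimate:
  assumes G: "green v r t" and vL: "in_L2 F v" and i: "i < n"
    and e: "\<And>\<tau>. 0 \<le> \<tau> \<Longrightarrow> \<tau> \<le> 1 \<Longrightarrow> t i (c + p i + \<tau> *\<^sub>R q i) = (\<Sum>j\<le>k. e j * \<tau> ^ j)"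
    and gram: "edge_gram_const k \<alpha>" and wedge: "wedge_const k b"
  shows "norm (q i) * \<alpha> * (\<Sum>j\<le>k. \<bar>e j\<bar>) \<le> real (k + 1) * (h * sqrt unit_area) *
    (L2_norm F (\<lambda>x. indicator (T i) x *\<^sub>R r x) + b * (1 / R + h / (R * norm (q i))) * L2_norm F (\<lambda>x. indicator (T i) x *\<^sub>R v x))"
proof -
  have \<alpha>: "\<alpha> * (\<Sum>j\<le>k. (e j)\<^sup>2) \<le> (\<integral>t. (\<Sum>j\<le>k. e j * (t ^ j * (t * (1 - t))))\<^sup>2 \<partial>lebesgue_on {0..1})" "0 < \<alpha>"
    using gram by (simp_all add: edge_gram_const_def)
  have b: "norm (xpow (0, j) y *\<^sub>R wedge_grad y + wedge y *\<^sub>R xpow_grad (0, j) y) \<le> b"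
    if "j \<le> k" "0 < y $ 2" "y $ 2 < y $ 1" "y $ 1 < 1" for j y
    using wedge that by (simp add: wedge_const_def)
  define S where "S = (\<Sum>j\<le>k. \<bar>e j\<bar>)"
  have S0: "S \<ge> 0" unfolding S_def by (rule sum_nonneg) simp
  \<comment> \<open>The edge polynomial is extended into the triangle independently of the
    coordinate s: only powers of the second coordinate occur.\<close>
  define \<Gamma> where "\<Gamma> = (\<lambda>y. \<Sum>j\<le>k. e j * xpow (0, j) y)"
  define \<Gamma>' where "\<Gamma>' = (\<lambda>y. \<Sum>j\<le>k. e j *\<^sub>R xpow_grad (0, j) y)"
  have \<Gamma>: "has_grad \<Gamma> \<Gamma>'" unfolding \<Gamma>_def \<Gamma>'_def by (intro has_grad_sum has_grad_cmult has_grad_xpow)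
  define \<phi> where "\<phi> = edge_test i \<Gamma>"
  define g where "g = edge_test_grad i \<Gamma> \<Gamma>'"
  have \<phi>: "has_grad \<phi> g" unfolding \<phi>_def g_def by (rule has_grad_edge_test[OF \<Gamma>])
  have rL: "in_L2 F r" using G by (simp add: green_def has_weak_rot_def)
  define B where "B = b * (1 / R + h / (R * norm (q i)))"
  have b0: "b \<ge> 0" using wedge by (simp add: wedge_const_def)
  have B0: "B \<ge> 0" unfolding B_def using b0 R_pos h_pos by simp
  have in_T: "x \<in> T i" if "x \<in> F" "0 < w i x \<and> w i x < s i x" for x using cone_F[OF i] that by simp
  have \<phi>b: "\<bar>\<phi> x\<bar> \<le> S" if x: "x \<in> F" for x
  proof (cases "0 < w i x \<and> w i x < s i x")
    case False then show ?thesis using edge_test_outside(1) S0 by (simp add: \<phi>_def)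
  next
    case True
    then have s1: "0 < w i x" "w i x < s i x" "s i x < 1" using in_T[OF x True] by (auto simp: T_iff)
    have "\<bar>\<Gamma> (coords i x)\<bar> \<le> (\<Sum>j\<le>k. \<bar>e j * xpow (0, j) (coords i x)\<bar>)" unfolding \<Gamma>_def by (rule sum_abs)
    also have "\<dots> \<le> S" unfolding S_def
      by (rule sum_mono) (use s1 in \<open>auto simp: xpow_def coords_nth abs_mult power_abs intro!: mult_left_le power_le_one\<close>)
    finally have "\<bar>\<Gamma> (coords i x)\<bar> \<le> S" .
    moreover have "0 \<le> wedge (coords i x)" "wedge (coords i x) \<le> 1"
      using s1 by (auto simp: wedge_def coords_nth intro!: mult_le_one power_le_one)
    ultimately have "\<bar>\<Gamma> (coords i x)\<bar> * \<bar>wedge (coords i x)\<bar> \<le> S * 1" using S0 by (intro mult_mono) auto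
    then show ?thesis by (simp add: \<phi>_def edge_test_def abs_mult)
  qed
  have gb: "norm (g x) \<le> S * B" if x: "x \<in> F" for x
  proof (cases "0 < w i x \<and> w i x < s i x")
    case False then show ?thesis using edge_test_outside(2) S0 B0 by (simp add: g_def)
  next
    case True
    then have s1: "0 < w i x" "w i x < s i x" "s i x < 1" using in_T[OF x True] by (auto simp: T_iff)
    let ?y = "coords i x"
    have "\<Gamma> ?y *\<^sub>R wedge_grad ?y + wedge ?y *\<^sub>R \<Gamma>' ?y = (\<Sum>j\<le>k. e j *\<^sub>R (xpow (0, j) ?y *\<^sub>R wedge_grad ?y + wedge ?y *\<^sub>R xpow_grad (0, j) ?y))"
      by (simp add: \<Gamma>_def \<Gamma>'_def scaleR_sum_left scaleR_sum_right sum.distrib scaleR_add_right mult.commute)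
    also have "norm \<dots> \<le> (\<Sum>j\<le>k. \<bar>e j\<bar> * b)"
    proof (rule order_trans[OF norm_sum], rule sum_mono)
      fix j assume "j \<in> {..k}"
      then have "norm (xpow (0, j) ?y *\<^sub>R wedge_grad ?y + wedge ?y *\<^sub>R xpow_grad (0, j) ?y) \<le> b"
        by (intro b) (use s1 in \<open>auto simp: coords_nth\<close>)
      then show "norm (e j *\<^sub>R (xpow (0, j) ?y *\<^sub>R wedge_grad ?y + wedge ?y *\<^sub>R xpow_grad (0, j) ?y)) \<le> \<bar>e j\<bar> * b"
        unfolding norm_scaleR by (rule mult_left_mono) simp
    qed
    also have "\<dots> = S * b" by (simp add: S_def sum_distrib_right)
    finally have "norm (\<Gamma> ?y *\<^sub>R wedge_grad ?y + wedge ?y *\<^sub>R \<Gamma>' ?y) \<le> S * b" .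
    from norm_edge_test_grad[where \<Gamma> = \<Gamma> and \<Gamma>' = \<Gamma>' and x = x, OF i this] show ?thesis by (simp add: g_def B_def mult.assoc)
  qed
  have \<phi>m: "\<phi> \<in> borel_measurable (lebesgue_on F)" "g \<in> borel_measurable (lebesgue_on F)"
    using has_grad_continuous_on[OF \<phi>] continuous_on_grad[OF \<phi>]
    by (auto intro!: measurable_restrict_space1 measurable_completion borel_continuous)
  have \<phi>n: "L2_norm F \<phi> \<le> S * (h * sqrt unit_area)"
    using L2_norm_bounded[OF F_meas(1) _ S0 \<phi>m(1)] \<phi>b mult_left_mono[OF area_le S0] by fastforce
  have gn: "L2_norm F g \<le> S * B * (h * sqrt unit_area)"
    using L2_norm_bounded[OF F_meas(1) _ _ \<phi>m(2), of "S * B"] gb mult_left_mono[OF area_le, of "S * B"] S0 B0 by fastforce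
  have \<phi>L: "in_L2 F \<phi>" "in_L2 F g"
    by (rule in_L2_continuous[OF has_grad_continuous_on[OF \<phi>] F_meas(1) bdF] in_L2_continuous[OF continuous_on_grad[OF \<phi>] F_meas(1) bdF])+
  define Nr where "Nr = L2_norm F (\<lambda>x. indicator (T i) x *\<^sub>R r x)"
  define Nv where "Nv = L2_norm F (\<lambda>x. indicator (T i) x *\<^sub>R v x)"
  have out: "\<not> (0 < w i x \<and> w i x < s i x)" if "x \<in> F" "x \<notin> T i" for x using in_T that by blast
  have "L2_inner F r \<phi> = L2_inner F (\<lambda>x. indicator (T i) x *\<^sub>R r x) \<phi>"
    by (rule L2_inner_localize) (use out edge_test_outside(1) in \<open>auto simp: \<phi>_def\<close>)
  also have "\<dots> \<le> Nr * L2_norm F \<phi>"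
    using L2_inner_CS[OF in_L2_indicator_T[OF rL] \<phi>L(1)] by (simp add: Nr_def abs_le_iff)
  also have "\<dots> \<le> Nr * (S * (h * sqrt unit_area))" by (rule mult_left_mono[OF \<phi>n]) (simp add: Nr_def)
  finally have 1: "L2_inner F r \<phi> \<le> Nr * (S * (h * sqrt unit_area))" .
  have "- L2_inner F v (\<lambda>x. rot90 (g x)) = - L2_inner F (\<lambda>x. indicator (T i) x *\<^sub>R v x) (\<lambda>x. rot90 (g x))"
    by (subst L2_inner_localize) (use out edge_test_outside(2) in \<open>auto simp: g_def linear_0[OF linear_rot90]\<close>)
  also have "\<dots> \<le> Nv * L2_norm F (\<lambda>x. rot90 (g x))"
    using L2_inner_CS[OF in_L2_indicator_T[OF vL] in_L2_rot90[OF \<phi>L(2) F_meas(2)]] by (simp only: Nv_def abs_le_iff)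
  also have "\<dots> \<le> Nv * (S * B * (h * sqrt unit_area))"
    unfolding L2_norm_rot90 by (rule mult_left_mono[OF gn]) (simp add: Nv_def)
  finally have 2: "- L2_inner F v (\<lambda>x. rot90 (g x)) \<le> Nv * (S * B * (h * sqrt unit_area))" .
  have 3: "edge_inner vs i (t i) \<phi> = L2_inner F r \<phi> - L2_inner F v (\<lambda>x. rot90 (g x))"
    using green_edge[OF G i \<phi>] edge_test_outside(1) by (simp add: \<phi>_def)
  have "edge_inner vs i (t i) \<phi> = norm (q i) * (\<integral>\<tau>. (\<Sum>j\<le>k. e j * (\<tau> ^ j * (\<tau> * (1 - \<tau>))))\<^sup>2 \<partial>lebesgue_on {0..1})"
    unfolding edge_inner_def edge_length_eq L2_inner_def
  proof (rule arg_cong[where f = "(*) (norm (q i))"], rule Bochner_Integration.integral_cong)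
    fix \<tau> :: real assume "\<tau> \<in> space (lebesgue_on {0..1})"
    then have \<tau>: "0 \<le> \<tau>" "\<tau> \<le> 1" by (auto simp: space_restrict_space)
    have "\<Gamma> (vector [1, \<tau>]) = (\<Sum>j\<le>k. e j * \<tau> ^ j)" by (simp add: \<Gamma>_def xpow_def)
    moreover have "(\<Sum>j\<le>k. e j * (\<tau> ^ j * (\<tau> * (1 - \<tau>)))) = (\<Sum>j\<le>k. e j * \<tau> ^ j) * (\<tau> * (1 - \<tau>))"
      by (simp add: sum_distrib_right mult.assoc)
    ultimately show "(t i \<circ> linepath (edge_start vs i) (edge_end vs i)) \<tau> \<bullet> (\<phi> \<circ> linepath (edge_start vs i) (edge_end vs i)) \<tau>
        = (\<Sum>j\<le>k. e j * (\<tau> ^ j * (\<tau> * (1 - \<tau>))))\<^sup>2"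
      using e[OF \<tau>] edge_test_on_edge[OF i \<tau>, of \<Gamma>] by (simp add: linepath_edge \<phi>_def power2_eq_square mult_ac)
  qed simp
  then have 4: "norm (q i) * (\<alpha> * (\<Sum>j\<le>k. (e j)\<^sup>2)) \<le> edge_inner vs i (t i) \<phi>"
    using mult_left_mono[OF \<alpha>(1), of "norm (q i)"] by simp
  \<comment> \<open>The tested identity is quadratic in the coefficients on the left and linear on
    the right, so one factor \<open>S\<close> cancels. The number \<open>k + 1\<close> comes from
    comparing the sum of absolute values with the sum of squares.\<close>
  have "norm (q i) * \<alpha> * S\<^sup>2 \<le> norm (q i) * \<alpha> * (real (k + 1) * (\<Sum>j\<le>k. (e j)\<^sup>2))"
    using sum_abs_sq_le[of "{..k}" e] \<alpha>(2) by (intro mult_left_mono) (auto simp: S_def)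
  also have "\<dots> = real (k + 1) * (norm (q i) * (\<alpha> * (\<Sum>j\<le>k. (e j)\<^sup>2)))" by (simp add: mult_ac)
  also have "\<dots> \<le> real (k + 1) * (Nr * (S * (h * sqrt unit_area)) + Nv * (S * B * (h * sqrt unit_area)))"
    by (rule mult_left_mono) (use 1 2 3 4 in linarith, simp)
  finally have 5: "norm (q i) * \<alpha> * S\<^sup>2 \<le> S * (real (k + 1) * (h * sqrt unit_area) * (Nr + B * Nv))"
    by (simp add: algebra_simps)
  have "norm (q i) * \<alpha> * S \<le> real (k + 1) * (h * sqrt unit_area) * (Nr + B * Nv)"
  proof (cases "S = 0")
    case True
    have "0 \<le> Nr + B * Nv" using B0 by (simp add: Nr_def Nv_def)
    then show ?thesis using True h_pos unit_area_pos by simp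
  next
    case False
    then have "S > 0" using S0 by simp
    moreover have "S * (norm (q i) * \<alpha> * S) \<le> S * (real (k + 1) * (h * sqrt unit_area) * (Nr + B * Nv))"
      using 5 by (simp add: power2_eq_square mult_ac)
    ultimately show ?thesis using mult_le_cancel_left_pos by blast
  qed
  then show ?thesis by (simp only: S_def Nr_def Nv_def B_def)
qed

text \<open>\<open>tangential_trace\<close> is a choice, so traces must be compared. Testing with a
  polynomial in \<open>w i\<close> times the edge bubble shows that the difference, weighted with
  the square of \<tau> (1 - \<tau>), has no polynomial moments. The rotations in the two Green
  formulas agree almost everywhere and cancel.\<close>

lemma trace_unique:
  assumes G: "green v r t" "green v r' t'" and i: "i < n"
  shows "AE \<tau> in lebesgue_on {0..1}. t i (c + p i + \<tau> *\<^sub>R q i) = t' i (c + p i + \<tau> *\<^sub>R q i)"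
proof -
  let ?u = "\<lambda>\<tau>. t i (c + p i + \<tau> *\<^sub>R q i)" and ?u' = "\<lambda>\<tau>. t' i (c + p i + \<tau> *\<^sub>R q i)"
  have uL: "in_L2 {0..1} ?u" "in_L2 {0..1} ?u'"
    using G i by (auto simp: green_def edge_L2_def comp_def linepath_edge)
  have ae: "AE x in lebesgue_on F. r x = r' x"
    using weak_rot_unique[OF opF bdF] G by (auto simp: green_def)
  let ?f = "\<lambda>\<tau>. (?u \<tau> - ?u' \<tau>) * (\<tau> * (1 - \<tau>))\<^sup>2"
  have poly_L2: "in_L2 {0..1::real} (\<lambda>\<tau>. (\<tau> * (1 - \<tau>))\<^sup>2 * P \<tau>)" if "continuous_on UNIV P" for P
    by (rule in_L2_continuous) (auto intro!: continuous_intros that)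
  have "AE \<tau> in lebesgue_on {0..1}. ?f \<tau> = 0"
  proof (rule AE_zero_of_polynomial_moments)
    show "compact {0..1::real}" by simp
    show "integrable (lebesgue_on {0..1}) ?f"
      using integrable_inner_L2[OF in_L2_diff[OF uL] poly_L2[of "\<lambda>_. 1"]] by simp
    fix P :: "real \<Rightarrow> real" assume P: "real_polynomial_function P"
    have Pc: "continuous_on UNIV P" using P continuous_on_polymonial_function real_polynomial_function_eq by blast
    have "bounded_linear (\<lambda>y::real^2. y $ 2)" by (rule bounded_linear_vec_nth)
    then have "polynomial_function (\<lambda>y::real^2. y $ 2)" 
      using real_polynomial_function.intros(1) real_polynomial_function_eq by blast
    from real_polynomial_function_compose[OF this P] obtain \<Gamma>' where \<Gamma>: "has_grad (\<lambda>y. P (y $ 2)) \<Gamma>'"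
      using real_polynomial_function_has_grad[of "P \<circ> (\<lambda>y. y $ 2)"] by (auto simp: comp_def)
    let ?\<phi> = "edge_test i (\<lambda>y. P (y $ 2))"
    let ?g = "edge_test_grad i (\<lambda>y. P (y $ 2)) \<Gamma>'"
    have \<phi>: "has_grad ?\<phi> ?g" by (rule has_grad_edge_test[OF \<Gamma>])
    have \<phi>L: "in_L2 F ?\<phi>" by (rule in_L2_continuous[OF has_grad_continuous_on[OF \<phi>] F_meas(1) bdF])
    have "L2_inner F r ?\<phi> = L2_inner F r' ?\<phi>"
      unfolding L2_inner_def
    proof (rule integral_cong_AE)
      show "AE x in lebesgue_on F. r x \<bullet> ?\<phi> x = r' x \<bullet> ?\<phi> x" using ae by eventually_elim simp
      have rL: "in_L2 F r" "in_L2 F r'" using G by (auto simp: green_def has_weak_rot_def)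
      show "(\<lambda>x. r x \<bullet> ?\<phi> x) \<in> borel_measurable (lebesgue_on F)" "(\<lambda>x. r' x \<bullet> ?\<phi> x) \<in> borel_measurable (lebesgue_on F)"
        by (rule borel_measurable_integrable[OF integrable_inner_L2[OF rL(1) \<phi>L]]
              borel_measurable_integrable[OF integrable_inner_L2[OF rL(2) \<phi>L]])+
    qed
    then have eq: "edge_inner vs i (t i) ?\<phi> = edge_inner vs i (t' i) ?\<phi>"
      using green_edge[OF G(1) i \<phi>] green_edge[OF G(2) i \<phi>] edge_test_outside(1) by simp
    have "edge_inner vs i z ?\<phi> = norm (q i) * (\<integral>\<tau>. z (c + p i + \<tau> *\<^sub>R q i) * ((\<tau> * (1 - \<tau>))\<^sup>2 * P \<tau>) \<partial>lebesgue_on {0..1})" for z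
      unfolding edge_inner_def edge_length_eq L2_inner_def
    proof (rule arg_cong[where f = "(*) (norm (q i))"], rule Bochner_Integration.integral_cong)
      fix \<tau> :: real assume "\<tau> \<in> space (lebesgue_on {0..1})"
      then have \<tau>: "0 \<le> \<tau>" "\<tau> \<le> 1" by (auto simp: space_restrict_space)
      show "(z \<circ> linepath (edge_start vs i) (edge_end vs i)) \<tau> \<bullet> (?\<phi> \<circ> linepath (edge_start vs i) (edge_end vs i)) \<tau>
        = z (c + p i + \<tau> *\<^sub>R q i) * ((\<tau> * (1 - \<tau>))\<^sup>2 * P \<tau>)"
        using edge_test_on_edge[OF i \<tau>, of "\<lambda>y. P (y $ 2)"] by (simp add: linepath_edge mult_ac)
    qed simp
    then have "(\<integral>\<tau>. ?u \<tau> * ((\<tau> * (1 - \<tau>))\<^sup>2 * P \<tau>) \<partial>lebesgue_on {0..1}) = (\<integral>\<tau>. ?u' \<tau> * ((\<tau> * (1 - \<tau>))\<^sup>2 * P \<tau>) \<partial>lebesgue_on {0..1})"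
      using eq q_nonzero[OF i] by simp
    then show "(\<integral>\<tau>. ?f \<tau> * P \<tau> \<partial>lebesgue_on {0..1}) = 0"
      using integrable_inner_L2[OF uL(1) poly_L2[OF Pc]] integrable_inner_L2[OF uL(2) poly_L2[OF Pc]]
      by (simp add: left_diff_distrib mult.assoc)
  qed
  \<comment> \<open>The weight vanishes only at the two endpoints, which form a null set.\<close>
  moreover have "AE \<tau> in lebesgue_on {0..1}. \<tau> \<noteq> (0::real)" "AE \<tau> in lebesgue_on {0..1}. \<tau> \<noteq> (1::real)"
  proof -
    have "AE \<tau> in lebesgue_on {0..1}. \<tau> \<noteq> a" for a :: real
    proof -
      have "AE \<tau> in lebesgue. \<tau> \<noteq> a" using AE_lborel_singleton[of a] by (rule AE_completion)
      then have "AE \<tau> in lebesgue. \<tau> \<in> {0..1} \<longrightarrow> \<tau> \<noteq> a" by eventually_elim simp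
      then show ?thesis by (subst AE_restrict_space_iff) simp_all
    qed
    then show "AE \<tau> in lebesgue_on {0..1}. \<tau> \<noteq> (0::real)" "AE \<tau> in lebesgue_on {0..1}. \<tau> \<noteq> (1::real)"
      by blast+
  qed
  ultimately show ?thesis by eventually_elim auto
qed

end

section \<open>Approximation of fields without divergence by curls\<close>

lemma integrable_L2_1:
  assumes "in_L2 D f" "D \<in> lmeasurable" shows "integrable (lebesgue_on D) (f :: 'a::euclidean_space \<Rightarrow> real)"
proof -
  have "in_L2 D (\<lambda>x::'a. 1::real)" by (rule in_L2_bounded[OF _ assms(2), of _ 1]) auto
  from integrable_inner_L2[OF assms(1) this] show ?thesis by simp
qed

lemma integrable_scaleR_L2:
  fixes f :: "'a::euclidean_space \<Rightarrow> real" and k :: "'a \<Rightarrow> 'b::euclidean_space"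
  assumes f: "in_L2 D f" and k: "in_L2 D k"
  shows "integrable (lebesgue_on D) (\<lambda>x. f x *\<^sub>R k x)"
proof (rule Bochner_Integration.integrable_bound)
  have fa: "in_L2 D (\<lambda>x. \<bar>f x\<bar>)" "in_L2 D (\<lambda>x. norm (k x))" using f k by (auto simp: in_L2_def)
  show "integrable (lebesgue_on D) (\<lambda>x. \<bar>f x\<bar> \<bullet> norm (k x))" by (rule integrable_inner_L2[OF fa])
  show "(\<lambda>x. f x *\<^sub>R k x) \<in> borel_measurable (lebesgue_on D)" using f k by (auto simp: in_L2_def)
qed auto

text \<open>Differentiation under the integral sign. The hypothesis \<open>mod\<close> asks for
  continuity of the gradient uniformly in the parameter up to the integrable weight
  \<open>B\<close>; the uses take \<open>B\<close> to be the absolute value of the smoothed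
  function, and the constant 1.\<close>

lemma has_grad_integral:
  fixes f :: "real^2 \<Rightarrow> 'w \<Rightarrow> real" and g :: "real^2 \<Rightarrow> 'w \<Rightarrow> real^2"
  assumes fg: "\<And>\<omega>. \<omega> \<in> space M \<Longrightarrow> has_grad (\<lambda>x. f x \<omega>) (\<lambda>x. g x \<omega>)"
    and fi: "\<And>x. integrable M (f x)" and gi: "\<And>x. integrable M (g x)"
    and B: "integrable M B" "\<And>\<omega>. 0 \<le> B \<omega>"
    and mod: "\<And>x0 e. e > 0 \<Longrightarrow> \<exists>d>0. \<forall>x. norm (x - x0) < d \<longrightarrow> (\<forall>\<omega>\<in>space M. norm (g x \<omega> - g x0 \<omega>) \<le> e * B \<omega>)"
  shows "has_grad (\<lambda>x. \<integral>\<omega>. f x \<omega> \<partial>M) (\<lambda>x. \<integral>\<omega>. g x \<omega> \<partial>M)"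
proof -
  define b where "b = (\<integral>\<omega>. B \<omega> \<partial>M)"
  have b0: "b \<ge> 0" unfolding b_def by (rule Bochner_Integration.integral_nonneg) (rule B(2))
  show ?thesis unfolding has_grad_def
  proof (intro conjI allI)
    fix x0
    show "((\<lambda>x. \<integral>\<omega>. f x \<omega> \<partial>M) has_derivative (\<lambda>v. (\<integral>\<omega>. g x0 \<omega> \<partial>M) \<bullet> v)) (at x0)"
      unfolding has_derivative_at_alt
    proof (intro conjI allI impI)
      show "bounded_linear (\<lambda>v. (\<integral>\<omega>. g x0 \<omega> \<partial>M) \<bullet> v)" by (rule bounded_linear_inner_right)
      fix e :: real assume e: "e > 0"
      then have "e / (b + 1) > 0" using b0 by simp
      from mod[OF this, of x0] obtain d where d: "d > 0"
        "\<And>x \<omega>. norm (x - x0) < d \<Longrightarrow> \<omega> \<in> space M \<Longrightarrow> norm (g x \<omega> - g x0 \<omega>) \<le> e / (b + 1) * B \<omega>" by auto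
      show "\<exists>d>0. \<forall>x. norm (x - x0) < d \<longrightarrow> norm ((\<integral>\<omega>. f x \<omega> \<partial>M) - (\<integral>\<omega>. f x0 \<omega> \<partial>M) - (\<integral>\<omega>. g x0 \<omega> \<partial>M) \<bullet> (x - x0)) \<le> e * norm (x - x0)"
      proof (intro exI[of _ d] conjI d(1) allI impI)
        fix x assume x: "norm (x - x0) < d"
        have pt: "norm (f x \<omega> - f x0 \<omega> - g x0 \<omega> \<bullet> (x - x0)) \<le> (e / (b + 1) * norm (x - x0)) * B \<omega>" if w: "\<omega> \<in> space M" for \<omega>
        proof -
          \<comment> \<open>Mean value inequality for \<open>f\<close> minus its linearization at
            \<open>x0\<close>: the derivative of this difference is the increment of the gradient,
            which \<open>mod\<close> makes small.\<close>
          have "norm ((f x \<omega> - g x0 \<omega> \<bullet> x) - (f x0 \<omega> - g x0 \<omega> \<bullet> x0)) \<le> (e / (b + 1) * B \<omega>) * norm (x - x0)"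
          proof (rule differentiable_bound[of "ball x0 d" "\<lambda>z. f z \<omega> - g x0 \<omega> \<bullet> z" "\<lambda>z v. (g z \<omega> - g x0 \<omega>) \<bullet> v"])
            fix z assume "z \<in> ball x0 d"
            then have z: "norm (z - x0) < d" by (simp add: dist_norm norm_minus_commute)
            show "((\<lambda>z. f z \<omega> - g x0 \<omega> \<bullet> z) has_derivative (\<lambda>v. (g z \<omega> - g x0 \<omega>) \<bullet> v)) (at z within ball x0 d)"
              by (rule has_derivative_eq_rhs[OF has_derivative_diff[OF
                    has_derivative_at_withinI[OF has_grad_derivative[OF fg[OF w]]] has_derivative_inner_right[OF has_derivative_ident]]])
                 (auto simp: inner_diff_left)
            show "onorm (\<lambda>v. (g z \<omega> - g x0 \<omega>) \<bullet> v) \<le> e / (b + 1) * B \<omega>"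
            proof (rule onorm_le)
              fix v
              have "\<bar>(g z \<omega> - g x0 \<omega>) \<bullet> v\<bar> \<le> norm (g z \<omega> - g x0 \<omega>) * norm v" by (rule Cauchy_Schwarz_ineq2)
              also have "\<dots> \<le> e / (b + 1) * B \<omega> * norm v" by (rule mult_right_mono[OF d(2)[OF z w]]) simp
              finally show "norm ((g z \<omega> - g x0 \<omega>) \<bullet> v) \<le> e / (b + 1) * B \<omega> * norm v" by simp
            qed
          qed (use x d(1) in \<open>auto simp: dist_norm norm_minus_commute\<close>)
          then show ?thesis by (simp add: inner_diff_right algebra_simps)
        qed
        have I: "integrable M (\<lambda>\<omega>. f x \<omega> - f x0 \<omega> - g x0 \<omega> \<bullet> (x - x0))"
          by (intro Bochner_Integration.integrable_diff fi integrable_inner_left gi)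
        have "(\<integral>\<omega>. f x \<omega> \<partial>M) - (\<integral>\<omega>. f x0 \<omega> \<partial>M) - (\<integral>\<omega>. g x0 \<omega> \<partial>M) \<bullet> (x - x0) = (\<integral>\<omega>. f x \<omega> - f x0 \<omega> - g x0 \<omega> \<bullet> (x - x0) \<partial>M)"
          using fi gi by simp
        also have "norm \<dots> \<le> (\<integral>\<omega>. norm (f x \<omega> - f x0 \<omega> - g x0 \<omega> \<bullet> (x - x0)) \<partial>M)" by (rule integral_norm_bound)
        also have "\<dots> \<le> (\<integral>\<omega>. (e / (b + 1) * norm (x - x0)) * B \<omega> \<partial>M)"
          by (rule integral_mono[OF integrable_norm[OF I]]) (use B(1) pt in auto)
        also have "\<dots> = (e * norm (x - x0)) * (b / (b + 1))" by (simp add: b_def[symmetric])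
        also have "\<dots> \<le> (e * norm (x - x0)) * 1" using b0 e by (intro mult_left_mono) auto
        finally show "norm ((\<integral>\<omega>. f x \<omega> \<partial>M) - (\<integral>\<omega>. f x0 \<omega> \<partial>M) - (\<integral>\<omega>. g x0 \<omega> \<partial>M) \<bullet> (x - x0)) \<le> e * norm (x - x0)" by simp
      qed
    qed
  next
    show "continuous_on UNIV (\<lambda>x. \<integral>\<omega>. g x \<omega> \<partial>M)"
      unfolding continuous_on_iff
    proof (intro ballI allI impI)
      fix x0 and e :: real assume e: "e > 0"
      then have "e / (b + 1) > 0" using b0 by simp
      from mod[OF this, of x0] obtain d where d: "d > 0"
        "\<And>x \<omega>. norm (x - x0) < d \<Longrightarrow> \<omega> \<in> space M \<Longrightarrow> norm (g x \<omega> - g x0 \<omega>) \<le> e / (b + 1) * B \<omega>" by auto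
      show "\<exists>d>0. \<forall>x\<in>UNIV. dist x x0 < d \<longrightarrow> dist (\<integral>\<omega>. g x \<omega> \<partial>M) (\<integral>\<omega>. g x0 \<omega> \<partial>M) < e"
      proof (intro exI[of _ d] conjI d(1) ballI impI)
        fix x assume "dist x x0 < d"
        then have x: "norm (x - x0) < d" by (simp add: dist_norm)
        have I: "integrable M (\<lambda>\<omega>. g x \<omega> - g x0 \<omega>)" by (intro Bochner_Integration.integrable_diff gi)
        have "dist (\<integral>\<omega>. g x \<omega> \<partial>M) (\<integral>\<omega>. g x0 \<omega> \<partial>M) = norm (\<integral>\<omega>. g x \<omega> - g x0 \<omega> \<partial>M)"
          using gi by (simp add: dist_norm)
        also have "\<dots> \<le> (\<integral>\<omega>. norm (g x \<omega> - g x0 \<omega>) \<partial>M)" by (rule integral_norm_bound)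
        also have "\<dots> \<le> (\<integral>\<omega>. e / (b + 1) * B \<omega> \<partial>M)"
          by (rule integral_mono[OF integrable_norm[OF I]]) (use B(1) d(2)[OF x] in auto)
        also have "\<dots> = e * (b / (b + 1))" by (simp add: b_def[symmetric])
        also have "\<dots> < e * 1" using b0 e by (intro mult_strict_left_mono) auto
        finally show "dist (\<integral>\<omega>. g x \<omega> \<partial>M) (\<integral>\<omega>. g x0 \<omega> \<partial>M) < e" by simp
      qed
    qed
  qed
qed

context star_domain
begin

section \<open>Averaging kernels adapted to the star shape\<close>

definition bump_mass :: real where "bump_mass = (\<integral>y. bump c (R / 2) y \<partial>lborel)"

lemma bump_borel: "bump a r \<in> borel_measurable borel"
  by (rule borel_continuous[OF has_grad_continuous_on[OF has_grad_bump]])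

lemma bump_mass: "integrable lborel (bump c (R / 2))" "bump_mass > 0"
proof -
  let ?D = "cball c (R / 2)"
  have L: "in_L2 ?D (bump c (R / 2))" by (rule in_L2_continuous[OF has_grad_continuous_on[OF has_grad_bump]]) auto
  then have i: "integrable (lebesgue_on ?D) (bump c (R / 2))" by (rule integrable_L2_1) simp
  have z: "bump c (R / 2) x = 0" if "x \<notin> ?D" for x using bump_outside(1)[OF that] R_pos by simp
  have e: "indicator ?D x *\<^sub>R bump c (R / 2) x = bump c (R / 2) x" for x using z[of x] by (auto simp: indicator_def)
  have "integrable lebesgue (\<lambda>x. indicator ?D x *\<^sub>R bump c (R / 2) x)" using i by (simp add: integrable_restrict_space)
  then have "integrable lebesgue (bump c (R / 2))" unfolding e .
  then show "integrable lborel (bump c (R / 2))" using bump_borel by (simp add: integrable_completion)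
  have I: "bump_mass = (\<integral>y. bump c (R / 2) y \<partial>lebesgue_on ?D)"
    unfolding bump_mass_def by (rule integral_lebesgue_on_lborel[symmetric]) (use bump_borel z in auto)
  have "bump_mass \<noteq> 0"
  proof
    assume "bump_mass = 0"
    then have "AE x in lebesgue_on ?D. bump c (R / 2) x = 0"
      using integral_nonneg_eq_0_iff_AE[OF i] I by simp
    then have "bump c (R / 2) c = 0"
      by (rule AE_zero_open[OF has_grad_continuous_on[OF has_grad_bump] _ open_ball[of c "R / 2"]]) (use R_pos in auto)
    then show False using bump_pos[of c c "R / 2"] R_pos by simp
  qed
  moreover have "bump_mass \<ge> 0" unfolding bump_mass_def by (rule Bochner_Integration.integral_nonneg) simp
  ultimately show "bump_mass > 0" by simp
qed

text \<open>The kernel at \<open>x\<close> averages over the points \<open>x + (y - x) / \<tau>\<close> with \<open>y\<close> in the inner disk, which lie in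
  \<open>F\<close> because \<open>F\<close> is star-shaped; so a function on \<open>F\<close> need not be extended.\<close>
definition ker :: "real \<Rightarrow> real^2 \<Rightarrow> real^2 \<Rightarrow> real" where
  "ker \<tau> x z = \<tau>\<^sup>2 / bump_mass * bump c (R / 2) (\<tau> *\<^sub>R z - (\<tau> - 1) *\<^sub>R x)"

lemma ker_nonneg: "0 \<le> ker \<tau> x z" using bump_mass(2) by (simp add: ker_def)

lemma ker_support:
  assumes \<tau>: "\<tau> \<ge> 2" and x: "x \<in> F" and k: "ker \<tau> x z \<noteq> 0"
  shows "z \<in> F" "norm (z - x) \<le> h / \<tau>"
proof -
  define y where "y = \<tau> *\<^sub>R z - (\<tau> - 1) *\<^sub>R x"
  have "y \<in> cball c (R / 2)" using bump_outside(1)[of y c "R / 2"] k R_pos by (auto simp: ker_def y_def)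
  then have y: "y \<in> ball c R" using R_pos by auto
  have z: "z = (1 - 1 / \<tau>) *\<^sub>R x + (1 / \<tau>) *\<^sub>R y"
    using \<tau> by (simp add: y_def algebra_simps)
  show "z \<in> F" unfolding z by (rule star'[OF x y]) (use \<tau> in auto)
  have "z - x = (1 / \<tau>) *\<^sub>R (y - x)" unfolding z by (simp add: algebra_simps)
  then have "norm (z - x) = dist y x / \<tau>" using \<tau> by (simp add: dist_norm)
  also have "\<dots> \<le> h / \<tau>" using dist_F[of y x] y ball_sub x \<tau> by (intro divide_right_mono) auto
  finally show "norm (z - x) \<le> h / \<tau>" .
qed

lemma ker_cont: "continuous_on UNIV (ker \<tau> x)" "continuous_on UNIV (\<lambda>x. ker \<tau> x z)"
  unfolding ker_def by (intro continuous_intros continuous_on_compose2[OF has_grad_continuous_on[OF has_grad_bump]]; simp)+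

lemma ker_integral: assumes \<tau>: "\<tau> \<ge> 2" and x: "x \<in> F" shows "(\<integral>z. ker \<tau> x z \<partial>lebesgue_on F) = 1"
proof -
  have "(\<integral>z. ker \<tau> x z \<partial>lebesgue_on F) = (\<integral>z. ker \<tau> x z \<partial>lborel)"
    by (rule integral_lebesgue_on_lborel[OF F_meas(2) borel_continuous[OF ker_cont(1)]]) (use ker_support(1)[OF \<tau> x] in blast)
  also have "\<dots> = (1 / \<tau>)\<^sup>2 * (\<integral>y. ker \<tau> x ((1 - 1 / \<tau>) *\<^sub>R x + (1 / \<tau>) *\<^sub>R y) \<partial>lborel)"
    by (rule integral_lborel_scale) (use \<tau> borel_continuous[OF ker_cont(1)] in auto)
  also have "\<dots> = (1 / \<tau>)\<^sup>2 * (\<integral>y. \<tau>\<^sup>2 / bump_mass * bump c (R / 2) y \<partial>lborel)"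
  proof -
    have "\<tau> *\<^sub>R ((1 - 1 / \<tau>) *\<^sub>R x + (1 / \<tau>) *\<^sub>R y) - (\<tau> - 1) *\<^sub>R x = y" for y
      using \<tau> by (simp add: algebra_simps)
    then show ?thesis by (simp add: ker_def)
  qed
  also have "\<dots> = 1" using \<tau> bump_mass(2) by (simp add: bump_mass_def[symmetric] power_divide)
  finally show ?thesis .
qed

text \<open>In the variable \<open>x\<close> the kernel argument has Jacobian
  \<open>(1 - \<tau>)\<^sup>2\<close>, whereas the normalization \<open>\<tau>\<^sup>2\<close>
  belongs to the variable \<open>z\<close>. For \<open>\<tau>\<close> at least 2 their quotient is
  at most 4.\<close>

lemma ker_integral_x: assumes \<tau>: "\<tau> \<ge> 2" shows "(\<integral>\<^sup>+x. ennreal (ker \<tau> x z) \<partial>lborel) \<le> 4"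
proof -
  let ?T = "\<lambda>x::real^2. \<tau> *\<^sub>R z + (1 - \<tau>) *\<^sub>R x"
  have [measurable]: "?T \<in> borel \<rightarrow>\<^sub>M borel" by (rule borel_continuous) (intro continuous_intros)
  have bm[measurable]: "bump c (R / 2) \<in> borel_measurable borel" by (rule bump_borel)
  have kT: "ker \<tau> x z = \<tau>\<^sup>2 / bump_mass * bump c (R / 2) (?T x)" for x by (simp add: ker_def algebra_simps)
  have "(\<integral>\<^sup>+y. ennreal (bump c (R / 2) y) \<partial>lborel) = (\<integral>\<^sup>+y. ennreal (bump c (R / 2) y) \<partial>density (distr lborel borel ?T) (\<lambda>_. ennreal (\<bar>1 - \<tau>\<bar> ^ 2)))"
    using lborel_affine[of "1 - \<tau>" "\<tau> *\<^sub>R z"] \<tau> by (simp add: ennreal_power)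
  also have "\<dots> = ennreal ((1 - \<tau>)\<^sup>2) * (\<integral>\<^sup>+x. ennreal (bump c (R / 2) (?T x)) \<partial>lborel)"
    by (simp add: nn_integral_density nn_integral_distr nn_integral_cmult)
  also have "(\<integral>\<^sup>+y. ennreal (bump c (R / 2) y) \<partial>lborel) = ennreal bump_mass"
    unfolding bump_mass_def by (rule nn_integral_eq_integral[OF bump_mass(1)]) simp
  finally have 1: "ennreal bump_mass = ennreal ((1 - \<tau>)\<^sup>2) * (\<integral>\<^sup>+x. ennreal (bump c (R / 2) (?T x)) \<partial>lborel)" .
  have "(\<integral>\<^sup>+x. ennreal (ker \<tau> x z) \<partial>lborel) = ennreal (\<tau>\<^sup>2 / bump_mass) * (\<integral>\<^sup>+x. ennreal (bump c (R / 2) (?T x)) \<partial>lborel)"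
  proof -
    have "ennreal (\<tau>\<^sup>2 / bump_mass * bump c (R / 2) (?T x)) = ennreal (\<tau>\<^sup>2 / bump_mass) * ennreal (bump c (R / 2) (?T x))" for x
      by (rule ennreal_mult) (use bump_mass(2) in auto)
    then show ?thesis unfolding kT by (simp only:) (rule nn_integral_cmult, measurable)
  qed
  also have "\<dots> \<le> ennreal (4 / bump_mass * (1 - \<tau>)\<^sup>2) * (\<integral>\<^sup>+x. ennreal (bump c (R / 2) (?T x)) \<partial>lborel)"
  proof (intro mult_right_mono ennreal_leI)
    have "\<tau>\<^sup>2 \<le> (2 * (\<tau> - 1))\<^sup>2" using \<tau> by (intro power_mono) auto
    also have "\<dots> = 4 * (1 - \<tau>)\<^sup>2" by (simp add: power2_eq_square algebra_simps)
    finally have "\<tau>\<^sup>2 \<le> 4 * (1 - \<tau>)\<^sup>2" .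
    then have "\<tau>\<^sup>2 / bump_mass \<le> 4 * (1 - \<tau>)\<^sup>2 / bump_mass" using bump_mass(2) by (intro divide_right_mono) auto
    then show "\<tau>\<^sup>2 / bump_mass \<le> 4 / bump_mass * (1 - \<tau>)\<^sup>2" by simp
  qed simp
  also have "\<dots> = ennreal (4 / bump_mass) * ennreal bump_mass" 
  proof -
    have "ennreal (4 / bump_mass * (1 - \<tau>)\<^sup>2) = ennreal (4 / bump_mass) * ennreal ((1 - \<tau>)\<^sup>2)"
      by (rule ennreal_mult) (use bump_mass(2) in auto)
    then show ?thesis unfolding 1 by (simp only: mult.assoc)
  qed
  also have "\<dots> = 4" using bump_mass(2) by (simp add: ennreal_mult[symmetric])
  finally show ?thesis .
qed

definition smooth :: "real \<Rightarrow> (real^2 \<Rightarrow> real) \<Rightarrow> real^2 \<Rightarrow> real" where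
  "smooth \<tau> f x = (\<integral>z. ker \<tau> x z * f z \<partial>lebesgue_on F)"

definition smooth_grad :: "real \<Rightarrow> (real^2 \<Rightarrow> real) \<Rightarrow> real^2 \<Rightarrow> real^2" where
  "smooth_grad \<tau> f x = (\<integral>z. f z *\<^sub>R ((\<tau>\<^sup>2 / bump_mass * (1 - \<tau>)) *\<^sub>R bump_grad c (R / 2) (\<tau> *\<^sub>R z - (\<tau> - 1) *\<^sub>R x)) \<partial>lebesgue_on F)"

lemma ker_L2: "in_L2 F (ker \<tau> x)"
  by (rule in_L2_continuous[OF ker_cont(1) F_meas(1) bdF])

lemma ker_f_integrable: "in_L2 F f \<Longrightarrow> integrable (lebesgue_on F) (\<lambda>z. ker \<tau> x z * f z)"
  using integrable_inner_L2[OF ker_L2] by simp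

text \<open>All derivatives fall on the kernel, so \<open>f\<close> only has to be square
  integrable. The increment of the kernel gradient is uniform in \<open>z\<close> by uniform
  continuity of \<open>bump_grad\<close> on a large ball.\<close>

lemma has_grad_smooth:
  assumes f: "in_L2 F f" shows "has_grad (smooth \<tau> f) (smooth_grad \<tau> f)"
proof -
  let ?b = "bump_grad c (R / 2)"
  let ?C = "\<tau>\<^sup>2 / bump_mass * (1 - \<tau>)"
  let ?g = "\<lambda>x z. f z *\<^sub>R (?C *\<^sub>R ?b (\<tau> *\<^sub>R z - (\<tau> - 1) *\<^sub>R x))"
  have bc: "continuous_on UNIV ?b" by (rule continuous_on_grad[OF has_grad_bump])
  have kg: "has_grad (\<lambda>x. ker \<tau> x z) (\<lambda>x. ?C *\<^sub>R ?b (\<tau> *\<^sub>R z - (\<tau> - 1) *\<^sub>R x))" for z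
  proof -
    have e: "\<tau> *\<^sub>R z - (\<tau> - 1) *\<^sub>R x = \<tau> *\<^sub>R z + (1 - \<tau>) *\<^sub>R x" for x by (simp add: algebra_simps)
    show ?thesis unfolding ker_def e
      using has_grad_cmult[OF has_grad_shift[OF has_grad_bump], of "\<tau>\<^sup>2 / bump_mass" c "R / 2" "\<tau> *\<^sub>R z" "1 - \<tau>"] by simp
  qed
  have "has_grad (\<lambda>x. \<integral>z. ker \<tau> x z * f z \<partial>lebesgue_on F) (\<lambda>x. \<integral>z. ?g x z \<partial>lebesgue_on F)"
  proof (rule has_grad_integral)
    show "has_grad (\<lambda>x. ker \<tau> x z * f z) (\<lambda>x. ?g x z)" for z
      using has_grad_cmult[OF kg[of z], of "f z"] by (simp add: mult.commute)
    show "integrable (lebesgue_on F) (\<lambda>z. ker \<tau> x z * f z)" for x by (rule ker_f_integrable[OF f])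
    show "integrable (lebesgue_on F) (\<lambda>z. ?g x z)" for x
      by (rule integrable_scaleR_L2[OF f in_L2_continuous[OF _ F_meas(1) bdF]])
         (intro continuous_intros continuous_on_compose2[OF bc]; simp)
    show "integrable (lebesgue_on F) (\<lambda>z. \<bar>f z\<bar>)" using integrable_L2_1[OF f F_meas(1)] by simp
    show "0 \<le> \<bar>f z\<bar>" for z by simp
    fix x0 :: "real^2" and e :: real assume e: "e > 0"
    obtain a where a: "\<And>z. z \<in> F \<Longrightarrow> norm z \<le> a" using bdF by (auto simp: bounded_iff)
    \<comment> \<open>Radius containing the kernel argument for every \<open>z\<close> in
      \<open>F\<close> and every point within distance 1 of \<open>x0\<close>.\<close>
    define A where "A = \<bar>\<tau>\<bar> * \<bar>a\<bar> + \<bar>\<tau> - 1\<bar> * (norm x0 + 1)"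
    have uc: "uniformly_continuous_on (cball 0 A) ?b"
      by (rule compact_uniformly_continuous[OF continuous_on_subset[OF bc]]) auto
    define e' where "e' = e / (\<bar>?C\<bar> + 1)"
    have e': "e' > 0" unfolding e'_def using e by (intro divide_pos_pos) (auto simp: add_nonneg_pos)
    obtain d where d: "d > 0" "\<And>y y'. y \<in> cball 0 A \<Longrightarrow> y' \<in> cball 0 A \<Longrightarrow> dist y' y < d \<Longrightarrow> dist (?b y') (?b y) < e'"
      using uc e' unfolding uniformly_continuous_on_def by meson
    define d' where "d' = min 1 (d / (\<bar>\<tau> - 1\<bar> + 1))"
    have d': "d' > 0" unfolding d'_def using d(1) by (auto simp: add_nonneg_pos)
    show "\<exists>d>0. \<forall>x. norm (x - x0) < d \<longrightarrow> (\<forall>z\<in>space (lebesgue_on F). norm (?g x z - ?g x0 z) \<le> e * \<bar>f z\<bar>)"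
    proof (intro exI[of _ d'] conjI d' allI impI ballI)
      fix x z assume x: "norm (x - x0) < d'" and "z \<in> space (lebesgue_on F)"
      then have z: "z \<in> F" by (simp add: space_restrict_space)
      have x1: "norm x \<le> norm x0 + 1" using x norm_triangle_ineq2[of x x0] by (simp add: d'_def)
      have inA: "\<tau> *\<^sub>R z - (\<tau> - 1) *\<^sub>R y \<in> cball 0 A" if "norm y \<le> norm x0 + 1" for y
      proof -
        have "norm (\<tau> *\<^sub>R z - (\<tau> - 1) *\<^sub>R y) \<le> \<bar>\<tau>\<bar> * norm z + \<bar>\<tau> - 1\<bar> * norm y"
          by (rule order_trans[OF norm_triangle_ineq4]) simp
        also have "\<dots> \<le> A" unfolding A_def using a[OF z] that by (intro add_mono mult_left_mono) auto
        finally show ?thesis by simp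
      qed
      have "dist (\<tau> *\<^sub>R z - (\<tau> - 1) *\<^sub>R x) (\<tau> *\<^sub>R z - (\<tau> - 1) *\<^sub>R x0) = \<bar>\<tau> - 1\<bar> * norm (x - x0)"
      proof -
        have "(\<tau> *\<^sub>R z - (\<tau> - 1) *\<^sub>R x) - (\<tau> *\<^sub>R z - (\<tau> - 1) *\<^sub>R x0) = (\<tau> - 1) *\<^sub>R (x0 - x)" by (simp add: algebra_simps)
        then show ?thesis by (simp add: dist_norm norm_minus_commute)
      qed
      also have "\<dots> \<le> (\<bar>\<tau> - 1\<bar> + 1) * norm (x - x0)" by (simp add: mult_right_mono)
      also have "\<dots> < (\<bar>\<tau> - 1\<bar> + 1) * (d / (\<bar>\<tau> - 1\<bar> + 1))"
        using x by (intro mult_strict_left_mono) (auto simp: d'_def add_nonneg_pos)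
      also have "\<dots> = d" by (simp add: add_nonneg_eq_0_iff)
      finally have "dist (?b (\<tau> *\<^sub>R z - (\<tau> - 1) *\<^sub>R x)) (?b (\<tau> *\<^sub>R z - (\<tau> - 1) *\<^sub>R x0)) < e'"
        using d(2)[OF inA inA] x1 by simp
      then have n: "norm (?b (\<tau> *\<^sub>R z - (\<tau> - 1) *\<^sub>R x) - ?b (\<tau> *\<^sub>R z - (\<tau> - 1) *\<^sub>R x0)) \<le> e'"
        by (simp add: dist_norm)
      have "?g x z - ?g x0 z = (f z * ?C) *\<^sub>R (?b (\<tau> *\<^sub>R z - (\<tau> - 1) *\<^sub>R x) - ?b (\<tau> *\<^sub>R z - (\<tau> - 1) *\<^sub>R x0))"
        by (simp only: scaleR_diff_right scaleR_scaleR)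
      then have "norm (?g x z - ?g x0 z) = \<bar>f z\<bar> * (\<bar>?C\<bar> * norm (?b (\<tau> *\<^sub>R z - (\<tau> - 1) *\<^sub>R x) - ?b (\<tau> *\<^sub>R z - (\<tau> - 1) *\<^sub>R x0)))"
        by (simp only: norm_scaleR abs_mult mult.assoc)
      also have "\<dots> \<le> \<bar>f z\<bar> * ((\<bar>?C\<bar> + 1) * e')"
        by (intro mult_left_mono mult_mono n) auto
      also have "\<dots> = e * \<bar>f z\<bar>" by (simp add: e'_def add_nonneg_eq_0_iff)
      finally show "norm (?g x z - ?g x0 z) \<le> e * \<bar>f z\<bar>" .
    qed
  qed
  then show ?thesis by (simp add: smooth_def[abs_def] smooth_grad_def[abs_def])
qed

text \<open>The kernel depends on \<open>x\<close> and \<open>z\<close> only through a linear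
  combination, so its gradient in \<open>x\<close> is (1 - \<tau>) / \<tau> times its gradient in
  \<open>z\<close>. As a function of \<open>z\<close> it is a test function on \<open>F\<close> by
  the star shape, so the divergence of the smoothed field is a weak divergence tested against
  it.\<close>

lemma smooth_div_free:
  assumes u: "in_L2 F u" and df: "\<And>\<phi> g. test_pair F \<phi> g \<Longrightarrow> (\<integral>x. u x \<bullet> g x \<partial>lebesgue_on F) = 0"
    and \<tau>: "\<tau> \<ge> 2" and x: "x \<in> F"
  shows "smooth_grad \<tau> (\<lambda>z. u z $ 1) x $ 1 + smooth_grad \<tau> (\<lambda>z. u z $ 2) x $ 2 = 0"
proof -
  let ?b = "\<lambda>z. bump_grad c (R / 2) (\<tau> *\<^sub>R z - (\<tau> - 1) *\<^sub>R x)"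
  let ?C = "\<tau>\<^sup>2 / bump_mass * (1 - \<tau>)"
  have bc: "continuous_on UNIV (\<lambda>z. ?C *\<^sub>R ?b z)"
    by (intro continuous_intros continuous_on_compose2[OF continuous_on_grad[OF has_grad_bump]]; simp)
  have bL: "in_L2 F (\<lambda>z. ?C *\<^sub>R ?b z)" by (rule in_L2_continuous[OF bc F_meas(1) bdF])
  have uL: "in_L2 F (\<lambda>z. u z $ i)" for i by (rule in_L2_component[OF u F_meas(2)])
  have nth: "smooth_grad \<tau> (\<lambda>z. u z $ i) x $ i = (\<integral>z. u z $ i * (?C * ?b z $ i) \<partial>lebesgue_on F)" for i
  proof -
    have "smooth_grad \<tau> (\<lambda>z. u z $ i) x $ i = (\<integral>z. (u z $ i *\<^sub>R (?C *\<^sub>R ?b z)) $ i \<partial>lebesgue_on F)"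
      unfolding smooth_grad_def
      by (rule integral_bounded_linear[OF bounded_linear_vec_nth integrable_scaleR_L2[OF uL bL], symmetric])
    then show ?thesis by (simp only: vector_scaleR_component real_scaleR_def)
  qed
  have int: "integrable (lebesgue_on F) (\<lambda>z. u z $ i * (?C * ?b z $ i))" for i
    using integrable_inner_L2[OF uL in_L2_component[OF bL F_meas(2)], of i i] by simp
  have "smooth_grad \<tau> (\<lambda>z. u z $ 1) x $ 1 + smooth_grad \<tau> (\<lambda>z. u z $ 2) x $ 2 = (\<integral>z. u z \<bullet> (?C *\<^sub>R ?b z) \<partial>lebesgue_on F)"
    unfolding nth using int by (simp add: inner_real2)
  also have "\<dots> = ?C / \<tau> * (\<integral>z. u z \<bullet> (\<tau> *\<^sub>R ?b z) \<partial>lebesgue_on F)"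
  proof -
    have "u z \<bullet> (?C *\<^sub>R ?b z) = ?C / \<tau> * (u z \<bullet> (\<tau> *\<^sub>R ?b z))" for z using \<tau> by simp
    then show ?thesis by (simp only: Bochner_Integration.integral_mult_right_zero)
  qed
  also have "(\<integral>z. u z \<bullet> (\<tau> *\<^sub>R ?b z) \<partial>lebesgue_on F) = 0"
  proof (rule df[of "\<lambda>z. bump c (R / 2) (\<tau> *\<^sub>R z - (\<tau> - 1) *\<^sub>R x)"])
    have e: "\<tau> *\<^sub>R z - (\<tau> - 1) *\<^sub>R x = - (\<tau> - 1) *\<^sub>R x + \<tau> *\<^sub>R z" for z by (simp add: algebra_simps)
    have g: "has_grad (\<lambda>z. bump c (R / 2) (\<tau> *\<^sub>R z - (\<tau> - 1) *\<^sub>R x)) (\<lambda>z. \<tau> *\<^sub>R ?b z)"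
      unfolding e by (rule has_grad_shift[OF has_grad_bump])
    let ?K = "(\<lambda>y. (1 - 1 / \<tau>) *\<^sub>R x + (1 / \<tau>) *\<^sub>R y) ` cball c (R / 2)"
    have "compact ?K" by (intro compact_continuous_image continuous_intros compact_cball)
    moreover have "?K \<subseteq> F"
    proof
      fix z assume "z \<in> ?K"
      then obtain y where y: "z = (1 - 1 / \<tau>) *\<^sub>R x + (1 / \<tau>) *\<^sub>R y" "y \<in> cball c (R / 2)" by (rule imageE)
      then have "y \<in> ball c R" using R_pos by auto
      from star'[OF x this, of "1 / \<tau>"] \<tau> show "z \<in> F" unfolding y(1) by simp
    qed
    moreover have "bump c (R / 2) (\<tau> *\<^sub>R z - (\<tau> - 1) *\<^sub>R x) = 0" if "z \<notin> ?K" for z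
    proof (rule bump_outside(1))
      show "\<tau> *\<^sub>R z - (\<tau> - 1) *\<^sub>R x \<notin> cball c (R / 2)"
      proof
        assume "\<tau> *\<^sub>R z - (\<tau> - 1) *\<^sub>R x \<in> cball c (R / 2)"
        moreover have "z = (1 - 1 / \<tau>) *\<^sub>R x + (1 / \<tau>) *\<^sub>R (\<tau> *\<^sub>R z - (\<tau> - 1) *\<^sub>R x)"
          using \<tau> by (simp add: algebra_simps)
        ultimately show False using that by (metis (no_types, lifting) image_eqI)
      qed
    qed (use R_pos in simp)
    ultimately show "test_pair F (\<lambda>z. bump c (R / 2) (\<tau> *\<^sub>R z - (\<tau> - 1) *\<^sub>R x)) (\<lambda>z. \<tau> *\<^sub>R ?b z)"
      using g unfolding test_pair_def by blast
  qed
  finally show ?thesis by simp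
qed

text \<open>Schur test: the kernel is split into two square roots, its integral over
  \<open>z\<close> is 1, and its integral over \<open>x\<close> is at most 4, whence the factor 2
  for norms.\<close>

lemma smooth_bound:
  assumes f: "in_L2 F f" and \<tau>: "\<tau> \<ge> 2"
  shows "L2_norm F (smooth \<tau> f) \<le> 2 * L2_norm F f"
proof -
  let ?M = "lebesgue_on F"
  interpret M: finite_measure ?M by (rule finite_measure_lebesgue_on[OF F_meas(1)])
  interpret P: pair_sigma_finite ?M ?M ..
  have fm[measurable]: "f \<in> borel_measurable ?M" by (rule in_L2_meas[OF f])
  have id[measurable]: "(\<lambda>x. x) \<in> borel_measurable ?M" by (intro measurable_restrict_space1 measurable_completion) simp
  have bm[measurable]: "bump c (R / 2) \<in> borel_measurable borel" by (rule bump_borel)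
  have km[measurable]: "(\<lambda>z. ker \<tau> x z) \<in> borel_measurable ?M" for x unfolding ker_def by measurable
  have pt: "ennreal ((smooth \<tau> f x)\<^sup>2) \<le> (\<integral>\<^sup>+z. ennreal (ker \<tau> x z) * ennreal ((f z)\<^sup>2) \<partial>?M)" if x: "x \<in> F" for x
  proof -
    have "\<bar>smooth \<tau> f x\<bar> \<le> (\<integral>z. \<bar>ker \<tau> x z * f z\<bar> \<partial>?M)" unfolding smooth_def by simp
    then have "ennreal \<bar>smooth \<tau> f x\<bar> \<le> ennreal (\<integral>z. \<bar>ker \<tau> x z * f z\<bar> \<partial>?M)" by (rule ennreal_leI)
    also have "\<dots> = (\<integral>\<^sup>+z. ennreal \<bar>ker \<tau> x z * f z\<bar> \<partial>?M)"
      by (rule nn_integral_eq_integral[symmetric]) (use ker_f_integrable[OF f] in auto)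
    also have "\<dots> = (\<integral>\<^sup>+z. ennreal (sqrt (ker \<tau> x z)) * ennreal (sqrt (ker \<tau> x z) * \<bar>f z\<bar>) \<partial>?M)"
    proof (rule nn_integral_cong)
      fix z
      have "\<bar>ker \<tau> x z * f z\<bar> = sqrt (ker \<tau> x z) * (sqrt (ker \<tau> x z) * \<bar>f z\<bar>)"
        using ker_nonneg[of \<tau> x z] by (simp add: abs_mult mult.assoc[symmetric])
      then show "ennreal \<bar>ker \<tau> x z * f z\<bar> = ennreal (sqrt (ker \<tau> x z)) * ennreal (sqrt (ker \<tau> x z) * \<bar>f z\<bar>)"
        using ker_nonneg[of \<tau> x z] by (simp add: ennreal_mult'[symmetric])
    qed
    finally have "(ennreal \<bar>smooth \<tau> f x\<bar>)\<^sup>2 \<le> (\<integral>\<^sup>+z. ennreal (sqrt (ker \<tau> x z)) * ennreal (sqrt (ker \<tau> x z) * \<bar>f z\<bar>) \<partial>?M)\<^sup>2"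
      by (rule power_mono) simp
    also have "\<dots> \<le> (\<integral>\<^sup>+z. (ennreal (sqrt (ker \<tau> x z)))\<^sup>2 \<partial>?M) * (\<integral>\<^sup>+z. (ennreal (sqrt (ker \<tau> x z) * \<bar>f z\<bar>))\<^sup>2 \<partial>?M)"
      by (rule Cauchy_Schwarz_nn_integral) measurable
    also have "(\<integral>\<^sup>+z. (ennreal (sqrt (ker \<tau> x z)))\<^sup>2 \<partial>?M) = (\<integral>\<^sup>+z. ennreal (ker \<tau> x z) \<partial>?M)"
      using ker_nonneg by (simp add: ennreal_power)
    also have "\<dots> = ennreal (\<integral>z. ker \<tau> x z \<partial>?M)"
      by (rule nn_integral_eq_integral[OF integrable_L2_1[OF ker_L2 F_meas(1)]]) (use ker_nonneg in simp)
    also have "\<dots> = 1" using ker_integral[OF \<tau> x] by simp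
    also have "(\<integral>\<^sup>+z. (ennreal (sqrt (ker \<tau> x z) * \<bar>f z\<bar>))\<^sup>2 \<partial>?M) = (\<integral>\<^sup>+z. ennreal (ker \<tau> x z) * ennreal ((f z)\<^sup>2) \<partial>?M)"
      using ker_nonneg by (simp add: ennreal_power power_mult_distrib ennreal_mult)
    finally show ?thesis by (simp add: ennreal_power)
  qed
  have sL: "in_L2 F (smooth \<tau> f)" by (rule in_L2_continuous[OF has_grad_continuous_on[OF has_grad_smooth[OF f]] F_meas(1) bdF])
  have "ennreal ((L2_norm F (smooth \<tau> f))\<^sup>2) = (\<integral>\<^sup>+x. ennreal ((smooth \<tau> f x)\<^sup>2) \<partial>?M)"
    unfolding L2_norm_sq using sL by (subst nn_integral_eq_integral[symmetric]) (auto simp: in_L2_def)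
  also have "\<dots> \<le> (\<integral>\<^sup>+x. \<integral>\<^sup>+z. ennreal (ker \<tau> x z) * ennreal ((f z)\<^sup>2) \<partial>?M \<partial>?M)"
    by (rule nn_integral_mono) (use pt F_meas in \<open>auto simp: space_restrict_space\<close>)
  also have "\<dots> = (\<integral>\<^sup>+z. \<integral>\<^sup>+x. ennreal (ker \<tau> x z) * ennreal ((f z)\<^sup>2) \<partial>?M \<partial>?M)"
    by (rule P.Fubini'[symmetric]) (unfold ker_def, measurable)
  also have "\<dots> \<le> (\<integral>\<^sup>+z. 4 * ennreal ((f z)\<^sup>2) \<partial>?M)"
  proof (rule nn_integral_mono)
    fix z
    have kx: "(\<lambda>x. ennreal (ker \<tau> x z)) \<in> borel_measurable ?M" unfolding ker_def by measurable
    have "(\<integral>\<^sup>+x. ennreal (ker \<tau> x z) * ennreal ((f z)\<^sup>2) \<partial>?M) = (\<integral>\<^sup>+x. ennreal (ker \<tau> x z) \<partial>?M) * ennreal ((f z)\<^sup>2)"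
      by (rule nn_integral_multc[OF kx])
    also have "(\<integral>\<^sup>+x. ennreal (ker \<tau> x z) \<partial>?M) = (\<integral>\<^sup>+x. ennreal (ker \<tau> x z) * indicator F x \<partial>lebesgue)"
      by (rule nn_integral_restrict_space) (use F_meas in simp)
    also have "\<dots> \<le> (\<integral>\<^sup>+x. ennreal (ker \<tau> x z) \<partial>lebesgue)" by (rule nn_integral_mono) (auto simp: indicator_def)
    also have "\<dots> = (\<integral>\<^sup>+x. ennreal (ker \<tau> x z) \<partial>lborel)" by (rule nn_integral_completion)
    also have "\<dots> \<le> 4" by (rule ker_integral_x[OF \<tau>])
    finally show "(\<integral>\<^sup>+x. ennreal (ker \<tau> x z) * ennreal ((f z)\<^sup>2) \<partial>?M) \<le> 4 * ennreal ((f z)\<^sup>2)" by (simp add: mult_right_mono)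
  qed
  also have "\<dots> = 4 * ennreal ((L2_norm F f)\<^sup>2)"
    unfolding L2_norm_sq using f by (simp add: nn_integral_cmult nn_integral_eq_integral in_L2_def)
  also have "\<dots> = ennreal (4 * (L2_norm F f)\<^sup>2)" by (simp add: ennreal_mult)
  finally have "(L2_norm F (smooth \<tau> f))\<^sup>2 \<le> (2 * L2_norm F f)\<^sup>2" by (simp add: power_mult_distrib)
  then show ?thesis by (rule power2_le_imp_le) simp
qed

text \<open>For a continuous function the kernel averages over points within h / \<tau>, so uniform
  continuity on the closure gives uniform convergence. The general case follows by density and
  \<open>smooth_bound\<close>.\<close>

lemma smooth_converges:
  assumes f: "in_L2 F f" and e: "e > 0"
  shows "\<exists>\<tau>0\<ge>2. \<forall>\<tau>\<ge>\<tau>0. L2_norm F (\<lambda>x. f x - smooth \<tau> f x) < e"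
proof -
  \<comment> \<open>The error f - g occurs once directly and with factor 2 through
    \<open>smooth_bound\<close>; three sixths and the half reserved for the continuous part make up
    \<open>e\<close>.\<close>
  obtain g where g: "continuous_on UNIV g" and fg: "L2_norm F (\<lambda>x. f x - g x) < e / 6"
    using L2_dense_continuous[OF F_meas(1) f, of "e / 6"] e by auto
  have gL: "in_L2 F g" by (rule in_L2_continuous[OF g F_meas(1) bdF])
  define m where "m = sqrt (measure lebesgue F) + 1"
  have m: "m > 0" unfolding m_def by (simp add: add_nonneg_pos)
  define e' where "e' = e / (2 * m)"
  have e': "e' > 0" using e m by (simp add: e'_def)
  have "uniformly_continuous_on (closure F) g"
    by (rule compact_uniformly_continuous[OF continuous_on_subset[OF g]]) (use bdF in auto)
  then obtain d where d: "d > 0" "\<And>x z. x \<in> closure F \<Longrightarrow> z \<in> closure F \<Longrightarrow> dist z x < d \<Longrightarrow> dist (g z) (g x) < e'"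
    unfolding uniformly_continuous_on_def using e' by meson
  \<comment> \<open>Beyond this value h / \<tau> is smaller than the modulus
    \<open>d\<close>.\<close>
  define \<tau>0 where "\<tau>0 = max 2 (h / d + 1)"
  show ?thesis
  proof (intro exI[of _ \<tau>0] conjI allI impI)
    show "\<tau>0 \<ge> 2" by (simp add: \<tau>0_def)
    fix \<tau> assume "\<tau> \<ge> \<tau>0"
    then have \<tau>: "\<tau> \<ge> 2" "\<tau> > h / d" by (auto simp: \<tau>0_def)
    then have hd: "h / \<tau> < d" using d(1) by (simp add: field_simps)
    have gb: "norm (g x - smooth \<tau> g x) \<le> e'" if x: "x \<in> F" for x
    proof -
      have i: "integrable (lebesgue_on F) (ker \<tau> x)" by (rule integrable_L2_1[OF ker_L2 F_meas(1)])
      have "smooth \<tau> g x - g x = (\<integral>z. ker \<tau> x z * g z \<partial>lebesgue_on F) - (\<integral>z. ker \<tau> x z * g x \<partial>lebesgue_on F)"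
        using ker_integral[OF \<tau>(1) x] by (simp add: smooth_def)
      also have "\<dots> = (\<integral>z. ker \<tau> x z * (g z - g x) \<partial>lebesgue_on F)"
        using ker_f_integrable[OF gL] i by (simp add: right_diff_distrib)
      also have "norm \<dots> \<le> (\<integral>z. norm (ker \<tau> x z * (g z - g x)) \<partial>lebesgue_on F)" by (rule integral_norm_bound)
      also have "\<dots> \<le> (\<integral>z. ker \<tau> x z * e' \<partial>lebesgue_on F)"
      proof (rule integral_mono)
        show "integrable (lebesgue_on F) (\<lambda>z. norm (ker \<tau> x z * (g z - g x)))"
          using ker_f_integrable[OF gL] i by (intro integrable_norm) (simp add: right_diff_distrib)
        show "integrable (lebesgue_on F) (\<lambda>z. ker \<tau> x z * e')" using i by simp
        fix z assume "z \<in> space (lebesgue_on F)"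
        show "norm (ker \<tau> x z * (g z - g x)) \<le> ker \<tau> x z * e'"
        proof (cases "ker \<tau> x z = 0")
          case False
          have "z \<in> F" "dist z x < d" using ker_support[OF \<tau>(1) x False] hd by (auto simp: dist_norm)
          moreover have "x \<in> closure F" "z \<in> closure F" using x \<open>z \<in> F\<close> closure_subset by auto
          ultimately have "\<bar>g z - g x\<bar> \<le> e'" using d(2)[of x z] by (simp add: dist_norm)
          then show ?thesis using ker_nonneg[of \<tau> x z] by (simp add: abs_mult mult_left_mono)
        qed simp
      qed
      also have "\<dots> = e'" using ker_integral[OF \<tau>(1) x] by simp
      finally show ?thesis by (simp add: norm_minus_commute)
    qed
    have sL: "in_L2 F (smooth \<tau> w)" if "in_L2 F w" for w
      by (rule in_L2_continuous[OF has_grad_continuous_on[OF has_grad_smooth[OF that]] F_meas(1) bdF])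
    have dL: "in_L2 F (\<lambda>x. f x - g x)" by (rule in_L2_diff[OF f gL])
    have lin: "smooth \<tau> (\<lambda>x. f x - g x) x = smooth \<tau> f x - smooth \<tau> g x" for x
      using ker_f_integrable[OF f] ker_f_integrable[OF gL] by (simp add: smooth_def right_diff_distrib)
    have gn: "L2_norm F (\<lambda>x. g x - smooth \<tau> g x) \<le> e' * sqrt (measure lebesgue F)"
      by (rule L2_norm_bounded[OF F_meas(1) gb]) (use e' in_L2_meas[OF in_L2_diff[OF gL sL[OF gL]]] in auto)
    also have "\<dots> \<le> e' * m" using e' by (intro mult_left_mono) (auto simp: m_def)
    also have "\<dots> = e / 2" using m by (simp add: e'_def)
    finally have gn: "L2_norm F (\<lambda>x. g x - smooth \<tau> g x) \<le> e / 2" .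
    have "L2_norm F (\<lambda>x. f x - smooth \<tau> f x) = L2_norm F (\<lambda>x. ((f x - g x) - smooth \<tau> (\<lambda>x. f x - g x) x) + (g x - smooth \<tau> g x))"
      by (simp add: lin)
    also have "\<dots> \<le> L2_norm F (\<lambda>x. (f x - g x) - smooth \<tau> (\<lambda>x. f x - g x) x) + L2_norm F (\<lambda>x. g x - smooth \<tau> g x)"
      by (intro L2_norm_triangle in_L2_diff[OF dL sL[OF dL]] in_L2_diff[OF gL sL[OF gL]])
    also have "\<dots> \<le> (L2_norm F (\<lambda>x. f x - g x) + L2_norm F (smooth \<tau> (\<lambda>x. f x - g x))) + e / 2"
      by (rule add_mono[OF L2_norm_triangle_diff[OF dL sL[OF dL]] gn])
    also have "\<dots> \<le> (L2_norm F (\<lambda>x. f x - g x) + 2 * L2_norm F (\<lambda>x. f x - g x)) + e / 2"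
      using smooth_bound[OF dL \<tau>(1)] by simp
    also have "\<dots> < e" using fg by simp
    finally show "L2_norm F (\<lambda>x. f x - smooth \<tau> f x) < e" .
  qed
qed

text \<open>Poincare lemma by radial integration from \<open>c\<close>. The equation asks for the
  partial derivatives -U2 and U1 of the potential, and a vanishing divergence is the closedness of
  the corresponding 1-form on \<open>F\<close>.\<close>

lemma div_free_potential:
  assumes U1: "has_grad U1 G1" and U2: "has_grad U2 G2" and div: "\<And>x. x \<in> F \<Longrightarrow> G1 x $ 1 + G2 x $ 2 = 0"
  shows "\<exists>\<eta> g. has_grad \<eta> g \<and> (\<forall>x\<in>F. rot90 (g x) = vector [U1 x, U2 x])"
proof -
  define z where "z = (\<lambda>(x :: real^2) s. c + s *\<^sub>R (x - c))"
  define f where "f = (\<lambda>x s. U1 (z x s) * (x - c) $ 2 - U2 (z x s) * (x - c) $ 1)"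
  define g where "g = (\<lambda>x s. (U1 (z x s) *\<^sub>R axis 2 1 + (s * (x - c) $ 2) *\<^sub>R G1 (z x s)) -
      (U2 (z x s) *\<^sub>R axis 1 1 + (s * (x - c) $ 1) *\<^sub>R G2 (z x s)))"
  let ?M = "lebesgue_on {0..1::real}"
  have coord: "has_grad (\<lambda>x. (x - c) $ i) (\<lambda>x. axis i 1)" for i
    using has_grad_diff[OF has_grad_coord has_grad_const[of "c $ i"], of i] by simp
  have shift: "has_grad (\<lambda>x. V (z x s)) (\<lambda>x. s *\<^sub>R V' (z x s))" if "has_grad V V'" for V V' s
  proof -
    have "z x s = (c - s *\<^sub>R c) + s *\<^sub>R x" for x by (simp add: z_def algebra_simps)
    then show ?thesis using has_grad_shift[OF that, of "c - s *\<^sub>R c" s] by simp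
  qed
  have fg: "has_grad (\<lambda>x. f x s) (\<lambda>x. g x s)" for s
    using has_grad_diff[OF has_grad_mult[OF shift[OF U1, of s] coord[of 2]] has_grad_mult[OF shift[OF U2, of s] coord[of 1]]]
    by (simp add: f_def g_def mult.commute)
  have zc: "continuous_on UNIV (\<lambda>a::(real^2) \<times> real. z (fst a) (snd a))"
    unfolding z_def by (intro continuous_intros)
  have cU: "continuous_on UNIV (\<lambda>a::(real^2) \<times> real. V (z (fst a) (snd a)))"
    if "continuous_on UNIV V" for V :: "real^2 \<Rightarrow> 'x::topological_space"
    by (rule continuous_on_compose2[OF that zc]) simp
  have gc: "continuous_on UNIV (\<lambda>a. g (fst a) (snd a))"
    unfolding g_def
    by (intro continuous_intros cU has_grad_continuous_on[OF U1] has_grad_continuous_on[OF U2] continuous_on_grad[OF U1] continuous_on_grad[OF U2])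
  have gcs: "continuous_on UNIV (g x)" for x
    using continuous_on_compose2[OF gc, of UNIV "\<lambda>s. (x, s)"] by (simp add: continuous_on_Pair)
  have fc: "continuous_on UNIV (\<lambda>a. f (fst a) (snd a))"
    unfolding f_def by (intro continuous_intros cU has_grad_continuous_on[OF U1] has_grad_continuous_on[OF U2])
  have fcs: "continuous_on UNIV (f x)" for x
    using continuous_on_compose2[OF fc, of UNIV "\<lambda>s. (x, s)"] by (simp add: continuous_on_Pair)
  have one: "in_L2 {0..1::real} (\<lambda>s. 1 :: real)" by (rule in_L2_continuous) auto
  have gi: "integrable ?M (g x)" for x
    using integrable_scaleR_L2[OF one in_L2_continuous[OF gcs]] by simp
  have fi: "integrable ?M (f x)" for x
    using integrable_L2_1[OF in_L2_continuous[OF fcs]] by simp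
  have \<eta>: "has_grad (\<lambda>x. \<integral>s. f x s \<partial>?M) (\<lambda>x. \<integral>s. g x s \<partial>?M)"
  proof (rule has_grad_integral[where B = "\<lambda>_. 1"])
    show "integrable ?M (\<lambda>_. 1 :: real)" using integrable_L2_1[OF one] by simp
    fix x0 :: "real^2" and e :: real assume e: "e > 0"
    have "continuous_on (UNIV \<times> {0..1}) (\<lambda>a. g (fst a) (snd a))" by (rule continuous_on_subset[OF gc]) simp
    then obtain X where X: "x0 \<in> X" "open X" "\<forall>x\<in>X \<inter> UNIV. \<forall>s\<in>{0..1}. dist (g (fst (x, s)) (snd (x, s))) (g (fst (x0, s)) (snd (x0, s))) \<le> e"
      by (rule continuous_on_prod_compactE[OF _ _ _ e, of UNIV "{0..1}"]) auto
    then obtain d where d: "d > 0" "ball x0 d \<subseteq> X" using open_contains_ball by blast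
    show "\<exists>d>0. \<forall>x. norm (x - x0) < d \<longrightarrow> (\<forall>s\<in>space ?M. norm (g x s - g x0 s) \<le> e * 1)"
    proof (intro exI[of _ d] conjI d(1) allI impI ballI)
      fix x s assume "norm (x - x0) < d" and s: "s \<in> space ?M"
      then have "x \<in> X" using d(2) by (auto simp: subset_iff dist_norm norm_minus_commute)
      moreover have "s \<in> {0..1}" using s by (simp add: space_restrict_space)
      ultimately have "dist (g x s) (g x0 s) \<le> e" using X(3) by simp
      then show "norm (g x s - g x0 s) \<le> e * 1" by (simp add: dist_norm)
    qed
  qed (use fg fi gi in auto)
  have val: "(\<integral>s. g x s \<partial>?M) $ i = (if i = 1 then - U2 x else U1 x)" if x: "x \<in> F" for x i
  proof -
    define y where "y = x - c"
    have zF: "z x s \<in> F" if "0 \<le> s" "s \<le> 1" for s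
      using star'[OF x, of c "1 - s"] R_pos that by (simp add: z_def algebra_simps)
    have dV: "((\<lambda>s. V (z x s)) has_real_derivative (V' (z x s) \<bullet> y)) (at s)" if "has_grad V V'" for V V' s
    proof -
      have "((\<lambda>s. c + s *\<^sub>R y) has_derivative (\<lambda>t. t *\<^sub>R y)) (at s)" by (auto intro!: derivative_eq_intros)
      from has_derivative_compose[OF this has_grad_derivative[OF that]]
      show ?thesis unfolding z_def y_def[symmetric] has_field_derivative_def by (simp add: mult.commute[of _ "_ \<bullet> _"])
    qed
    \<comment> \<open>Once the trace of the Jacobian vanishes, each component of the integrand
      \<open>g x s\<close> is the derivative in \<open>s\<close> of \<open>s\<close> times a
      component of the field, up to sign. The integral is then its value at
      \<open>s = 1\<close>.\<close>
    define P where "P = (\<lambda>s. if i = 1 then - (s * U2 (z x s)) else s * U1 (z x s))"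
    have i12: "i = 1 \<or> i = 2" by (rule exhaust_2)
    have dP: "(P has_real_derivative g x s $ i) (at s)" if s: "0 \<le> s" "s \<le> 1" for s
    proof -
      have tr: "G1 (z x s) $ 1 = - G2 (z x s) $ 2" using div[OF zF[OF s]] by simp
      show ?thesis
      proof (cases "i = 1")
        case True
        have "((\<lambda>s. - (s * U2 (z x s))) has_real_derivative - (U2 (z x s) + s * (G2 (z x s) \<bullet> y))) (at s)"
          by (auto intro!: derivative_eq_intros dV[OF U2])
        moreover have "g x s $ 1 = - (U2 (z x s) + s * (G2 (z x s) \<bullet> y))"
          unfolding g_def y_def[symmetric] by (simp add: tr inner_real2 axis_def algebra_simps)
        ultimately show ?thesis using True by (simp add: P_def)
      next
        case False
        then have i2: "i = 2" using i12 by simp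
        have "((\<lambda>s. s * U1 (z x s)) has_real_derivative (U1 (z x s) + s * (G1 (z x s) \<bullet> y))) (at s)"
          by (auto intro!: derivative_eq_intros dV[OF U1])
        moreover have "g x s $ 2 = U1 (z x s) + s * (G1 (z x s) \<bullet> y)"
          unfolding g_def y_def[symmetric] by (simp add: tr inner_real2 axis_def algebra_simps)
        ultimately show ?thesis using i2 by (simp add: P_def)
      qed
    qed
    have gic: "continuous_on UNIV (\<lambda>s. g x s $ i)" by (rule continuous_on_component[OF gcs])
    have "(\<integral>s. g x s \<partial>?M) $ i = (\<integral>s. g x s $ i \<partial>?M)"
      by (rule integral_bounded_linear[OF bounded_linear_vec_nth gi, symmetric])
    also have "\<dots> = (\<integral>s. indicator {0..1} s *\<^sub>R (g x s $ i) \<partial>lebesgue)"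
      by (rule integral_restrict_space) simp
    also have "\<dots> = (\<integral>s. indicator {0..1} s *\<^sub>R (g x s $ i) \<partial>lborel)"
      by (rule integral_completion) (use borel_continuous[OF gic] in simp)
    also have "\<dots> = (\<integral>s. g x s $ i * indicator {0..1} s \<partial>lborel)" by (simp add: mult.commute)
    also have "\<dots> = P 1 - P 0"
      by (rule integral_FTC_Icc_real) (use dP gic in \<open>auto simp: continuous_on_eq_continuous_at\<close>)
    also have "\<dots> = (if i = 1 then - U2 x else U1 x)" by (simp add: P_def z_def)
    finally show ?thesis .
  qed
  have "\<forall>x\<in>F. rot90 (\<integral>s. g x s \<partial>?M) = vector [U1 x, U2 x]"
    using val by (simp add: vec_eq_iff forall_2)
  then show ?thesis using \<eta> by blast
qed

text \<open>A square integrable field is too rough for the radial formula. It is first smoothed,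
  which keeps it free of divergence in \<open>F\<close>, and the smoothed field is then a genuine
  curl there.\<close>

lemma curl_dense:
  assumes u: "in_L2 F u" and df: "\<And>\<phi> g. test_pair F \<phi> g \<Longrightarrow> (\<integral>x. u x \<bullet> g x \<partial>lebesgue_on F) = 0"
    and e: "e > 0"
  shows "\<exists>\<eta> g. has_grad \<eta> g \<and> L2_norm F (\<lambda>x. u x - rot90 (g x)) \<le> e"
proof -
  have uL: "in_L2 F (\<lambda>x. u x $ i)" for i by (rule in_L2_component[OF u F_meas(2)])
  obtain t1 where t1: "t1 \<ge> 2" "\<And>\<tau>. \<tau> \<ge> t1 \<Longrightarrow> L2_norm F (\<lambda>x. u x $ 1 - smooth \<tau> (\<lambda>x. u x $ 1) x) < e / 2"
    using smooth_converges[OF uL, of "e / 2" 1] e by auto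
  obtain t2 where t2: "t2 \<ge> 2" "\<And>\<tau>. \<tau> \<ge> t2 \<Longrightarrow> L2_norm F (\<lambda>x. u x $ 2 - smooth \<tau> (\<lambda>x. u x $ 2) x) < e / 2"
    using smooth_converges[OF uL, of "e / 2" 2] e by auto
  define \<tau> where "\<tau> = max t1 t2"
  have \<tau>: "\<tau> \<ge> 2" "\<tau> \<ge> t1" "\<tau> \<ge> t2" using t1 t2 by (auto simp: \<tau>_def)
  define U1 where "U1 = smooth \<tau> (\<lambda>x. u x $ 1)"
  define U2 where "U2 = smooth \<tau> (\<lambda>x. u x $ 2)"
  have U: "has_grad U1 (smooth_grad \<tau> (\<lambda>x. u x $ 1))" "has_grad U2 (smooth_grad \<tau> (\<lambda>x. u x $ 2))"
    unfolding U1_def U2_def by (rule has_grad_smooth[OF uL])+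
  have "smooth_grad \<tau> (\<lambda>x. u x $ 1) x $ 1 + smooth_grad \<tau> (\<lambda>x. u x $ 2) x $ 2 = 0" if "x \<in> F" for x
    by (rule smooth_div_free[OF u _ \<tau>(1) that]) (rule df)
  from div_free_potential[OF U this] obtain \<eta> g where
    \<eta>: "has_grad \<eta> g" and g: "\<And>x. x \<in> F \<Longrightarrow> rot90 (g x) = vector [U1 x, U2 x]" by auto
  have UL: "in_L2 F U1" "in_L2 F U2"
    by (rule in_L2_continuous[OF has_grad_continuous_on[OF U(1)] F_meas(1) bdF] in_L2_continuous[OF has_grad_continuous_on[OF U(2)] F_meas(1) bdF])+
  define w1 where "w1 = (\<lambda>x. u x $ 1 - U1 x)"
  define w2 where "w2 = (\<lambda>x. u x $ 2 - U2 x)"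
  have wL: "in_L2 F w1" "in_L2 F w2" unfolding w1_def w2_def by (intro in_L2_diff uL UL)+
  have n1: "L2_norm F w1 \<le> e / 2" "L2_norm F w2 \<le> e / 2"
    using t1(2)[OF \<tau>(2)] t2(2)[OF \<tau>(3)] by (auto simp: w1_def w2_def U1_def U2_def)
  have "L2_norm F (\<lambda>x. u x - rot90 (g x)) \<le> e"
  proof (rule L2_norm_le)
    have "(\<integral>x. (norm (u x - rot90 (g x)))\<^sup>2 \<partial>lebesgue_on F) = (\<integral>x. (norm (w1 x))\<^sup>2 + (norm (w2 x))\<^sup>2 \<partial>lebesgue_on F)"
    proof (rule Bochner_Integration.integral_cong)
      fix x assume "x \<in> space (lebesgue_on F)"
      then have x: "x \<in> F" by (simp add: space_restrict_space)
      show "(norm (u x - rot90 (g x)))\<^sup>2 = (norm (w1 x))\<^sup>2 + (norm (w2 x))\<^sup>2"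
        unfolding power2_norm_eq_inner g[OF x] by (simp add: inner_real2 w1_def w2_def)
    qed simp
    also have "\<dots> = (L2_norm F w1)\<^sup>2 + (L2_norm F w2)\<^sup>2" using wL by (simp add: L2_norm_sq in_L2_def)
    also have "\<dots> \<le> (e / 2)\<^sup>2 + (e / 2)\<^sup>2" by (intro add_mono power_mono n1) auto
    also have "\<dots> \<le> e\<^sup>2" using e by (simp add: power2_eq_square)
    finally show "(\<integral>x. (norm (u x - rot90 (g x)))\<^sup>2 \<partial>lebesgue_on F) \<le> e\<^sup>2" .
  qed (use e in simp)
  then show ?thesis using \<eta> by blast
qed

section \<open>Polynomials in the scaled variable\<close>

lemma scaled_norm_le_1: "x \<in> F \<Longrightarrow> norm ((1 / h) *\<^sub>R (x - c)) \<le> 1"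
  using dist_F[OF c_in_F, of x] h_pos by (simp add: dist_norm norm_minus_commute)

lemma poly_L2_norm_le:
  assumes a: "\<And>y. d (c + h *\<^sub>R y) = (\<Sum>p\<in>degs k. a p * xpow p y)" and d: "d \<in> polys k"
  shows "L2_norm F d \<le> (\<Sum>p\<in>degs k. \<bar>a p\<bar>) * (h * sqrt unit_area)"
proof -
  let ?S = "\<Sum>p\<in>degs k. \<bar>a p\<bar>"
  have S: "?S \<ge> 0" by (rule sum_nonneg) simp
  have "L2_norm F d \<le> ?S * sqrt (measure lebesgue F)"
  proof (rule L2_norm_bounded[OF F_meas(1) _ S])
    fix x assume x: "x \<in> F"
    let ?y = "(1 / h) *\<^sub>R (x - c)"
    have "d x = (\<Sum>p\<in>degs k. a p * xpow p ?y)" using a[of ?y] h_pos by simp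
    also have "norm \<dots> \<le> (\<Sum>p\<in>degs k. \<bar>a p * xpow p ?y\<bar>)" by (simp add: sum_abs)
    also have "\<dots> \<le> ?S"
      by (rule sum_mono) (simp add: abs_mult mult_left_le abs_xpow_le_1[OF scaled_norm_le_1[OF x]])
    finally show "norm (d x) \<le> ?S" .
  qed (rule in_L2_meas[OF in_L2_continuous[OF continuous_on_polys[OF d] F_meas(1) bdF]])
  also have "\<dots> \<le> ?S * (h * sqrt unit_area)" by (rule mult_left_mono[OF area_le S])
  finally show ?thesis .
qed

text \<open>Monomials in the scaled variable are integrated in the first coordinate only. The new
  coefficients do not grow, since they are divided by positive integers, and undoing the scaling
  contributes one factor \<open>h\<close>.\<close>

lemma poly_antiderivative:
  assumes a: "\<And>y. d (c + h *\<^sub>R y) = (\<Sum>p\<in>degs k. a p * xpow p y)" and d: "d \<in> polys k"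
  shows "\<exists>P P'. P \<in> polys (k + 1) \<and> has_grad P P' \<and> (\<forall>x. P' x $ 1 = d x) \<and>
    L2_norm F P \<le> h * (\<Sum>p\<in>degs k. \<bar>a p\<bar>) * (h * sqrt unit_area)"
proof -
  define Q where "Q = (\<lambda>y. \<Sum>p\<in>degs k. (a p / (real (fst p) + 1)) * xpow (Suc (fst p), snd p) y)"
  define Q' where "Q' = (\<lambda>y. \<Sum>p\<in>degs k. (a p / (real (fst p) + 1)) *\<^sub>R xpow_grad (Suc (fst p), snd p) y)"
  have Q: "has_grad Q Q'" unfolding Q_def Q'_def by (intro has_grad_sum has_grad_cmult has_grad_xpow)
  have Qp: "Q \<in> polys (k + 1)" unfolding Q_def
    by (intro polys_sum polys_cmult polys_xpow) (auto simp: degs_def)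
  define s where "s = 1 / h"
  have s: "h * s = 1" "s > 0" using h_pos by (auto simp: s_def)
  define P where "P = (\<lambda>x. h * Q (- s *\<^sub>R c + s *\<^sub>R x))"
  define P' where "P' = (\<lambda>x. h *\<^sub>R (s *\<^sub>R Q' (- s *\<^sub>R c + s *\<^sub>R x)))"
  have y: "- s *\<^sub>R c + s *\<^sub>R x = s *\<^sub>R (x - c)" for x by (simp add: algebra_simps)
  have "P \<in> polys (k + 1)" unfolding P_def by (intro polys_cmult polys_scale Qp)
  moreover have P: "has_grad P P'" unfolding P_def P'_def by (intro has_grad_cmult has_grad_shift Q)
  moreover have "P' x $ 1 = d x" for x
  proof -
    have "P' x $ 1 = Q' (s *\<^sub>R (x - c)) $ 1" unfolding P'_def y using s by simp
    also have "\<dots> = (\<Sum>p\<in>degs k. a p * xpow p (s *\<^sub>R (x - c)))"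
      unfolding Q'_def sum_component
    proof (rule sum.cong[OF refl])
      fix p :: "nat \<times> nat"
      have "real (fst p) + 1 \<noteq> 0" by (simp add: add_nonneg_eq_0_iff)
      then show "((a p / (real (fst p) + 1)) *\<^sub>R xpow_grad (Suc (fst p), snd p) (s *\<^sub>R (x - c))) $ 1 = a p * xpow p (s *\<^sub>R (x - c))"
        by (simp add: xpow_grad_def xpow_def add.commute)
    qed
    also have "\<dots> = d x" using a[of "s *\<^sub>R (x - c)"] s by simp
    finally show ?thesis .
  qed
  moreover have "L2_norm F P \<le> h * (\<Sum>p\<in>degs k. \<bar>a p\<bar>) * (h * sqrt unit_area)"
  proof -
    let ?S = "\<Sum>p\<in>degs k. \<bar>a p\<bar>"
    have S: "h * ?S \<ge> 0" using h_pos by (simp add: sum_nonneg)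
    have "L2_norm F P \<le> (h * ?S) * sqrt (measure lebesgue F)"
    proof (rule L2_norm_bounded[OF F_meas(1) _ S])
      fix x assume x: "x \<in> F"
      have "\<bar>Q (s *\<^sub>R (x - c))\<bar> \<le> (\<Sum>p\<in>degs k. \<bar>(a p / (real (fst p) + 1)) * xpow (Suc (fst p), snd p) (s *\<^sub>R (x - c))\<bar>)"
        unfolding Q_def by (rule sum_abs)
      also have "\<dots> \<le> ?S"
      proof (rule sum_mono)
        fix p :: "nat \<times> nat"
        have "\<bar>a p / (real (fst p) + 1)\<bar> \<le> \<bar>a p\<bar>" by (simp add: field_simps mult_left_le)
        moreover have "\<bar>xpow (Suc (fst p), snd p) (s *\<^sub>R (x - c))\<bar> \<le> 1"
          by (rule abs_xpow_le_1) (use scaled_norm_le_1[OF x] in \<open>simp add: s_def\<close>)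
        ultimately have "\<bar>a p / (real (fst p) + 1)\<bar> * \<bar>xpow (Suc (fst p), snd p) (s *\<^sub>R (x - c))\<bar> \<le> \<bar>a p\<bar> * 1"
          by (intro mult_mono) auto
        then show "\<bar>(a p / (real (fst p) + 1)) * xpow (Suc (fst p), snd p) (s *\<^sub>R (x - c))\<bar> \<le> \<bar>a p\<bar>"
          by (simp add: abs_mult)
      qed
      finally have "h * \<bar>Q (s *\<^sub>R (x - c))\<bar> \<le> h * ?S" using h_pos by (simp add: mult_left_mono)
      then show "norm (P x) \<le> h * ?S" unfolding P_def y using h_pos by (simp add: abs_mult)
    qed (rule in_L2_meas[OF in_L2_continuous[OF has_grad_continuous_on[OF P] F_meas(1) bdF]])
    also have "\<dots> \<le> (h * ?S) * (h * sqrt unit_area)" by (rule mult_left_mono[OF area_le S])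
    finally show ?thesis .
  qed
  ultimately show ?thesis by blast
qed

end

section \<open>The two bounds\<close>

context star_polygon
begin

lemma F_ball_cball: "R = \<rho> * h \<Longrightarrow> ball c (\<rho> * h) \<subseteq> F"
  using ball_sub by simp

lemma L2_proj_norm_le:
  assumes v: "in_L2 F v"
  shows "L2_norm F (L2_proj k F v) \<le> L2_norm F v" "in_L2 F (L2_proj k F v)"
    "\<And>p. p \<in> vec_polys k \<Longrightarrow> L2_inner F v p = L2_inner F (L2_proj k F v) p"
proof -
  let ?q = "L2_proj k F v"
  have F0: "F \<noteq> {}" using c_in_F by auto
  note pr = L2_proj_props[where k = k, OF opF F0 bdF v]
  have L: "in_L2 F p" if "p \<in> vec_polys k" for p
    by (rule in_L2_continuous[OF continuous_on_vec_polys[OF that] F_meas(1) bdF])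
  show qL: "in_L2 F ?q" by (rule L[OF pr(1)])
  show orth: "L2_inner F v p = L2_inner F ?q p" if "p \<in> vec_polys k" for p
    using pr(2)[OF that] L2_inner_diff_left[OF v qL L[OF that]] by simp
  have "(L2_norm F ?q)\<^sup>2 = L2_inner F v ?q" using orth[OF pr(1)] by (simp add: L2_inner_self)
  also have "\<dots> \<le> L2_norm F v * L2_norm F ?q" using L2_inner_CS[OF v qL] by simp
  finally have *: "L2_norm F ?q * L2_norm F ?q \<le> L2_norm F v * L2_norm F ?q" by (simp add: power2_eq_square)
  show "L2_norm F ?q \<le> L2_norm F v"
  proof (cases "L2_norm F ?q = 0")
    case False
    then have "L2_norm F ?q > 0" using L2_norm_nonneg[of F ?q] by linarith
    then show ?thesis using * by simp
  qed simp
qed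

text \<open>\<open>poly_on\<close> fixes values on \<open>F\<close> only, so the weak derivatives
  are replaced by polynomials on the plane. The divergence identity is written with
  \<open>- v\<close>, the form in which \<open>bubble_const\<close> takes it.\<close>

lemma edge_spaceE:
  assumes "v \<in> edge_space k vs F"
  obtains d r g where "in_L2 F v" "d \<in> polys k" "\<forall>\<phi> \<phi>'. test_pair F \<phi> \<phi>' \<longrightarrow> (\<integral>x. d x * \<phi> x \<partial>lebesgue_on F) = (\<integral>x. - v x \<bullet> \<phi>' x \<partial>lebesgue_on F)"
    "r \<in> polys (k - 1)" "has_weak_rot F v r"
    "has_tangential_trace vs F v g" "\<forall>i<n. poly_on k (edge vs i) (g i)"
proof -
  from assms obtain d0 r0 g where v: "in_L2 F v" and d0: "has_weak_div F v d0" "poly_on k F d0"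
    and r0: "has_weak_rot F v r0" "poly_on (k - 1) F r0"
    and g: "has_tangential_trace vs F v g" "\<forall>i<n. poly_on k (edge vs i) (g i)"
    unfolding edge_space_def by blast
  obtain d where d: "d \<in> polys k" "\<And>x. x \<in> F \<Longrightarrow> d0 x = d x" using d0(2) by (auto simp: poly_on_def)
  obtain r where r: "r \<in> polys (k - 1)" "\<And>x. x \<in> F \<Longrightarrow> r0 x = r x" using r0(2) by (auto simp: poly_on_def)
  have cong: "(\<integral>x. a x * \<phi> x \<partial>lebesgue_on F) = (\<integral>x. b x * \<phi> x \<partial>lebesgue_on F)"
    if "\<And>x. x \<in> F \<Longrightarrow> a x = b x" for a b \<phi> :: "real^2 \<Rightarrow> real"
    by (rule Bochner_Integration.integral_cong) (use that in \<open>auto simp: space_restrict_space\<close>)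
  have "has_weak_rot F v r"
    using r0(1) in_L2_continuous[OF continuous_on_polys[OF r(1)] F_meas(1) bdF] cong[of r0 r, OF r(2)]
    by (simp add: has_weak_rot_def)
  moreover have "(\<integral>x. d x * \<phi> x \<partial>lebesgue_on F) = (\<integral>x. - v x \<bullet> \<phi>' x \<partial>lebesgue_on F)" if "test_pair F \<phi> \<phi>'" for \<phi> \<phi>'
    using has_weak_div_test[OF d0(1) that] cong[of d0 d, OF d(2)] by simp
  ultimately show thesis using v d(1) r(1) g by (intro that) auto
qed

lemma weak_rot_norm:
  assumes "has_weak_rot F v r"
  shows "L2_norm F (weak_rot F v) = L2_norm F r"
proof -
  have "has_weak_rot F v (weak_rot F v)" unfolding weak_rot_def by (rule someI[of "has_weak_rot F v", OF assms])
  then show ?thesis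
    using weak_rot_unique[OF opF bdF _ assms] assms
    by (intro L2_norm_cong_AE) (auto simp: has_weak_rot_def in_L2_def)
qed

lemma S_edge_eq:
  assumes "has_weak_rot F v r"
  shows "S_edge k vs F v v = h * (\<Sum>i<n. edge_inner vs i (tangential_trace vs F v i) (tangential_trace vs F v i))
     + h\<^sup>2 * (L2_norm F r)\<^sup>2 + (L2_norm F (L2_proj (k + 1) F v))\<^sup>2"
  unfolding S_edge_def L2_inner_self weak_rot_norm[OF assms] ..

text \<open>The squared norm of \<open>v\<close> is split into its products with \<open>p\<close>,
  with a curl, and with the remaining error. The first two are bounded by the root of
  \<open>S_edge\<close> times the norm of \<open>v\<close>. The trace chosen in
  \<open>S_edge\<close> enters directly, since it satisfies Green's formula.\<close>

lemma lower_bound: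
  assumes R: "R = \<rho> * h" and bub: "bubble_const k \<rho> C" and C: "C > 0" and v: "v \<in> edge_space k vs F"
  defines "C1 \<equiv> C * sqrt unit_area" and "C3 \<equiv> sqrt ((12 / \<rho>\<^sup>2 + 1) / \<rho>)"
  shows "L2_norm F v \<le> 2 * (C1 + (2 + C1) * (2 / \<rho> + C3)) * sqrt (S_edge k vs F v v)"
proof -
  have \<rho>: "\<rho> > 0" using R R_pos h_pos by (simp add: zero_less_mult_iff)
  from v obtain d r0 g0 where vL: "in_L2 F v" and d: "d \<in> polys k"
    and weak': "\<forall>\<phi> \<phi>'. test_pair F \<phi> \<phi>' \<longrightarrow> (\<integral>x. d x * \<phi> x \<partial>lebesgue_on F) = (\<integral>x. - v x \<bullet> \<phi>' x \<partial>lebesgue_on F)"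
    and "r0 \<in> polys (k - 1)" "has_weak_rot F v r0"
    and g0: "has_tangential_trace vs F v g0" and "\<forall>i<n. poly_on k (edge vs i) (g0 i)" by (rule edge_spaceE)
  note weak = weak'[rule_format]
  define A where "A = L2_norm F v"
  define S where "S = S_edge k vs F v v"
  define t where "t = tangential_trace vs F v"
  have "has_tangential_trace vs F v t" unfolding t_def tangential_trace_def
    by (rule someI[of "has_tangential_trace vs F v", OF g0])
  then obtain r where G: "green v r t" using trace_green by blast
  then have r: "has_weak_rot F v r" by (simp add: green_def)
  define E where "E = (\<Sum>i<n. edge_inner vs i (t i) (t i))"
  have E0: "E \<ge> 0" unfolding E_def by (intro sum_nonneg edge_inner_nonneg)
  let ?\<Pi> = "L2_norm F (L2_proj (k + 1) F v)"
  have S: "S = h * E + h\<^sup>2 * (L2_norm F r)\<^sup>2 + ?\<Pi>\<^sup>2"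
    using S_edge_eq[OF r] by (simp add: S_def E_def t_def)
  have hE: "h * E \<ge> 0" using E0 h_pos by simp
  have S1: "sqrt (h * E) \<le> sqrt S" "h * L2_norm F r \<le> sqrt S" "?\<Pi> \<le> sqrt S"
    using hE by (auto simp: S power_mult_distrib intro!: real_sqrt_le_mono real_le_rsqrt)
  have sS: "sqrt S \<ge> 0" using S1(3) L2_norm_nonneg order_trans by blast
  have C1: "C1 \<ge> 0" unfolding C1_def using C unit_area_pos by simp
  have C3: "C3 \<ge> 0" unfolding C3_def using \<rho> by simp
  have mL: "in_L2 F (\<lambda>x. - v x)" by (rule in_L2_minus[OF vL])
  have "\<exists>a. (\<forall>y. d (c + h *\<^sub>R y) = (\<Sum>p\<in>degs k. a p * xpow p y)) \<and> h\<^sup>2 * (\<Sum>p\<in>degs k. \<bar>a p\<bar>) \<le> C * L2_norm F (\<lambda>x. - v x)"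
    using bub[unfolded bubble_const_def, rule_format, OF h_pos opF F_ball_cball[OF R] F_cball(1) mL d weak] .
  then obtain a where a: "\<And>y. d (c + h *\<^sub>R y) = (\<Sum>p\<in>degs k. a p * xpow p y)" and aC: "h\<^sup>2 * (\<Sum>p\<in>degs k. \<bar>a p\<bar>) \<le> C * A"
    by (auto simp: A_def)
  from poly_antiderivative[OF a d] obtain P P' where P: "P \<in> polys (k + 1)" "has_grad P P'" "\<And>x. P' x $ 1 = d x"
    and Pn: "L2_norm F P \<le> h * (\<Sum>p\<in>degs k. \<bar>a p\<bar>) * (h * sqrt unit_area)" by auto
  \<comment> \<open>A field with a single nonzero component suffices: the divergence of (P, 0) is
    the derivative of \<open>P\<close> in the first variable, which is \<open>d\<close>.\<close>
  define p where "p = (\<lambda>x. vector [P x, 0] :: real^2)"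
  have pv: "p \<in> vec_polys (k + 1)"
    unfolding vec_polys_def mem_Collect_eq forall_2 p_def using P(1) polys_zero by simp
  have pL: "in_L2 F p" by (rule in_L2_continuous[OF continuous_on_vec_polys[OF pv] F_meas(1) bdF])
  have pn: "L2_norm F p \<le> C1 * A"
  proof -
    have "L2_norm F p = L2_norm F P" by (simp add: L2_norm_def L2_inner_def p_def inner_real2)
    also have "\<dots> \<le> (h\<^sup>2 * (\<Sum>p\<in>degs k. \<bar>a p\<bar>)) * sqrt unit_area" using Pn by (simp add: power2_eq_square mult_ac)
    also have "\<dots> \<le> (C * A) * sqrt unit_area" using aC unit_area_pos by (intro mult_right_mono) auto
    finally show ?thesis by (simp add: C1_def mult_ac)
  qed
  define u where "u = (\<lambda>x. v x - p x)"
  have uL: "in_L2 F u" unfolding u_def by (rule in_L2_diff[OF vL pL])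
  have udf: "(\<integral>x. u x \<bullet> g x \<partial>lebesgue_on F) = 0" if tp: "test_pair F \<phi> g" for \<phi> g
  proof -
    have gL: "in_L2 F g"
      using tp by (intro in_L2_continuous[OF continuous_on_grad F_meas(1) bdF]) (auto simp: test_pair_def)
    have "(\<integral>x. u x \<bullet> g x \<partial>lebesgue_on F) = (\<integral>x. v x \<bullet> g x \<partial>lebesgue_on F) - (\<integral>x. p x \<bullet> g x \<partial>lebesgue_on F)"
      using L2_inner_diff_left[OF vL pL gL] by (simp add: u_def L2_inner_def)
    also have "(\<integral>x. p x \<bullet> g x \<partial>lebesgue_on F) = - (\<integral>x. d x * \<phi> x \<partial>lebesgue_on F)"
      using integration_by_parts[OF opF bdF P(2) tp, of "axis 1 1"] P(3)
      by (simp add: p_def inner_real2 axis_def)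
    finally show ?thesis using weak[OF tp] by simp
  qed
  show ?thesis
  proof (cases "A = 0")
    case True
    then show ?thesis using C1 C3 \<rho> sS by (simp add: A_def[symmetric] S_def[symmetric])
  next
    case False
    then have A: "A > 0" using L2_norm_nonneg[of F v] unfolding A_def by linarith
    \<comment> \<open>The tolerance must be positive, hence the separate case \<open>A = 0\<close>.
      Cauchy-Schwarz turns it into half of \<open>A\<^sup>2\<close>, which moves to the left-hand
      side and causes the factor 2 in the constant.\<close>
    have "\<exists>\<eta> g. has_grad \<eta> g \<and> L2_norm F (\<lambda>x. u x - rot90 (g x)) \<le> A / 2"
    proof (rule curl_dense[OF uL])
      show "(\<integral>x. u x \<bullet> g x \<partial>lebesgue_on F) = 0" if "test_pair F \<phi> g" for \<phi> g using that by (rule udf)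
    qed (use A in simp)
    then obtain \<eta> g where \<eta>: "has_grad \<eta> g" and gn: "L2_norm F (\<lambda>x. u x - rot90 (g x)) \<le> A / 2" by auto
    have gL: "in_L2 F g" by (rule in_L2_continuous[OF continuous_on_grad[OF \<eta>] F_meas(1) bdF])
    have jL: "in_L2 F (\<lambda>x. rot90 (g x))" by (rule in_L2_rot90[OF gL F_meas(2)])
    have ujL: "in_L2 F (\<lambda>x. u x - rot90 (g x))" by (rule in_L2_diff[OF uL jL])
    \<comment> \<open>The contributions are 1 from \<open>v\<close>, \<open>C1\<close> from
      \<open>p\<close> and 1/2 from the approximation, rounded up to \<open>2 + C1\<close>.\<close>
    have gA: "L2_norm F g \<le> (2 + C1) * A"
    proof -
      have "L2_norm F g = L2_norm F (\<lambda>x. u x - (u x - rot90 (g x)))" by simp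
      also have "\<dots> \<le> L2_norm F u + L2_norm F (\<lambda>x. u x - rot90 (g x))" by (rule L2_norm_triangle_diff[OF uL ujL])
      also have "\<dots> \<le> (A + C1 * A) + A / 2"
        using L2_norm_triangle_diff[OF vL pL] pn gn unfolding u_def A_def by linarith
      also have "\<dots> \<le> (2 + C1) * A" using A by (simp add: distrib_right)
      finally show ?thesis .
    qed
    define D where "D = L2_norm F r * (2 * h * (h / R)) + sqrt E * sqrt ((3 * (2 * h * (h / R))\<^sup>2 + h\<^sup>2) / R)"
    have "D = (2 / \<rho>) * (h * L2_norm F r) + C3 * sqrt (h * E)"
    proof -
      have 1: "h / R = 1 / \<rho>" using R h_pos by simp
      \<comment> \<open>With \<open>R = \<rho> * h\<close> the numerator is \<open>h\<^sup>2\<close>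
        times a constant. One factor \<open>h\<close> survives the division and joins
        \<open>E\<close>, which gives the boundary part of \<open>S_edge\<close>.\<close>
      have "(3 * (2 * h * (h / R))\<^sup>2 + h\<^sup>2) / R = h * ((12 / \<rho>\<^sup>2 + 1) / \<rho>)"
        unfolding 1 R using h_pos \<rho> by (simp add: field_simps power2_eq_square)
      then have "sqrt E * sqrt ((3 * (2 * h * (h / R))\<^sup>2 + h\<^sup>2) / R) = C3 * sqrt (h * E)"
        unfolding C3_def by (simp only: real_sqrt_mult mult_ac)
      then show ?thesis unfolding D_def 1 by simp
    qed
    also have "\<dots> \<le> (2 / \<rho>) * sqrt S + C3 * sqrt S"
      by (intro add_mono mult_left_mono S1 C3) (use \<rho> in simp)
    finally have D: "D \<le> (2 / \<rho> + C3) * sqrt S" by (simp add: distrib_right)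
    have "A\<^sup>2 = L2_inner F v (\<lambda>x. p x + ((u x - rot90 (g x)) + rot90 (g x)))"
      by (simp add: u_def A_def L2_inner_self[symmetric])
    also have "\<dots> = L2_inner F v p + (L2_inner F v (\<lambda>x. u x - rot90 (g x)) + L2_inner F v (\<lambda>x. rot90 (g x)))"
      by (simp only: L2_inner_add_right[OF vL pL in_L2_add[OF ujL jL]] L2_inner_add_right[OF vL ujL jL])
    also have "\<dots> \<le> sqrt S * (C1 * A) + (A * (A / 2) + ((2 / \<rho> + C3) * sqrt S) * ((2 + C1) * A))"
    proof (intro add_mono)
      have "L2_inner F v p = L2_inner F (L2_proj (k + 1) F v) p" by (rule L2_proj_norm_le(3)[OF vL pv])
      also have "\<dots> \<le> ?\<Pi> * L2_norm F p" using L2_inner_CS[OF L2_proj_norm_le(2)[OF vL] pL] by (simp add: abs_le_iff)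
      also have "\<dots> \<le> sqrt S * (C1 * A)" by (intro mult_mono S1 pn sS) simp
      finally show "L2_inner F v p \<le> sqrt S * (C1 * A)" .
      have "L2_inner F v (\<lambda>x. u x - rot90 (g x)) \<le> A * L2_norm F (\<lambda>x. u x - rot90 (g x))"
        using L2_inner_CS[OF vL ujL] by (simp add: A_def abs_le_iff)
      also have "\<dots> \<le> A * (A / 2)" using A gn by (intro mult_left_mono) auto
      finally show "L2_inner F v (\<lambda>x. u x - rot90 (g x)) \<le> A * (A / 2)" .
      have "L2_inner F v (\<lambda>x. rot90 (g x)) \<le> D * L2_norm F g"
        using rot_duality[OF G \<eta> vL] by (simp add: D_def E_def abs_le_iff)
      also have "\<dots> \<le> ((2 / \<rho> + C3) * sqrt S) * ((2 + C1) * A)"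
        by (intro mult_mono D gA) (use \<rho> C3 sS in simp_all)
      finally show "L2_inner F v (\<lambda>x. rot90 (g x)) \<le> ((2 / \<rho> + C3) * sqrt S) * ((2 + C1) * A)" .
    qed
    finally have fin: "A\<^sup>2 \<le> sqrt S * (C1 * A) + (A * (A / 2) + ((2 / \<rho> + C3) * sqrt S) * ((2 + C1) * A))" .
    define \<kappa> where "\<kappa> = 2 / \<rho> + C3"
    have "A * A \<le> A * (sqrt S * C1 + A / 2 + \<kappa> * sqrt S * (2 + C1))"
      using fin unfolding \<kappa>_def[symmetric] by (simp add: power2_eq_square algebra_simps)
    then have "A \<le> sqrt S * C1 + A / 2 + \<kappa> * sqrt S * (2 + C1)" using A by simp
    then have "A \<le> 2 * (C1 + (2 + C1) * \<kappa>) * sqrt S" by (simp add: algebra_simps)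
    then show ?thesis by (simp only: A_def S_def \<kappa>_def)
  qed
qed

text \<open>For a polynomial trace, the edge norm is at most the root of the edge length times the
  sum of coefficients, which \<open>edge_estimate\<close> bounds. Squaring separates the
  contributions of \<open>r\<close> and \<open>v\<close>, and these are summed over the
  triangles.\<close>

lemma edge_sum_bound:
  assumes R: "R = \<rho> * h" and len: "\<And>i. i < n \<Longrightarrow> \<rho> * h \<le> edge_length vs i"
    and gram: "edge_gram_const k \<alpha>" and wedge: "wedge_const k b"
    and vL: "in_L2 F v" and G: "green v r g" and pol: "\<And>i. i < n \<Longrightarrow> poly_on k (edge vs i) (g i)"
  defines "M \<equiv> real (k + 1) * sqrt unit_area / \<alpha>" and "b' \<equiv> b * (1 / \<rho> + 1 / \<rho>\<^sup>2)"
  shows "h * (\<Sum>i<n. edge_inner vs i (g i) (g i)) \<le> (2 * M\<^sup>2 / \<rho>) * (h\<^sup>2 * (L2_norm F r)\<^sup>2 + b'\<^sup>2 * (L2_norm F v)\<^sup>2)"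
proof -
  have \<rho>: "\<rho> > 0" using R R_pos h_pos by (simp add: zero_less_mult_iff)
  have rL: "in_L2 F r" using G by (simp add: green_def has_weak_rot_def)
  define Nr where "Nr = (\<lambda>i. L2_norm F (\<lambda>x. indicator (T i) x *\<^sub>R r x))"
  define Nv where "Nv = (\<lambda>i. L2_norm F (\<lambda>x. indicator (T i) x *\<^sub>R v x))"
  have \<alpha>: "\<alpha> > 0" using gram by (simp add: edge_gram_const_def)
  have b0: "b \<ge> 0" using wedge by (simp add: wedge_const_def)
  have M0: "M \<ge> 0" unfolding M_def using \<alpha> unit_area_pos by simp
  have b'0: "b' \<ge> 0" unfolding b'_def using b0 \<rho> by simp
  have edge: "h * edge_inner vs i (g i) (g i) \<le> (2 * M\<^sup>2 / \<rho>) * (h\<^sup>2 * (Nr i)\<^sup>2 + b'\<^sup>2 * (Nv i)\<^sup>2)" if i: "i < n" for i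
  proof -
    define l where "l = norm (q i)"
    have l: "\<rho> * h \<le> l" using len[OF i] by (simp add: l_def edge_length_eq)
    have \<rho>h: "0 < \<rho> * h" using \<rho> h_pos by simp
    have l0: "0 < l" using l \<rho>h by linarith
    from pol[OF i] obtain f where f: "f \<in> polys k" "\<And>x. x \<in> edge vs i \<Longrightarrow> g i x = f x" by (auto simp: poly_on_def)
    obtain e where e: "\<And>t. f (linepath (edge_start vs i) (edge_end vs i) t) = (\<Sum>j\<le>k. e j * t ^ j)"
      using polys_on_line[OF f(1)] by metis
    have ge: "g i (c + p i + t *\<^sub>R q i) = (\<Sum>j\<le>k. e j * t ^ j)" if "0 \<le> t" "t \<le> 1" for t
      using f(2)[OF edge_point[OF that]] e[of t] by (simp add: linepath_edge)
    define S where "S = (\<Sum>j\<le>k. \<bar>e j\<bar>)"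
    have S0: "S \<ge> 0" unfolding S_def by (rule sum_nonneg) simp
    define X where "X = b * (1 / R + h / (R * l))"
    have est: "l * \<alpha> * S \<le> real (k + 1) * (h * sqrt unit_area) * (Nr i + X * Nv i)"
      unfolding X_def l_def S_def Nr_def Nv_def by (rule edge_estimate[OF G vL i ge gram wedge])
    \<comment> \<open>\<open>h / R\<close> equals 1 / \<rho>, and the edge length is at least
      \<open>\<rho> * h\<close>, which turns the second term into the inverse square of
      \<open>\<rho>\<close>.\<close>
    have "h * X \<le> b'"
    proof -
      have "h / (R * l) \<le> h / (R * (\<rho> * h))"
        using l l0 R_pos \<rho>h h_pos by (intro divide_left_mono mult_left_mono) auto
      then have "h * (1 / R + h / (R * l)) \<le> h * (1 / R + h / (R * (\<rho> * h)))" using h_pos by (intro mult_left_mono) auto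
      also have "\<dots> = 1 / \<rho> + 1 / \<rho>\<^sup>2" unfolding R using h_pos \<rho> by (simp add: field_simps power2_eq_square)
      finally have "b * (h * (1 / R + h / (R * l))) \<le> b'" unfolding b'_def by (rule mult_left_mono[OF _ b0])
      then show ?thesis by (simp add: X_def mult_ac)
    qed
    then have "h * X * Nv i \<le> b' * Nv i" by (rule mult_right_mono) (simp add: Nv_def)
    then have "(real (k + 1) * sqrt unit_area) * (h * Nr i + h * X * Nv i) \<le> (real (k + 1) * sqrt unit_area) * (h * Nr i + b' * Nv i)"
      using unit_area_pos by (intro mult_left_mono) auto
    then have "l * S * \<alpha> \<le> (real (k + 1) * sqrt unit_area) * (h * Nr i + b' * Nv i)"
      using est by (simp add: algebra_simps)
    then have lS: "l * S \<le> M * (h * Nr i + b' * Nv i)" using \<alpha> by (simp add: M_def field_simps)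
    have ie: "edge_inner vs i (g i) (g i) \<le> l * S\<^sup>2"
    proof -
      have sq: "(\<Sum>j\<le>k. e j * t ^ j)\<^sup>2 \<le> S\<^sup>2" if "0 \<le> t" "t \<le> 1" for t
      proof -
        have "\<bar>\<Sum>j\<le>k. e j * t ^ j\<bar> \<le> (\<Sum>j\<le>k. \<bar>e j * t ^ j\<bar>)" by (rule sum_abs)
        also have "\<dots> \<le> S" unfolding S_def
          by (rule sum_mono) (use that in \<open>auto simp: abs_mult power_abs intro!: mult_left_le power_le_one\<close>)
        finally show ?thesis using S0 by (simp add: abs_le_square_iff[symmetric])
      qed
      have c: "in_L2 {0..1::real} (\<lambda>t. \<Sum>j\<le>k. e j * t ^ j)" by (rule in_L2_continuous) (auto intro!: continuous_intros)
      have "edge_inner vs i (g i) (g i) = l * (\<integral>t. (\<Sum>j\<le>k. e j * t ^ j)\<^sup>2 \<partial>lebesgue_on {0..1})"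
        unfolding edge_inner_def edge_length_eq l_def L2_inner_def
        by (rule arg_cong[where f = "(*) _"], rule Bochner_Integration.integral_cong)
           (auto simp: space_restrict_space linepath_edge ge power2_eq_square)
      also have "\<dots> \<le> l * (\<integral>t. S\<^sup>2 \<partial>lebesgue_on {0..1::real})"
      proof (intro mult_left_mono integral_mono)
        show "integrable (lebesgue_on {0..1}) (\<lambda>t. (\<Sum>j\<le>k. e j * t ^ j)\<^sup>2)" using c by (simp add: in_L2_def)
        show "integrable (lebesgue_on {0..1::real}) (\<lambda>t. S\<^sup>2)"
          by (rule finite_measure.integrable_const[OF finite_measure_lebesgue_on]) simp
        show "(\<Sum>j\<le>k. e j * t ^ j)\<^sup>2 \<le> S\<^sup>2" if "t \<in> space (lebesgue_on {0..1})" for t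
          using sq that by (simp add: space_restrict_space)
      qed (use l0 in simp)
      also have "(\<integral>t. S\<^sup>2 \<partial>lebesgue_on {0..1::real}) = S\<^sup>2" by (simp add: measure_restrict_space space_restrict_space)
      finally show ?thesis .
    qed
    have "h * edge_inner vs i (g i) (g i) \<le> h * (l * S\<^sup>2)" using ie h_pos by (intro mult_left_mono) auto
    \<comment> \<open>Rearranged so that the quantity \<open>l * S\<close> bounded in
      \<open>lS\<close> appears; the remaining quotient is at most 1 / \<rho>.\<close>
    also have "\<dots> = (h / l) * (l * S)\<^sup>2" using l0 by (simp add: power2_eq_square)
    also have "\<dots> \<le> (1 / \<rho>) * (M * (h * Nr i + b' * Nv i))\<^sup>2"
    proof (rule mult_mono)
      show "h / l \<le> 1 / \<rho>" using l l0 \<rho> by (simp add: field_simps)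
      show "(l * S)\<^sup>2 \<le> (M * (h * Nr i + b' * Nv i))\<^sup>2" by (rule power_mono[OF lS]) (use l0 S0 in simp)
    qed (use \<rho> in auto)
    also have "\<dots> = (M\<^sup>2 / \<rho>) * (h * Nr i + b' * Nv i)\<^sup>2" by (simp add: power_mult_distrib)
    also have "\<dots> \<le> (M\<^sup>2 / \<rho>) * (2 * (h\<^sup>2 * (Nr i)\<^sup>2 + b'\<^sup>2 * (Nv i)\<^sup>2))"
    proof (rule mult_left_mono)
      have "0 \<le> (h * Nr i - b' * Nv i)\<^sup>2" by simp
      then show "(h * Nr i + b' * Nv i)\<^sup>2 \<le> 2 * (h\<^sup>2 * (Nr i)\<^sup>2 + b'\<^sup>2 * (Nv i)\<^sup>2)"
        by (simp add: power2_eq_square algebra_simps)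
    qed (use \<rho> in simp)
    also have "\<dots> = (2 * M\<^sup>2 / \<rho>) * (h\<^sup>2 * (Nr i)\<^sup>2 + b'\<^sup>2 * (Nv i)\<^sup>2)" by simp
    finally show ?thesis .
  qed
  have "h * (\<Sum>i<n. edge_inner vs i (g i) (g i)) \<le> (\<Sum>i<n. (2 * M\<^sup>2 / \<rho>) * (h\<^sup>2 * (Nr i)\<^sup>2 + b'\<^sup>2 * (Nv i)\<^sup>2))"
    unfolding sum_distrib_left by (rule sum_mono) (use edge in simp)
  also have "\<dots> = (2 * M\<^sup>2 / \<rho>) * (h\<^sup>2 * (\<Sum>i<n. (Nr i)\<^sup>2) + b'\<^sup>2 * (\<Sum>i<n. (Nv i)\<^sup>2))"
    by (simp add: sum_distrib_left sum.distrib distrib_left)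
  also have "\<dots> \<le> (2 * M\<^sup>2 / \<rho>) * (h\<^sup>2 * (L2_norm F r)\<^sup>2 + b'\<^sup>2 * (L2_norm F v)\<^sup>2)"
    unfolding Nr_def Nv_def
    by (intro mult_left_mono add_mono sum_L2_norm_T[OF rL] sum_L2_norm_T[OF vL]) (use \<rho> in auto)
  finally show ?thesis .
qed

text \<open>The polynomial rotation and trace supplied by \<open>edge_space\<close> are estimated,
  and uniqueness transfers the bounds to the representatives occurring in \<open>S_edge\<close>. The
  projection contributes the summand 1.\<close>

lemma upper_bound:
  assumes R: "R = \<rho> * h" and len: "\<And>i. i < n \<Longrightarrow> \<rho> * h \<le> edge_length vs i"
    and gram: "edge_gram_const k \<alpha>" and wedge: "wedge_const k b"
    and bub: "bubble_const (k - 1) \<rho> C" and C: "C > 0" and v: "v \<in> edge_space k vs F"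
  defines "M \<equiv> real (k + 1) * sqrt unit_area / \<alpha>" and "b' \<equiv> b * (1 / \<rho> + 1 / \<rho>\<^sup>2)" and "Cr \<equiv> C * sqrt unit_area"
  shows "S_edge k vs F v v \<le> ((2 * M\<^sup>2 / \<rho>) * (Cr\<^sup>2 + b'\<^sup>2) + Cr\<^sup>2 + 1) * (L2_norm F v)\<^sup>2"
proof -
  have \<rho>: "\<rho> > 0" using R R_pos h_pos by (simp add: zero_less_mult_iff)
  from v obtain d r g where vL: "in_L2 F v" and "d \<in> polys k"
    and "\<forall>\<phi> \<phi>'. test_pair F \<phi> \<phi>' \<longrightarrow> (\<integral>x. d x * \<phi> x \<partial>lebesgue_on F) = (\<integral>x. - v x \<bullet> \<phi>' x \<partial>lebesgue_on F)"
    and r: "r \<in> polys (k - 1)" "has_weak_rot F v r"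
    and g: "has_tangential_trace vs F v g" "\<forall>i<n. poly_on k (edge vs i) (g i)" by (rule edge_spaceE)
  define A where "A = L2_norm F v"
  define t where "t = tangential_trace vs F v"
  have "has_tangential_trace vs F v t" unfolding t_def tangential_trace_def
    by (rule someI[of "has_tangential_trace vs F v", OF g(1)])
  then obtain r1 where G1: "green v r1 t" using trace_green by blast
  obtain r2 where G2: "green v r2 g" using trace_green[OF g(1)] by blast
  \<comment> \<open>The rotation \<open>r2\<close> in the Green formula for \<open>g\<close> may
    differ from the polynomial \<open>r\<close> on a null set, which no integral notices.\<close>
  have G: "green v r g"
    unfolding green_def
  proof (intro conjI r(2) allI impI)
    show "edge_L2 vs i (g i)" if "i < n" for i using G2 that by (simp add: green_def)
    fix \<phi> \<phi>' assume \<phi>: "has_grad \<phi> \<phi>'"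
    have w2: "has_weak_rot F v r2" using G2 by (simp add: green_def)
    have \<phi>L: "in_L2 F \<phi>" by (rule in_L2_continuous[OF has_grad_continuous_on[OF \<phi>] F_meas(1) bdF])
    have L: "in_L2 F r" "in_L2 F r2" using r(2) w2 by (auto simp: has_weak_rot_def)
    have "L2_inner F r \<phi> = L2_inner F r2 \<phi>"
      unfolding L2_inner_def
    proof (rule integral_cong_AE)
      show "AE x in lebesgue_on F. r x \<bullet> \<phi> x = r2 x \<bullet> \<phi> x"
        using weak_rot_unique[OF opF bdF r(2) w2] by eventually_elim simp
      show "(\<lambda>x. r x \<bullet> \<phi> x) \<in> borel_measurable (lebesgue_on F)" "(\<lambda>x. r2 x \<bullet> \<phi> x) \<in> borel_measurable (lebesgue_on F)"
        by (rule borel_measurable_integrable[OF integrable_inner_L2[OF L(1) \<phi>L]]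
              borel_measurable_integrable[OF integrable_inner_L2[OF L(2) \<phi>L]])+
    qed
    then show "L2_inner F r \<phi> = L2_inner F v (\<lambda>x. rot90 (\<phi>' x)) + (\<Sum>i<n. edge_inner vs i (g i) \<phi>)"
      using G2 \<phi> by (simp add: green_def)
  qed
  \<comment> \<open>\<open>S_edge\<close> contains the chosen trace \<open>t\<close>, while
    polynomial structure is known only for \<open>g\<close>.\<close>
  have te: "edge_inner vs i (t i) (t i) = edge_inner vs i (g i) (g i)" if i: "i < n" for i
  proof -
    have L: "in_L2 {0..1} (t i \<circ> linepath (edge_start vs i) (edge_end vs i))" "in_L2 {0..1} (g i \<circ> linepath (edge_start vs i) (edge_end vs i))"
      using G1 G i by (auto simp: green_def edge_L2_def)
    have "AE a in lebesgue_on {0..1}. (t i \<circ> linepath (edge_start vs i) (edge_end vs i)) a = (g i \<circ> linepath (edge_start vs i) (edge_end vs i)) a"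
      using trace_unique[OF G1 G i] by (simp add: linepath_edge)
    then have "L2_norm {0..1} (t i \<circ> linepath (edge_start vs i) (edge_end vs i)) = L2_norm {0..1} (g i \<circ> linepath (edge_start vs i) (edge_end vs i))"
      by (rule L2_norm_cong_AE[OF _ in_L2_meas[OF L(1)] in_L2_meas[OF L(2)]])
    then show ?thesis by (simp add: edge_inner_def L2_inner_self)
  qed
  have rn: "h * L2_norm F r \<le> Cr * A"
  proof -
    have VL: "in_L2 F (\<lambda>x. - rot90 (v x))" by (rule in_L2_minus[OF in_L2_rot90[OF vL F_meas(2)]])
    \<comment> \<open>Moving \<open>rot90\<close> from the gradient to \<open>v\<close> changes the
      sign and brings the rotation into the form of \<open>bubble_const\<close>.\<close>
    have weak: "(\<integral>x. r x * \<phi> x \<partial>lebesgue_on F) = (\<integral>x. - rot90 (v x) \<bullet> \<phi>' x \<partial>lebesgue_on F)" if "test_pair F \<phi> \<phi>'" for \<phi> \<phi>'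
      using has_weak_rot_test[OF r(2) that] by (simp add: inner_rot90(1))
    have "\<exists>a. (\<forall>y. r (c + h *\<^sub>R y) = (\<Sum>p\<in>degs (k - 1). a p * xpow p y)) \<and> h\<^sup>2 * (\<Sum>p\<in>degs (k - 1). \<bar>a p\<bar>) \<le> C * L2_norm F (\<lambda>x. - rot90 (v x))"
      using bub[unfolded bubble_const_def, rule_format, OF h_pos opF F_ball_cball[OF R] F_cball(1) VL r(1) weak] .
    then obtain a where a: "\<And>y. r (c + h *\<^sub>R y) = (\<Sum>p\<in>degs (k - 1). a p * xpow p y)" and aC: "h\<^sup>2 * (\<Sum>p\<in>degs (k - 1). \<bar>a p\<bar>) \<le> C * A"
      by (auto simp: A_def)
    have "h * L2_norm F r \<le> h * ((\<Sum>p\<in>degs (k - 1). \<bar>a p\<bar>) * (h * sqrt unit_area))"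
      using poly_L2_norm_le[OF a r(1)] h_pos by (intro mult_left_mono) auto
    also have "\<dots> = (h\<^sup>2 * (\<Sum>p\<in>degs (k - 1). \<bar>a p\<bar>)) * sqrt unit_area" by (simp add: power2_eq_square mult_ac)
    also have "\<dots> \<le> (C * A) * sqrt unit_area" using aC unit_area_pos by (intro mult_right_mono) auto
    finally show ?thesis by (simp add: Cr_def mult_ac)
  qed
  have "(h * L2_norm F r)\<^sup>2 \<le> (Cr * A)\<^sup>2" by (rule power_mono[OF rn]) (use h_pos in simp)
  then have rn2: "h\<^sup>2 * (L2_norm F r)\<^sup>2 \<le> Cr\<^sup>2 * A\<^sup>2" by (simp add: power_mult_distrib)
  have "h * (\<Sum>i<n. edge_inner vs i (t i) (t i)) = h * (\<Sum>i<n. edge_inner vs i (g i) (g i))" using te by simp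
  also have "\<dots> \<le> (2 * M\<^sup>2 / \<rho>) * (h\<^sup>2 * (L2_norm F r)\<^sup>2 + b'\<^sup>2 * A\<^sup>2)"
    unfolding M_def b'_def A_def by (rule edge_sum_bound[OF R len gram wedge vL G g(2)[rule_format]])
  also have "\<dots> \<le> (2 * M\<^sup>2 / \<rho>) * (Cr\<^sup>2 * A\<^sup>2 + b'\<^sup>2 * A\<^sup>2)" using rn2 \<rho> by (intro mult_left_mono) auto
  finally have 1: "h * (\<Sum>i<n. edge_inner vs i (t i) (t i)) \<le> (2 * M\<^sup>2 / \<rho>) * (Cr\<^sup>2 + b'\<^sup>2) * A\<^sup>2"
    by (simp only: distrib_right[symmetric] mult.assoc)
  have "(L2_norm F (L2_proj (k + 1) F v))\<^sup>2 \<le> A\<^sup>2"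
    unfolding A_def by (rule power_mono[OF L2_proj_norm_le(1)[OF vL]]) simp
  with 1 rn2 have "S_edge k vs F v v \<le> (2 * M\<^sup>2 / \<rho>) * (Cr\<^sup>2 + b'\<^sup>2) * A\<^sup>2 + Cr\<^sup>2 * A\<^sup>2 + A\<^sup>2"
    unfolding S_edge_eq[OF r(2)] t_def[symmetric] by linarith
  also have "\<dots> = ((2 * M\<^sup>2 / \<rho>) * (Cr\<^sup>2 + b'\<^sup>2) + Cr\<^sup>2 + 1) * A\<^sup>2" by (simp only: distrib_right mult_1)
  finally show ?thesis by (simp only: A_def)
qed

end

text \<open>The given disk may be larger than required and is cut down to radius exactly
  \<open>\<rho> * diameter F\<close>. That it lies in \<open>F\<close> follows from star-shapedness
  only for nonempty \<open>F\<close>; the edges ensure this, since they give \<open>F\<close> a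
  nonempty frontier.\<close>

lemma mesh_regular_star_polygon:
  assumes \<rho>: "\<rho> > 0" and m: "mesh_regular \<rho> vs F"
  shows "\<exists>c. star_polygon F c (\<rho> * diameter F) vs"
proof -
  from m obtain c r where poly: "polygon vs F" and r: "r \<ge> \<rho> * diameter F" "star_shaped_wrt F (ball c r)"
    by (auto simp: mesh_regular_def)
  have F: "open F" "bounded F" using poly by (auto simp: polygon_def)
  have "frontier F \<noteq> {}"
  proof -
    have "frontier F = (\<Union>i<length vs. edge vs i)" "0 < length vs" using poly by (auto simp: polygon_def)
    moreover have "edge_start vs 0 \<in> edge vs 0" by (simp add: edge_def)
    ultimately show ?thesis by blast
  qed
  then have "F \<noteq> {}" using frontier_empty by auto
  then obtain x where x: "x \<in> F" by auto
  obtain e where e: "e > 0" "ball x e \<subseteq> F" using F(1) x open_contains_ball by blast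
  have "x + (e / 2) *\<^sub>R axis 1 1 \<in> F" using e by (auto simp: subset_iff dist_norm)
  from diameter_bounded_bound[OF F(2) x this] e have h: "diameter F > 0" by (simp add: dist_norm)
  have hull: "convex hull (insert y (ball c r)) \<subseteq> F" if "y \<in> F" for y
    using r(2) that by (simp add: star_shaped_wrt_def)
  have sub: "ball c (\<rho> * diameter F) \<subseteq> ball c r" using r(1) by auto
  have "star_polygon F c (\<rho> * diameter F) vs"
  proof
    show "open F" "bounded F" by (rule F)+
    show "0 < \<rho> * diameter F" using \<rho> h by simp
    have "ball c r \<subseteq> convex hull (insert x (ball c r))" using hull_subset[of "insert x (ball c r)" convex] by blast
    then show "ball c (\<rho> * diameter F) \<subseteq> F" using sub hull[OF x] by blast
    show "closed_segment y z \<subseteq> F" if "y \<in> F" "z \<in> ball c (\<rho> * diameter F)" for y z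
    proof -
      have "closed_segment y z = convex hull {y, z}" by (rule segment_convex_hull)
      also have "\<dots> \<subseteq> convex hull (insert y (ball c r))" by (rule hull_mono) (use that sub in auto)
      finally show ?thesis using hull[OF that(1)] by blast
    qed
    show "polygon vs F" by (rule poly)
  qed
  then show ?thesis by (rule exI[where x = c])
qed

theorem theorem5p1:
  fixes k :: nat and \<rho> :: real
  assumes "k \<ge> 1" and "\<rho> > 0"
  shows "\<exists>C1 C2 :: real. C1 > 0 \<and> C2 > 0 \<and>
    (\<forall>vs F. mesh_regular \<rho> vs F \<longrightarrow>
      (\<forall>v \<in> edge_space k vs F.
        C1 * (L2_norm F v)\<^sup>2 \<le> S_edge k vs F v v \<and>
        S_edge k vs F v v \<le> C2 * (L2_norm F v)\<^sup>2))"
proof -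
  obtain Cd where Cd: "Cd > 0" "bubble_const k \<rho> Cd" using bubble_estimate[OF assms(2)] by blast
  obtain Cr where Cr: "Cr > 0" "bubble_const (k - 1) \<rho> Cr" using bubble_estimate[OF assms(2)] by blast
  obtain \<alpha> b where gw: "edge_gram_const k \<alpha>" "wedge_const k b"
    using edge_gram[of k] wedge_grad_bound[of k] by auto
  \<comment> \<open>The factor in \<open>lower_bound\<close>. It bounds norms, so its inverse square
    is the constant for the quadratic form.\<close>
  define K where "K = 2 * (Cd * sqrt unit_area + (2 + Cd * sqrt unit_area) * (2 / \<rho> + sqrt ((12 / \<rho>\<^sup>2 + 1) / \<rho>)))"
  have K: "K > 0" unfolding K_def using Cd(1) unit_area_pos assms(2)
    by (intro mult_pos_pos add_pos_nonneg mult_nonneg_nonneg add_nonneg_nonneg) auto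
  define M where "M = real (k + 1) * sqrt unit_area / \<alpha>"
  define C2 where "C2 = (2 * M\<^sup>2 / \<rho>) * ((Cr * sqrt unit_area)\<^sup>2 + (b * (1 / \<rho> + 1 / \<rho>\<^sup>2))\<^sup>2) + (Cr * sqrt unit_area)\<^sup>2 + 1"
  have C2: "C2 > 0" unfolding C2_def using assms(2) by (intro add_nonneg_pos add_nonneg_nonneg mult_nonneg_nonneg) auto
  show ?thesis
  proof (rule exI[of _ "1 / K\<^sup>2"], rule exI[of _ C2], intro conjI allI impI ballI)
    show "0 < 1 / K\<^sup>2" using K by simp
    show "0 < C2" by (rule C2)
    fix vs F v assume m: "mesh_regular \<rho> vs F" and v: "v \<in> edge_space k vs F"
    from mesh_regular_star_polygon[OF assms(2) m] obtain c where sp: "star_polygon F c (\<rho> * diameter F) vs" ..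
    then interpret star_polygon F c "\<rho> * diameter F" vs .
    have len: "\<rho> * diameter F \<le> edge_length vs i" if "i < length vs" for i
      using m that by (simp add: mesh_regular_def)
    show up: "S_edge k vs F v v \<le> C2 * (L2_norm F v)\<^sup>2"
      unfolding C2_def M_def by (rule upper_bound[OF refl len gw Cr(2,1) v])
    have low: "L2_norm F v \<le> K * sqrt (S_edge k vs F v v)"
      unfolding K_def by (rule lower_bound[OF refl Cd(2,1) v])
    \<comment> \<open>Nonnegativity allows the root in \<open>lower_bound\<close> to be squared back
      to the form itself.\<close>
    have S0: "S_edge k vs F v v \<ge> 0"
      using h_pos unfolding S_edge_def L2_inner_self
      by (intro add_nonneg_nonneg mult_nonneg_nonneg sum_nonneg edge_inner_nonneg) auto
    have "(L2_norm F v)\<^sup>2 \<le> (K * sqrt (S_edge k vs F v v))\<^sup>2" by (rule power_mono[OF low]) simp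
    also have "\<dots> = K\<^sup>2 * S_edge k vs F v v" using S0 by (simp add: power_mult_distrib)
    finally show "1 / K\<^sup>2 * (L2_norm F v)\<^sup>2 \<le> S_edge k vs F v v" using K by (simp add: field_simps)
  qed
qed

end
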